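(* For an abelian group $G$, the following conditions are equivalent: (a) $G$ is of the form $\mathrm{Aut}(f)$ for some function $f:X\to X$ (up to isomorphism). (b) $G$ is (isomorphic to) an abelianization $\mathrm{Aut}(f)_{ab}$ for some function $f:X\to X$. (c) $G$ is a product of (finite or infinite) cyclic groups.
   Context: For a function $f:X\to X$ on a non-empty set $X$, $\mathrm{Aut}(f)=\{\sigma\in\Sigma_X:\sigma\circ f=f\circ\sigma\}$, where $\Sigma_X$ is the group of all permutations of $X$. Products are unrestricted direct products of arbitrary (possibly infinite) families. $H_{ab}$ denotes the abelianization of a group $H$. *)

theory Defs
  imports "HOL-Algebra.Bij" "HOL-Algebra.Product_Groups"
begin

text \<open>
  Permutations of \<open>X\<close> are the elements of the library's \<open>BijGroup X\<close>: bijections of \<open>X\<close> that are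
  extensional, so that each permutation is counted once. Both commutation and \<open>f \<in> X \<rightarrow> X\<close> only
  concern values on \<open>X\<close>.
\<close>

definition Aut :: "'x set \<Rightarrow> ('x \<Rightarrow> 'x) \<Rightarrow> ('x \<Rightarrow> 'x) monoid"
  where "Aut X f =
    (BijGroup X)\<lparr>carrier := {\<sigma> \<in> carrier (BijGroup X). \<forall>x\<in>X. \<sigma> (f x) = f (\<sigma> x)}\<rparr>"

definition abelianization :: "('a, 'b) monoid_scheme \<Rightarrow> 'a set monoid"
  where "abelianization H = H Mod (derived H (carrier H))"

text \<open>
  HOL cannot quantify existentially over types, so each of the following three properties carries
  as an argument the type(s) in which the witnesses live. The theorem states the equivalence for
  types determined by the type \<open>'a\<close> of the elements of \<open>G\<close>, together with the fact that these
  types are large enough: a witness in any type at all yields one there.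
\<close>

definition is_Aut :: "'x itself \<Rightarrow> ('a, 'b) monoid_scheme \<Rightarrow> bool"
  where "is_Aut (_ :: 'x itself) G \<longleftrightarrow>
    (\<exists>(X :: 'x set) f. X \<noteq> {} \<and> f \<in> X \<rightarrow> X \<and> G \<cong> Aut X f)"

definition is_Aut_ab :: "'x itself \<Rightarrow> ('a, 'b) monoid_scheme \<Rightarrow> bool"
  where "is_Aut_ab (_ :: 'x itself) G \<longleftrightarrow>
    (\<exists>(X :: 'x set) f. X \<noteq> {} \<and> f \<in> X \<rightarrow> X \<and> G \<cong> abelianization (Aut X f))"

text \<open>
  The library's \<open>cyclic_group\<close> does not include the group axioms, and its \<open>product_group\<close> is the
  unrestricted product. In the type argument, \<open>'i\<close> hosts the index set and \<open>'c\<close> the factors.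
\<close>

definition is_product_of_cyclic :: "('i \<times> 'c) itself \<Rightarrow> ('a, 'b) monoid_scheme \<Rightarrow> bool"
  where "is_product_of_cyclic (_ :: ('i \<times> 'c) itself) G \<longleftrightarrow>
    (\<exists>(I :: 'i set) (C :: 'i \<Rightarrow> 'c monoid).
       (\<forall>i\<in>I. group (C i) \<and> cyclic_group (C i)) \<and> G \<cong> product_group I C)"

end

theory Submission
  imports Defs "HOL-Algebra.Free_Abelian_Groups" "HOL-Algebra.Multiplicative_Group" "HOL-Combinatorics.Permutations"
begin

text \<open>
  Only the passage from \<open>Aut(f)\<^sub>a\<^sub>b\<close> to a product of cyclic groups is difficult. Components of the functional
  graph in one \<open>Aut(f)\<close>-orbit may be permuted arbitrarily. If there are infinitely many, an Eilenberg
  swindle shows that their group is perfect; if there are finitely many, its abelianization is that of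
  the wreath product of one component with a finite symmetric group.

  In a single component, automorphisms are detected by the rotation or translation they induce and by
  the signs of the permutations they induce on finite orbits of branches. If all these vanish, an
  automorphism is a product of boundedly many commutators: an even permutation \<open>a\<close> has a full cycle
  \<open>c\<close> with \<open>a \<circ> c\<close> again a full cycle, so \<open>a\<close> is a commutator, and these choices can be made on all
  levels of a tree at once; the infinite orbits are handled by the swindle. The uniform bound on the
  number of commutators makes the argument compatible with infinite products of components.

  The one case without explicit coordinates is that of an increasing union of stabilizers of vertices
  along a ray. There the abelianization has exponent two, and its cardinality is that of a power set,
  so that it is an infinite product of groups of order two by comparing dimensions over \<open>F\<^sub>2\<close>.
\<close>

section \<open>Permutations with a single orbit\<close>

text \<open>Two full cycles \<open>c\<close> and \<open>a \<circ> c\<close> of the same set are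
  conjugate, say \<open>h \<circ> c = a \<circ> c \<circ> h\<close>, and then \<open>a\<close> is
  the commutator of \<open>h\<close> and \<open>c\<close>. Only even permutations can arise in this
  way, so signs are the one obstruction on a finite orbit. An element of an infinite product whose
  coordinates are all products of commutators need not be such a product itself; hence every kernel
  statement carries a number. A single component needs 3: one for all finite orbits at once, two for
  the infinite ones, since a swindle requires an element that is trivial on a large part and a
  general element is a product of two of these. Finitely many copies of a component cost 2 more,
  which gives the constant 5. Along a ray, each stabilizer has a product of sign groups as
  abelianization, but a later stabilizer absorbs finitely many side branches into one larger tree
  and may kill their signs. The direct limit has no evident coordinates. Exponent and cardinality
  can be computed all the same, and they determine it.\<close>

abbreviation pinv :: "('a \<Rightarrow> 'b) \<Rightarrow> 'b \<Rightarrow> 'a"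
  where "pinv \<equiv> inv_into UNIV"

definition single_orbit :: "('a \<Rightarrow> 'a) \<Rightarrow> 'a set \<Rightarrow> bool"
  where "single_orbit v S \<longleftrightarrow> (\<forall>x\<in>S. \<forall>y\<in>S. \<exists>i. (v ^^ i) x = y)"

lemma funpow_in: "(\<And>x. x \<in> S \<Longrightarrow> f x \<in> S) \<Longrightarrow> x \<in> S \<Longrightarrow> (f ^^ i) x \<in> S"
  by (induction i) auto

lemma funpow_Suc_swap: "(f ^^ Suc i) x = (f ^^ i) (f x)"
  by (simp add: funpow_swap1)

lemma funpow_plus: "(f ^^ i) ((f ^^ j) x) = (f ^^ (i + j)) x"
  by (simp add: funpow_add)

text \<open>The right factor \<open>transpose w y\<close> opens the cycle of \<open>u\<close> after
  \<open>w\<close> and leads it through \<open>y\<close>: now \<open>w\<close> goes to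
  \<open>y\<close>, and \<open>y\<close> to \<open>u w\<close>.\<close>

lemma single_orbit_insert:
  assumes u: "u permutes S" and so: "single_orbit u S" and w: "w \<in> S" and y: "y \<notin> S"
  shows "single_orbit (u \<circ> transpose w y) (insert y S)"
proof -
  let ?u = "u \<circ> transpose w y"
  have uy: "u y = y" using u y by (simp add: permutes_not_in)
  have wy: "w \<noteq> y" using w y by auto
  have step: "\<exists>j. (?u ^^ j) x = (u ^^ i) x" if "x \<in> S" for x i
  proof (induction i)
    case 0 then show ?case by (rule exI[of _ 0]) simp
  next
    case (Suc i)
    then obtain j where j: "(?u ^^ j) x = (u ^^ i) x" by blast
    have inS: "(u ^^ i) x \<in> S" using that u by (intro funpow_in) (auto simp: permutes_in_image)
    show ?case
    proof (cases "(u ^^ i) x = w")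
      case True
      have "(?u ^^ Suc (Suc j)) x = (u ^^ Suc i) x"
        using j True wy uy by (simp add: transpose_def)
      then show ?thesis by blast
    next
      case False
      have "(u ^^ i) x \<noteq> y" using inS y by auto
      then have "(?u ^^ Suc j) x = (u ^^ Suc i) x" using j False by (simp add: transpose_def)
      then show ?thesis by blast
    qed
  qed
  have reach: "\<exists>j. (?u ^^ j) x = z" if "x \<in> S" "z \<in> S" for x z
    using step[OF that(1)] so that unfolding single_orbit_def by metis
  have uy': "?u y = u w" by (simp add: transpose_def)
  have uw: "?u w = y" using uy by simp
  have uwS: "u w \<in> S" using u w by (simp add: permutes_in_image)
  have A: "\<exists>j. (?u ^^ j) y = z" if z: "z \<in> S" for z
  proof -
    obtain j where "(?u ^^ j) (u w) = z" using reach uwS z by blast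
    then have "(?u ^^ Suc j) y = z" unfolding funpow_Suc_swap uy' .
    then show ?thesis by blast
  qed
  have B: "\<exists>j. (?u ^^ j) z = y" if z: "z \<in> S" for z
  proof -
    obtain j where "(?u ^^ j) z = w" using reach w z by blast
    then have "(?u ^^ Suc j) z = y" using uw by simp
    then show ?thesis by blast
  qed
  have C: "\<exists>j. (?u ^^ j) y = y" by (rule exI[of _ 0]) simp
  show ?thesis unfolding single_orbit_def using A B C reach by blast
qed

text \<open>Induction on \<open>S\<close>, removing a fixed point, two points of a cycle of length
  at least three, or two 2-cycles. Transpositions turn \<open>a\<close> into an even
  \<open>a'\<close> that fixes the removed points, and these are then inserted into both cycles
  obtained for \<open>a'\<close>. Evenness excludes the one case that admits no reduction, a single
  2-cycle.\<close>

lemma even_factor_long_cycles: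
  assumes "finite S" "a permutes S" "evenperm a"
  shows "\<exists>c. c permutes S \<and> single_orbit c S \<and> single_orbit (a \<circ> c) S"
  using assms
proof (induction S arbitrary: a rule: finite_psubset_induct)
  case (psubset S)
  note aS = psubset.prems(1) and ev = psubset.prems(2) and fin = psubset.hyps(1)
  have perm: "permutation a" using aS fin by (auto simp: permutation_permutes)
  have ain: "a t \<in> S \<longleftrightarrow> t \<in> S" for t using aS by (rule permutes_in_image)
  have ainj: "a s = a t \<longleftrightarrow> s = t" for s t using aS by (auto dest: permutes_inj injD)
  consider (empty) "S = {}" | (fixp) y where "y \<in> S" "a y = y"
    | (long) x where "x \<in> S" "a x \<noteq> x" "a (a x) \<noteq> x" "\<forall>y\<in>S. a y \<noteq> y"
    | (inv) "S \<noteq> {}" "\<forall>y\<in>S. a y \<noteq> y" "\<forall>y\<in>S. a (a y) = y"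
    by blast
  then show ?case
  proof cases
    case empty
    then show ?thesis by (intro exI[of _ id]) (simp add: single_orbit_def id_def)
  next
    case (fixp y)
    let ?S = "S - {y}"
    have aS': "a permutes ?S"
      using aS fixp by (intro permutes_superset[OF aS]) auto
    obtain c where c: "c permutes ?S" "single_orbit c ?S" "single_orbit (a \<circ> c) ?S"
      using psubset.IH[of ?S a] fixp aS' ev by blast
    show ?thesis
    proof (cases "?S = {}")
      case True
      then have "S = {y}" using fixp by auto
      then show ?thesis using fixp
        by (intro exI[of _ id]) (auto simp: single_orbit_def intro: exI[of _ 0])
    next
      case False
      then obtain w where w: "w \<in> ?S" by auto
      have "c \<circ> transpose w y permutes S"
        using c(1) w fixp by (intro permutes_compose permutes_swap_id) (auto intro: permutes_subset)
      moreover have "single_orbit (c \<circ> transpose w y) (insert y ?S)"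
        using c w by (intro single_orbit_insert) auto
      moreover have "single_orbit ((a \<circ> c) \<circ> transpose w y) (insert y ?S)"
        using c w aS' by (intro single_orbit_insert permutes_compose) auto
      moreover have "insert y ?S = S" using fixp by auto
      ultimately show ?thesis by (metis comp_assoc)
    qed
  next
    case (long x)
    define y where "y = a x"
    define z where "z = a y"
    have d: "x \<noteq> y" "y \<noteq> z" "x \<noteq> z" "y \<in> S" "z \<in> S"
      using long ain ainj unfolding y_def z_def by metis+
    let ?S = "S - {y, z}"
    have xS: "x \<in> ?S" using d long by auto
    \<comment> \<open>This cuts \<open>y\<close> and \<open>z\<close> out of the cycle:
      \<open>x\<close> now goes directly to \<open>a z\<close>.\<close>
    define a' where "a' = a \<circ> (transpose x y \<circ> transpose x z)"
    have a'v: "a' y = y" "a' z = z" "a' x = a z" "\<And>t. t \<noteq> x \<Longrightarrow> t \<noteq> y \<Longrightarrow> t \<noteq> z \<Longrightarrow> a' t = a t"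
      using d by (auto simp: a'_def transpose_def y_def z_def)
    have "a' permutes S" unfolding a'_def using d long
      by (intro permutes_compose permutes_swap_id aS) auto
    then have a'S: "a' permutes ?S"
      by (rule permutes_superset) (use a'v in auto)
    have "evenperm a'" unfolding a'_def using ev d perm
      by (simp add: evenperm_comp evenperm_swap permutation_compose permutation_swap_id)
    then obtain c where c: "c permutes ?S" "single_orbit c ?S" "single_orbit (a' \<circ> c) ?S"
      using psubset.IH[of ?S a'] d a'S by blast
    define x' where "x' = pinv c x"
    have x': "c x' = x" "x' \<in> ?S" unfolding x'_def using c(1) xS
      by (simp add: permutes_inverses, subst permutes_in_image[OF permutes_inv[OF c(1)]])
    have cyz: "c y = y" "c z = z" using c(1) by (auto simp: permutes_not_in)
    have ct: "c t = x \<longleftrightarrow> t = x'" "c t = y \<longleftrightarrow> t = y" "c t = z \<longleftrightarrow> t = z" for t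
      using inj_eq[OF permutes_inj[OF c(1)]] x' cyz by metis+
    have pc: "u \<circ> transpose x' p \<circ> transpose x' q permutes S" if "u permutes ?S" "p \<in> S" "q \<in> S" for u p q
      using that x' by (intro permutes_compose permutes_swap_id) (auto intro: permutes_subset)
    have so: "single_orbit (u \<circ> transpose x' p \<circ> transpose x' q) S"
      if "u permutes ?S" "single_orbit u ?S" "p = y \<and> q = z \<or> p = z \<and> q = y" for u p q
    proof -
      have 1: "single_orbit (u \<circ> transpose x' p) (insert p ?S)"
        using that x' by (intro single_orbit_insert) auto
      have 2: "u \<circ> transpose x' p permutes insert p ?S"
        using that x' by (intro permutes_compose permutes_swap_id) (auto intro: permutes_subset)
      have "single_orbit (u \<circ> transpose x' p \<circ> transpose x' q) (insert q (insert p ?S))"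
        using that x' d by (intro single_orbit_insert 1 2) auto
      moreover have "insert q (insert p ?S) = S" using that d by auto
      ultimately show ?thesis by simp
    qed
    \<comment> \<open>Moved through \<open>c\<close>, the 3-cycle by which \<open>a\<close> differs
      from \<open>a'\<close> becomes \<open>transpose x' z \<circ> transpose x' y\<close>. In
      \<open>a \<circ> ?c\<close> it thus occurs twice, and its square is its inverse: the same two
      insertions in the opposite order.\<close>
    let ?c = "c \<circ> transpose x' z \<circ> transpose x' y"
    have ac: "a \<circ> ?c = (a' \<circ> c) \<circ> transpose x' y \<circ> transpose x' z"
    proof
      fix t
      have xd: "x' \<noteq> y" "x' \<noteq> z" using x' by auto
      have ax: "a x = y" "a y = z" by (simp_all add: y_def z_def)
      show "(a \<circ> ?c) t = ((a' \<circ> c) \<circ> transpose x' y \<circ> transpose x' z) t"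
      proof (cases "t = x' \<or> t = y \<or> t = z")
        case True
        then show ?thesis using xd d(1-3) x'(1) cyz a'v(1-3) ax by (auto simp: transpose_def)
      next
        case False
        then have "c t \<noteq> x" "c t \<noteq> y" "c t \<noteq> z" using ct by auto
        then show ?thesis using False a'v(4) by (simp add: transpose_def)
      qed
    qed
    have "?c permutes S" by (rule pc[OF c(1) d(5) d(4)])
    moreover have "single_orbit ?c S" by (rule so[OF c(1) c(2)]) simp
    moreover have "single_orbit (a \<circ> ?c) S" unfolding ac
      by (rule so[OF permutes_compose[OF c(1) a'S] c(3)]) simp
    ultimately show ?thesis by blast
  next
    case inv
    then obtain x where x: "x \<in> S" by auto
    define y where "y = a x"
    have y: "y \<in> S" "y \<noteq> x" "a y = x" using x inv ain by (auto simp: y_def)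
    \<comment> \<open>A lone 2-cycle is odd, so there is a second one.\<close>
    have "S \<noteq> {x, y}"
    proof
      assume "S = {x, y}"
      then have "a = id \<or> a = transpose x y" using aS by (simp add: permutes_doubleton_iff)
      moreover have "a \<noteq> id" using y by auto
      ultimately have "evenperm (transpose x y)" using ev by metis
      then show False using y by (simp add: evenperm_swap)
    qed
    then obtain z where z: "z \<in> S" "z \<noteq> x" "z \<noteq> y" using x y by auto
    define w where "w = a z"
    have w: "w \<in> S" "w \<noteq> z" "w \<noteq> x" "w \<noteq> y" "a w = z"
      using z inv ain ainj x y by (metis w_def)+
    have ax: "a x = y" "a z = w" by (simp_all add: y_def w_def)
    let ?S = "S - {x, y, z, w}"
    define a' where "a' = a \<circ> (transpose x y \<circ> transpose z w)"
    have a'v: "a' x = x" "a' y = y" "a' z = z" "a' w = w"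
        "\<And>t. t \<noteq> x \<Longrightarrow> t \<noteq> y \<Longrightarrow> t \<noteq> z \<Longrightarrow> t \<noteq> w \<Longrightarrow> a' t = a t"
      using y z w by (auto simp: a'_def transpose_def ax)
    have "a' permutes S" unfolding a'_def using x y z w
      by (intro permutes_compose permutes_swap_id aS) auto
    then have a'S: "a' permutes ?S"
      by (rule permutes_superset) (use a'v in auto)
    have "evenperm a'" unfolding a'_def using ev x y z w perm
      by (simp add: evenperm_comp evenperm_swap permutation_compose permutation_swap_id)
    then obtain c where c: "c permutes ?S" "single_orbit c ?S" "single_orbit (a' \<circ> c) ?S"
      using psubset.IH[of ?S a'] x a'S by blast
    have ins: "u \<circ> transpose t p permutes insert p T \<and> single_orbit (u \<circ> transpose t p) (insert p T)"
      if "u permutes T" "single_orbit u T" "t \<in> T" "p \<notin> T" for u t p and T :: "'a set"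
      using that by (intro conjI single_orbit_insert permutes_compose permutes_swap_id) (auto intro: permutes_subset)
    show ?thesis
    proof (cases "?S = {}")
      case True
      then have S: "S = {x, y, z, w}" using x y z w by auto
      have ch: "id \<circ> transpose x p \<circ> transpose x q \<circ> transpose x r permutes S \<and>
         single_orbit (id \<circ> transpose x p \<circ> transpose x q \<circ> transpose x r) S"
        if "{p, q, r} = {y, z, w}" "distinct [p, q, r]" for p q r
      proof -
        have 0: "id permutes {x} \<and> single_orbit id {x}" by (auto simp: single_orbit_def intro: exI[of _ 0])
        have xx: "x \<notin> {p, q, r}" using that(1) y z w by auto
        have S': "insert r (insert q (insert p {x})) = S" using S that(1) by auto
        have i1: "id \<circ> transpose x p permutes insert p {x} \<and> single_orbit (id \<circ> transpose x p) (insert p {x})"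
          using 0 xx by (intro ins) auto
        have i2: "id \<circ> transpose x p \<circ> transpose x q permutes insert q (insert p {x}) \<and>
           single_orbit (id \<circ> transpose x p \<circ> transpose x q) (insert q (insert p {x}))"
          using i1 xx that(2) by (intro ins) auto
        show ?thesis
          using ins[OF conjunct1[OF i2] conjunct2[OF i2], of x r] xx that(2) unfolding S' by auto
      qed
      \<comment> \<open>The double transposition \<open>a\<close> is the inverse square of this
        4-cycle, so \<open>a \<circ> ?c\<close> is the inverse 4-cycle.\<close>
      let ?c = "id \<circ> transpose x w \<circ> transpose x y \<circ> transpose x z"
      have ac: "a \<circ> ?c = id \<circ> transpose x z \<circ> transpose x y \<circ> transpose x w"
      proof
        fix t
        have out: "a t = t" if "t \<notin> S" for t using aS that by (simp add: permutes_not_in)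
        consider "t = x" | "t = y" | "t = z" | "t = w" | "t \<notin> S" using S by blast
        then show "(a \<circ> ?c) t = (id \<circ> transpose x z \<circ> transpose x y \<circ> transpose x w) t"
          by cases (use x y z w ax S out in \<open>auto simp add: transpose_def\<close>)
      qed
      have "{w, y, z} = {y, z, w}" "{z, y, w} = {y, z, w}" by auto
      then have "?c permutes S \<and> single_orbit ?c S" "single_orbit (a \<circ> ?c) S"
        unfolding ac using ch[of w y z] ch[of z y w] y z w by simp_all
      then show ?thesis by blast
    next
      case False
      then obtain t0 where t0: "t0 \<in> ?S" by auto
      have ch: "u \<circ> transpose t0 p \<circ> transpose t0 q \<circ> transpose t0 r \<circ> transpose t0 s permutes S \<and>
         single_orbit (u \<circ> transpose t0 p \<circ> transpose t0 q \<circ> transpose t0 r \<circ> transpose t0 s) S"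
        if "{p, q, r, s} = {x, y, z, w}" "distinct [p, q, r, s]" "u permutes ?S" "single_orbit u ?S" for u p q r s
      proof -
        have xx: "t0 \<notin> {p, q, r, s}" using that(1) t0 by auto
        have "insert s (insert r (insert q (insert p ?S))) = {p, q, r, s} \<union> ?S" by auto
        then have S': "insert s (insert r (insert q (insert p ?S))) = S"
          unfolding that(1) using x y z w by auto
        have 1: "p \<notin> ?S" "q \<notin> ?S" "r \<notin> ?S" "s \<notin> ?S" using that(1) by auto
        note i1 = ins[OF that(3,4) t0 1(1)]
        have i2: "u \<circ> transpose t0 p \<circ> transpose t0 q permutes insert q (insert p ?S) \<and>
           single_orbit (u \<circ> transpose t0 p \<circ> transpose t0 q) (insert q (insert p ?S))"
          using i1 t0 1 that(2) by (intro ins) auto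
        have i3: "u \<circ> transpose t0 p \<circ> transpose t0 q \<circ> transpose t0 r permutes insert r (insert q (insert p ?S)) \<and>
           single_orbit (u \<circ> transpose t0 p \<circ> transpose t0 q \<circ> transpose t0 r) (insert r (insert q (insert p ?S)))"
          using i2 t0 1 that(2) by (intro ins) auto
        show ?thesis
          using ins[OF conjunct1[OF i3] conjunct2[OF i3], of t0 s] t0 1 that(2) unfolding S' by auto
      qed
      \<comment> \<open>The four points are inserted after the same \<open>t0\<close>, in an order
        for which exchanging the images \<open>x\<close> and \<open>y\<close>, and \<open>z\<close>
        and \<open>w\<close>, gives another chain of insertions.\<close>
      let ?c = "c \<circ> transpose t0 w \<circ> transpose t0 y \<circ> transpose t0 z \<circ> transpose t0 x"
      let ?d = "(a' \<circ> c) \<circ> transpose t0 w \<circ> transpose t0 x \<circ> transpose t0 z \<circ> transpose t0 y"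
      have cf: "c x = x" "c y = y" "c z = z" "c w = w" using c(1) by (auto simp: permutes_not_in)
      have cne: "c t \<noteq> x \<and> c t \<noteq> y \<and> c t \<noteq> z \<and> c t \<noteq> w"
        if "t \<noteq> x" "t \<noteq> y" "t \<noteq> z" "t \<noteq> w" for t
        using inj_eq[OF permutes_inj[OF c(1)]] that cf by metis
      have ac: "a \<circ> ?c = ?d"
      proof
        fix t
        have td: "t0 \<noteq> x" "t0 \<noteq> y" "t0 \<noteq> z" "t0 \<noteq> w" using t0 by auto
        consider "t = x" | "t = y" | "t = z" | "t = w" | "t = t0"
          | "t \<noteq> x" "t \<noteq> y" "t \<noteq> z" "t \<noteq> w" "t \<noteq> t0" by blast
        then show "(a \<circ> ?c) t = ?d t"
          by cases (use td x y z w ax cf cne[OF td] cne[of t] a'v in \<open>simp_all add: transpose_def\<close>)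
      qed
      have ds: "{w, y, z, x} = {x, y, z, w}" "{w, x, z, y} = {x, y, z, w}" by auto
      have "?c permutes S \<and> single_orbit ?c S" using ch[OF ds(1) _ c(1,2)] y z w by simp
      moreover have "single_orbit ?d S"
        using ch[OF ds(2) _ permutes_compose[OF c(1) a'S] c(3)] y z w by simp
      ultimately show ?thesis unfolding ac[symmetric] by blast
    qed
  qed
qed

section \<open>Periods, parity and lifting of single cycles\<close>

lemma single_orbitE:
  assumes "single_orbit v S" "x \<in> S" "y \<in> S"
  obtains i where "(v ^^ i) x = y"
  using assms unfolding single_orbit_def by blast

text \<open>Since \<open>single_orbit\<close> speaks of forward iterates, \<open>v x\<close> must
  return to \<open>x\<close>. So the orbit is finite, and its least period is its
  cardinality.\<close>

lemma single_orbit_funpow_eq_iff: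
  assumes so: "single_orbit v S" and vS: "\<And>x. x \<in> S \<Longrightarrow> v x \<in> S" and x: "x \<in> S"
  shows "(v ^^ i) x = x \<longleftrightarrow> card S dvd i" and "finite S"
proof -
  obtain j where "(v ^^ j) (v x) = x" by (rule single_orbitE[OF so vS[OF x] x])
  then have ex: "\<exists>m>0. (v ^^ m) x = x" using funpow_Suc_swap[of j v x] by (metis zero_less_Suc)
  define m where "m = (LEAST m. m > 0 \<and> (v ^^ m) x = x)"
  have m: "m > 0" "(v ^^ m) x = x" using LeastI_ex[OF ex] by (auto simp: m_def)
  have least: "m \<le> n" if "n > 0" "(v ^^ n) x = x" for n
    using that unfolding m_def by (intro Least_le) simp
  have S: "S = (\<lambda>i. (v ^^ i) x) ` {..<m}"
  proof (intro equalityI subsetI)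
    fix y assume "y \<in> S"
    obtain i where "(v ^^ i) x = y" by (rule single_orbitE[OF so x \<open>y \<in> S\<close>])
    then have "(v ^^ (i mod m)) x = y" using funpow_mod_eq[OF m(2), of i] by simp
    then show "y \<in> (\<lambda>i. (v ^^ i) x) ` {..<m}" using m(1) by (auto intro!: image_eqI[of _ _ "i mod m"])
  next
    fix y assume "y \<in> (\<lambda>i. (v ^^ i) x) ` {..<m}"
    then show "y \<in> S" using funpow_in[of S v x] vS x by auto
  qed
  have ne: "(v ^^ i) x \<noteq> (v ^^ j) x" if "i < j" "j < m" for i j
  proof
    assume e: "(v ^^ i) x = (v ^^ j) x"
    have "(v ^^ (m - j + i)) x = (v ^^ (m - j)) ((v ^^ i) x)" by (simp add: funpow_plus)
    also have "\<dots> = (v ^^ m) x" unfolding e using that by (simp add: funpow_plus)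
    finally have "(v ^^ (m - j + i)) x = x" using m by simp
    then show False using least[of "m - j + i"] that by simp
  qed
  have "inj_on (\<lambda>i. (v ^^ i) x) {..<m}"
    by (rule inj_onI) (metis ne lessThan_iff linorder_neqE_nat)
  then have card: "card S = m" unfolding S by (simp add: card_image)
  show "finite S" unfolding S by simp
  show "(v ^^ i) x = x \<longleftrightarrow> card S dvd i"
  proof
    assume "(v ^^ i) x = x"
    then have "(v ^^ (i mod m)) x = x" using funpow_mod_eq[OF m(2), of i] by simp
    then have "i mod m = 0" using least[of "i mod m"] m(1) by (metis mod_less_divisor leD gr0I)
    then show "card S dvd i" unfolding card by auto
  next
    assume "card S dvd i"
    then have "i mod m = 0" unfolding card by simp
    then show "(v ^^ i) x = x" using funpow_mod_eq[OF m(2), of i] by simp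
  qed
qed

lemma single_orbit_funpow_cong:
  assumes "single_orbit v S" "\<And>x. x \<in> S \<Longrightarrow> v x \<in> S" "inj v" "x \<in> S" "i \<le> j"
  shows "(v ^^ i) x = (v ^^ j) x \<longleftrightarrow> card S dvd (j - i)"
proof -
  have "(v ^^ j) x = (v ^^ i) ((v ^^ (j - i)) x)" using assms(5) by (simp add: funpow_plus)
  moreover have "inj (v ^^ i)" using assms(3) by (rule inj_fn)
  ultimately have "(v ^^ i) x = (v ^^ j) x \<longleftrightarrow> x = (v ^^ (j - i)) x" by (simp add: inj_eq)
  then show ?thesis using single_orbit_funpow_eq_iff(1)[OF assms(1,2,4), of "j - i"] by auto
qed

lemma permutes_funpow_back:
  assumes "v permutes S" "finite S" "(v ^^ i) x = y"
  shows "\<exists>j. (v ^^ j) y = x"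
proof -
  have "permutation v" using assms by (auto simp: permutation_permutes)
  then obtain k where k: "(v ^^ k) x = x" "k > 0" using permutation_self by metis
  have "(v ^^ (i * k)) x = x" using funpow_mod_eq[OF k(1), of "i * k"] by simp
  moreover have "i \<le> i * k" using k by simp
  ultimately have "(v ^^ (i * k - i)) y = x" unfolding assms(3)[symmetric] by (simp add: funpow_plus)
  then show ?thesis by blast
qed

lemma evenperm_conj:
  assumes "\<phi> permutes S" "w permutes S" "w' permutes S" "finite S" "\<phi> \<circ> w = w' \<circ> \<phi>"
  shows "evenperm w = evenperm w'"
proof -
  have p: "permutation \<phi>" "permutation w" "permutation w'" using assms by (auto simp: permutation_permutes)
  have "evenperm (\<phi> \<circ> w) = evenperm (w' \<circ> \<phi>)" using assms(5) by simp
  then show ?thesis using p by (auto simp: evenperm_comp)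
qed

text \<open>
  If \<open>v\<close> covers a single cycle \<open>vq\<close> on the quotient, then it is a single cycle as soon as its first return map
  to one fibre is. This reduces the choice of cycles on one level of a tree to a choice on one fibre.
\<close>

locale fibre_cycle =
  fixes S :: "'a set" and p :: "'a \<Rightarrow> 'b" and v :: "'a \<Rightarrow> 'a" and vq :: "'b \<Rightarrow> 'b" and q0 :: 'b
  assumes fin: "finite S" and vS: "v permutes S" and pv: "\<And>x. x \<in> S \<Longrightarrow> p (v x) = vq (p x)"
    and so: "single_orbit vq (p ` S)" and q0: "q0 \<in> p ` S"
begin

definition "fib = {z \<in> S. p z = q0}"
definition "N = card (p ` S)"
definition "ret z = (if z \<in> fib then (v ^^ N) z else z)"

lemma N_pos: "N > 0" unfolding N_def using fin q0 by (auto simp: card_gt_0_iff)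

lemma v_pow_in: "x \<in> S \<Longrightarrow> (v ^^ i) x \<in> S"
  using vS by (intro funpow_in) (auto simp: permutes_in_image)

lemma v_pow_in_iff: "(v ^^ i) x \<in> S \<longleftrightarrow> x \<in> S"
  by (induction i) (simp_all add: permutes_in_image[OF vS])

lemma p_pow: "x \<in> S \<Longrightarrow> p ((v ^^ i) x) = (vq ^^ i) (p x)"
  by (induction i) (auto simp: pv v_pow_in)

lemma vq_closed: "q \<in> p ` S \<Longrightarrow> vq q \<in> p ` S"
  using vS by (auto simp: pv[symmetric] permutes_in_image)

lemma pow_in_fib: "z \<in> fib \<Longrightarrow> (v ^^ i) z \<in> fib \<longleftrightarrow> N dvd i"
  unfolding fib_def N_def using single_orbit_funpow_eq_iff(1)[OF so vq_closed q0, of i]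
  by (auto simp: p_pow v_pow_in)

lemma fib_sub: "fib \<subseteq> S" by (auto simp: fib_def)

lemma fin_fib: "finite fib" using fib_sub fin finite_subset by blast

lemma inj_v_pow: "inj (v ^^ i)" using vS permutes_inj inj_fn by blast

lemma ret_permutes: "ret permutes fib"
proof (rule bij_imp_permutes)
  have "inj_on ret fib" using inj_v_pow[of N] by (auto simp: inj_on_def ret_def)
  moreover have "ret ` fib \<subseteq> fib" by (auto simp: ret_def pow_in_fib)
  ultimately show "bij_betw ret fib fib"
    using fin_fib by (simp add: bij_betw_def endo_inj_surj)
qed (simp add: ret_def)

text \<open>Between two visits to the fibre an orbit avoids the support of \<open>c\<close>. Hence
  the first return map of \<open>v \<circ> c\<close> is \<open>ret \<circ> c\<close>, and every
  orbit reaches the fibre.\<close>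

lemma single_orbit_comp:
  assumes c: "c permutes fib" and soc: "single_orbit (ret \<circ> c) fib"
  shows "single_orbit (v \<circ> c) S"
proof -
  let ?t = "v \<circ> c"
  have tS: "?t permutes S" using c vS fib_sub by (auto intro: permutes_compose permutes_subset)
  have cin: "c z \<in> fib \<longleftrightarrow> z \<in> fib" for z using c by (rule permutes_in_image)
  have cout: "z \<notin> fib \<Longrightarrow> c z = z" for z using c by (rule permutes_not_in)
  have pc: "z \<in> S \<Longrightarrow> p (c z) = p z \<and> c z \<in> S" for z
    by (cases "z \<in> fib") (use cin[of z] in \<open>auto simp: cout fib_def\<close>)
  have tpow: "(?t ^^ Suc i) z = (v ^^ Suc i) (c z)" if z: "z \<in> fib" and i: "i < N" for z i
    using i
  proof (induction i)
    case (Suc i)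
    have "\<not> N dvd Suc i" using Suc.prems by (auto dest: dvd_imp_le)
    then have "(v ^^ Suc i) (c z) \<notin> fib" using pow_in_fib[of "c z" "Suc i"] cin z by auto
    then show ?case using Suc cout by (auto simp del: funpow.simps simp: funpow.simps(2)[of "Suc i"])
  qed simp
  have tN: "(?t ^^ N) z = (ret \<circ> c) z" if "z \<in> fib" for z
    using tpow[OF that, of "N - 1"] N_pos cin that by (simp add: ret_def)
  have tNk: "\<exists>j. (?t ^^ j) z = ((ret \<circ> c) ^^ k) z \<and> ((ret \<circ> c) ^^ k) z \<in> fib" if "z \<in> fib" for z k
  proof (induction k)
    case 0 show ?case using that by (intro exI[of _ 0]) simp
  next
    case (Suc k)
    then obtain j where j: "(?t ^^ j) z = ((ret \<circ> c) ^^ k) z" "((ret \<circ> c) ^^ k) z \<in> fib" by blast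
    have "(?t ^^ (N + j)) z = ((ret \<circ> c) ^^ Suc k) z"
      using tN[OF j(2)] j(1) by (simp add: funpow_add)
    moreover have "((ret \<circ> c) ^^ Suc k) z \<in> fib"
      using j(2) permutes_in_image[OF ret_permutes] cin by simp
    ultimately show ?case by blast
  qed
  have tp: "x \<in> S \<Longrightarrow> (?t ^^ i) x \<in> S \<and> p ((?t ^^ i) x) = (vq ^^ i) (p x)" for x i
    by (induction i) (auto simp: pv pc permutes_in_image[OF vS])
  have to_fib: "\<exists>i. (?t ^^ i) x \<in> fib" if x: "x \<in> S" for x
  proof -
    obtain i where "(vq ^^ i) (p x) = q0" by (rule single_orbitE[OF so imageI[of _ _ p, OF x] q0])
    then show ?thesis using tp[OF x] by (intro exI[of _ i]) (auto simp: fib_def)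
  qed
  show ?thesis unfolding single_orbit_def
  proof (intro ballI)
    fix x y assume x: "x \<in> S" and y: "y \<in> S"
    obtain i where i: "(?t ^^ i) x \<in> fib" using to_fib x by blast
    obtain j where j: "(?t ^^ j) y \<in> fib" using to_fib y by blast
    obtain k where "((ret \<circ> c) ^^ k) ((?t ^^ i) x) = (?t ^^ j) y"
      by (rule single_orbitE[OF soc i j])
    then obtain l where "(?t ^^ l) ((?t ^^ i) x) = (?t ^^ j) y" using tNk[OF i, of k] by auto
    moreover obtain m where "(?t ^^ m) ((?t ^^ j) y) = y"
      using permutes_funpow_back[OF tS fin refl] by blast
    ultimately have "(?t ^^ (m + (l + i))) x = y" by (simp only: funpow_plus[symmetric])
    then show "\<exists>i. (?t ^^ i) x = y" by blast
  qed
qed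

text \<open>\<open>v\<close> with its return map divided out: each point of the fibre comes back to
  itself after \<open>N\<close> steps, so this is a union of \<open>N\<close>-cycles, one for each
  point of the fibre. Its cycle type depends only on \<open>N\<close> and the size of the fibre,
  which isolates the share of \<open>ret\<close> in the sign of \<open>v\<close>.\<close>

definition "w = pinv ret \<circ> v"

lemma w_permutes: "w permutes S"
  unfolding w_def using vS permutes_inv[OF ret_permutes] fib_sub
  by (auto intro: permutes_compose permutes_subset)

lemma evenperm_v: "evenperm v \<longleftrightarrow> (evenperm ret \<longleftrightarrow> evenperm w)"
proof -
  have "permutation ret" "permutation w"
    using ret_permutes w_permutes fin fin_fib by (auto simp: permutation_permutes)
  moreover have "v = ret \<circ> w" unfolding w_def using permutes_inv_o(1)[OF ret_permutes]
    by (simp add: comp_assoc[symmetric])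
  ultimately show ?thesis by (metis evenperm_comp)
qed

lemma w_pow: "z \<in> fib \<Longrightarrow> i < N \<Longrightarrow> (w ^^ i) z = (v ^^ i) z"
proof (induction i)
  case (Suc i)
  have "\<not> N dvd Suc i" using Suc.prems by (auto dest: dvd_imp_le)
  then have "(v ^^ Suc i) z \<notin> fib" using pow_in_fib Suc.prems by blast
  then show ?case using Suc permutes_not_in[OF permutes_inv[OF ret_permutes]] by (simp add: w_def)
qed simp

lemma w_N: "z \<in> fib \<Longrightarrow> (w ^^ N) z = z"
proof -
  assume z: "z \<in> fib"
  obtain n where n: "N = Suc n" using N_pos gr0_implies_Suc by blast
  have "(w ^^ N) z = w ((v ^^ n) z)" unfolding n using w_pow[OF z, of n] n by simp
  also have "\<dots> = pinv ret ((v ^^ N) z)" unfolding n by (simp add: w_def)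
  also have "\<dots> = pinv ret (ret z)" using z by (simp add: ret_def)
  also have "\<dots> = z" using permutes_inverses(2)[OF ret_permutes] .
  finally show ?thesis .
qed

definition "coord = (\<lambda>(i, z). (w ^^ i) z)"

lemma bij_coord: "bij_betw coord ({..<N} \<times> fib) S"
proof (rule bij_betw_imageI)
  show "inj_on coord ({..<N} \<times> fib)"
  proof (rule inj_onI, clarify)
    fix i z j y assume a: "i < N" "z \<in> fib" "j < N" "y \<in> fib" "coord (i, z) = coord (j, y)"
    then have e: "(v ^^ i) z = (v ^^ j) y" by (simp add: coord_def w_pow)
    have "p ((v ^^ i) z) = (vq ^^ i) q0" "p ((v ^^ j) y) = (vq ^^ j) q0"
      using a by (auto simp: fib_def p_pow)
    then have q: "(vq ^^ i) q0 = (vq ^^ j) q0" using e by simp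
    have per: "(vq ^^ N) q0 = q0"
      using single_orbit_funpow_eq_iff(1)[OF so vq_closed q0, of N] by (simp add: N_def)
    have *: False if "i < j" "j < N" "(vq ^^ i) q0 = (vq ^^ j) q0" for i j
    proof -
      have "(vq ^^ (N - j + i)) q0 = (vq ^^ (N - j)) ((vq ^^ j) q0)"
        unfolding that(3)[symmetric] funpow_plus ..
      also have "\<dots> = q0" using that per by (simp add: funpow_plus)
      finally have "N dvd N - j + i"
        using single_orbit_funpow_eq_iff(1)[OF so vq_closed q0, of "N - j + i"] by (simp add: N_def)
      then show False using that by (auto dest: dvd_imp_le)
    qed
    have "i = j" using *[of i j] *[of j i] a q by (metis linorder_neqE_nat)
    then show "i = j \<and> z = y" using e inj_v_pow by (auto dest: injD)
  qed
  show "coord ` ({..<N} \<times> fib) = S"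
  proof (intro equalityI subsetI)
    fix y assume "y \<in> coord ` ({..<N} \<times> fib)"
    then show "y \<in> S" using v_pow_in fib_sub by (auto simp: coord_def w_pow)
  next
    fix y assume y: "y \<in> S"
    obtain i where i: "(vq ^^ i) q0 = p y" by (rule single_orbitE[OF so q0 imageI[of _ _ p, OF y]])
    have per: "(vq ^^ N) q0 = q0"
      using single_orbit_funpow_eq_iff(1)[OF so vq_closed q0, of N] by (simp add: N_def)
    let ?i = "i mod N"
    have i': "(vq ^^ ?i) q0 = p y" "?i < N" using funpow_mod_eq[OF per, of i] i N_pos by auto
    have "bij (v ^^ ?i)" using vS permutes_bij bij_fn by blast
    then obtain z where z: "(v ^^ ?i) z = y" by (metis bij_pointE)
    have "(v ^^ ?i) z \<in> S \<longleftrightarrow> z \<in> S" by (rule v_pow_in_iff)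
    then have zS: "z \<in> S" using y z by simp
    obtain m where m: "(vq ^^ m) (p y) = q0" by (rule single_orbitE[OF so imageI[of _ _ p, OF y] q0])
    have "p z = q0"
    proof -
      have "card (p ` S) dvd m + ?i"
        using single_orbit_funpow_eq_iff(1)[OF so vq_closed q0, of "m + ?i"] i' m by (simp add: funpow_plus[symmetric])
      then have "(vq ^^ (m + ?i)) (p z) = p z"
        using single_orbit_funpow_eq_iff(1)[OF so vq_closed, of "p z" "m + ?i"] zS by auto
      moreover have "(vq ^^ ?i) (p z) = p y" using z p_pow[OF zS, of ?i] by simp
      ultimately show ?thesis using m by (simp add: funpow_plus[symmetric])
    qed
    then have "z \<in> fib" using zS by (simp add: fib_def)
    then show "y \<in> coord ` ({..<N} \<times> fib)"
      using z i' by (auto simp: coord_def w_pow intro!: image_eqI[of _ _ "(?i, z)"])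
  qed
qed

lemma w_coord: "i < N \<Longrightarrow> z \<in> fib \<Longrightarrow> w (coord (i, z)) = coord (Suc i mod N, z)"
proof (cases "Suc i = N")
  case True
  assume "z \<in> fib"
  then have "(w ^^ Suc i) z = z" using w_N[of z] unfolding True by simp
  moreover have "Suc i mod N = 0" using True by simp
  ultimately show ?thesis by (simp add: coord_def)
qed (simp add: coord_def)

end

text \<open>The two remainders \<open>w\<close> consist of equally many cycles of the same length,
  so they are conjugate through the coordinates \<open>coord\<close> and have the same sign. Equal
  signs of \<open>v\<close> and \<open>u\<close> thus mean equal signs of the return maps.\<close>

lemma evenperm_return:
  assumes "fibre_cycle S p v vq q0" "fibre_cycle S p u uq q0" "evenperm v = evenperm u"
  shows "evenperm (fibre_cycle.ret S p v q0) = evenperm (fibre_cycle.ret S p u q0)"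
proof -
  interpret V: fibre_cycle S p v vq q0 by fact
  interpret U: fibre_cycle S p u uq q0 by fact
  define D where "D = {..<V.N} \<times> V.fib"
  have bV: "bij_betw V.coord D S" and bU: "bij_betw U.coord D S"
    using V.bij_coord U.bij_coord by (simp_all add: D_def)
  define \<phi> where "\<phi> x = (if x \<in> S then U.coord (inv_into D V.coord x) else x)" for x
  have "bij_betw (U.coord \<circ> inv_into D V.coord) S S"
    using bij_betw_trans[OF bij_betw_inv_into[OF bV] bU] .
  then have "bij_betw \<phi> S S" by (rule bij_betw_cong[THEN iffD1, rotated]) (simp add: \<phi>_def)
  then have \<phi>: "\<phi> permutes S" by (rule bij_imp_permutes) (simp add: \<phi>_def)
  have \<phi>c: "\<phi> (V.coord d) = U.coord d" if "d \<in> D" for d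
    using that bV by (auto simp: \<phi>_def bij_betw_inv_into_left bij_betw_apply)
  have "\<phi> \<circ> V.w = U.w \<circ> \<phi>"
  proof
    fix x show "(\<phi> \<circ> V.w) x = (U.w \<circ> \<phi>) x"
    proof (cases "x \<in> S")
      case True
      then obtain i z where iz: "i < V.N" "z \<in> V.fib" "x = V.coord (i, z)"
        using bV unfolding bij_betw_def D_def by blast
      have "Suc i mod V.N < V.N" using V.N_pos by simp
      then show ?thesis using iz V.w_coord[of i z] U.w_coord[of i z] \<phi>c[of "(i, z)"] \<phi>c[of "(Suc i mod V.N, z)"]
        by (simp add: D_def)
    next
      case False
      then show ?thesis using V.w_permutes U.w_permutes \<phi> by (simp add: permutes_not_in)
    qed
  qed
  then have "evenperm V.w = evenperm U.w"
    using evenperm_conj[OF \<phi> V.w_permutes U.w_permutes V.fin] by simp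
  then show ?thesis using V.evenperm_v U.evenperm_v assms(3) by blast
qed

text \<open>It suffices to choose \<open>c\<close> on one fibre, in such a way that both return maps
  followed by it become full cycles. The quotient of the return maps is even, so
  \<open>even_factor_long_cycles\<close> applies to it. If \<open>p\<close> is injective, the fibre
  is a single point and signs do not matter.\<close>

lemma lift_single_orbit:
  fixes p :: "'a \<Rightarrow> 'b"
  assumes fin: "finite S" and v: "v permutes S" and u: "u permutes S"
    and pv: "\<And>x. x \<in> S \<Longrightarrow> p (v x) = vq (p x)" and pu: "\<And>x. x \<in> S \<Longrightarrow> p (u x) = uq (p x)"
    and so: "single_orbit vq (p ` S)" "single_orbit uq (p ` S)"
    and ev: "evenperm v = evenperm u \<or> inj_on p S"
  shows "\<exists>c. c permutes S \<and> (\<forall>z\<in>S. p (c z) = p z) \<and> single_orbit (v \<circ> c) S \<and> single_orbit (u \<circ> c) S"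
proof (cases "S = {}")
  case True
  then show ?thesis by (intro exI[of _ id]) (simp add: single_orbit_def)
next
  case False
  then obtain q0 where q0: "q0 \<in> p ` S" by auto
  have V: "fibre_cycle S p v vq q0" and U: "fibre_cycle S p u uq q0"
    using assms q0 by (simp_all add: fibre_cycle_def)
  interpret V: fibre_cycle S p v vq q0 by (rule V)
  interpret U: fibre_cycle S p u uq q0 by (rule U)
  have ret: "V.ret permutes V.fib" "U.ret permutes V.fib" using V.ret_permutes U.ret_permutes by auto
  have perm: "permutation V.ret" "permutation U.ret" using ret V.fin_fib by (auto simp: permutation_permutes)
  have "evenperm V.ret = evenperm U.ret"
  proof (cases "inj_on p S")
    case True
    obtain s where "s \<in> S" "p s = q0" using q0 by auto
    then have "V.fib = {s}" using True by (auto simp: V.fib_def inj_on_def)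
    then have "V.ret = id" "U.ret = id" using ret by auto
    then show ?thesis by simp
  next
    case False
    then show ?thesis using evenperm_return[OF V U] ev by simp
  qed
  then have "evenperm (V.ret \<circ> pinv U.ret)"
    using perm by (simp add: evenperm_comp evenperm_inv permutation_inverse)
  moreover have pp: "V.ret \<circ> pinv U.ret permutes V.fib"
    by (intro permutes_compose permutes_inv ret)
  ultimately obtain c where c: "c permutes V.fib" "single_orbit c V.fib"
      "single_orbit ((V.ret \<circ> pinv U.ret) \<circ> c) V.fib"
    using even_factor_long_cycles[OF V.fin_fib] by blast
  define d where "d = pinv U.ret \<circ> c"
  have d: "d permutes V.fib" unfolding d_def by (intro permutes_compose permutes_inv ret c(1))
  have "V.ret \<circ> d = (V.ret \<circ> pinv U.ret) \<circ> c" "U.ret \<circ> d = c"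
    unfolding d_def using permutes_inv_o(1)[OF ret(2)] by (simp_all add: comp_assoc[symmetric])
  then have "single_orbit (V.ret \<circ> d) V.fib" "single_orbit (U.ret \<circ> d) V.fib" using c by simp_all
  then have "single_orbit (v \<circ> d) S" "single_orbit (u \<circ> d) S"
    using V.single_orbit_comp U.single_orbit_comp d by simp_all
  moreover have "d permutes S" using d V.fib_sub by (rule permutes_subset)
  moreover have "p (d z) = p z" if "z \<in> S" for z
  proof (cases "z \<in> V.fib")
    case True
    then have "d z \<in> V.fib" using permutes_in_image[OF d] by simp
    then show ?thesis using True by (simp add: V.fib_def)
  qed (simp add: permutes_not_in[OF d])
  ultimately show ?thesis by blast
qed

section \<open>Permutations commuting with a function\<close>

text \<open>Total functions that are the identity off \<open>Y\<close>, in contrast to the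
  extensional bijections of \<open>Aut\<close>. Thus the groups for different sets \<open>Y\<close>
  are literally nested, and local automorphisms can be composed without being extended or
  restricted.\<close>

definition aut :: "('x \<Rightarrow> 'x) \<Rightarrow> 'x set \<Rightarrow> ('x \<Rightarrow> 'x) set"
  where "aut f Y = {g. g permutes Y \<and> (\<forall>x. g (f x) = f (g x))}"

lemma autI: "g permutes Y \<Longrightarrow> (\<And>x. g (f x) = f (g x)) \<Longrightarrow> g \<in> aut f Y"
  by (simp add: aut_def)

lemma aut_permutes: "g \<in> aut f Y \<Longrightarrow> g permutes Y"
  by (simp add: aut_def)

lemma aut_comm: "g \<in> aut f Y \<Longrightarrow> g (f x) = f (g x)"
  by (simp add: aut_def)

lemma aut_comm_funpow: assumes "g \<in> aut f Y" shows "g ((f ^^ n) x) = (f ^^ n) (g x)"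
  by (induction n) (auto simp: aut_comm[OF assms])

lemma aut_out: "g \<in> aut f Y \<Longrightarrow> x \<notin> Y \<Longrightarrow> g x = x"
  by (rule permutes_not_in[OF aut_permutes])

lemma aut_in: "g \<in> aut f Y \<Longrightarrow> g x \<in> Y \<longleftrightarrow> x \<in> Y"
  by (rule permutes_in_image[OF aut_permutes])

lemma aut_bij: "g \<in> aut f Y \<Longrightarrow> bij g"
  by (rule permutes_bij[OF aut_permutes])

lemma aut_inj: "g \<in> aut f Y \<Longrightarrow> inj g"
  by (rule permutes_inj[OF aut_permutes])

lemma aut_eq: "g \<in> aut f Y \<Longrightarrow> g x = g y \<longleftrightarrow> x = y"
  using inj_eq[OF aut_inj] .

lemma aut_inv_l [simp]: "g \<in> aut f Y \<Longrightarrow> pinv g (g x) = x"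
  by (simp add: aut_inj)

lemma aut_inv_r: "g \<in> aut f Y \<Longrightarrow> g (pinv g x) = x"
  by (simp add: aut_bij bij_is_surj surj_f_inv_f)

lemma aut_pinv_o [simp]: "g \<in> aut f Y \<Longrightarrow> pinv g \<circ> g = id" "g \<in> aut f Y \<Longrightarrow> g \<circ> pinv g = id"
  by (auto simp: fun_eq_iff aut_inv_r)

lemma aut_id [simp]: "id \<in> aut f Y"
  by (simp add: aut_def)

lemma aut_comp: "g \<in> aut f Y \<Longrightarrow> h \<in> aut f Y \<Longrightarrow> g \<circ> h \<in> aut f Y"
  by (auto simp: aut_def intro: permutes_compose)

lemma aut_inv: assumes g: "g \<in> aut f Y" shows "pinv g \<in> aut f Y"
proof (rule autI)
  show "pinv g permutes Y" using g by (simp add: aut_def permutes_inv)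
  fix x
  have "g (pinv g (f x)) = g (f (pinv g x))" by (simp add: aut_comm[OF g] aut_inv_r[OF g])
  then show "pinv g (f x) = f (pinv g x)" using aut_eq[OF g] by blast
qed

lemma aut_pow: assumes "g \<in> aut f Y" shows "g ^^ n \<in> aut f Y"
proof (induction n)
  case (Suc n)
  show ?case using aut_comp[OF assms Suc] unfolding funpow.simps .
qed (simp only: funpow.simps aut_id)

lemma aut_mono: "Y \<subseteq> Z \<Longrightarrow> aut f Y \<subseteq> aut f Z"
  by (auto simp: aut_def intro: permutes_subset)

lemma aut_mono': "g \<in> aut f Y \<Longrightarrow> Y \<subseteq> Z \<Longrightarrow> g \<in> aut f Z"
  using aut_mono by blast

lemma aut_restrict: "g \<in> aut f Z \<Longrightarrow> (\<And>x. x \<notin> Y \<Longrightarrow> g x = x) \<Longrightarrow> g \<in> aut f Y"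
  unfolding aut_def permutes_def by blast

lemma aut_UNIV: "g \<in> aut f Y \<Longrightarrow> g \<in> aut f UNIV"
  by (rule aut_mono') auto

section \<open>Products of a fixed number of commutators\<close>

abbreviation commutator :: "('x \<Rightarrow> 'x) \<Rightarrow> ('x \<Rightarrow> 'x) \<Rightarrow> 'x \<Rightarrow> 'x"
  where "commutator a b \<equiv> a \<circ> b \<circ> pinv a \<circ> pinv b"

fun comm_prods :: "('x \<Rightarrow> 'x) set \<Rightarrow> nat \<Rightarrow> ('x \<Rightarrow> 'x) set" where
  "comm_prods H 0 = {id}"
| "comm_prods H (Suc n) = {commutator a b \<circ> u | a b u. a \<in> H \<and> b \<in> H \<and> u \<in> comm_prods H n}"

lemma comm_prods_SucI: "a \<in> H \<Longrightarrow> b \<in> H \<Longrightarrow> u \<in> comm_prods H n \<Longrightarrow> commutator a b \<circ> u \<in> comm_prods H (Suc n)"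
  unfolding comm_prods.simps by (rule CollectI, rule exI[of _ a], rule exI[of _ b], rule exI[of _ u]) simp

lemma comm_prods_1I: "a \<in> H \<Longrightarrow> b \<in> H \<Longrightarrow> commutator a b \<in> comm_prods H 1"
  using comm_prods_SucI[of a H b id 0] by simp

lemma comm_prods_mono: "H \<subseteq> K \<Longrightarrow> comm_prods H n \<subseteq> comm_prods K n"
proof (induction n)
  case (Suc n)
  show ?case
  proof
    fix g assume "g \<in> comm_prods H (Suc n)"
    then obtain a b u where "g = commutator a b \<circ> u" "a \<in> H" "b \<in> H" "u \<in> comm_prods H n" by auto
    then show "g \<in> comm_prods K (Suc n)" using Suc comm_prods_SucI[of a K b u n] by blast
  qed
qed simp

lemma comm_prods_add: "u \<in> comm_prods H m \<Longrightarrow> v \<in> comm_prods H n \<Longrightarrow> u \<circ> v \<in> comm_prods H (m + n)"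
proof (induction m arbitrary: u)
  case (Suc m)
  then obtain a b w where w: "u = commutator a b \<circ> w" "a \<in> H" "b \<in> H" "w \<in> comm_prods H m" by auto
  have "commutator a b \<circ> (w \<circ> v) \<in> comm_prods H (Suc (m + n))" by (intro comm_prods_SucI w Suc.IH Suc.prems)
  then show ?case unfolding w(1) comp_assoc add_Suc .
qed simp

lemma id_in_comm_prods: "id \<in> H \<Longrightarrow> id \<in> comm_prods H n"
proof (induction n)
  case (Suc n)
  show ?case using comm_prods_SucI[OF Suc.prems Suc.prems Suc.IH[OF Suc.prems]] by (simp only: comp_id inv_id)
qed simp

lemma comm_prods_le: "id \<in> H \<Longrightarrow> m \<le> n \<Longrightarrow> u \<in> comm_prods H m \<Longrightarrow> u \<in> comm_prods H n"
  using comm_prods_add[OF _ id_in_comm_prods[of H "n - m"], of u m] by simp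

lemma comm_prods_aut: "u \<in> comm_prods (aut f Y) n \<Longrightarrow> u \<in> aut f Y"
proof (induction n arbitrary: u)
  case (Suc n)
  then obtain a b w where w: "u = commutator a b \<circ> w" "a \<in> aut f Y" "b \<in> aut f Y" "w \<in> comm_prods (aut f Y) n" by auto
  show ?case unfolding w(1) by (intro aut_comp aut_inv w Suc.IH)
qed simp

text \<open>\<open>B\<close> labels the pieces and \<open>s\<close> permutes the labels. Each label
  \<open>b\<close> has an automorphism \<open>k b\<close>, of which only the effect on the piece
  \<open>b\<close> is used; the second assumption says that it carries this piece onto the piece
  \<open>s b\<close>. Commutation with \<open>f\<close> is a condition only on edges that join
  different pieces.\<close>

lemma glue_aut:
  assumes k: "\<And>x. k (B x) \<in> aut f UNIV"
    and B: "\<And>x y. B (k (B y) x) = s (B y) \<longleftrightarrow> B x = B y"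
    and inj: "\<And>x y. s (B x) = s (B y) \<Longrightarrow> B x = B y"
    and surj: "\<And>y. \<exists>x. s (B x) = B y"
    and comm: "\<And>x. k (B x) (f x) = k (B (f x)) (f x)"
    and out: "\<And>x. x \<notin> Y \<Longrightarrow> k (B x) x = x"
  shows "(\<lambda>x. k (B x) x) \<in> aut f Y"
proof (rule autI)
  let ?h = "\<lambda>x. k (B x) x"
  have Bh: "B (?h x) = s (B x)" for x using B[of x x] by simp
  have "inj ?h"
  proof (rule injI)
    fix x y assume e: "?h x = ?h y"
    then have "B x = B y" using Bh[of x] Bh[of y] inj by simp
    then show "x = y" using e aut_eq[OF k[of y]] by simp
  qed
  moreover have "surj ?h"
  proof (rule surjI)
    fix y
    obtain x0 where x0: "s (B x0) = B y" using surj by blast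
    define x where "x = pinv (k (B x0)) y"
    have kx: "k (B x0) x = y" unfolding x_def using aut_inv_r[OF k[of x0]] .
    then have "B x = B x0" using B[of x0 x] x0 by simp
    then have "?h x = y" using kx by simp
    then show "?h (SOME x. ?h x = y) = y" by (rule someI)
  qed
  ultimately have "bij ?h" by (simp add: bij_def)
  then show "?h permutes Y" using out by (simp add: permutes_def bij_iff)
  fix x show "?h (f x) = f (?h x)" using comm[of x] aut_comm[OF k] by simp
qed

lemma glue_restrict:
  assumes g: "g \<in> aut f UNIV" and T: "\<And>x. g x \<in> T \<longleftrightarrow> x \<in> T"
    and b: "\<And>x. x \<in> T \<Longrightarrow> f x \<notin> T \<Longrightarrow> g (f x) = f x" "\<And>x. x \<notin> T \<Longrightarrow> f x \<notin> T"
  shows "(\<lambda>x. if x \<in> T then g x else x) \<in> aut f T"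
proof -
  have "(\<lambda>x. (if x \<in> T then g else id) x) \<in> aut f T"
    by (rule glue_aut[where B = "\<lambda>x. x \<in> T" and k = "\<lambda>t. if t then g else id" and s = "\<lambda>t. t"])
      (use g T b in auto)
  moreover have "(\<lambda>x. (if x \<in> T then g else id) x) = (\<lambda>x. if x \<in> T then g x else x)" by auto
  ultimately show ?thesis by metis
qed

text \<open>Every point is moved by a sufficiently late member of the sequence. As all members
  preserve the level \<open>N\<close>, bijectivity can be checked on each level with a single
  \<open>G n\<close>.\<close>

lemma lim_aut:
  assumes G: "\<And>n. G n \<in> aut f Y"
    and st: "\<And>n x. N x \<le> n \<Longrightarrow> G n x = G (N x) x"
    and N: "\<And>n x. N (G n x) = (N x :: nat)"
  shows "(\<lambda>x. G (N x) x) \<in> aut f Y"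
proof (rule autI)
  let ?h = "\<lambda>x. G (N x) x"
  have "inj ?h"
  proof (rule injI)
    fix x y assume e: "?h x = ?h y"
    then have "N x = N y" using N by metis
    then show "x = y" using e aut_eq[OF G] by simp
  qed
  moreover have "surj ?h"
  proof (rule surjI)
    fix y
    have "N (pinv (G (N y)) y) = N y" using N[of "N y" "pinv (G (N y)) y"] by (simp add: aut_inv_r[OF G])
    then show "?h (pinv (G (N y)) y) = y" by (simp add: aut_inv_r[OF G])
  qed
  ultimately have "bij ?h" by (simp add: bij_def)
  moreover have "?h x = x" if "x \<notin> Y" for x using aut_out[OF G that] .
  ultimately show "?h permutes Y" by (simp add: permutes_def bij_iff)
  fix x
  let ?n = "max (N x) (N (f x))"
  show "?h (f x) = f (?h x)" using st[of x ?n] st[of "f x" ?n] aut_comm[OF G, of ?n x] by simp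
qed

text \<open>
  \<open>g\<close> is the commutator of \<open>\<sigma>\<close> and the infinite product of the conjugates of \<open>g\<close> by the powers of \<open>\<sigma>\<close>.
  At \<open>x\<close> only the factors with exponent below \<open>N x\<close> act.
\<close>

lemma swindle:
  fixes N :: "'x \<Rightarrow> nat"
  assumes g: "g \<in> aut f Y" and \<sigma>: "\<sigma> \<in> aut f Y"
    and N: "\<And>i z. N ((\<sigma> ^^ i) (g z)) = N ((\<sigma> ^^ i) z)"
    and fixed: "\<And>i z. N ((\<sigma> ^^ i) z) \<le> i \<Longrightarrow> g z = z"
  shows "g \<in> comm_prods (aut f Y) 1"
proof -
  define a where "a i = (\<sigma> ^^ i) \<circ> g \<circ> pinv (\<sigma> ^^ i)" for i
  have \<sigma>i: "\<sigma> ^^ i \<in> aut f Y" for i using \<sigma> by (rule aut_pow)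
  have a: "a i \<in> aut f Y" for i unfolding a_def by (intro aut_comp aut_inv \<sigma>i g)
  have a_z: "a i ((\<sigma> ^^ i) z) = (\<sigma> ^^ i) (g z)" for i z
    by (simp add: a_def aut_inv_l[OF \<sigma>i])
  have Na: "N (a i x) = N x" for i x
    using a_z[of i "pinv (\<sigma> ^^ i) x"] N[of i "pinv (\<sigma> ^^ i) x"] by (simp add: aut_inv_r[OF \<sigma>i])
  have fixa: "a i x = x" if "N x \<le> i" for i x
    using a_z[of i "pinv (\<sigma> ^^ i) x"] fixed[of i "pinv (\<sigma> ^^ i) x"] that by (simp add: aut_inv_r[OF \<sigma>i])
  define G where "G = rec_nat id (\<lambda>i h. h \<circ> a i)"
  have G0: "G 0 = id" and GS: "G (Suc n) = G n \<circ> a n" for n by (simp_all add: G_def)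
  have G: "G n \<in> aut f Y" for n by (induction n) (simp_all only: G0 GS aut_id aut_comp[OF _ a])
  have NG: "N (G n x) = N x" for n x by (induction n arbitrary: x) (auto simp: G0 GS Na)
  have st: "G n x = G (N x) x" if "N x \<le> n" for n x
    using that by (induction n rule: dec_induct) (auto simp: GS fixa)
  define h where "h x = G (N x) x" for x
  have h: "h \<in> aut f Y" unfolding h_def using G st NG by (rule lim_aut)
  have shift: "\<sigma> (a i x) = a (Suc i) (\<sigma> x)" for i x
    using a_z[of i "pinv (\<sigma> ^^ i) x"] a_z[of "Suc i" "pinv (\<sigma> ^^ i) x"] by (simp add: aut_inv_r[OF \<sigma>i])
  have GG: "G (Suc n) (\<sigma> x) = g (\<sigma> (G n x))" for n x
  proof (induction n arbitrary: x)
    case 0 show ?case by (simp add: GS G0 a_def)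
  next
    case (Suc n)
    have "G (Suc (Suc n)) (\<sigma> x) = G (Suc n) (\<sigma> (a n x))" unfolding GS[of "Suc n"] comp_apply shift ..
    also have "\<dots> = g (\<sigma> (G (Suc n) x))" using Suc[of "a n x"] by (simp only: GS[of n] comp_apply)
    finally show ?case .
  qed
  \<comment> \<open>Conjugation by \<open>\<sigma>\<close> shifts the factors of the infinite
    product \<open>h\<close> by one place and so drops its first factor, which is
    \<open>g\<close>.\<close>
  have key: "h (\<sigma> x) = g (\<sigma> (h x))" for x
  proof -
    let ?n = "max (N x) (N (\<sigma> x))"
    have "h x = G ?n x" "h (\<sigma> x) = G (Suc ?n) (\<sigma> x)" using st[of x ?n] st[of "\<sigma> x" "Suc ?n"] by (simp_all add: h_def)
    then show ?thesis by (simp only: GG)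
  qed
  have "g = commutator h \<sigma>"
  proof
    fix x
    have "commutator h \<sigma> x = g (\<sigma> (h (pinv h (pinv \<sigma> x))))" using key by simp
    also have "\<dots> = g x" by (simp add: aut_inv_r[OF h] aut_inv_r[OF \<sigma>])
    finally show "g x = commutator h \<sigma> x" by simp
  qed
  then show ?thesis using comm_prods_1I[OF h \<sigma>] by simp
qed

section \<open>Cardinal arithmetic for the swindle\<close>

lemma lepoll_iff_ordLeq: "A \<lesssim> B \<longleftrightarrow> |A| \<le>o |B|"
  by (simp add: lepoll_def card_of_ordLeq)

lemma infinite_times_eqpoll:
  assumes "infinite A" "B \<noteq> {}" "B \<lesssim> A" shows "A \<times> B \<approx> A"
  using card_of_Times_infinite[OF assms(1,2)] assms(3)
  by (simp add: lepoll_iff_ordLeq eqpoll_iff_card_of_ordIso)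

lemma infinite_Un_lepoll:
  assumes "infinite F" "F \<subseteq> A \<union> B" shows "F \<lesssim> A \<or> F \<lesssim> B"
proof (rule ccontr)
  assume "\<not> ?thesis"
  then have "|A| <o |F|" "|B| <o |F|" by (simp_all add: lepoll_iff_ordLeq)
  then have "|A \<union> B| <o |F|" using card_of_Un_ordLess_infinite assms(1) by blast
  moreover have "|F| \<le>o |A \<union> B|" using assms(2) by (rule card_of_mono1)
  ultimately show False using not_ordLess_ordLeq by blast
qed

lemma infinite_lepoll_infinite: "infinite A \<Longrightarrow> A \<lesssim> B \<Longrightarrow> infinite B"
  using lepoll_iff_ordLeq card_of_ordLeq_infinite by blast

lemma countable_lepoll_infinite:
  assumes "countable B" "infinite A" shows "B \<lesssim> A"
proof -
  have "B \<lesssim> (UNIV :: nat set)" using assms(1) by (auto simp: countable_def lepoll_def)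
  then show ?thesis using assms(2) infinite_le_lepoll lepoll_trans by blast
qed

lemma infinite_halves:
  assumes "infinite A"
  obtains A1 A2 where "A = A1 \<union> A2" "A1 \<inter> A2 = {}" "A \<lesssim> A1" "A \<lesssim> A2"
proof -
  have "A \<times> (UNIV :: bool set) \<approx> A"
    using assms by (intro infinite_times_eqpoll countable_lepoll_infinite) auto
  then obtain \<psi> where \<psi>: "bij_betw \<psi> (A \<times> (UNIV :: bool set)) A" by (auto simp: eqpoll_def)
  have half: "A \<lesssim> \<psi> ` (A \<times> {b})" for b
  proof -
    have "inj_on (\<lambda>a. \<psi> (a, b)) A" using \<psi> by (auto simp: bij_betw_def inj_on_def)
    then show ?thesis unfolding lepoll_def by (intro exI[of _ "\<lambda>a. \<psi> (a, b)"]) auto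
  qed
  have "A \<times> (UNIV :: bool set) = A \<times> {True} \<union> A \<times> {False}" by auto
  then have "A = \<psi> ` (A \<times> {True}) \<union> \<psi> ` (A \<times> {False})"
    using bij_betw_imp_surj_on[OF \<psi>] by (simp add: image_Un[symmetric])
  moreover have "\<psi> ` (A \<times> {True}) \<inter> \<psi> ` (A \<times> {False}) = {}"
    using \<psi> by (auto simp: bij_betw_def inj_on_def)
  ultimately show ?thesis by (rule that[OF _ _ half half])
qed

text \<open>The grading \<open>col\<close> makes the powers of \<open>s\<close> move \<open>B0\<close> off itself.\<close>

lemma shift_exists:
  fixes F :: "'a set"
  assumes "infinite F" "B0 \<subseteq> F" "F \<lesssim> F - B0"
  shows "\<exists>s col. s permutes F \<and> (\<forall>w\<in>F. col (s w) = col w + (1::int)) \<and> (\<forall>w\<in>B0. col w = 0)"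
proof -
  have inf: "infinite (F - B0)" by (rule infinite_lepoll_infinite[OF assms(1,3)])
  obtain M1 M2 where M: "F - B0 = M1 \<union> M2" "M1 \<inter> M2 = {}" "F - B0 \<lesssim> M1" "F - B0 \<lesssim> M2"
    by (rule infinite_halves[OF inf])
  have sub: "M1 \<subseteq> F" "M2 \<subseteq> F" using M by auto
  have "F \<lesssim> M1" "F \<lesssim> M2" using lepoll_trans[OF assms(3) M(3)] lepoll_trans[OF assms(3) M(4)] .
  then have 1: "B0 \<union> M1 \<approx> F" "M2 \<approx> F"
    using sub assms(2) lepoll_trans[OF \<open>F \<lesssim> M1\<close> subset_imp_lepoll[of M1 "B0 \<union> M1"]]
    by (auto intro!: lepoll_antisym subset_imp_lepoll)
  have "(1::int) \<in> UNIV - {0}" by simp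
  then have Fint: "F \<times> (UNIV - {0 :: int}) \<approx> F"
    using assms(1) by (intro infinite_times_eqpoll countable_lepoll_infinite) blast+
  from 1(2) have 2: "M2 \<approx> F \<times> (UNIV - {0 :: int})" by (rule eqpoll_trans[OF _ eqpoll_sym[OF Fint]])
  have "F \<approx> F \<times> {0 :: int}" by (rule eqpoll_sym, rule eqpoll_trans[OF times_commute_eqpoll times_singleton_eqpoll])
  from this have 3: "B0 \<union> M1 \<approx> F \<times> {0 :: int}" by (rule eqpoll_trans[OF 1(1)])
  obtain p where p: "bij_betw p M2 (F \<times> (UNIV - {0 :: int}))" using 2 by (auto simp: eqpoll_def)
  obtain q where q: "bij_betw q (B0 \<union> M1) (F \<times> {0 :: int})" using 3 by (auto simp: eqpoll_def)
  \<comment> \<open>\<open>r\<close> identifies \<open>F\<close> with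
    \<open>F \<times> UNIV\<close>, a stack of layers indexed by the integers, with
    \<open>B0\<close> in layer 0: the half \<open>M1\<close> fills up this layer, the half
    \<open>M2\<close> supplies all others. Shifting the layers is the permutation sought.\<close>
  define r where "r w = (if w \<in> M2 then p w else q w)" for w
  have "bij_betw r M2 (F \<times> (UNIV - {0}))" using p by (rule bij_betw_cong[THEN iffD1, rotated]) (simp add: r_def)
  moreover have "bij_betw r (B0 \<union> M1) (F \<times> {0})"
    using q by (rule bij_betw_cong[THEN iffD1, rotated]) (use M in \<open>auto simp: r_def\<close>)
  ultimately have "bij_betw r (M2 \<union> (B0 \<union> M1)) (F \<times> (UNIV - {0}) \<union> F \<times> {0})"
    by (rule bij_betw_combine) auto
  moreover have "M2 \<union> (B0 \<union> M1) = F" using M assms(2) by auto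
  moreover have "F \<times> (UNIV - {0 :: int}) \<union> F \<times> {0} = F \<times> UNIV" by auto
  ultimately have r: "bij_betw r F (F \<times> (UNIV :: int set))" by simp
  define t :: "'a \<times> int \<Rightarrow> 'a \<times> int" where "t = (\<lambda>(a, i). (a, i + 1))"
  have t: "bij_betw t (F \<times> UNIV) (F \<times> UNIV)"
    by (rule bij_betwI[where g = "\<lambda>(a, i). (a, i - 1)"]) (auto simp: t_def)
  define s where "s w = (if w \<in> F then inv_into F r (t (r w)) else w)" for w
  have "bij_betw (inv_into F r \<circ> (t \<circ> r)) F F"
    using bij_betw_trans[OF bij_betw_trans[OF r t] bij_betw_inv_into[OF r]] by (simp add: comp_assoc)
  then have "bij_betw s F F" by (rule bij_betw_cong[THEN iffD1, rotated]) (simp add: s_def)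
  then have s: "s permutes F" by (rule bij_imp_permutes) (simp add: s_def)
  have "snd (r (s w)) = snd (r w) + 1" if "w \<in> F" for w
  proof -
    have "t (r w) \<in> F \<times> UNIV" using bij_betw_apply[OF t bij_betw_apply[OF r that]] .
    then have "r (s w) = t (r w)" using that r by (simp add: s_def bij_betw_inv_into_right)
    then show ?thesis by (simp add: t_def split: prod.splits)
  qed
  moreover have "snd (r w) = 0" if "w \<in> B0" for w
  proof -
    have "w \<notin> M2" using that M by auto
    then have "r w \<in> F \<times> {0}" using bij_betw_apply[OF q, of w] that by (simp add: r_def)
    then show ?thesis by auto
  qed
  ultimately show ?thesis using s by (intro exI[of _ s] exI[of _ "snd \<circ> r"]) simp
qed

text \<open>
  Correcting \<open>\<gamma>\<close> by a permutation that agrees with it on \<open>\<Sigma>\<close> splits it into two factors, each of which is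
  trivial on a set of full cardinality, as the swindle needs.
\<close>

lemma moiety_exists:
  assumes inf: "infinite F" and \<gamma>: "\<gamma> permutes F"
  shows "\<exists>\<Sigma>\<subseteq>F. F \<lesssim> \<Sigma> \<and> F \<lesssim> F - (\<Sigma> \<union> \<gamma> ` \<Sigma>) \<and> (\<forall>w\<in>\<Sigma>. \<gamma> w = w \<or> \<gamma> w \<notin> \<Sigma>)"
proof -
  \<comment> \<open>A maximal set disjoint from its image: by maximality it covers, together with
    its image and its preimage, all points that \<open>\<gamma>\<close> moves. So this set or the
    set of fixed points has full cardinality, and one half of it is the set sought.\<close>
  define \<A> where "\<A> = {\<Sigma>. \<Sigma> \<subseteq> F \<and> \<Sigma> \<inter> \<gamma> ` \<Sigma> = {}}"
  have "\<Union>C \<in> \<A>" if C: "subset.chain \<A> C" for C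
  proof -
    have ch: "C \<subseteq> \<A>" "\<And>X Y. X \<in> C \<Longrightarrow> Y \<in> C \<Longrightarrow> X \<subseteq> Y \<or> Y \<subseteq> X"
      using C by (auto simp: subset.chain_def)
    have "\<Union>C \<inter> \<gamma> ` (\<Union>C) = {}"
    proof (rule ccontr)
      assume "\<Union>C \<inter> \<gamma> ` (\<Union>C) \<noteq> {}"
      then obtain X Y y where XY: "X \<in> C" "Y \<in> C" "y \<in> Y" "\<gamma> y \<in> X" by auto
      obtain Z where "Z \<in> C" "X \<subseteq> Z" "Y \<subseteq> Z" using ch(2)[OF XY(1,2)] XY(1,2) by auto
      moreover from this have "Z \<in> \<A>" using ch(1) by blast
      ultimately show False using XY unfolding \<A>_def by blast
    qed
    moreover have "\<Union>C \<subseteq> F" using ch(1) by (auto simp: \<A>_def)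
    ultimately show ?thesis by (simp add: \<A>_def)
  qed
  then have "\<exists>M\<in>\<A>. \<forall>X\<in>\<A>. M \<subseteq> X \<longrightarrow> X = M" by (rule subset_Zorn')
  then obtain M where M: "M \<in> \<A>" "\<And>X. X \<in> \<A> \<Longrightarrow> M \<subseteq> X \<Longrightarrow> X = M" by auto
  define Fx where "Fx = {w \<in> F. \<gamma> w = w}"
  have Msub: "M \<subseteq> F" "M \<inter> \<gamma> ` M = {}" using M by (auto simp: \<A>_def)
  have cover: "F \<subseteq> (M \<union> \<gamma> ` M \<union> pinv \<gamma> ` M) \<union> Fx"
  proof
    fix w assume w: "w \<in> F"
    show "w \<in> (M \<union> \<gamma> ` M \<union> pinv \<gamma> ` M) \<union> Fx"
    proof (rule ccontr)
      assume n: "w \<notin> (M \<union> \<gamma> ` M \<union> pinv \<gamma> ` M) \<union> Fx"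
      then have "\<gamma> w \<noteq> w" using w by (auto simp: Fx_def)
      moreover have "\<gamma> w \<notin> M" using n permutes_inverses(2)[OF \<gamma>, of w] by (metis UnCI image_eqI)
      ultimately have "insert w M \<in> \<A>" using n w Msub unfolding \<A>_def by auto
      then show False using M(2)[of "insert w M"] n by auto
    qed
  qed
  have im: "\<gamma> ` M \<lesssim> M" "pinv \<gamma> ` M \<lesssim> M" by (rule image_lepoll)+
  have "F \<lesssim> M \<or> F \<lesssim> Fx"
  proof -
    have "F \<lesssim> M \<union> \<gamma> ` M \<union> pinv \<gamma> ` M \<or> F \<lesssim> Fx" using infinite_Un_lepoll[OF inf cover] .
    moreover have "F \<lesssim> M" if a: "F \<lesssim> M \<union> \<gamma> ` M \<union> pinv \<gamma> ` M"
    proof -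
      have i: "infinite (M \<union> \<gamma> ` M \<union> pinv \<gamma> ` M)" by (rule infinite_lepoll_infinite[OF inf a])
      have Mi: "infinite (M \<union> \<gamma> ` M)" using i by auto
      have 1: "M \<union> \<gamma> ` M \<lesssim> M"
        using infinite_Un_lepoll[OF Mi subset_refl] im(1) lepoll_trans[OF _ im(1)] by auto
      have "(M \<union> \<gamma> ` M \<union> pinv \<gamma> ` M) \<lesssim> M \<union> \<gamma> ` M \<or> (M \<union> \<gamma> ` M \<union> pinv \<gamma> ` M) \<lesssim> pinv \<gamma> ` M"
        by (rule infinite_Un_lepoll[OF i]) simp
      then show ?thesis using lepoll_trans[OF lepoll_trans[OF a] 1] lepoll_trans[OF lepoll_trans[OF a] im(2)] by auto
    qed
    ultimately show ?thesis by blast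
  qed
  then show ?thesis
  proof
    assume FM: "F \<lesssim> M"
    have "infinite M" by (rule infinite_lepoll_infinite[OF inf FM])
    from infinite_halves[OF this] obtain A B where AB: "M = A \<union> B" "A \<inter> B = {}" "M \<lesssim> A" "M \<lesssim> B" .
    have "B \<subseteq> F - (A \<union> \<gamma> ` A)" using AB Msub by auto
    then have "F \<lesssim> F - (A \<union> \<gamma> ` A)" using lepoll_trans[OF lepoll_trans[OF FM AB(4)] subset_imp_lepoll] by simp
    moreover have "F \<lesssim> A" using FM AB(3) by (rule lepoll_trans)
    ultimately show ?thesis using AB Msub by (intro exI[of _ A]) auto
  next
    assume FM: "F \<lesssim> Fx"
    have "infinite Fx" by (rule infinite_lepoll_infinite[OF inf FM])
    from infinite_halves[OF this] obtain A B where AB: "Fx = A \<union> B" "A \<inter> B = {}" "Fx \<lesssim> A" "Fx \<lesssim> B" .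
    have fA: "\<gamma> a = a" if "a \<in> A" for a using AB(1) that unfolding Fx_def by blast
    then have "\<gamma> ` A = A" by force
    then have "B \<subseteq> F - (A \<union> \<gamma> ` A)" using AB by (auto simp: Fx_def)
    then have "F \<lesssim> F - (A \<union> \<gamma> ` A)" using lepoll_trans[OF lepoll_trans[OF FM AB(4)] subset_imp_lepoll] by simp
    moreover have "F \<lesssim> A" using FM AB(3) by (rule lepoll_trans)
    moreover have "A \<subseteq> F" using AB(1) unfolding Fx_def by blast
    ultimately show ?thesis using fA by (intro exI[of _ A]) auto
  qed
qed

section \<open>Permuting infinitely many isomorphic blocks\<close>

text \<open>A block is the set of points with a given label; its edges stay inside or lead to
  unlabelled points. \<open>R\<close> relates blocks that some automorphism carries onto each other
  while fixing the unlabelled points to which they are attached, so blocks can be permuted within a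
  class without disturbing anything else.\<close>

locale block_system =
  fixes f :: "'x \<Rightarrow> 'x" and B :: "'x \<Rightarrow> 'w option" and W :: "'w set" and R :: "('w \<times> 'w) set"
  assumes B_f: "\<And>x. B (f x) = None \<or> B (f x) = B x"
    and B_W: "\<And>w. w \<in> W \<longleftrightarrow> (\<exists>x. B x = Some w)"
    and eq: "equiv W R"
    and inf: "\<And>w. w \<in> W \<Longrightarrow> infinite (R `` {w})"
    and block_iso: "\<And>w w'. (w, w') \<in> R \<Longrightarrow> \<exists>k\<in>aut f UNIV. (\<forall>x. B (k x) = Some w' \<longleftrightarrow> B x = Some w) \<and>
        (\<forall>x. B x = Some w \<longrightarrow> B (f x) = None \<longrightarrow> k (f x) = f x)"
begin

definition "D = {x. B x \<noteq> None}"

lemma R_W: "(w, w') \<in> R \<Longrightarrow> w \<in> W \<and> w' \<in> W"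
  using eq by (auto simp: equiv_def refl_on_def)

lemma lift_block_perm:
  assumes s: "s permutes W" and R: "\<And>w. w \<in> W \<Longrightarrow> (w, s w) \<in> R"
  shows "\<exists>\<sigma>\<in>aut f D. \<forall>x w. B x = Some w \<longrightarrow> B (\<sigma> x) = Some (s w)"
proof -
  obtain k where k: "\<And>w. w \<in> W \<Longrightarrow> k w \<in> aut f UNIV"
      "\<And>w x. w \<in> W \<Longrightarrow> B (k w x) = Some (s w) \<longleftrightarrow> B x = Some w"
      "\<And>w x. w \<in> W \<Longrightarrow> B x = Some w \<Longrightarrow> B (f x) = None \<Longrightarrow> k w (f x) = f x"
    using block_iso[OF R] by metis
  define K where "K b = (case b of None \<Rightarrow> id | Some w \<Rightarrow> k w)" for b
  have BW: "B x = Some w \<Longrightarrow> w \<in> W" for x w using B_W by blast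
  have "(\<lambda>x. K (B x) x) \<in> aut f D"
  proof (rule glue_aut[where s = "map_option s"])
    show "K (B x) \<in> aut f UNIV" for x using k(1) BW by (cases "B x") (auto simp: K_def)
    show "B (K (B y) x) = map_option s (B y) \<longleftrightarrow> B x = B y" for x y
      using k(2) BW by (cases "B y") (auto simp: K_def)
    show "map_option s (B x) = map_option s (B y) \<Longrightarrow> B x = B y" for x y
      using inj_eq[OF permutes_inj[OF s]] by (cases "B x"; cases "B y") auto
    show "\<exists>x. map_option s (B x) = B y" for y
    proof (cases "B y")
      case None then show ?thesis by (intro exI[of _ y]) simp
    next
      case (Some w)
      then have "pinv s w \<in> W" using BW permutes_in_image[OF permutes_inv[OF s]] by blast
      then obtain x where "B x = Some (pinv s w)" using B_W by blast
      then show ?thesis using Some permutes_inverses(1)[OF s] by (intro exI[of _ x]) simp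
    qed
    show "K (B x) (f x) = K (B (f x)) (f x)" for x
      using B_f[of x] k(3)[of _ x] BW[of x] by (cases "B x") (auto simp: K_def)
    show "K (B x) x = x" if "x \<notin> D" for x using that by (simp add: K_def D_def)
  qed
  moreover have "B (K (B x) x) = Some (s w)" if "B x = Some w" for x w
    using k(2)[OF BW[OF that], of x] that by (simp add: K_def)
  ultimately show ?thesis by (intro bexI[of _ "\<lambda>x. K (B x) x"]) auto
qed

text \<open>Each class contains as many blocks in \<open>Z\<close> as it has blocks at all, and
  \<open>g\<close> is trivial on these. So there is room to push the other blocks off themselves:
  they get grade 0, and a permutation of the blocks that raises the grade by one yields the
  automorphism \<open>\<sigma>\<close> of the swindle.\<close>

lemma swindle_blocks:
  assumes g: "g \<in> aut f D" and \<gamma>: "\<gamma> permutes W"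
    and B\<gamma>: "\<And>x w. B x = Some w \<Longrightarrow> B (g x) = Some (\<gamma> w)"
    and Z: "\<And>w. w \<in> W \<Longrightarrow> R `` {w} \<lesssim> R `` {w} \<inter> Z"
    and gZ: "\<And>x w. B x = Some w \<Longrightarrow> w \<in> Z \<Longrightarrow> g x = x"
  shows "g \<in> comm_prods (aut f D) 1"
proof -
  have "\<forall>F\<in>W // R. \<exists>p. fst p permutes F \<and> (\<forall>w\<in>F. snd p (fst p w) = snd p w + (1::int)) \<and> (\<forall>w\<in>F - Z. snd p w = 0)"
  proof
    fix F assume F: "F \<in> W // R"
    obtain w where w: "w \<in> W" "F = R `` {w}" using F by (auto elim: quotientE)
    have "F - (F - Z) = F \<inter> Z" by auto
    then have "F \<lesssim> F - (F - Z)" using Z[OF w(1)] w(2) by simp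
    moreover have "infinite F" using inf[OF w(1)] w(2) by simp
    ultimately obtain s col where "s permutes F \<and> (\<forall>w\<in>F. col (s w) = col w + (1::int)) \<and> (\<forall>w\<in>F - Z. col w = 0)"
      using shift_exists[of F "F - Z"] by blast
    then show "\<exists>p. fst p permutes F \<and> (\<forall>w\<in>F. snd p (fst p w) = snd p w + (1::int)) \<and> (\<forall>w\<in>F - Z. snd p w = 0)"
      by (intro exI[of _ "(s, col)"]) simp
  qed
  from bchoice[OF this] obtain p where p: "\<forall>F\<in>W // R. fst (p F) permutes F \<and>
      (\<forall>w\<in>F. snd (p F) (fst (p F) w) = snd (p F) w + (1::int)) \<and> (\<forall>w\<in>F - Z. snd (p F) w = 0)" ..
  define s' where "s' F = fst (p F)" for F
  define col' where "col' F = snd (p F)" for F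
  have s': "\<And>F. F \<in> W // R \<Longrightarrow> s' F permutes F"
      "\<And>F w. F \<in> W // R \<Longrightarrow> w \<in> F \<Longrightarrow> col' F (s' F w) = col' F w + (1::int)"
      "\<And>F w. F \<in> W // R \<Longrightarrow> w \<in> F - Z \<Longrightarrow> col' F w = 0"
    using p by (simp_all add: s'_def col'_def)
  define s where "s w = (if w \<in> W then s' (R `` {w}) w else w)" for w
  define col where "col w = col' (R `` {w}) w" for w
  have FQ: "R `` {w} \<in> W // R" "w \<in> R `` {w}" if "w \<in> W" for w
    using quotientI[OF that] equiv_class_self[OF eq that] by simp_all
  have sR: "(w, s w) \<in> R" if "w \<in> W" for w
    using permutes_in_image[OF s'(1)[OF FQ(1)[OF that]], of w] FQ(2)[OF that] that by (simp add: s_def)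
  have cls: "R `` {s w} = R `` {w}" if "w \<in> W" for w
    using sR[OF that] eq by (simp add: equiv_class_eq)
  have col: "col (s w) = col w + 1" if "w \<in> W" for w
    using s'(2)[OF FQ[OF that]] cls[OF that] that by (simp add: col_def s_def)
  have colZ: "col w = 0" if "w \<in> W" "w \<notin> Z" for w
    using s'(3)[OF FQ(1), of w w] FQ(2) that by (simp add: col_def)
  have s: "s permutes W"
  proof -
    have "s w \<in> W" if "w \<in> W" for w using sR[OF that] R_W by blast
    moreover have "w = w'" if "w \<in> W" "w' \<in> W" "s w = s w'" for w w'
    proof -
      have "R `` {w} = R `` {w'}" using cls that by metis
      then show ?thesis using that inj_eq[OF permutes_inj[OF s'(1)[OF FQ(1)[OF that(1)]]]] by (simp add: s_def)
    qed
    moreover have "\<exists>w'\<in>W. s w' = w" if "w \<in> W" for w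
    proof -
      let ?p = "s' (R `` {w})"
      have p: "?p permutes R `` {w}" using s'(1)[OF FQ(1)[OF that]] .
      then have "pinv ?p w \<in> R `` {w}"
        using permutes_in_image[OF permutes_inv[OF p], of w] FQ(2)[OF that] by simp
      then have "(w, pinv ?p w) \<in> R" by simp
      then have "R `` {pinv ?p w} = R `` {w}" "pinv ?p w \<in> W"
        using eq R_W by (auto simp: equiv_class_eq[symmetric])
      then show ?thesis using permutes_inverses(1)[OF p] by (intro bexI[of _ "pinv ?p w"]) (simp_all add: s_def)
    qed
    ultimately have "bij_betw s W W" unfolding bij_betw_def inj_on_def by blast
    then show ?thesis by (rule bij_imp_permutes) (simp add: s_def)
  qed
  obtain \<sigma> where \<sigma>: "\<sigma> \<in> aut f D" "\<And>x w. B x = Some w \<Longrightarrow> B (\<sigma> x) = Some (s w)"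
    using lift_block_perm[OF s sR] by blast
  have BW: "B x = Some w \<Longrightarrow> w \<in> W" for x w using B_W by blast
  have gfix: "g x = x" if "B x = Some w" "col w \<noteq> 0" for x w
    using gZ[OF that(1)] colZ[OF BW[OF that(1)]] that(2) by blast
  have \<gamma>Z: "\<gamma> w = w" if w: "w \<in> Z" "w \<in> W" for w
  proof -
    obtain x where "B x = Some w" using w B_W by blast
    then show ?thesis using gZ[of x w] B\<gamma>[of x w] w by simp
  qed
  have \<gamma>W: "w \<in> W \<Longrightarrow> \<gamma> w \<in> W" for w using permutes_in_image[OF \<gamma>] by simp
  have col\<gamma>: "col (\<gamma> w) = col w" if w: "w \<in> W" for w
  proof (cases "\<gamma> w = w")
    case False
    then have "w \<notin> Z" using \<gamma>Z w by blast
    moreover have "\<gamma> w \<notin> Z" using \<gamma>Z[OF _ \<gamma>W[OF w]] False inj_eq[OF permutes_inj[OF \<gamma>]] by metis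
    ultimately show ?thesis using colZ w \<gamma>W by simp
  qed simp
  have sW: "w \<in> W \<Longrightarrow> (s ^^ i) w \<in> W" for w i
    by (rule funpow_in) (simp_all add: permutes_in_image[OF s])
  have coli: "col ((s ^^ i) w) = col w + int i" if "w \<in> W" for w i
    by (induction i) (simp_all add: col sW that)
  have Bi: "B ((\<sigma> ^^ i) x) = Some ((s ^^ i) w)" if "B x = Some w" for x w i
    by (induction i) (simp_all add: \<sigma>(2) that)
  \<comment> \<open>The conjugate of \<open>g\<close> by the \<open>i\<close>-th power of
    \<open>\<sigma>\<close> acts only on blocks of grade \<open>i\<close>; hence \<open>N\<close> is
    the grade plus one.\<close>
  define N where "N x = (case B x of None \<Rightarrow> 0 | Some w \<Rightarrow> nat (col w + 1))" for x
  have BN: "B x = None \<Longrightarrow> x \<notin> D" for x by (simp add: D_def)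
  show ?thesis
  proof (rule swindle[OF g \<sigma>(1), of N])
    fix i z
    show "N ((\<sigma> ^^ i) (g z)) = N ((\<sigma> ^^ i) z)"
    proof (cases "B z")
      case None
      then show ?thesis using aut_out[OF g BN] by simp
    next
      case (Some w)
      then show ?thesis using Bi[OF Some, of i] Bi[OF B\<gamma>[OF Some], of i] BW[OF Some]
        by (simp add: N_def coli col\<gamma> \<gamma>W)
    qed
    assume le: "N ((\<sigma> ^^ i) z) \<le> i"
    show "g z = z"
    proof (cases "B z")
      case None
      then show ?thesis using aut_out[OF g BN] by simp
    next
      case (Some w)
      have "col w + int i + 1 \<le> int i" using le Bi[OF Some, of i] BW[OF Some] by (simp add: N_def coli)
      then show ?thesis using gfix[OF Some] by simp
    qed
  qed
qed

text \<open>\<open>g\<close> is split as \<open>b \<circ> a\<close>, where \<open>a\<close> is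
  \<open>g\<close> on a large set \<open>T\<close> of blocks and the inverse of \<open>g\<close> on
  the image of \<open>T\<close>. Then \<open>a\<close> is trivial off \<open>T\<close> and its
  image, and \<open>b\<close> is trivial on the image of \<open>T\<close>. Both sets meet every
  class in full cardinality, so each factor is one commutator.\<close>

lemma comm_prods_blocks:
  assumes g: "g \<in> aut f D" and \<gamma>: "\<gamma> permutes W"
    and B\<gamma>: "\<And>x w. B x = Some w \<Longrightarrow> B (g x) = Some (\<gamma> w)"
    and R\<gamma>: "\<And>w. w \<in> W \<Longrightarrow> (w, \<gamma> w) \<in> R"
  shows "g \<in> comm_prods (aut f D) 2"
proof -
  have BW: "B x = Some w \<Longrightarrow> w \<in> W" for x w using B_W by blast
  have B\<gamma>': "B (g x) = Some (\<gamma> w) \<longleftrightarrow> B x = Some w" for x w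
  proof (cases "B x")
    case None
    then have "g x = x" using aut_out[OF g] by (simp add: D_def)
    then show ?thesis using None by simp
  next
    case (Some w')
    then show ?thesis using B\<gamma>[OF Some] inj_eq[OF permutes_inj[OF \<gamma>]] by auto
  qed
  have FQ: "R `` {w} \<in> W // R" "w \<in> R `` {w}" if "w \<in> W" for w
    using quotientI[OF that] equiv_class_self[OF eq that] by simp_all
  have "\<exists>\<Sigma>\<subseteq>F. F \<lesssim> \<Sigma> \<and> F \<lesssim> F - (\<Sigma> \<union> \<gamma> ` \<Sigma>) \<and> (\<forall>w\<in>\<Sigma>. \<gamma> w = w \<or> \<gamma> w \<notin> \<Sigma>)"
    if F: "F \<in> W // R" for F
  proof -
    obtain w where w: "w \<in> W" "F = R `` {w}" using F by (auto elim: quotientE)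
    define \<gamma>F where "\<gamma>F v = (if v \<in> F then \<gamma> v else v)" for v
    have in_F: "\<gamma> v \<in> F \<longleftrightarrow> v \<in> F" if "v \<in> W" for v
      using R\<gamma>[OF that] eq unfolding w(2) equiv_def sym_def trans_def by blast
    have FW: "F \<subseteq> W" using w R_W by auto
    have "bij_betw \<gamma>F F F"
    proof (rule bij_betw_imageI)
      show "inj_on \<gamma>F F" using inj_eq[OF permutes_inj[OF \<gamma>]] by (simp add: inj_on_def \<gamma>F_def)
      show "\<gamma>F ` F = F"
      proof (intro equalityI subsetI)
        fix v assume v: "v \<in> F"
        have v': "\<gamma> (pinv \<gamma> v) = v" using permutes_inverses(1)[OF \<gamma>] .
        then have "pinv \<gamma> v \<in> W" using permutes_in_image[OF \<gamma>, of "pinv \<gamma> v"] v FW by auto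
        then have "pinv \<gamma> v \<in> F" using in_F v v' by metis
        then show "v \<in> \<gamma>F ` F" using v' by (intro image_eqI[of _ _ "pinv \<gamma> v"]) (simp_all add: \<gamma>F_def)
      qed (use in_F FW in \<open>auto simp: \<gamma>F_def\<close>)
    qed
    then have "\<gamma>F permutes F" by (rule bij_imp_permutes) (simp add: \<gamma>F_def)
    moreover have "infinite F" using inf w by simp
    ultimately obtain \<Sigma> where S: "\<Sigma> \<subseteq> F" "F \<lesssim> \<Sigma>" "F \<lesssim> F - (\<Sigma> \<union> \<gamma>F ` \<Sigma>)"
        "\<forall>w\<in>\<Sigma>. \<gamma>F w = w \<or> \<gamma>F w \<notin> \<Sigma>"
      using moiety_exists by blast
    have e: "\<gamma>F w = \<gamma> w" if "w \<in> \<Sigma>" for w using that S(1) by (auto simp: \<gamma>F_def)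
    then have "\<gamma>F ` \<Sigma> = \<gamma> ` \<Sigma>" by auto
    then show ?thesis using S e by (intro exI[of _ \<Sigma>]) auto
  qed
  then obtain S where S: "\<And>F. F \<in> W // R \<Longrightarrow> S F \<subseteq> F" "\<And>F. F \<in> W // R \<Longrightarrow> F \<lesssim> S F"
      "\<And>F. F \<in> W // R \<Longrightarrow> F \<lesssim> F - (S F \<union> \<gamma> ` S F)"
      "\<And>F w. F \<in> W // R \<Longrightarrow> w \<in> S F \<Longrightarrow> \<gamma> w = w \<or> \<gamma> w \<notin> S F"
    by metis
  define T where "T = {w \<in> W. w \<in> S (R `` {w})}"
  have TW: "T \<subseteq> W" by (auto simp: T_def)
  have T\<gamma>: "\<gamma> w = w \<or> \<gamma> w \<notin> T" if "w \<in> T" for w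
  proof -
    have w: "w \<in> W" "w \<in> S (R `` {w})" using that by (auto simp: T_def)
    have "R `` {\<gamma> w} = R `` {w}" using R\<gamma>[OF w(1)] eq by (simp add: equiv_class_eq)
    then show ?thesis using S(4)[OF FQ(1)[OF w(1)] w(2)] by (auto simp: T_def)
  qed
  have clsT: "R `` {w} \<inter> T = S (R `` {w})" if "w \<in> W" for w
  proof -
    have "R `` {v} = R `` {w}" if "(w, v) \<in> R" for v using that eq by (simp add: equiv_class_eq)
    then show ?thesis using S(1)[OF FQ(1)[OF that]] R_W unfolding T_def by (auto; blast)
  qed
  \<comment> \<open>A block of \<open>T\<close> that also lies in the image of \<open>T\<close> is
    fixed by \<open>\<gamma>\<close>, and the first branch takes care of it. On all others the two
    sets are disjoint, so that \<open>s\<close> is an involution.\<close>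
  define s where "s w = (if w \<in> T then \<gamma> w else if w \<in> \<gamma> ` T then pinv \<gamma> w else w)" for w
  have ss: "s (s w) = w" for w
  proof -
    consider "w \<in> T" | "w \<notin> T" "w \<in> \<gamma> ` T" | "w \<notin> T" "w \<notin> \<gamma> ` T" by blast
    then show ?thesis
    proof cases
      case 1
      then show ?thesis using T\<gamma>[OF 1] permutes_inverses(2)[OF \<gamma>] by (auto simp: s_def)
    next
      case 2
      then obtain v where "w = \<gamma> v" "v \<in> T" by auto
      then show ?thesis using 2 permutes_inverses[OF \<gamma>] by (auto simp: s_def)
    qed (simp add: s_def)
  qed
  have \<gamma>W: "\<gamma> w \<in> W \<longleftrightarrow> w \<in> W" "pinv \<gamma> w \<in> W \<longleftrightarrow> w \<in> W" for w
    using permutes_in_image[OF \<gamma>] permutes_in_image[OF permutes_inv[OF \<gamma>]] by simp_all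
  have sW: "s w \<in> W \<longleftrightarrow> w \<in> W" for w by (simp add: s_def \<gamma>W)
  have s: "s permutes W"
  proof (rule bij_imp_permutes)
    show "bij_betw s W W" by (rule bij_betwI[where g = s]) (auto simp: ss sW)
    show "w \<notin> W \<Longrightarrow> s w = w" for w using TW \<gamma>W by (auto simp: s_def)
  qed
  define k where "k w = (if w \<in> T then g else if w \<in> \<gamma> ` T then pinv g else id)" for w
  define K where "K b = (case b of None \<Rightarrow> id | Some w \<Rightarrow> k w)" for b
  have gi: "pinv g \<in> aut f D" using g by (rule aut_inv)
  have Bgi: "B (pinv g x) = Some (pinv \<gamma> w) \<longleftrightarrow> B x = Some w" for x w
    using B\<gamma>'[of "pinv g x" "pinv \<gamma> w"] by (simp add: aut_inv_r[OF g] permutes_inverses(1)[OF \<gamma>])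
  have Bk: "B (k w x) = Some (s w) \<longleftrightarrow> B x = Some w" for w x
    using Bgi B\<gamma>' by (simp add: k_def s_def)
  have kD: "k w \<in> aut f D" for w using g gi by (simp add: k_def)
  define a where "a = (\<lambda>x. K (B x) x)"
  have a: "a \<in> aut f D" unfolding a_def
  proof (rule glue_aut[where s = "map_option s"])
    show "K (B x) \<in> aut f UNIV" for x using aut_UNIV[OF kD] by (cases "B x") (auto simp: K_def)
    show "B (K (B y) x) = map_option s (B y) \<longleftrightarrow> B x = B y" for x y
      using Bk by (cases "B y") (auto simp: K_def)
    show "map_option s (B x) = map_option s (B y) \<Longrightarrow> B x = B y" for x y
      using inj_eq[OF permutes_inj[OF s]] by (cases "B x"; cases "B y") auto
    show "\<exists>x. map_option s (B x) = B y" for y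
    proof (cases "B y")
      case None then show ?thesis by (intro exI[of _ y]) simp
    next
      case (Some w)
      then have "s w \<in> W" using BW sW by blast
      then obtain x where "B x = Some (s w)" using B_W by blast
      then show ?thesis using Some ss by (intro exI[of _ x]) simp
    qed
    show "K (B x) (f x) = K (B (f x)) (f x)" for x
    proof (cases "B (f x)")
      case None
      then have "f x \<notin> D" by (simp add: D_def)
      then show ?thesis using aut_out[OF kD] None by (cases "B x") (auto simp: K_def)
    next
      case (Some w)
      then show ?thesis using B_f[of x] by simp
    qed
    show "K (B x) x = x" if "x \<notin> D" for x using that by (simp add: K_def D_def)
  qed
  have a_eq: "a x = k w x" if "B x = Some w" for x w using that by (simp add: a_def K_def)
  have Ba: "B (a x) = Some (s w)" if "B x = Some w" for x w using a_eq[OF that] Bk that by simp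
  have a1: "a \<in> comm_prods (aut f D) 1"
  proof (rule swindle_blocks[OF a s Ba, where Z = "W - (T \<union> \<gamma> ` T)"])
    fix w assume w: "w \<in> W"
    have sub: "R `` {w} - (S (R `` {w}) \<union> \<gamma> ` S (R `` {w})) \<subseteq> R `` {w} \<inter> (W - (T \<union> \<gamma> ` T))"
    proof
      fix v assume v: "v \<in> R `` {w} - (S (R `` {w}) \<union> \<gamma> ` S (R `` {w}))"
      have "v \<notin> \<gamma> ` T"
      proof
        assume "v \<in> \<gamma> ` T"
        then obtain u where u: "u \<in> T" "v = \<gamma> u" by auto
        have "R `` {u} = R `` {\<gamma> u}" by (rule equiv_class_eq[OF eq R\<gamma>]) (use u TW in auto)
        moreover have "R `` {w} = R `` {v}" by (rule equiv_class_eq[OF eq]) (use v in auto)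
        ultimately have "u \<in> S (R `` {w})" using u by (auto simp: T_def)
        then show False using v u by auto
      qed
      moreover have "v \<notin> T" using v clsT[OF w] by blast
      ultimately show "v \<in> R `` {w} \<inter> (W - (T \<union> \<gamma> ` T))" using v R_W by blast
    qed
    show "R `` {w} \<lesssim> R `` {w} \<inter> (W - (T \<union> \<gamma> ` T))"
      by (rule lepoll_trans[OF S(3)[OF FQ(1)[OF w]] subset_imp_lepoll[OF sub]])
  next
    fix x w assume "B x = Some w" "w \<in> W - (T \<union> \<gamma> ` T)"
    then show "a x = x" by (simp add: a_eq k_def)
  qed
  define b where "b = g \<circ> pinv a"
  have b: "b \<in> aut f D" unfolding b_def by (intro aut_comp aut_inv g a)
  have ai: "B (pinv a x) = Some (s w)" if "B x = Some w" for x w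
  proof (cases "B (pinv a x)")
    case None
    then have "pinv a x \<notin> D" by (simp add: D_def)
    then have "x \<notin> D" using aut_in[OF aut_inv[OF a]] by blast
    then show ?thesis using that by (simp add: D_def)
  next
    case (Some v)
    then show ?thesis using Ba[OF Some] that ss[of v] by (simp add: aut_inv_r[OF a])
  qed
  have b1: "b \<in> comm_prods (aut f D) 1"
  proof (rule swindle_blocks[OF b permutes_compose[OF s \<gamma>], where Z = "\<gamma> ` T"])
    show "B (b x) = Some ((\<gamma> \<circ> s) w)" if "B x = Some w" for x w
      using B\<gamma>[OF ai[OF that]] by (simp add: b_def)
  next
    fix w assume w: "w \<in> W"
    have sub: "\<gamma> ` S (R `` {w}) \<subseteq> R `` {w} \<inter> \<gamma> ` T"
    proof
      fix v assume "v \<in> \<gamma> ` S (R `` {w})"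
      then obtain u where u: "u \<in> S (R `` {w})" "v = \<gamma> u" by auto
      then have uT: "u \<in> T" "(w, u) \<in> R" using clsT[OF w] by auto
      have "(w, v) \<in> R" using uT u R\<gamma>[of u] R_W eq unfolding equiv_def trans_def by blast
      then show "v \<in> R `` {w} \<inter> \<gamma> ` T" using u uT by auto
    qed
    have "inj_on \<gamma> (S (R `` {w}))" using permutes_inj[OF \<gamma>] inj_on_subset by blast
    then have "S (R `` {w}) \<lesssim> \<gamma> ` S (R `` {w})" by (simp add: lepoll_refl)
    then show "R `` {w} \<lesssim> R `` {w} \<inter> \<gamma> ` T"
      by (rule lepoll_trans[OF lepoll_trans[OF S(2)[OF FQ(1)[OF w]]] subset_imp_lepoll[OF sub]])
  next
    fix x w assume x: "B x = Some w" "w \<in> \<gamma> ` T"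
    then obtain v where v: "w = \<gamma> v" "v \<in> T" by auto
    have "B (pinv g x) = Some v" using Bgi[of x w] x(1) v permutes_inverses(2)[OF \<gamma>] by simp
    then have "a (pinv g x) = x" using v by (simp add: a_eq k_def aut_inv_r[OF g])
    then have "pinv a x = pinv g x" using aut_inv_l[OF a, of "pinv g x"] by simp
    then show "b x = x" by (simp add: b_def aut_inv_r[OF g])
  qed
  have "g = b \<circ> a" unfolding b_def using a by (simp add: comp_assoc)
  then show ?thesis using comm_prods_add[OF b1 a1] by (simp add: numeral_2_eq_2)
qed

end

section \<open>Trees over a rigid base\<close>

definition restr :: "('x \<Rightarrow> 'x) \<Rightarrow> 'x set \<Rightarrow> 'x \<Rightarrow> 'x"
  where "restr g S x = (if x \<in> S then g x else x)"

lemma single_orbit_cong: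
  assumes so: "single_orbit v S" and vS: "\<And>x. x \<in> S \<Longrightarrow> v x \<in> S" and eq: "\<And>x. x \<in> S \<Longrightarrow> v' x = v x"
  shows "single_orbit v' S"
proof -
  have "(v' ^^ i) x = (v ^^ i) x \<and> (v ^^ i) x \<in> S" if "x \<in> S" for x i
    by (induction i) (simp_all add: that vS eq)
  then show ?thesis using so unfolding single_orbit_def by metis
qed

text \<open>
  \<open>R\<close> is the base: a cycle, or a set that is fixed pointwise when \<open>\<rho> = id\<close>.
\<close>

locale tree =
  fixes f :: "'x \<Rightarrow> 'x" and Z R :: "'x set" and \<rho> :: "'x \<Rightarrow> 'x" and m :: nat
  assumes ZR: "- Z \<subseteq> R" and fR: "\<And>x. x \<in> R \<Longrightarrow> f x \<in> R" and enter: "\<And>x. \<exists>n. (f ^^ n) x \<in> R"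
    and \<rho>: "\<rho> \<in> aut f Z" and \<rho>R: "\<And>x. x \<in> R \<Longrightarrow> \<rho> x \<in> R"
    and H_R: "\<And>g. g \<in> aut f Z \<Longrightarrow> \<exists>i. \<forall>x\<in>R. g x = (\<rho> ^^ i) x"
    and m: "m > 0" "\<And>x. x \<in> R \<Longrightarrow> (\<rho> ^^ m) x = x"
begin

abbreviation "H \<equiv> aut f Z"
abbreviation "A \<equiv> aut f (- R)"

lemma A_sub: "A \<subseteq> H" using ZR by (intro aut_mono) auto

lemma AH: "g \<in> A \<Longrightarrow> g \<in> H" using A_sub by blast

lemma A_fix: "g \<in> A \<Longrightarrow> x \<in> R \<Longrightarrow> g x = x" using aut_out by fastforce

definition "orb x = {g x | g. g \<in> H}"
definition "depth x = (LEAST n. (f ^^ n) x \<in> R)"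

lemma H_R1: "g \<in> H \<Longrightarrow> x \<in> R \<Longrightarrow> g x \<in> R"
  using H_R[of g] funpow_in[of R \<rho> x] \<rho>R by auto

lemma H_R_iff: "g \<in> H \<Longrightarrow> g x \<in> R \<longleftrightarrow> x \<in> R"
  using H_R1[of g x] H_R1[OF aut_inv, of g "g x"] by auto

lemma orb_self: "x \<in> orb x"
  unfolding orb_def by (rule CollectI, rule exI[of _ id]) simp

lemma orbI: "g \<in> H \<Longrightarrow> g x \<in> orb x"
  unfolding orb_def by blast

lemma orbE: assumes "y \<in> orb x" obtains g where "g \<in> H" "y = g x"
  using assms unfolding orb_def by blast

lemma orb_img: assumes g: "g \<in> H" shows "orb (g x) = orb x"
proof (intro equalityI subsetI)
  fix y assume "y \<in> orb (g x)"
  then obtain h where h: "h \<in> H" "y = h (g x)" by (rule orbE)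
  then show "y \<in> orb x" using orbI[OF aut_comp[OF h(1) g], of x] by simp
next
  fix y assume "y \<in> orb x"
  then obtain h where h: "h \<in> H" "y = h x" by (rule orbE)
  then show "y \<in> orb (g x)" using orbI[OF aut_comp[OF h(1) aut_inv[OF g]], of "g x"] g by simp
qed

lemma orb_eq: "y \<in> orb x \<Longrightarrow> orb y = orb x"
  using orb_img by (auto elim: orbE)

lemma orb_mem_eq: "g \<in> H \<Longrightarrow> g x \<in> orb y \<longleftrightarrow> x \<in> orb y"
  using orb_img orb_eq orb_self by metis

lemma f_orb: "f ` orb x = orb (f x)"
proof (intro equalityI subsetI)
  fix y assume "y \<in> f ` orb x"
  then obtain g where g: "g \<in> H" "y = f (g x)" by (auto elim: orbE)
  then show "y \<in> orb (f x)" using orbI[OF g(1), of "f x"] by (simp add: aut_comm[OF g(1)])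
next
  fix y assume "y \<in> orb (f x)"
  then obtain g where g: "g \<in> H" "y = g (f x)" by (rule orbE)
  then show "y \<in> f ` orb x" using orbI[OF g(1), of x] by (simp add: aut_comm[OF g(1)])
qed

lemma f_in_orb: "y \<in> orb x \<Longrightarrow> f y \<in> orb (f x)"
  using f_orb by blast

lemma depth_0: "depth x = 0 \<longleftrightarrow> x \<in> R"
proof
  have "(f ^^ depth x) x \<in> R" unfolding depth_def using LeastI_ex[OF enter[of x]] .
  then show "depth x = 0 \<Longrightarrow> x \<in> R" by simp
qed (auto simp: depth_def intro!: Least_equality)

lemma depth_R: "x \<in> R \<Longrightarrow> depth x = 0"
  using depth_0 by blast

lemma depth_Suc: assumes "x \<notin> R" shows "depth x = Suc (depth (f x))"
proof -
  have "(LEAST n. (f ^^ n) x \<in> R) = Suc (LEAST n. (f ^^ Suc n) x \<in> R)"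
    using enter[of x] assms by (elim exE, intro Least_Suc) auto
  then show ?thesis unfolding depth_def by (simp add: funpow_swap1)
qed

lemma depth_img: assumes g: "g \<in> H" shows "depth (g x) = depth x"
proof -
  have "(f ^^ n) (g x) \<in> R \<longleftrightarrow> (f ^^ n) x \<in> R" for n
    using H_R_iff[OF g, of "(f ^^ n) x"] by (simp add: aut_comm_funpow[OF g])
  then show ?thesis by (simp add: depth_def)
qed

lemma depth_orb: "y \<in> orb x \<Longrightarrow> depth y = depth x"
  using depth_img by (auto elim: orbE)

lemma finite_orb_f: "finite (orb x) \<Longrightarrow> finite (orb (f x))"
  using f_orb by (metis finite_imageI)

lemma orb_R: assumes x: "x \<in> R" shows "finite (orb x)" "y \<in> orb x \<Longrightarrow> \<exists>i. y = (\<rho> ^^ i) x"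
proof -
  show *: "\<exists>i. y = (\<rho> ^^ i) x" if "y \<in> orb x" for y
    using that H_R x by (auto elim!: orbE)
  have "orb x \<subseteq> (\<lambda>i. (\<rho> ^^ i) x) ` {..<m}"
  proof
    fix y assume "y \<in> orb x"
    then obtain i where "y = (\<rho> ^^ i) x" using * by blast
    then have "y = (\<rho> ^^ (i mod m)) x" using funpow_mod_eq[OF m(2)[OF x], of i] by simp
    then show "y \<in> (\<lambda>i. (\<rho> ^^ i) x) ` {..<m}" using m(1) by (intro image_eqI[of _ _ "i mod m"]) auto
  qed
  then show "finite (orb x)" using finite_subset by blast
qed

lemma single_orbit_R: assumes x: "x \<in> R" shows "single_orbit \<rho> (orb x)"
  unfolding single_orbit_def
proof (intro ballI)
  fix y z assume y: "y \<in> orb x" and z: "z \<in> orb x"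
  have yR: "y \<in> R" using y x depth_orb depth_0 by metis
  have "z \<in> orb y" using y z orb_eq by blast
  then show "\<exists>i. (\<rho> ^^ i) y = z" using orb_R(2)[OF yR] by blast
qed

text \<open>Every point \<open>x\<close> hangs below the first point \<open>B x\<close> of its
  forward path that lies in \<open>Y\<close>. It is moved by some element of \<open>H\<close> that
  agrees with \<open>s\<close> at \<open>B x\<close>; such an element exists because
  \<open>s\<close> keeps points in their orbits.\<close>

lemma extend_invariant:
  assumes RY: "R \<subseteq> Y" and fY: "\<And>x. x \<in> Y \<Longrightarrow> f x \<in> Y"
    and HY: "\<And>g x. g \<in> H \<Longrightarrow> g x \<in> Y \<longleftrightarrow> x \<in> Y"
    and s: "bij_betw s Y Y" "\<And>p. p \<in> Y \<Longrightarrow> s p \<in> orb p" "\<And>p. p \<in> Y \<Longrightarrow> s (f p) = f (s p)"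
      "\<And>p. p \<in> R \<Longrightarrow> s p = p"
  shows "\<exists>h\<in>A. \<forall>p\<in>Y. h p = s p"
proof -
  have enterY: "\<exists>n. (f ^^ n) x \<in> Y" for x using enter[of x] RY by blast
  define e where "e x = (LEAST n. (f ^^ n) x \<in> Y)" for x
  define B where "B x = (f ^^ e x) x" for x
  have BY: "B x \<in> Y" for x unfolding B_def e_def using LeastI_ex[OF enterY[of x]] .
  have e0: "e x = 0" if "x \<in> Y" for x unfolding e_def using that by (intro Least_equality) auto
  have B0: "B x = x" if "x \<in> Y" for x using e0[OF that] by (simp add: B_def)
  have eS: "e x = Suc (e (f x))" if "x \<notin> Y" for x
  proof -
    have "(LEAST n. (f ^^ n) x \<in> Y) = Suc (LEAST n. (f ^^ Suc n) x \<in> Y)"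
      using enterY[of x] that by (elim exE, intro Least_Suc) auto
    then show ?thesis unfolding e_def by (simp add: funpow_swap1)
  qed
  have BS: "B (f x) = B x" if "x \<notin> Y" for x using eS[OF that] by (simp add: B_def funpow_swap1)
  have Bk: "B (k x) = k (B x)" if k: "k \<in> H" for k x
  proof -
    have "(f ^^ n) (k x) \<in> Y \<longleftrightarrow> (f ^^ n) x \<in> Y" for n
      using HY[OF k, of "(f ^^ n) x"] by (simp add: aut_comm_funpow[OF k])
    then have "e (k x) = e x" by (simp add: e_def)
    then show ?thesis by (simp add: B_def aut_comm_funpow[OF k])
  qed
  define K where "K p = (SOME k. k \<in> H \<and> k p = s p)" for p
  have K: "K p \<in> H" "K p p = s p" if "p \<in> Y" for p
  proof -
    from s(2)[OF that] obtain k where "k \<in> H" "s p = k p" by (rule orbE)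
    then have "\<exists>k. k \<in> H \<and> k p = s p" by auto
    from someI_ex[OF this] show "K p \<in> H" "K p p = s p" unfolding K_def by auto
  qed
  have inj: "s p = s q \<longleftrightarrow> p = q" if "p \<in> Y" "q \<in> Y" for p q
    using s(1) that unfolding bij_betw_def inj_on_def by blast
  have "(\<lambda>x. K (B x) x) \<in> A"
  proof (rule glue_aut[where s = s and B = B and k = K])
    show "K (B x) \<in> aut f UNIV" for x using aut_UNIV[OF K(1)[OF BY]] .
    show "B (K (B y) x) = s (B y) \<longleftrightarrow> B x = B y" for x y
      using Bk[OF K(1)[OF BY]] aut_eq[OF K(1)[OF BY]] K(2)[OF BY] by metis
    show "s (B x) = s (B y) \<Longrightarrow> B x = B y" for x y using inj[OF BY BY] by simp
    show "\<exists>x. s (B x) = B y" for y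
    proof -
      obtain q where "q \<in> Y" "s q = B y" using s(1) BY[of y] unfolding bij_betw_def by (metis imageE)
      then show ?thesis using B0 by metis
    qed
    show "K (B x) (f x) = K (B (f x)) (f x)" for x
    proof (cases "x \<in> Y")
      case True
      have "K x (f x) = s (f x)" using aut_comm[OF K(1)[OF True], of x] K(2)[OF True] s(3)[OF True] by simp
      then show ?thesis using B0[OF True] B0[OF fY[OF True]] K(2)[OF fY[OF True]] by simp
    next
      case False then show ?thesis using BS by simp
    qed
    show "K (B x) x = x" if "x \<notin> - R" for x
    proof -
      have "x \<in> Y" "x \<in> R" using that RY by auto
      then show ?thesis using B0 K(2) s(4) by simp
    qed
  qed
  moreover have "K (B p) p = s p" if "p \<in> Y" for p using B0[OF that] K(2)[OF that] by simp
  ultimately show ?thesis by (intro bexI[of _ "\<lambda>x. K (B x) x"]) auto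
qed

lemma extend_level:
  assumes c: "c permutes {z. depth z = Suc k}"
    and cz: "\<And>z. depth z = Suc k \<Longrightarrow> c z \<in> orb z \<and> f (c z) = f z"
  shows "\<exists>h\<in>A. (\<forall>z. depth z = Suc k \<longrightarrow> h z = c z) \<and> (\<forall>x. depth x \<le> k \<longrightarrow> h x = x)"
proof -
  define Y where "Y = {x. depth x \<le> Suc k}"
  have cid: "c z = z" if "depth z \<noteq> Suc k" for z using permutes_not_in[OF c] that by simp
  have cdep: "depth (c z) = depth z" for z by (cases "depth z = Suc k") (use cz[of z] depth_orb[of "c z" z] cid[of z] in auto)
  have "\<exists>h\<in>A. \<forall>p\<in>Y. h p = c p"
  proof (rule extend_invariant)
    show "R \<subseteq> Y" by (auto simp: Y_def depth_R)
    show "f x \<in> Y" if "x \<in> Y" for x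
      using that depth_Suc[of x] fR[of x] depth_0[of "f x"] by (cases "x \<in> R") (auto simp: Y_def)
    show "g x \<in> Y \<longleftrightarrow> x \<in> Y" if "g \<in> H" for g x using depth_img[OF that] by (simp add: Y_def)
    show "bij_betw c Y Y"
    proof -
      have "c permutes Y" using c by (rule permutes_subset) (auto simp: Y_def)
      then show ?thesis by (rule permutes_imp_bij)
    qed
    show "c p \<in> orb p" for p by (cases "depth p = Suc k") (use cz cid orb_self in auto)
    show "c (f p) = f (c p)" if "p \<in> Y" for p
    proof -
      have "depth (f p) \<noteq> Suc k"
        using that depth_Suc[of p] fR[of p] depth_0[of "f p"] by (cases "p \<in> R") (auto simp: Y_def)
      then show ?thesis using cid cz by (cases "depth p = Suc k") auto
    qed
    show "c p = p" if "p \<in> R" for p using cid[of p] that depth_0[of p] by simp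
  qed
  then obtain h where "h \<in> A" "\<forall>p\<in>Y. h p = c p" by blast
  then show ?thesis using cid by (intro bexI[of _ h]) (auto simp: Y_def)
qed

section \<open>Signs on finite orbits\<close>

lemma restr_permutes: assumes g: "g \<in> H" shows "restr g (orb x) permutes orb x"
proof (rule bij_imp_permutes)
  show "bij_betw (restr g (orb x)) (orb x) (orb x)"
    by (rule bij_betwI[where g = "pinv g"])
      (use orb_mem_eq[OF g] orb_mem_eq[OF aut_inv[OF g]] g in \<open>auto simp: restr_def aut_inv_r[OF g]\<close>)
qed (simp add: restr_def)

lemma restr_comp: assumes h: "h \<in> H" shows "restr (g \<circ> h) (orb x) = restr g (orb x) \<circ> restr h (orb x)"
  using orb_mem_eq[OF h] by (auto simp: restr_def fun_eq_iff)

lemma evenperm_rs_comp: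
  assumes "g \<in> H" "h \<in> H" "finite (orb x)"
  shows "evenperm (restr (g \<circ> h) (orb x)) \<longleftrightarrow> (evenperm (restr g (orb x)) \<longleftrightarrow> evenperm (restr h (orb x)))"
  unfolding restr_comp[OF assms(2)]
  by (rule evenperm_comp) (use restr_permutes assms in \<open>auto simp: permutation_permutes\<close>)

text \<open>If \<open>f\<close> is injective on an orbit, the sign there is that of the action on
  the image orbit. A new sign can occur only if two points of the orbit have the same image, because
  these siblings can be exchanged while everything closer to the base stays fixed. The set
  \<open>parity g\<close> is a vector over the field with two elements, with symmetric difference as
  addition.\<close>

definition "branching = {orb x | x. x \<notin> R \<and> finite (orb x) \<and> (\<exists>y\<in>orb x. y \<noteq> x \<and> f y = f x)}"
definition "parity g = {S \<in> branching. \<not> evenperm (restr g S)}"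

lemma branching_D: assumes "S \<in> branching" "x \<in> S"
  shows "S = orb x" "x \<notin> R" "finite (orb x)"
proof -
  obtain z where z: "S = orb z" "z \<notin> R" "finite (orb z)" using assms unfolding branching_def by blast
  then show "S = orb x" "x \<notin> R" "finite (orb x)"
    using assms(2) orb_eq[of x z] depth_orb[of x z] depth_0[of x] depth_0[of z] by auto
qed

lemma branching_pair: assumes "S \<in> branching" shows "\<exists>p. fst p \<in> S \<and> snd p \<in> S \<and> fst p \<noteq> snd p \<and> f (fst p) = f (snd p)"
proof -
  obtain x y where "S = orb x" "y \<in> orb x" "y \<noteq> x" "f y = f x" using assms unfolding branching_def by blast
  then show ?thesis using orb_self[of x] by (intro exI[of _ "(x, y)"]) simp
qed

lemma parity_comp:
  assumes "g \<in> H" "h \<in> H" shows "S \<in> parity (g \<circ> h) \<longleftrightarrow> (S \<in> parity g) \<noteq> (S \<in> parity h)"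
proof (cases "S \<in> branching")
  case True
  then obtain x where "S = orb x" "finite (orb x)" unfolding branching_def by blast
  then show ?thesis using evenperm_rs_comp[OF assms, of x] True unfolding parity_def by blast
qed (simp add: parity_def)

lemma lim_H:
  assumes "\<And>n. G n \<in> H" "\<And>n x. depth x \<le> n \<Longrightarrow> G (Suc n) x = G n x"
  shows "(\<lambda>x. G (depth x) x) \<in> H" and "depth x \<le> n \<Longrightarrow> G n x = G (depth x) x"
proof -
  show *: "G n x = G (depth x) x" if "depth x \<le> n" for n x
    using that by (induction n rule: dec_induct) (simp_all add: assms(2))
  show "(\<lambda>x. G (depth x) x) \<in> H" using lim_aut[of G f Z depth, OF assms(1) * depth_img[OF assms(1)]] .
qed

text \<open>Signs are corrected level by level. Exchanging two siblings changes the sign of their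
  orbit and fixes all points of smaller depth, so earlier corrections survive in the limit.\<close>

lemma parity_surj:
  assumes E: "E \<subseteq> branching" shows "\<exists>g\<in>A. parity g = E"
proof -
  define P where "P n g \<longleftrightarrow> g \<in> A \<and> (\<forall>x. orb x \<in> branching \<longrightarrow> depth x \<le> n \<longrightarrow> (\<not> evenperm (restr g (orb x)) \<longleftrightarrow> orb x \<in> E))"
    for n :: nat and g
  define Q where "Q n g g' \<longleftrightarrow> (\<forall>x. depth x \<le> n \<longrightarrow> g' x = g x)" for n :: nat and g g' :: "'x \<Rightarrow> 'x"
  have "\<exists>G. \<forall>n. P n (G n) \<and> Q n (G n) (G (Suc n))"
  proof (rule dependent_nat_choice)
    have "orb x \<notin> branching" if "depth x \<le> 0" for x
      using that depth_0[of x] branching_D(2)[OF _ orb_self[of x]] by auto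
    then have "P 0 id" unfolding P_def by auto
    then show "\<exists>g. P 0 g" by blast
  next
    fix g n assume P: "P n g"
    then have gA: "g \<in> A" by (simp add: P_def)
    define wrong where "wrong z \<longleftrightarrow> depth z = Suc n \<and> orb z \<in> branching \<and> (\<not> evenperm (restr g (orb z)) \<longleftrightarrow> orb z \<notin> E)" for z
    have "\<forall>S\<in>branching. \<exists>p. fst p \<in> S \<and> snd p \<in> S \<and> fst p \<noteq> snd p \<and> f (fst p) = f (snd p)"
      using branching_pair by blast
    from bchoice[OF this] obtain p where p': "\<forall>S\<in>branching. fst (p S) \<in> S \<and> snd (p S) \<in> S \<and>
        fst (p S) \<noteq> snd (p S) \<and> f (fst (p S)) = f (snd (p S))" ..
    then have p: "fst (p S) \<in> S" "snd (p S) \<in> S" "fst (p S) \<noteq> snd (p S)" "f (fst (p S)) = f (snd (p S))"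
      if "S \<in> branching" for S using that by auto
    define c where "c z = (if wrong z then transpose (fst (p (orb z))) (snd (p (orb z))) z else z)" for z
    have corb: "c z \<in> orb z \<and> f (c z) = f z" for z
      using p[of "orb z"] orb_self[of z] by (auto simp: c_def wrong_def transpose_def)
    have oc: "orb (c z) = orb z" and dc: "depth (c z) = depth z" for z
      using orb_eq[of "c z" z] depth_orb[of "c z" z] corb by auto
    have wc: "wrong (c z) = wrong z" for z by (simp add: wrong_def oc dc)
    have cc: "c (c z) = z" for z
      unfolding c_def[of "c z"] wc oc by (simp add: c_def)
    have c: "c permutes {z. depth z = Suc n}"
    proof (rule bij_imp_permutes)
      show "bij_betw c {z. depth z = Suc n} {z. depth z = Suc n}"
        by (rule bij_betwI[where g = c]) (auto simp: cc dc)
    qed (simp add: c_def wrong_def)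
    obtain h where h: "h \<in> A" "\<And>z. depth z = Suc n \<Longrightarrow> h z = c z" "\<And>x. depth x \<le> n \<Longrightarrow> h x = x"
      using extend_level[OF c corb] by blast
    have ghA: "g \<circ> h \<in> A" using gA h by (intro aut_comp)
    have "\<not> evenperm (restr (g \<circ> h) (orb x)) \<longleftrightarrow> orb x \<in> E" if x: "orb x \<in> branching" "depth x \<le> Suc n" for x
    proof (cases "depth x \<le> n")
      case True
      then have "restr (g \<circ> h) (orb x) = restr g (orb x)" using h(3) depth_orb[of _ x] by (auto simp: restr_def fun_eq_iff)
      then show ?thesis using P x True by (simp add: P_def)
    next
      case False
      then have d: "depth x = Suc n" using x by simp
      have fin: "finite (orb x)" using branching_D(3)[OF x(1) orb_self] .
      have hr: "restr h (orb x) y = (if y \<in> orb x then c y else y)" for y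
        using h(2) depth_orb[of y x] d by (simp add: restr_def)
      have wr: "wrong y \<longleftrightarrow> wrong x" if "y \<in> orb x" for y
        using orb_eq[OF that] depth_orb[OF that] by (simp add: wrong_def)
      have "evenperm (restr h (orb x)) \<longleftrightarrow> \<not> wrong x"
      proof (cases "wrong x")
        case True
        have "restr h (orb x) = transpose (fst (p (orb x))) (snd (p (orb x)))"
        proof
          fix y show "restr h (orb x) y = transpose (fst (p (orb x))) (snd (p (orb x))) y"
            using True wr[of y] orb_eq[of y x] p[OF x(1)] unfolding hr c_def by (auto simp: transpose_def)
        qed
        then show ?thesis using p[OF x(1)] True by (simp add: evenperm_swap)
      next
        case False
        then have "restr h (orb x) = id" using wr unfolding hr[abs_def] c_def fun_eq_iff by auto
        then show ?thesis using False by simp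
      qed
      then show ?thesis using evenperm_rs_comp[OF AH[OF gA] AH[OF h(1)] fin] d x by (auto simp: wrong_def)
    qed
    then have "P (Suc n) (g \<circ> h)" using ghA by (simp add: P_def)
    moreover have "Q n g (g \<circ> h)" using h(3) by (simp add: Q_def)
    ultimately show "\<exists>g'. P (Suc n) g' \<and> Q n g g'" by blast
  qed
  then obtain G where G: "\<And>n. P n (G n)" "\<And>n. Q n (G n) (G (Suc n))" by blast
  have GA: "G n \<in> A" for n using G(1) by (simp add: P_def)
  have st: "G (Suc n) x = G n x" if "depth x \<le> n" for n x using G(2) that by (simp add: Q_def)
  define g where "g x = G (depth x) x" for x
  have gH: "g \<in> H" unfolding g_def by (rule lim_H(1)) (use AH[OF GA] st in auto)
  have "g x = x" if "x \<notin> - R" for x using A_fix[OF GA] that by (simp add: g_def)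
  then have gA: "g \<in> A" by (intro aut_restrict[OF gH])
  have "S \<in> parity g \<longleftrightarrow> S \<in> E" for S
  proof (cases "S \<in> branching")
    case True
    then obtain x where x: "S = orb x" unfolding branching_def by blast
    have "restr g S = restr (G (depth x)) S" using depth_orb[of _ x] by (auto simp: restr_def g_def fun_eq_iff x)
    then show ?thesis using G(1)[of "depth x"] True x by (simp add: P_def parity_def)
  qed (use E in \<open>auto simp: parity_def\<close>)
  then show ?thesis using gA by blast
qed

text \<open>The recursion on the depth starts with \<open>\<rho>\<close> on the base. On the next
  level, \<open>v\<close> and \<open>g \<circ> v\<close> both cover single cycles on the level
  above, and \<open>lift_single_orbit\<close> corrects both by the same \<open>h\<close>: either
  \<open>g\<close> is even on the orbit, so that the two signs agree, or \<open>f\<close> is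
  injective there.\<close>

lemma simultaneous_single_orbits:
  assumes g: "g \<in> A" and even: "parity g = {}"
  shows "\<exists>v\<in>H. (\<forall>x\<in>R. v x = \<rho> x) \<and>
    (\<forall>x. finite (orb x) \<longrightarrow> single_orbit v (orb x) \<and> single_orbit (g \<circ> v) (orb x))"
proof -
  have gH: "g \<in> H" using g by (rule AH)
  define ok where "ok v x \<longleftrightarrow> single_orbit v (orb x) \<and> single_orbit (g \<circ> v) (orb x)" for v x
  define P where "P n v \<longleftrightarrow> v \<in> H \<and> (\<forall>x\<in>R. v x = \<rho> x) \<and> (\<forall>x. depth x \<le> n \<longrightarrow> finite (orb x) \<longrightarrow> ok v x)"
    for n :: nat and v
  define Q where "Q n v v' \<longleftrightarrow> (\<forall>x. depth x \<le> n \<longrightarrow> v' x = v x)" for n :: nat and v v' :: "'x \<Rightarrow> 'x"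
  have cong: "ok v' x" if "ok v x" "v \<in> H" "\<And>y. y \<in> orb x \<Longrightarrow> v' y = v y" for v v' x
    unfolding ok_def
  proof
    show "single_orbit v' (orb x)"
      by (rule single_orbit_cong[of v]) (use that orb_mem_eq in \<open>auto simp: ok_def\<close>)
    show "single_orbit (g \<circ> v') (orb x)"
      by (rule single_orbit_cong[of "g \<circ> v"]) (use that orb_mem_eq gH in \<open>auto simp: ok_def\<close>)
  qed
  have "\<exists>G. \<forall>n. P n (G n) \<and> Q n (G n) (G (Suc n))"
  proof (rule dependent_nat_choice)
    have "ok \<rho> x" if "depth x \<le> 0" for x
    proof -
      have x: "x \<in> R" using that depth_0[of x] by simp
      have yR: "y \<in> R" if "y \<in> orb x" for y using depth_orb[OF that] depth_0 depth_R[OF x] by simp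
      have "single_orbit (g \<circ> \<rho>) (orb x)"
      proof (rule single_orbit_cong[OF single_orbit_R[OF x]])
        fix y assume y: "y \<in> orb x"
        show "\<rho> y \<in> orb x" using y orb_mem_eq[OF \<rho>] by simp
        then show "(g \<circ> \<rho>) y = \<rho> y" using A_fix[OF g yR] by simp
      qed
      then show ?thesis using single_orbit_R[OF x] by (simp add: ok_def)
    qed
    then have "P 0 \<rho>" using \<rho> unfolding P_def by auto
    then show "\<exists>v. P 0 v" by blast
  next
    fix v n assume P: "P n v"
    then have vH: "v \<in> H" by (simp add: P_def)
    have gvH: "g \<circ> v \<in> H" using gH vH by (rule aut_comp)
    define lv where "lv S \<longleftrightarrow> (\<exists>x. S = orb x \<and> depth x = Suc n \<and> finite (orb x))" for S
    have "\<exists>c. c permutes S \<and> (\<forall>z\<in>S. f (c z) = f z) \<and> single_orbit (restr v S \<circ> c) S \<and>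
        single_orbit (restr (g \<circ> v) S \<circ> c) S" if "lv S" for S
    proof -
      obtain x where x: "S = orb x" "depth x = Suc n" "finite (orb x)" using \<open>lv S\<close> unfolding lv_def by blast
      have xR: "x \<notin> R" using x(2) depth_R by force
      have ok: "ok v (f x)" using P depth_Suc[OF xR] x(2) finite_orb_f[OF x(3)] by (simp add: P_def)
      have ev: "evenperm (restr v S) = evenperm (restr (g \<circ> v) S) \<or> inj_on f S"
      proof (cases "S \<in> branching")
        case True
        then have "evenperm (restr g S)" using even by (auto simp: parity_def)
        then show ?thesis using evenperm_rs_comp[OF gH vH x(3)] unfolding x(1) by blast
      next
        case False
        have "inj_on f S"
        proof (rule inj_onI, rule ccontr)
          fix y z assume yz: "y \<in> S" "z \<in> S" "f y = f z" "y \<noteq> z"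
          have oy: "orb y = orb x" using yz(1) x(1) orb_eq by blast
          have "y \<notin> R" using yz(1) x depth_orb[of y x] depth_R[of y] by auto
          moreover have "z \<in> orb y" "finite (orb y)" using yz x oy by auto
          ultimately have "orb y \<in> branching" unfolding branching_def using yz(3,4) by (intro CollectI exI[of _ y]) auto
          then show False using False x oy by simp
        qed
        then show ?thesis ..
      qed
      show ?thesis
      proof (rule lift_single_orbit[where vq = v and uq = "g \<circ> v"])
        show "finite S" using x by simp
        show "restr v S permutes S" "restr (g \<circ> v) S permutes S" unfolding x(1) by (rule restr_permutes; fact)+
        show "y \<in> S \<Longrightarrow> f (restr v S y) = v (f y)" for y by (simp add: restr_def aut_comm[OF vH])
        show "y \<in> S \<Longrightarrow> f (restr (g \<circ> v) S y) = (g \<circ> v) (f y)" for y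
          by (simp add: restr_def aut_comm[OF vH] aut_comm[OF gH])
        show "single_orbit v (f ` S)" "single_orbit (g \<circ> v) (f ` S)"
          using ok unfolding x(1) f_orb ok_def by blast+
      qed (rule ev)
    qed
    then have "\<forall>S\<in>{S. lv S}. \<exists>c. c permutes S \<and> (\<forall>z\<in>S. f (c z) = f z) \<and> single_orbit (restr v S \<circ> c) S \<and>
        single_orbit (restr (g \<circ> v) S \<circ> c) S" by blast
    from bchoice[OF this] obtain cc where cc': "\<forall>S\<in>{S. lv S}. cc S permutes S \<and> (\<forall>z\<in>S. f (cc S z) = f z) \<and>
        single_orbit (restr v S \<circ> cc S) S \<and> single_orbit (restr (g \<circ> v) S \<circ> cc S) S" ..
    then have cc: "cc S permutes S" "z \<in> S \<Longrightarrow> f (cc S z) = f z" "single_orbit (restr v S \<circ> cc S) S"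
        "single_orbit (restr (g \<circ> v) S \<circ> cc S) S" if "lv S" for S z using that by blast+
    define c where "c z = (if depth z = Suc n \<and> lv (orb z) then cc (orb z) z else z)" for z
    have cS: "c z = cc (orb x) z" if "lv (orb x)" "z \<in> orb x" for x z
    proof -
      obtain y where "orb x = orb y" "depth y = Suc n" using \<open>lv (orb x)\<close> unfolding lv_def by blast
      then have "depth z = Suc n" "orb z = orb x" using that(2) depth_orb orb_eq by auto
      then show ?thesis using that(1) by (simp add: c_def)
    qed
    have corb: "c z \<in> orb z \<and> f (c z) = f z" for z
    proof (cases "depth z = Suc n \<and> lv (orb z)")
      case True
      then show ?thesis using cS[of z z] cc(2)[of "orb z" z] permutes_in_image[OF cc(1), of "orb z" z] orb_self[of z] by simp
    next
      case False then show ?thesis using orb_self[of z] unfolding c_def by auto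
    qed
    have oc: "orb (c z) = orb z" and dc: "depth (c z) = depth z" for z
      using orb_eq[of "c z" z] depth_orb[of "c z" z] corb[of z] by auto
    have c: "c permutes {z. depth z = Suc n}"
    proof (rule bij_imp_permutes)
      have "\<exists>z. depth z = Suc n \<and> c z = y" if y: "depth y = Suc n" for y
      proof (cases "lv (orb y)")
        case True
        have "pinv (cc (orb y)) y \<in> orb y"
          using permutes_in_image[OF permutes_inv[OF cc(1)[OF True]], of y] orb_self[of y] by simp
        then show ?thesis using cS[OF True] permutes_inverses(1)[OF cc(1)[OF True]] depth_orb y by metis
      next
        case False
        then show ?thesis using y by (intro exI[of _ y]) (simp add: c_def)
      qed
      moreover have "y = z" if "depth y = Suc n" "depth z = Suc n" "c y = c z" for y z
      proof (cases "lv (orb y)")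
        case True
        have o: "orb z = orb y" using oc that(3) by metis
        then have zo: "z \<in> orb y" using orb_self[of z] by simp
        have "cc (orb y) y = cc (orb y) z" by (rule trans[OF cS[OF True orb_self, symmetric] trans[OF that(3) cS[OF True zo]]])
        then show ?thesis using inj_eq[OF permutes_inj[OF cc(1)[OF True]]] by simp
      next
        case False
        have o: "orb z = orb y" using oc that(3) by metis
        then show ?thesis using False that(3) by (simp add: c_def)
      qed
      ultimately show "bij_betw c {z. depth z = Suc n} {z. depth z = Suc n}"
        by (intro bij_betw_imageI inj_onI equalityI subsetI) (auto simp: dc image_iff eq_commute)
    qed (simp add: c_def)
    obtain h where h: "h \<in> A" "\<And>z. depth z = Suc n \<Longrightarrow> h z = c z" "\<And>x. depth x \<le> n \<Longrightarrow> h x = x"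
      using extend_level[OF c corb] by blast
    have vhH: "v \<circ> h \<in> H" using vH AH[OF h(1)] by (rule aut_comp)
    have "ok (v \<circ> h) x" if x: "depth x \<le> Suc n" "finite (orb x)" for x
    proof (cases "depth x \<le> n")
      case True
      then have "ok v x" using P x by (simp add: P_def)
      then show ?thesis by (rule cong[OF _ vH]) (use h(3) depth_orb True in auto)
    next
      case False
      then have d: "depth x = Suc n" using x by simp
      then have l: "lv (orb x)" using x unfolding lv_def by blast
      have e: "(v \<circ> h) y = (restr v (orb x) \<circ> cc (orb x)) y" "(g \<circ> (v \<circ> h)) y = (restr (g \<circ> v) (orb x) \<circ> cc (orb x)) y"
        if y: "y \<in> orb x" for y
      proof -
        have "h y = cc (orb x) y" using h(2)[of y] depth_orb[OF y] d cS[OF l y] by simp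
        moreover have "cc (orb x) y \<in> orb x" using permutes_in_image[OF cc(1)[OF l]] y by simp
        ultimately show "(v \<circ> h) y = (restr v (orb x) \<circ> cc (orb x)) y"
            "(g \<circ> (v \<circ> h)) y = (restr (g \<circ> v) (orb x) \<circ> cc (orb x)) y" by (simp_all add: restr_def)
      qed
      have cl: "(restr v (orb x) \<circ> cc (orb x)) y \<in> orb x" "(restr (g \<circ> v) (orb x) \<circ> cc (orb x)) y \<in> orb x"
        if "y \<in> orb x" for y
        using that permutes_in_image[OF cc(1)[OF l]] permutes_in_image[OF restr_permutes[OF vH]]
          permutes_in_image[OF restr_permutes[OF gvH]] by auto
      show ?thesis unfolding ok_def
        using single_orbit_cong[OF cc(3)[OF l] cl(1) e(1)] single_orbit_cong[OF cc(4)[OF l] cl(2) e(2)] by blast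
    qed
    moreover have "(v \<circ> h) x = \<rho> x" if "x \<in> R" for x
      using P h(3)[of x] depth_R[OF that] that by (simp add: P_def)
    ultimately have "P (Suc n) (v \<circ> h)" using vhH unfolding P_def by blast
    moreover have "Q n v (v \<circ> h)" using h(3) by (simp add: Q_def)
    ultimately show "\<exists>v'. P (Suc n) v' \<and> Q n v v'" by blast
  qed
  then obtain G where G: "\<And>n. P n (G n)" "\<And>n. Q n (G n) (G (Suc n))" by blast
  have GH: "G n \<in> H" for n using G(1) by (simp add: P_def)
  have st: "G (Suc n) x = G n x" if "depth x \<le> n" for n x using G(2) that by (simp add: Q_def)
  define v where "v x = G (depth x) x" for x
  have vH: "v \<in> H" unfolding v_def by (rule lim_H(1)[of G, OF GH st])
  have "ok v x" if "finite (orb x)" for x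
  proof -
    have "ok (G (depth x)) x" using G(1)[of "depth x"] that by (simp add: P_def)
    then show ?thesis by (rule cong[OF _ GH]) (simp add: v_def depth_orb)
  qed
  moreover have "v x = \<rho> x" if "x \<in> R" for x using G(1)[of "depth x"] that by (simp add: P_def v_def)
  ultimately show ?thesis using vH unfolding ok_def by blast
qed

text \<open>A section of the orbit map that is compatible with \<open>f\<close>: it depends only on the orbit of \<open>x\<close>.\<close>

primrec sec :: "nat \<Rightarrow> 'x \<Rightarrow> 'x" where
  "sec 0 x = (SOME y. y \<in> orb x)"
| "sec (Suc n) x = (SOME y. y \<in> orb x \<and> f y = sec n (f x))"

lemma sec: "depth x = n \<Longrightarrow> sec n x \<in> orb x \<and> (\<forall>y\<in>orb x. sec n y = sec n x) \<and> (n > 0 \<longrightarrow> f (sec n x) = sec (n - 1) (f x))"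
proof (induction n arbitrary: x)
  case 0
  have "sec 0 x \<in> orb x" unfolding sec.simps using someI[of "\<lambda>y. y \<in> orb x", OF orb_self] .
  then show ?case using orb_eq by simp
next
  case (Suc n)
  then have "x \<notin> R" using depth_R by force
  then have d: "depth (f x) = n" using depth_Suc Suc.prems by simp
  have "sec n (f x) \<in> f ` orb x" using Suc.IH[OF d] f_orb by simp
  then have "\<exists>y. y \<in> orb x \<and> f y = sec n (f x)" by auto
  from someI_ex[OF this] have 1: "sec (Suc n) x \<in> orb x \<and> f (sec (Suc n) x) = sec n (f x)" by simp
  have "sec (Suc n) y = sec (Suc n) x" if y: "y \<in> orb x" for y
    using Suc.IH[OF d] f_in_orb[OF y] orb_eq[OF y] by simp
  then show ?case using 1 by simp
qed

text \<open>On a finite orbit, the \<open>i\<close>-th iterate of the representative under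
  \<open>v\<close> is sent to its \<open>i\<close>-th iterate under \<open>u\<close>. Both maps have
  the size of the orbit as period, so this is well defined, and it commutes with \<open>f\<close>
  because the representatives given by \<open>sec\<close> do. On the base both maps are
  \<open>\<rho>\<close>, and nothing moves.\<close>

lemma conjugate_single_orbits:
  assumes v: "v \<in> H" and u: "u \<in> H" and R: "\<And>x. x \<in> R \<Longrightarrow> v x = \<rho> x" "\<And>x. x \<in> R \<Longrightarrow> u x = \<rho> x"
    and so: "\<And>x. finite (orb x) \<Longrightarrow> single_orbit v (orb x)" "\<And>x. finite (orb x) \<Longrightarrow> single_orbit u (orb x)"
  shows "\<exists>h\<in>A. \<forall>x. finite (orb x) \<longrightarrow> h (v x) = u (h x)"
proof -
  define Y where "Y = {x. finite (orb x)}"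
  define r where "r x = sec (depth x) x" for x
  have r: "r x \<in> orb x" for x using sec[OF refl, of x] by (simp add: r_def)
  have r_orb: "r y = r x" if "y \<in> orb x" for x y using sec[OF refl, of x] depth_orb[OF that] that by (simp add: r_def)
  have r_f: "f (r x) = r (f x)" if "x \<notin> R" for x
    using sec[OF refl, of x] depth_Suc[OF that] by (simp add: r_def)
  have cl: "v y \<in> orb x" "u y \<in> orb x" if "y \<in> orb x" for x y
    using orb_mem_eq v u that by auto
  have pw: "(v ^^ i) (r x) = (v ^^ j) (r x) \<longleftrightarrow> (u ^^ i) (r x) = (u ^^ j) (r x)" if "x \<in> Y" for x i j
  proof -
    have fin: "finite (orb x)" using that by (simp add: Y_def)
    have *: "(v ^^ i) (r x) = (v ^^ j) (r x) \<longleftrightarrow> (u ^^ i) (r x) = (u ^^ j) (r x)" if "i \<le> j" for i j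
      using single_orbit_funpow_cong[OF so(1)[OF fin] cl(1) aut_inj[OF v] r that]
        single_orbit_funpow_cong[OF so(2)[OF fin] cl(2) aut_inj[OF u] r that] by simp
    show ?thesis using *[of i j] *[of j i] by (cases "i \<le> j") auto
  qed
  have ex: "\<exists>i. (w ^^ i) (r x) = x" if "x \<in> Y" "w = v \<or> w = u" for x w
  proof -
    have "single_orbit w (orb x)" using so that by (auto simp: Y_def)
    then show ?thesis by (rule single_orbitE[OF _ r orb_self]) blast
  qed
  define s where "s x = (u ^^ (SOME i. (v ^^ i) (r x) = x)) (r x)" for x
  have s: "s x = (u ^^ i) (r x)" if "x \<in> Y" "(v ^^ i) (r x) = x" for x i
  proof -
    have "(v ^^ (SOME i. (v ^^ i) (r x) = x)) (r x) = x" by (rule someI[of _ i]) fact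
    then show ?thesis unfolding s_def using pw[OF that(1), of _ i] that(2) by simp
  qed
  have HY: "g x \<in> Y \<longleftrightarrow> x \<in> Y" if "g \<in> H" for g x using orb_img[OF that] by (simp add: Y_def)
  have uw: "(u ^^ i) y \<in> orb x" if "y \<in> orb x" for i x y by (rule funpow_in) (use cl that in auto)
  have s_orb: "s x \<in> orb x" for x unfolding s_def by (rule uw[OF r])
  have orbY: "y \<in> Y" if "y \<in> orb x" "x \<in> Y" for x y using orb_eq[OF that(1)] that(2) by (simp add: Y_def)
  have s_v: "s (v x) = u (s x)" if x: "x \<in> Y" for x
  proof -
    obtain i where i: "(v ^^ i) (r x) = x" using ex[OF x] by blast
    have rv: "r (v x) = r x" by (rule r_orb) (rule cl(1)[OF orb_self])
    have "(v ^^ Suc i) (r (v x)) = v x" unfolding rv using i by simp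
    then have "s (v x) = (u ^^ Suc i) (r (v x))" using HY[OF v] x by (intro s) auto
    then show ?thesis unfolding rv using s[OF x i] by simp
  qed
  have "\<exists>h\<in>A. \<forall>p\<in>Y. h p = s p"
  proof (rule extend_invariant)
    show "R \<subseteq> Y" using orb_R(1) by (auto simp: Y_def)
    show "f x \<in> Y" if "x \<in> Y" for x using that finite_orb_f by (simp add: Y_def)
    show "g x \<in> Y \<longleftrightarrow> x \<in> Y" if "g \<in> H" for g x by (rule HY[OF that])
    show "s p \<in> orb p" for p by (rule s_orb)
    show "bij_betw s Y Y" unfolding bij_betw_def
    proof
      show "inj_on s Y"
      proof (rule inj_onI)
        fix x y assume x: "x \<in> Y" and y: "y \<in> Y" and e: "s x = s y"
        have "orb x = orb y" using orb_eq[OF s_orb[of x]] orb_eq[OF s_orb[of y]] e by simp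
        then have rr: "r x = r y" using r_orb[of x y] orb_self[of x] by simp
        obtain i where i: "(v ^^ i) (r x) = x" using ex[OF x] by blast
        obtain j where j: "(v ^^ j) (r y) = y" using ex[OF y] by blast
        have "(u ^^ i) (r x) = (u ^^ j) (r x)" using s[OF x i] s[OF y j] e rr by simp
        then have "(v ^^ i) (r x) = (v ^^ j) (r y)" unfolding rr[symmetric] using pw[OF x] by simp
        then show "x = y" unfolding i j .
      qed
      show "s ` Y = Y"
      proof (intro equalityI subsetI)
        fix y assume "y \<in> s ` Y"
        then obtain x where "x \<in> Y" "y = s x" by blast
        then show "y \<in> Y" using orbY[OF s_orb[of x]] by simp
      next
        fix y assume y: "y \<in> Y"
        obtain i where i: "(u ^^ i) (r y) = y" using ex[OF y] by blast
        define x where "x = (v ^^ i) (r y)"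
        have xo: "x \<in> orb y" unfolding x_def by (rule funpow_in) (use cl r in auto)
        have xY: "x \<in> Y" by (rule orbY[OF xo y])
        have rx: "r x = r y" by (rule r_orb[OF xo])
        have "s x = (u ^^ i) (r x)" by (rule s[OF xY], unfold rx, rule x_def[symmetric])
        then show "y \<in> s ` Y" using xY i rx by (intro image_eqI[of _ _ x]) simp_all
      qed
    qed
    have sR: "s p = p" if p: "p \<in> R" for p
    proof -
      have pY: "p \<in> Y" using orb_R(1)[OF p] by (simp add: Y_def)
      obtain i where i: "(v ^^ i) (r p) = p" using ex[OF pY] by blast
      have rR: "r p \<in> R" using depth_orb[OF r[of p]] depth_R[OF p] depth_0[of "r p"] by simp
      have "(u ^^ j) (r p) = (v ^^ j) (r p) \<and> (v ^^ j) (r p) \<in> R" for j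
        by (induction j) (use rR R \<rho>R in auto)
      then show ?thesis using s[OF pY i] i by simp
    qed
    then show "s p = p" if "p \<in> R" for p using that .
    show "s (f p) = f (s p)" if p: "p \<in> Y" for p
    proof (cases "p \<in> R")
      case True then show ?thesis using sR fR by simp
    next
      case False
      obtain i where i: "(v ^^ i) (r p) = p" using ex[OF p] by blast
      have "f p \<in> Y" using p finite_orb_f by (simp add: Y_def)
      moreover have "(v ^^ i) (r (f p)) = f p"
        using i r_f[OF False] aut_comm[OF aut_pow[OF v], of i "r p"] by simp
      ultimately have "s (f p) = (u ^^ i) (r (f p))" by (rule s)
      then show ?thesis using s[OF p i] r_f[OF False] aut_comm[OF aut_pow[OF u], of i "r p"] by simp
    qed
  qed
  then obtain h where h: "h \<in> A" "\<And>p. p \<in> Y \<Longrightarrow> h p = s p" by blast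
  have "h (v x) = u (h x)" if "finite (orb x)" for x
    using h(2)[of x] h(2)[of "v x"] HY[OF v, of x] s_v[of x] that by (simp add: Y_def)
  then show ?thesis using h(1) by blast
qed

text \<open>Beyond the union \<open>Y\<close> of the finite orbits there remain the subtrees rooted
  at the points \<open>W\<close> whose image lies in \<open>Y\<close>. An infinite orbit over a
  finite one has infinite fibres, so every such subtree has infinitely many isomorphic siblings, and
  \<open>block_system\<close> applies.\<close>

lemma fix_finite_orbits_comm_prods:
  assumes q: "q \<in> A" and fixed: "\<And>x. finite (orb x) \<Longrightarrow> q x = x"
  shows "q \<in> comm_prods A 2"
proof -
  define Y where "Y = {x. finite (orb x)}"
  have RY: "R \<subseteq> Y" using orb_R(1) by (auto simp: Y_def)
  have fY: "f x \<in> Y" if "x \<in> Y" for x using that finite_orb_f by (simp add: Y_def)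
  have HY: "g x \<in> Y \<longleftrightarrow> x \<in> Y" if "g \<in> H" for g x using orb_img[OF that] by (simp add: Y_def)
  have enterY: "\<exists>n. (f ^^ n) x \<in> Y" for x using enter[of x] RY by blast
  define e where "e x = (LEAST n. (f ^^ n) x \<in> Y)" for x
  have eY: "(f ^^ e x) x \<in> Y" for x unfolding e_def using LeastI_ex[OF enterY[of x]] .
  have e0: "e x = 0 \<longleftrightarrow> x \<in> Y" for x
  proof
    show "e x = 0 \<Longrightarrow> x \<in> Y" using eY[of x] by simp
  qed (auto simp: e_def intro!: Least_equality)
  have eS: "e x = Suc (e (f x))" if "x \<notin> Y" for x
  proof -
    have "(LEAST n. (f ^^ n) x \<in> Y) = Suc (LEAST n. (f ^^ Suc n) x \<in> Y)"
      using enterY[of x] that by (elim exE, intro Least_Suc) auto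
    then show ?thesis unfolding e_def by (simp add: funpow_swap1)
  qed
  have ek: "e (k x) = e x" if k: "k \<in> H" for k x
  proof -
    have "(f ^^ n) (k x) \<in> Y \<longleftrightarrow> (f ^^ n) x \<in> Y" for n
      using HY[OF k, of "(f ^^ n) x"] by (simp add: aut_comm_funpow[OF k])
    then show ?thesis by (simp add: e_def)
  qed
  define B where "B x = (if x \<in> Y then None else Some ((f ^^ (e x - 1)) x))" for x
  define W where "W = {z. z \<notin> Y \<and> f z \<in> Y}"
  define E where "E = {(z, z'). z \<in> W \<and> z' \<in> orb z \<and> f z' = f z}"
  have Bk: "B (k x) = map_option k (B x)" if k: "k \<in> H" for k x
    using HY[OF k] ek[OF k] aut_comm_funpow[OF k] by (simp add: B_def)
  have BWx: "w \<in> W" if "B x = Some w" for x w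
    using that
  proof (induction "e x" arbitrary: x)
    case 0 then show ?case using e0[of x] by (simp add: B_def)
  next
    case (Suc n)
    have x: "x \<notin> Y" using Suc.prems by (auto simp: B_def split: if_splits)
    show ?case
    proof (cases "f x \<in> Y")
      case True
      then have "e x = 1" using eS[OF x] e0[of "f x"] by simp
      then show ?thesis using Suc.prems x True by (simp add: B_def W_def)
    next
      case False
      then have "e (f x) > 0" using e0[of "f x"] by simp
      then have "(f ^^ (e (f x) - 1)) (f x) = (f ^^ (e x - 1)) x"
        using eS[OF x] funpow_swap1[of f "e (f x) - 1" x] by (cases "e (f x)") simp_all
      then show ?thesis using Suc False x eS[OF x] by (simp add: B_def)
    qed
  qed
  have BW: "B w = Some w" if "w \<in> W" for w
    using that eS[of w] e0[of "f w"] by (simp add: B_def W_def)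
  have W_orb: "z' \<in> W" if "z \<in> W" "z' \<in> orb z" "f z' = f z" for z z'
    using that orb_eq[OF that(2)] by (simp add: W_def Y_def)
  interpret I: block_system f B W E
  proof
    show "B (f x) = None \<or> B (f x) = B x" for x
    proof (cases "f x \<in> Y")
      case False
      then have x: "x \<notin> Y" using fY by blast
      have "e (f x) > 0" using e0[of "f x"] False by simp
      then have "(f ^^ (e (f x) - 1)) (f x) = (f ^^ (e x - 1)) x"
        using eS[OF x] funpow_swap1[of f "e (f x) - 1" x] by (cases "e (f x)") simp_all
      then show ?thesis using False x by (simp add: B_def)
    qed (simp add: B_def)
    show "w \<in> W \<longleftrightarrow> (\<exists>x. B x = Some w)" for w using BW BWx by blast
    show "equiv W E"
    proof (rule equivI)
      show "E \<subseteq> W \<times> W" using W_orb by (auto simp: E_def)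
      show "refl_on W E" using orb_self by (auto simp: refl_on_def E_def W_orb)
      show "sym E" using orb_eq orb_self W_orb by (auto simp: sym_def E_def)
      show "trans E" using orb_eq W_orb by (auto simp: trans_def E_def)
    qed
    show "infinite (E `` {w})" if w: "w \<in> W" for w
    proof
      assume fin: "finite (E `` {w})"
      have "finite (orb (f w))" "infinite (orb w)" using w by (simp_all add: W_def Y_def)
      \<comment> \<open>The fibres over the finite orbit of \<open>f w\<close> are translates of one
        another, so a single finite fibre would make the orbit of \<open>w\<close> finite.\<close>
      have "orb w \<subseteq> (\<Union>p\<in>orb (f w). {z \<in> orb w. f z = p})" using f_in_orb by auto
      moreover have "finite {z \<in> orb w. f z = p}" if "p \<in> orb (f w)" for p
      proof -
        obtain k where k: "k \<in> H" "p = k (f w)" using \<open>p \<in> orb (f w)\<close> by (rule orbE)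
        have "{z \<in> orb w. f z = p} \<subseteq> k ` (E `` {w})"
        proof
          fix z assume z: "z \<in> {z \<in> orb w. f z = p}"
          have ki: "pinv k \<in> H" using k(1) by (rule aut_inv)
          have "f (pinv k z) = pinv k (k (f w))" using z k(2) aut_comm[OF ki, of z] by simp
          then have "f (pinv k z) = f w" using k(1) by simp
          moreover have "pinv k z \<in> orb w" using z orb_mem_eq[OF ki] by simp
          ultimately have "pinv k z \<in> E `` {w}" using w by (simp add: E_def)
          then show "z \<in> k ` (E `` {w})" using aut_inv_r[OF k(1), of z] by (metis image_eqI)
        qed
        then show ?thesis using fin finite_subset by blast
      qed
      ultimately have "finite (orb w)" using \<open>finite (orb (f w))\<close> finite_subset by blast
      then show False using \<open>infinite (orb w)\<close> by blast
    qed
    show "\<exists>k\<in>aut f UNIV. (\<forall>x. B (k x) = Some w' \<longleftrightarrow> B x = Some w) \<and>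
        (\<forall>x. B x = Some w \<longrightarrow> B (f x) = None \<longrightarrow> k (f x) = f x)" if ww: "(w, w') \<in> E" for w w'
    proof -
      have w: "w \<in> W" "w' \<in> orb w" "f w' = f w" using ww by (auto simp: E_def)
      from w(2) obtain k where k: "k \<in> H" "w' = k w" by (rule orbE)
      have "k (f x) = f x" if "B x = Some w" "B (f x) = None" for x
      proof -
        have "x \<notin> Y" "f x \<in> Y" using that by (auto simp: B_def split: if_splits)
        then have "w = x" using that(1) eS[of x] e0[of "f x"] by (simp add: B_def)
        then show ?thesis using w(3) k(2) aut_comm[OF k(1), of x] by simp
      qed
      moreover have "B (k x) = Some w' \<longleftrightarrow> B x = Some w" for x
        unfolding Bk[OF k(1)] k(2) using aut_eq[OF k(1)] by auto
      ultimately show ?thesis using aut_UNIV[OF k(1)] by blast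
    qed
  qed
  have D: "I.D = - Y" by (auto simp: I.D_def B_def)
  have qH: "q \<in> H" using q by (rule AH)
  have qY: "q x = x" if "x \<in> Y" for x using fixed that by (simp add: Y_def)
  have qW: "q w \<in> orb w \<and> f (q w) = f w" if "w \<in> W" for w
    using orbI[OF qH] aut_comm[OF qH, of w] qY[of "f w"] that by (simp add: W_def)
  have qWW: "q w \<in> W \<longleftrightarrow> w \<in> W" for w
    using HY[OF qH, of w] HY[OF qH, of "f w"] aut_comm[OF qH, of w] by (simp add: W_def)
  have "q \<in> comm_prods (aut f I.D) 2"
  proof (rule I.comm_prods_blocks)
    show "q \<in> aut f I.D" unfolding D by (rule aut_restrict[OF q]) (simp add: qY)
    show "restr q W permutes W"
    proof (rule bij_imp_permutes)
      show "bij_betw (restr q W) W W"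
      proof (rule bij_betwI[where g = "pinv q"])
        have pW: "pinv q w \<in> W \<longleftrightarrow> w \<in> W" for w using qWW[of "pinv q w"] by (simp add: aut_inv_r[OF qH])
        then show "pinv q \<in> W \<rightarrow> W" by simp
        show "restr q W \<in> W \<rightarrow> W" using qWW by (simp add: restr_def)
        show "pinv q (restr q W w) = w" if "w \<in> W" for w using that qH by (simp add: restr_def)
        show "restr q W (pinv q w) = w" if "w \<in> W" for w using that pW by (simp add: restr_def aut_inv_r[OF qH])
      qed
    qed (simp add: restr_def)
    show "B (q x) = Some (restr q W w)" if "B x = Some w" for x w
      using Bk[OF qH, of x] that BWx[OF that] by (simp add: restr_def)
    show "(w, restr q W w) \<in> E" if "w \<in> W" for w using qW[OF that] that by (simp add: E_def restr_def)
  qed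
  moreover have "aut f I.D \<subseteq> A" unfolding D using RY by (intro aut_mono) auto
  ultimately show ?thesis using comm_prods_mono by blast
qed

text \<open>\<open>v\<close> and \<open>g \<circ> v\<close> are conjugate by some \<open>h\<close>
  on the finite orbits, so the commutator of \<open>h\<close> and \<open>v\<close> agrees with
  \<open>g\<close> there. The quotient fixes all finite orbits and costs two more
  commutators.\<close>

theorem parity_kernel:
  assumes g: "g \<in> A" and even: "parity g = {}" shows "g \<in> comm_prods H 3"
proof -
  obtain v where v: "v \<in> H" "\<And>x. x \<in> R \<Longrightarrow> v x = \<rho> x" "\<And>x. finite (orb x) \<Longrightarrow> single_orbit v (orb x)"
      "\<And>x. finite (orb x) \<Longrightarrow> single_orbit (g \<circ> v) (orb x)"
    using simultaneous_single_orbits[OF g even] by blast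
  have gH: "g \<in> H" using g by (rule AH)
  have "\<exists>h\<in>A. \<forall>x. finite (orb x) \<longrightarrow> h (v x) = (g \<circ> v) (h x)"
  proof (rule conjugate_single_orbits[OF v(1) aut_comp[OF gH v(1)] v(2) _ v(3,4)])
    show "(g \<circ> v) x = \<rho> x" if "x \<in> R" for x using v(2)[OF that] A_fix[OF g \<rho>R[OF that]] by simp
  qed
  then obtain h where h: "h \<in> A" "\<And>x. finite (orb x) \<Longrightarrow> h (v x) = g (v (h x))" by auto
  have hH: "h \<in> H" using h(1) by (rule AH)
  define t where "t = commutator h v"
  have t: "t \<in> H" unfolding t_def by (intro aut_comp aut_inv hH v(1))
  have tg: "t x = g x" if x: "finite (orb x)" for x
  proof -
    let ?y = "pinv h (pinv v x)"
    have "orb ?y = orb x" using orb_img[OF aut_inv[OF hH]] orb_img[OF aut_inv[OF v(1)]] by simp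
    then have "h (v ?y) = g (v (h ?y))" using h(2) x by simp
    then show ?thesis by (simp add: t_def aut_inv_r[OF hH] aut_inv_r[OF v(1)])
  qed
  define q where "q = pinv t \<circ> g"
  have qH: "q \<in> H" unfolding q_def by (intro aut_comp aut_inv t gH)
  have qf: "q x = x" if "finite (orb x)" for x using tg[OF that] t by (simp add: q_def tg[OF that, symmetric])
  have "q \<in> A" by (rule aut_restrict[OF qH]) (use qf orb_R(1) in auto)
  then have "q \<in> comm_prods A 2" by (rule fix_finite_orbits_comm_prods) (rule qf)
  then have "q \<in> comm_prods H 2" using comm_prods_mono[OF A_sub] by blast
  then have "t \<circ> q \<in> comm_prods H (Suc 2)" unfolding t_def by (rule comm_prods_SucI[OF hH v(1)])
  moreover have "t \<circ> q = g" unfolding q_def using t by (simp add: comp_assoc[symmetric])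
  ultimately show ?thesis by (simp add: numeral_3_eq_3)
qed

end

section \<open>Components with a cycle or a translation\<close>

text \<open>
  \<open>\<Phi>\<close> is a surjection to the product of the groups \<open>\<int> / n\<^sub>i\<close>, written with representatives, whose kernel
  consists of products of \<open>N\<close> commutators.
\<close>

definition cyclic_ab :: "('x \<Rightarrow> 'x) \<Rightarrow> 'x set \<Rightarrow> nat \<Rightarrow> 'j set \<Rightarrow> ('j \<Rightarrow> nat) \<Rightarrow> bool"
  where "cyclic_ab f Y N I n \<longleftrightarrow> (\<exists>\<Phi> :: ('x \<Rightarrow> 'x) \<Rightarrow> 'j \<Rightarrow> int.
    (\<forall>g\<in>aut f Y. \<forall>h\<in>aut f Y. \<forall>i\<in>I. int (n i) dvd \<Phi> (g \<circ> h) i - (\<Phi> g i + \<Phi> h i)) \<and>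
    (\<forall>t. \<exists>g\<in>aut f Y. \<forall>i\<in>I. int (n i) dvd \<Phi> g i - t i) \<and>
    (\<forall>g\<in>aut f Y. (\<forall>i\<in>I. int (n i) dvd \<Phi> g i) \<longrightarrow> g \<in> comm_prods (aut f Y) N))"

lemma cyclic_ab_le: "cyclic_ab f Y M I n \<Longrightarrow> M \<le> N \<Longrightarrow> cyclic_ab f Y N I n"
  unfolding cyclic_ab_def using comm_prods_le[OF aut_id] by blast

text \<open>The index \<open>(1, {})\<close> carries the rotation of the base modulo
  \<open>m\<close>, the indices \<open>(0, S)\<close> carry the signs on branching orbits. By
  \<open>min\<close>, the number \<open>m\<close> is the exact order of \<open>\<rho>\<close> on the
  base, so the rotation number is well defined modulo \<open>m\<close>.\<close>

lemma (in tree) cyclic_ab_tree: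
  assumes min: "\<And>i. (\<And>x. x \<in> R \<Longrightarrow> (\<rho> ^^ i) x = x) \<Longrightarrow> m dvd i"
  shows "cyclic_ab f Z 3 (insert (1, {}) (Pair 0 ` branching)) (\<lambda>(k :: nat, S :: 'x set). if k = 0 then 2 else m)"
proof -
  define rot where "rot g = (SOME i. \<forall>x\<in>R. g x = (\<rho> ^^ i) x)" for g
  have rot: "g x = (\<rho> ^^ rot g) x" if "g \<in> H" "x \<in> R" for g x
    using someI_ex[OF H_R[OF that(1)]] that(2) unfolding rot_def by blast
  have uniq: "int m dvd int i - int j" if e: "\<And>x. x \<in> R \<Longrightarrow> (\<rho> ^^ i) x = (\<rho> ^^ j) x" for i j
  proof -
    have *: "m dvd j - i" if "i \<le> j" "\<And>x. x \<in> R \<Longrightarrow> (\<rho> ^^ i) x = (\<rho> ^^ j) x" for i j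
    proof (rule min)
      fix x assume "x \<in> R"
      then have "(\<rho> ^^ i) x = (\<rho> ^^ i) ((\<rho> ^^ (j - i)) x)" using that by (simp add: funpow_plus)
      then show "(\<rho> ^^ (j - i)) x = x" using aut_eq[OF aut_pow[OF \<rho>]] by metis
    qed
    show ?thesis
    proof (cases "i \<le> j")
      case True
      have "int m dvd int (j - i)" using *[OF True e] by (simp only: int_dvd_int_iff)
      then show ?thesis unfolding of_nat_diff[OF True] by (simp only: dvd_diff_commute)
    next
      case False
      then have ji: "j \<le> i" by simp
      have "int m dvd int (i - j)" using *[OF ji e[symmetric]] by (simp only: int_dvd_int_iff)
      then show ?thesis unfolding of_nat_diff[OF ji] .
    qed
  qed
  have rotI: "int m dvd int (rot g) - int i" if "g \<in> H" "\<And>x. x \<in> R \<Longrightarrow> g x = (\<rho> ^^ i) x" for g i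
    by (rule uniq) (use rot[OF that(1)] that(2) in simp)
  define \<Phi> where "\<Phi> g = (\<lambda>(k :: nat, S). if k = 0 then (if S \<in> parity g then 1 else 0) else int (rot g))" for g
  show ?thesis unfolding cyclic_ab_def
  proof (intro exI[of _ \<Phi>] conjI ballI allI impI)
    fix g h i assume g: "g \<in> H" and h: "h \<in> H" and i: "i \<in> insert (1 :: nat, {}) (Pair 0 ` branching)"
    have "int m dvd int (rot (g \<circ> h)) - int (rot g + rot h)"
    proof (rule rotI[OF aut_comp[OF g h]])
      fix x assume "x \<in> R"
      then show "(g \<circ> h) x = (\<rho> ^^ (rot g + rot h)) x"
        using rot[OF h] rot[OF g, of "h x"] H_R1[OF h] by (simp add: funpow_plus)
    qed
    then show "int ((\<lambda>(k, S). if k = 0 then 2 else m) i) dvd \<Phi> (g \<circ> h) i - (\<Phi> g i + \<Phi> h i)"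
      using i parity_comp[OF g h] by (auto simp: \<Phi>_def)
  next
    fix t :: "nat \<times> 'x set \<Rightarrow> int"
    define i where "i = nat (t (1, {}) mod int m)"
    have i: "int i = t (1, {}) mod int m" using m(1) by (simp add: i_def)
    have \<rho>i: "\<rho> ^^ i \<in> H" using \<rho> by (rule aut_pow)
    \<comment> \<open>The power of \<open>\<rho>\<close> has signs of its own; \<open>a\<close>
      contributes the difference to the prescribed ones.\<close>
    obtain a where a: "a \<in> A" "parity a = {S \<in> branching. odd (t (0, S)) \<noteq> (S \<in> parity (\<rho> ^^ i))}"
      using parity_surj[of "{S \<in> branching. odd (t (0, S)) \<noteq> (S \<in> parity (\<rho> ^^ i))}"] by auto
    have gH: "(\<rho> ^^ i) \<circ> a \<in> H" using \<rho>i AH[OF a(1)] by (rule aut_comp)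
    have "int m dvd int (rot ((\<rho> ^^ i) \<circ> a)) - int i"
      by (rule rotI[OF gH]) (simp add: A_fix[OF a(1)])
    moreover have "int m dvd int i - t (1, {})" unfolding i by (simp add: mod_eq_dvd_iff[symmetric])
    ultimately have 1: "int m dvd int (rot ((\<rho> ^^ i) \<circ> a)) - t (1, {})"
      using dvd_add[of "int m" "int (rot ((\<rho> ^^ i) \<circ> a)) - int i" "int i - t (1, {})"] by simp
    have 2: "2 dvd (if S \<in> parity ((\<rho> ^^ i) \<circ> a) then 1 else 0) - t (0, S)" if "S \<in> branching" for S
      using parity_comp[OF \<rho>i AH[OF a(1)], of S] a(2) that by auto
    show "\<exists>g\<in>H. \<forall>i\<in>insert (1, {}) (Pair 0 ` branching). int ((\<lambda>(k, S). if k = 0 then 2 else m) i) dvd \<Phi> g i - t i"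
      using gH 1 2 by (intro bexI[of _ "(\<rho> ^^ i) \<circ> a"]) (auto simp: \<Phi>_def)
  next
    fix g assume g: "g \<in> H" and z: "\<forall>i\<in>insert (1 :: nat, {}) (Pair 0 ` branching). int ((\<lambda>(k, S). if k = 0 then 2 else m) i) dvd \<Phi> g i"
    have "m dvd rot g" using z by (auto simp: \<Phi>_def)
    then have "g x = x" if "x \<in> R" for x
      using rot[OF g that] funpow_mod_eq[OF m(2)[OF that], of "rot g"] by simp
    then have gA: "g \<in> A" by (intro aut_restrict[OF g]) auto
    have "S \<notin> parity g" for S
    proof (cases "S \<in> branching")
      case True
      then have "2 dvd \<Phi> g (0, S)" using z by force
      then show ?thesis by (auto simp: \<Phi>_def split: if_splits)
    qed (simp add: parity_def)
    then show "g \<in> comm_prods H 3" by (intro parity_kernel[OF gA]) auto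
  qed
qed

section \<open>Components of the functional graph\<close>

definition conn :: "('x \<Rightarrow> 'x) \<Rightarrow> 'x \<Rightarrow> 'x \<Rightarrow> bool"
  where "conn f x y \<longleftrightarrow> (\<exists>a b. (f ^^ a) x = (f ^^ b) y)"

lemma connI: "(f ^^ a) x = (f ^^ b) y \<Longrightarrow> conn f x y"
  unfolding conn_def by blast

lemma conn_refl: "conn f x x"
  by (rule connI[of 0 _ _ 0]) simp

lemma conn_sym: "conn f x y \<Longrightarrow> conn f y x"
  unfolding conn_def by metis

lemma conn_trans: assumes "conn f x y" "conn f y z" shows "conn f x z"
proof -
  obtain a b c d where e: "(f ^^ a) x = (f ^^ b) y" "(f ^^ c) y = (f ^^ d) z" using assms unfolding conn_def by blast
  have "(f ^^ (c + a)) x = (f ^^ (c + b)) y" using e(1) by (simp add: funpow_plus[symmetric])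
  also have "\<dots> = (f ^^ (b + d)) z" using e(2) by (simp add: add.commute[of c b] funpow_plus[symmetric])
  finally show ?thesis by (rule connI)
qed

lemma conn_pow: "conn f x ((f ^^ i) x)"
  by (rule connI[of i _ _ 0]) simp

lemma conn_f: "conn f x (f y) \<longleftrightarrow> conn f x y"
proof -
  have "conn f y (f y)" using conn_pow[of f y 1] by simp
  then show ?thesis using conn_trans conn_sym by metis
qed

lemma conn_pow_iff: "conn f x ((f ^^ i) y) \<longleftrightarrow> conn f x y"
  by (induction i) (simp_all add: conn_f)

lemma conn_aut: assumes "g \<in> aut f Y" "conn f x y" shows "conn f (g x) (g y)"
proof -
  obtain a b where "(f ^^ a) x = (f ^^ b) y" using assms(2) unfolding conn_def by blast
  then have "(f ^^ a) (g x) = (f ^^ b) (g y)" using aut_comm_funpow[OF assms(1)] by metis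
  then show ?thesis by (rule connI)
qed

locale component =
  fixes f :: "'x \<Rightarrow> 'x" and K :: "'x set" and x0 :: 'x
  assumes K: "K = {y. conn f x0 y}"
begin

lemma x0: "x0 \<in> K" by (simp add: K conn_refl)

lemma f_K: "f x \<in> K \<longleftrightarrow> x \<in> K" by (simp add: K conn_f)

lemma pow_K: "(f ^^ i) x \<in> K \<longleftrightarrow> x \<in> K" by (simp add: K conn_pow_iff)

lemma conn_K: "x \<in> K \<Longrightarrow> y \<in> K \<Longrightarrow> conn f x y"
  unfolding K mem_Collect_eq by (rule conn_trans[OF conn_sym])

text \<open>Automorphisms rotate the cycle through \<open>z\<close>. By division with remainder, all
  these rotations are powers of one with least positive step \<open>d\<close>, and the cycle,
  together with the complement of \<open>K\<close>, is the base of a tree.\<close>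

lemma cyclic_ab_cycle:
  assumes z: "z \<in> K" and l: "l > 0" "(f ^^ l) z = z"
  shows "\<exists>I n. cyclic_ab f K 3 (I :: (nat \<times> 'x set) set) n"
proof -
  have lz: "(f ^^ (c * l)) z = z" for c using funpow_mod_eq[OF l(2), of "c * l"] by simp
  define P where "P r \<longleftrightarrow> r > 0 \<and> (\<exists>\<sigma>\<in>aut f K. \<sigma> z = (f ^^ r) z)" for r
  \<comment> \<open>The identity counts as the rotation by the full length \<open>l\<close>, so that
    a positive step exists at all.\<close>
  have "P l" unfolding P_def using l by (intro conjI bexI[of _ id]) auto
  define d where "d = (LEAST r. P r)"
  have d: "P d" unfolding d_def using \<open>P l\<close> by (rule LeastI)
  have dmin: "d \<le> r" if "P r" for r unfolding d_def using that by (rule Least_le)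
  obtain \<rho> where \<rho>: "\<rho> \<in> aut f K" "\<rho> z = (f ^^ d) z" and d0: "d > 0" using d unfolding P_def by blast
  have \<rho>q: "(\<rho> ^^ q) z = (f ^^ (d * q)) z" for q
  proof (induction q)
    case (Suc q)
    then show ?case by (simp add: aut_comm_funpow[OF \<rho>(1)] \<rho>(2) funpow_plus add.commute)
  qed simp
  have rot: "\<exists>q. g z = (\<rho> ^^ q) z" if g: "g \<in> aut f K" for g
  proof -
    have "g z \<in> K" using z aut_in[OF g] by simp
    then obtain a b where ab: "(f ^^ a) z = (f ^^ b) (g z)" using conn_K[OF z] unfolding conn_def by blast
    have "b \<le> b * l" using l(1) by simp
    then have "g z = (f ^^ (b * l - b)) ((f ^^ b) (g z))"
      using lz[of b] aut_comm_funpow[OF g, of "b * l" z] by (simp add: funpow_plus)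
    also have "\<dots> = (f ^^ (b * l - b + a)) z" unfolding ab[symmetric] by (simp add: funpow_plus)
    finally obtain r where r: "g z = (f ^^ r) z" by blast
    define q where "q = r div d"
    define r' where "r' = r mod d"
    have rr: "r = r' + d * q" by (simp add: q_def r'_def)
    define p where "p = pinv (\<rho> ^^ q)"
    have \<rho>q': "\<rho> ^^ q \<in> aut f K" using \<rho>(1) by (rule aut_pow)
    have p: "p \<in> aut f K" unfolding p_def using \<rho>q' by (rule aut_inv)
    have "(p \<circ> g) z = p ((f ^^ r') ((\<rho> ^^ q) z))" unfolding \<rho>q by (simp add: r rr funpow_plus)
    also have "\<dots> = (f ^^ r') z" unfolding aut_comm_funpow[OF p] unfolding p_def using \<rho>q' by simp
    finally have pg: "(p \<circ> g) z = (f ^^ r') z" .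
    have "r' = 0"
    proof (rule ccontr)
      assume "r' \<noteq> 0"
      then have "P r'" unfolding P_def using pg aut_comp[OF p g] by blast
      then have "d \<le> r'" by (rule dmin)
      then show False using mod_less_divisor[OF d0, of r] by (simp add: r'_def)
    qed
    then show ?thesis using r rr \<rho>q by auto
  qed
  have "(\<rho> ^^ l) z = z" using \<rho>q[of l] lz[of d] by simp
  then have ex: "\<exists>m>0. (\<rho> ^^ m) z = z" using l(1) by blast
  define m where "m = (LEAST m. m > 0 \<and> (\<rho> ^^ m) z = z)"
  have m: "m > 0" "(\<rho> ^^ m) z = z" using LeastI_ex[OF ex] unfolding m_def by blast+
  define R where "R = - K \<union> range (\<lambda>i. (f ^^ i) z)"
  have Rext: "g x = h x" if "g \<in> aut f K" "h \<in> aut f K" "g z = h z" "x \<in> R" for g h x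
    using that(4) aut_out[OF that(1), of x] aut_out[OF that(2), of x] that(3)
    by (auto simp: R_def aut_comm_funpow[OF that(1)] aut_comm_funpow[OF that(2)])
  interpret T: tree f K R \<rho> m
  proof
    show "- K \<subseteq> R" by (simp add: R_def)
    show "f x \<in> R" if "x \<in> R" for x
      using that f_K by (auto simp: R_def intro: range_eqI[of _ _ "Suc _"])
    show "\<exists>n. (f ^^ n) x \<in> R" for x
    proof (cases "x \<in> K")
      case True
      then obtain a b where "(f ^^ a) x = (f ^^ b) z" using conn_K[OF _ z] unfolding conn_def by blast
      then show ?thesis by (intro exI[of _ a]) (simp add: R_def)
    qed (auto simp: R_def intro: exI[of _ 0])
    show "\<rho> \<in> aut f K" by (rule \<rho>(1))
    show "\<rho> x \<in> R" if "x \<in> R" for x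
      using that aut_out[OF \<rho>(1), of x]
      by (auto simp: R_def aut_comm_funpow[OF \<rho>(1)] \<rho>(2) funpow_plus)
    show "\<exists>i. \<forall>x\<in>R. g x = (\<rho> ^^ i) x" if g: "g \<in> aut f K" for g
      using rot[OF g] Rext[OF g aut_pow[OF \<rho>(1)]] by blast
    show "(\<rho> ^^ m) x = x" if "x \<in> R" for x using Rext[OF aut_pow[OF \<rho>(1)] aut_id _ that] m(2) by simp
  qed (rule m(1))
  have "m dvd i" if "\<And>x. x \<in> R \<Longrightarrow> (\<rho> ^^ i) x = x" for i
  proof -
    have "z \<in> R" unfolding R_def by (auto intro: range_eqI[of _ _ 0])
    then have "(\<rho> ^^ (i mod m)) z = z" using that funpow_mod_eq[OF m(2), of i] by simp
    then have "i mod m = 0"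
      using Least_le[of "\<lambda>m. m > 0 \<and> (\<rho> ^^ m) z = z" "i mod m"] m(1) mod_less_divisor[OF m(1), of i]
      unfolding m_def by fastforce
    then show ?thesis by auto
  qed
  then show ?thesis using T.cyclic_ab_tree by blast
qed

end

locale acyclic_component = component f K x0 for f :: "'x \<Rightarrow> 'x" and K x0 +
  assumes acyc: "\<And>x n. x \<in> K \<Longrightarrow> n > 0 \<Longrightarrow> (f ^^ n) x \<noteq> x"
begin

lemma pow_inj: assumes x: "x \<in> K" and e: "(f ^^ i) x = (f ^^ j) x" shows "i = j"
proof -
  have False if "i < j" "(f ^^ i) x = (f ^^ j) x" for i j
  proof -
    have "(f ^^ (j - i)) ((f ^^ i) x) = (f ^^ j) x" using that(1) by (simp add: funpow_plus)
    then have "(f ^^ (j - i)) ((f ^^ i) x) = (f ^^ i) x" unfolding that(2) .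
    then show False using acyc[of "(f ^^ i) x" "j - i"] x pow_K that(1) by simp
  qed
  then show ?thesis using e by (metis linorder_neqE_nat)
qed

text \<open>The signed distance of \<open>x\<close> from \<open>w\<close> along \<open>f\<close>,
  positive after \<open>w\<close>: both points are followed to a common iterate. Without cycles the
  result is unique. An automorphism shifts all levels by the same integer, its translation
  length.\<close>

definition "level w x = (THE l. \<exists>a b. (f ^^ a) x = (f ^^ b) w \<and> l = int b - int a)"

lemma level_eqI: assumes w: "w \<in> K" and ab: "(f ^^ a) x = (f ^^ b) w" shows "level w x = int b - int a"
  unfolding level_def
proof (rule the_equality)
  show "\<exists>a' b'. (f ^^ a') x = (f ^^ b') w \<and> int b - int a = int b' - int a'" using ab by blast
  fix l assume "\<exists>a b. (f ^^ a) x = (f ^^ b) w \<and> l = int b - int a"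
  then obtain c d where cd: "(f ^^ c) x = (f ^^ d) w" "l = int d - int c" by blast
  have "(f ^^ (c + b)) w = (f ^^ c) ((f ^^ a) x)" unfolding ab by (simp add: funpow_plus)
  also have "\<dots> = (f ^^ a) ((f ^^ c) x)" by (simp add: funpow_plus add.commute)
  also have "\<dots> = (f ^^ (a + d)) w" unfolding cd(1) by (simp add: funpow_plus)
  finally have "c + b = a + d" by (rule pow_inj[OF w])
  then show "l = int b - int a" using cd(2) by simp
qed

lemma level_ex: assumes "w \<in> K" "x \<in> K"
  obtains a b where "(f ^^ a) x = (f ^^ b) w" "level w x = int b - int a"
  using conn_K[OF assms(2,1)] level_eqI[OF assms(1)] unfolding conn_def by blast

lemma level_self: "w \<in> K \<Longrightarrow> level w w = 0"
  using level_eqI[of w 0 w 0] by simp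

lemma level_apply:
  assumes g: "g \<in> aut f K" and w: "w \<in> K" and x: "x \<in> K"
  shows "level w (g x) = level w x + level w (g w)"
proof -
  obtain a b where ab: "(f ^^ a) x = (f ^^ b) w" "level w x = int b - int a" by (rule level_ex[OF w x])
  have "g w \<in> K" using aut_in[OF g] w by simp
  then obtain c d where cd: "(f ^^ c) (g w) = (f ^^ d) w" "level w (g w) = int d - int c" by (rule level_ex[OF w])
  have "(f ^^ (c + a)) (g x) = (f ^^ c) (g ((f ^^ a) x))" by (simp add: aut_comm_funpow[OF g] funpow_plus)
  also have "\<dots> = (f ^^ b) ((f ^^ c) (g w))" unfolding ab(1) by (simp add: aut_comm_funpow[OF g] funpow_plus add.commute)
  also have "\<dots> = (f ^^ (b + d)) w" unfolding cd(1) by (simp add: funpow_plus)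
  finally show ?thesis using level_eqI[OF w, of "c + a" "g x" "b + d"] ab cd by simp
qed

lemma level_inv: assumes g: "g \<in> aut f K" and w: "w \<in> K" shows "level w (pinv g w) = - level w (g w)"
  using level_apply[OF g w, of "pinv g w"] aut_in[OF aut_inv[OF g], of w] w level_self[OF w]
  by (simp add: aut_inv_r[OF g])

text \<open>The abelianization is infinite cyclic, given by the translation length divided by the
  least positive one; no signs survive. An element of length 0 fixes some vertex \<open>w\<close>
  far enough along \<open>f\<close>. It splits into a part supported on the subtree below
  \<open>w\<close> and a part trivial there, and powers of \<open>\<rho>\<close> move these away,
  backwards for the first and forwards for the second, as the swindle requires.\<close>

lemma cyclic_ab_translation:
  assumes "\<sigma> \<in> aut f K" "y' \<in> K" "r > 0" "\<sigma> y' = (f ^^ r) y'"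
  shows "\<exists>I n. cyclic_ab f K 2 (I :: (nat \<times> 'x set) set) n"
proof -
  define P where "P r \<longleftrightarrow> r > 0 \<and> (\<exists>\<sigma>\<in>aut f K. \<exists>y\<in>K. \<sigma> y = (f ^^ r) y)" for r
  have "P r" unfolding P_def using assms by blast
  define d where "d = (LEAST r. P r)"
  have d: "P d" unfolding d_def using \<open>P r\<close> by (rule LeastI)
  have dmin: "d \<le> r" if "P r" for r unfolding d_def using that by (rule Least_le)
  obtain \<rho> y where \<rho>: "\<rho> \<in> aut f K" "y \<in> K" "\<rho> y = (f ^^ d) y" and d0: "d > 0" using d unfolding P_def by blast
  define D where "D g = level y (g y)" for g
  have gK: "g x \<in> K \<longleftrightarrow> x \<in> K" if "g \<in> aut f K" for g x by (rule aut_in[OF that])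
  have D_comp: "D (g \<circ> h) = D g + D h" if "g \<in> aut f K" "h \<in> aut f K" for g h
    using level_apply[OF that(1) \<rho>(2), of "h y"] gK[OF that(2)] \<rho>(2) by (simp add: D_def)
  have D\<rho>: "D \<rho> = int d" unfolding D_def using level_eqI[OF \<rho>(2), of 0 "\<rho> y" d] \<rho>(3) by simp
  have D_id: "D id = 0" by (simp add: D_def level_self \<rho>(2))
  have D_pow: "D (\<rho> ^^ i) = int d * int i" for i
  proof (induction i)
    case 0
    show ?case unfolding funpow.simps(1) D_id by simp
  next
    case (Suc i)
    show ?case unfolding funpow.simps(2) D_comp[OF \<rho>(1) aut_pow[OF \<rho>(1)]] Suc D\<rho> by (simp add: algebra_simps)
  qed
  have D_inv: "D (pinv g) = - D g" if "g \<in> aut f K" for g unfolding D_def by (rule level_inv[OF that \<rho>(2)])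
  have all: "\<exists>p\<in>aut f K. D p = int d * j" for j
  proof (cases "j \<ge> 0")
    case True
    then show ?thesis using D_pow[of "nat j"] aut_pow[OF \<rho>(1)] by (intro bexI[of _ "\<rho> ^^ nat j"]) auto
  next
    case False
    then show ?thesis using D_pow[of "nat (- j)"] D_inv[OF aut_pow[OF \<rho>(1), of "nat (- j)"]] aut_inv[OF aut_pow[OF \<rho>(1)]]
      by (intro bexI[of _ "pinv (\<rho> ^^ nat (- j))"]) auto
  qed
  have dvd: "int d dvd D g" if g: "g \<in> aut f K" for g
  proof (rule ccontr)
    assume n: "\<not> int d dvd D g"
    define r where "r = D g mod int d"
    have "r \<noteq> 0" using n unfolding r_def dvd_eq_mod_eq_0 .
    moreover have "0 \<le> r" "r < int d" using d0 by (simp_all add: r_def)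
    ultimately have r: "0 < r" "r < int d" by linarith+
    obtain p where p: "p \<in> aut f K" "D p = int d * (- (D g div int d))" using all by blast
    have gp: "g \<circ> p \<in> aut f K" using g p(1) by (rule aut_comp)
    have "D (g \<circ> p) = r" using D_comp[OF g p(1)] p(2) by (simp add: r_def minus_div_mult_eq_mod[symmetric] algebra_simps)
    moreover have "(g \<circ> p) y \<in> K" using gK[OF gp] \<rho>(2) by blast
    ultimately obtain a b where ab: "(f ^^ a) ((g \<circ> p) y) = (f ^^ b) y" "r = int b - int a"
      using level_ex[OF \<rho>(2)] unfolding D_def by metis
    have "b = nat r + a" using ab(2) r by simp
    then have "(g \<circ> p) ((f ^^ a) y) = (f ^^ nat r) ((f ^^ a) y)"
      using ab(1) aut_comm_funpow[OF gp, of a y] by (simp add: funpow_plus)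
    moreover have "(f ^^ a) y \<in> K" using \<rho>(2) pow_K by simp
    ultimately have "P (nat r)" unfolding P_def
      using r gp by (intro conjI bexI[of _ "g \<circ> p"] bexI[of _ "(f ^^ a) y"]) simp_all
    then have "d \<le> nat r" by (rule dmin)
    then show False using r by simp
  qed
  have kernel: "g \<in> comm_prods (aut f K) 2" if g: "g \<in> aut f K" and Dg: "D g = 0" for g
  proof -
    have "g y \<in> K" using gK[OF g] \<rho>(2) by simp
    then obtain a b where ab: "(f ^^ a) (g y) = (f ^^ b) y" "0 = int b - int a"
      using level_ex[OF \<rho>(2)] Dg unfolding D_def by metis
    then have ga: "g ((f ^^ a) y) = (f ^^ a) y" by (simp add: aut_comm_funpow[OF g])
    define w where "w = (f ^^ a) y"
    have w: "w \<in> K" "g w = w" "\<rho> w = (f ^^ d) w"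
      using \<rho> ga pow_K aut_comm_funpow[OF \<rho>(1), of a y] by (simp_all add: w_def funpow_plus add.commute)
    have \<rho>w: "(\<rho> ^^ i) w = (f ^^ (d * i)) w" for i
    proof (induction i)
      case (Suc i)
      then show ?case by (simp add: aut_comm_funpow[OF \<rho>(1)] w(3) funpow_plus add.commute)
    qed simp
    define T where "T = {x. \<exists>i. (f ^^ i) x = w}"
    have TK: "T \<subseteq> K" using w(1) pow_K by (auto simp: T_def)
    have gT: "g x \<in> T \<longleftrightarrow> x \<in> T" for x
    proof -
      have "(f ^^ i) (g x) = w \<longleftrightarrow> (f ^^ i) x = w" for i
        using aut_eq[OF g, of "(f ^^ i) x" w] w(2) aut_comm_funpow[OF g, of i x] by simp
      then show ?thesis by (simp add: T_def)
    qed
    have wT: "w \<in> T" unfolding T_def by (intro CollectI exI[of _ 0]) simp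
    define g1 where "g1 = (\<lambda>x. if x \<in> T then g x else x)"
    have "g1 \<in> aut f T" unfolding g1_def
    proof (rule glue_restrict[OF aut_UNIV[OF g] gT])
      fix x assume x: "x \<in> T" "f x \<notin> T"
      then obtain i where i: "(f ^^ i) x = w" by (auto simp: T_def)
      have "i = 0"
      proof (cases i)
        case (Suc j)
        then have "(f ^^ j) (f x) = w" using i funpow_swap1[of f j x] by simp
        then show ?thesis using x(2) by (auto simp: T_def)
      qed
      then have "x = w" using i by simp
      then show "g (f x) = f x" using w(2) aut_comm[OF g, of x] by simp
    next
      fix x assume x: "x \<notin> T"
      show "f x \<notin> T"
      proof
        assume "f x \<in> T"
        then obtain i where "(f ^^ i) (f x) = w" by (auto simp: T_def)
        then have "(f ^^ Suc i) x = w" by (simp add: funpow_swap1)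
        then show False using x unfolding T_def by blast
      qed
    qed
    then have g1K: "g1 \<in> aut f K" using TK by (rule aut_mono')
    define g2 where "g2 = pinv g1 \<circ> g"
    have g2K: "g2 \<in> aut f K" unfolding g2_def by (intro aut_comp aut_inv g1K g)
    have g12: "g = g1 \<circ> g2" unfolding g2_def using g1K by (simp add: comp_assoc[symmetric])
    have g1T: "g1 x = g x" if "x \<in> T" for x using that by (simp add: g1_def)
    have g1n: "g1 x = x" if "x \<notin> T" for x using that by (simp add: g1_def)
    have g2T: "g2 x = x" if "x \<in> T" for x unfolding g2_def using g1T[OF that, symmetric] g1K by simp
    have w2: "g2 w = w" by (rule g2T[OF wT])
    have w1: "g1 w = w" using g1T[OF wT] w(2) by simp
    have level_T: "level w x \<le> 0" if xT: "x \<in> T" for x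
    proof -
      obtain i where "(f ^^ i) x = w" using xT by (auto simp: T_def)
      then show ?thesis using level_eqI[OF w(1), of i x 0] by simp
    qed
    have pow_lev: "level w ((s ^^ i) x) = level w x + int i * level w (s w)" if s: "s \<in> aut f K" and x: "x \<in> K" for s i x
    proof (induction i)
      case (Suc i)
      have "(s ^^ i) x \<in> K" using gK[OF aut_pow[OF s]] x by simp
      then show ?case using level_apply[OF s w(1)] Suc by (simp add: algebra_simps)
    qed simp
    \<comment> \<open>The conjugate of \<open>g1\<close> with exponent \<open>i\<close> lives at
      levels not above \<open>- i * d\<close>, hence not above \<open>- i\<close>. So at
      \<open>x\<close> only exponents up to minus the level can act, and \<open>N\<close> is one
      more.\<close>
    have c1: "g1 \<in> comm_prods (aut f K) 1"
    proof (rule swindle[OF g1K aut_inv[OF \<rho>(1)], of "\<lambda>x. if x \<in> K then nat (- level w x) + 1 else 0"])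
      fix i z
      have l\<rho>: "level w (pinv \<rho> w) = - int d"
        using level_inv[OF \<rho>(1) w(1)] level_eqI[OF w(1), of 0 "\<rho> w" d] w(3) by simp
      have pK: "(pinv \<rho> ^^ i) x \<in> K \<longleftrightarrow> x \<in> K" for x by (rule gK[OF aut_pow[OF aut_inv[OF \<rho>(1)]]])
      have lz: "level w (g1 z) = level w z" if "z \<in> K" using level_apply[OF g1K w(1) that] w1 level_self[OF w(1)] by simp
      show "(if (pinv \<rho> ^^ i) (g1 z) \<in> K then nat (- level w ((pinv \<rho> ^^ i) (g1 z))) + 1 else 0) =
          (if (pinv \<rho> ^^ i) z \<in> K then nat (- level w ((pinv \<rho> ^^ i) z)) + 1 else 0)"
        using pow_lev[OF aut_inv[OF \<rho>(1)], of _ i] lz gK[OF g1K] by (cases "z \<in> K") (simp_all add: pK)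
      assume le: "(if (pinv \<rho> ^^ i) z \<in> K then nat (- level w ((pinv \<rho> ^^ i) z)) + 1 else 0) \<le> i"
      show "g1 z = z"
      proof (cases "z \<in> K")
        case True
        have "nat (- (level w z - int i * int d)) + 1 \<le> i"
          using le pow_lev[OF aut_inv[OF \<rho>(1)] True, of i] True by (simp add: pK l\<rho>)
        then have "int i * int d - level w z < int i" by linarith
        moreover have "int i \<le> int i * int d" using d0 by (simp add: mult_le_cancel_left1)
        ultimately have "level w z > 0" by linarith
        then show ?thesis using level_T[of z] by (intro g1n) auto
      qed (rule aut_out[OF g1K])
    qed
    \<comment> \<open>The first \<open>j\<close> for which \<open>x\<close> lies below
      \<open>(\<rho> ^^ j) w\<close>. On the subtree of this vertex the conjugates of
      \<open>g2\<close> with exponents from \<open>j\<close> on are trivial.\<close>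
    define N where "N x = (LEAST j. \<exists>l. (f ^^ l) x = (\<rho> ^^ j) w)" for x
    have up: "\<exists>l. (f ^^ l) x = (\<rho> ^^ j') w" if ex: "\<exists>l. (f ^^ l) x = (\<rho> ^^ j) w" and le: "j \<le> j'" for x j j'
    proof -
      obtain l where l: "(f ^^ l) x = (\<rho> ^^ j) w" using ex by blast
      have "d * j' = d * (j' - j) + d * j" using le by (simp add: diff_mult_distrib2)
      then have "(\<rho> ^^ j') w = (f ^^ (d * (j' - j))) ((f ^^ l) x)" unfolding l \<rho>w by (simp add: funpow_plus)
      then show ?thesis unfolding funpow_plus by metis
    qed
    have reach: "\<exists>j l. (f ^^ l) x = (\<rho> ^^ j) w" if x: "x \<in> K" for x
    proof -
      obtain a b where ab: "(f ^^ a) x = (f ^^ b) w" using conn_K[OF x w(1)] unfolding conn_def by blast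
      have "b \<le> d * b" using d0 by simp
      then have "(f ^^ (d * b - b)) ((f ^^ a) x) = (\<rho> ^^ b) w" unfolding ab \<rho>w by (simp add: funpow_plus)
      then show ?thesis unfolding funpow_plus by blast
    qed
    have c2: "g2 \<in> comm_prods (aut f K) 1"
    proof (rule swindle[OF g2K \<rho>(1), of N])
      fix i z
      have mem: "(\<exists>l. (f ^^ l) ((\<rho> ^^ i) x) = (\<rho> ^^ i) w) \<longleftrightarrow> x \<in> T" for x
        unfolding T_def mem_Collect_eq
        using aut_eq[OF aut_pow[OF \<rho>(1), of i]] aut_comm_funpow[OF aut_pow[OF \<rho>(1), of i]] by metis
      have "(\<exists>l. (f ^^ l) ((\<rho> ^^ i) (g2 z)) = (\<rho> ^^ j) w) \<longleftrightarrow> (\<exists>l. (f ^^ l) ((\<rho> ^^ i) z) = (\<rho> ^^ j) w)" for j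
      proof (cases "i \<le> j")
        case True
        have fixw: "g2 ((\<rho> ^^ (j - i)) w) = (\<rho> ^^ (j - i)) w"
          unfolding \<rho>w using aut_comm_funpow[OF g2K, of "d * (j - i)" w] w2 by simp
        have "(f ^^ l) ((\<rho> ^^ i) x) = (\<rho> ^^ j) w \<longleftrightarrow> (f ^^ l) x = (\<rho> ^^ (j - i)) w" for l x
        proof -
          have "(\<rho> ^^ j) w = (\<rho> ^^ i) ((\<rho> ^^ (j - i)) w)" using True by (simp add: funpow_plus)
          moreover have "(f ^^ l) ((\<rho> ^^ i) x) = (\<rho> ^^ i) ((f ^^ l) x)"
            by (simp add: aut_comm_funpow[OF aut_pow[OF \<rho>(1)]])
          ultimately show ?thesis using aut_eq[OF aut_pow[OF \<rho>(1), of i]] by simp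
        qed
        moreover have "(f ^^ l) (g2 z) = (\<rho> ^^ (j - i)) w \<longleftrightarrow> (f ^^ l) z = (\<rho> ^^ (j - i)) w" for l
          using aut_eq[OF g2K, of "(f ^^ l) z" "(\<rho> ^^ (j - i)) w"] fixw aut_comm_funpow[OF g2K, of l z] by simp
        ultimately show ?thesis by simp
      next
        case False
        have g2T': "g2 z \<in> T \<longleftrightarrow> z \<in> T"
        proof
          assume "g2 z \<in> T"
          then have "g2 (g2 z) = g2 z" by (rule g2T)
          then have "g2 z = z" using aut_eq[OF g2K] by simp
          then show "z \<in> T" using \<open>g2 z \<in> T\<close> by simp
        qed (simp add: g2T)
        have "x \<in> T" if "\<exists>l. (f ^^ l) ((\<rho> ^^ i) x) = (\<rho> ^^ j) w" for x
          using up[OF that, of i] False mem by simp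
        then show ?thesis using g2T' g2T by metis
      qed
      then show "N ((\<rho> ^^ i) (g2 z)) = N ((\<rho> ^^ i) z)" by (simp add: N_def)
      assume le: "N ((\<rho> ^^ i) z) \<le> i"
      show "g2 z = z"
      proof (cases "z \<in> K")
        case True
        then have "(\<rho> ^^ i) z \<in> K" using gK[OF aut_pow[OF \<rho>(1)]] by simp
        from LeastI_ex[OF reach[OF this]] have "\<exists>l. (f ^^ l) ((\<rho> ^^ i) z) = (\<rho> ^^ N ((\<rho> ^^ i) z)) w"
          unfolding N_def .
        from up[OF this le] show ?thesis using mem g2T by blast
      qed (rule aut_out[OF g2K])
    qed
    show ?thesis using comm_prods_add[OF c1 c2] unfolding g12 by (simp add: numeral_2_eq_2)
  qed
  define \<Phi> :: "('x \<Rightarrow> 'x) \<Rightarrow> nat \<times> 'x set \<Rightarrow> int" where "\<Phi> g i = D g div int d" for g i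
  \<comment> \<open>Modulus 0 stands for the infinite cyclic group.\<close>
  have "cyclic_ab f K 2 {(0 :: nat, {} :: 'x set)} (\<lambda>_. 0)" unfolding cyclic_ab_def
  proof (intro exI[of _ \<Phi>] conjI ballI allI impI)
    fix g h assume "g \<in> aut f K" "h \<in> aut f K"
    then show "int 0 dvd \<Phi> (g \<circ> h) i - (\<Phi> g i + \<Phi> h i)" for i
      using dvd[of g] by (simp add: \<Phi>_def D_comp div_plus_div_distrib_dvd_left)
  next
    fix t :: "nat \<times> 'x set \<Rightarrow> int"
    obtain p where "p \<in> aut f K" "D p = int d * t (0, {})" using all by blast
    then show "\<exists>g\<in>aut f K. \<forall>i\<in>{(0, {})}. int 0 dvd \<Phi> g i - t i"
      using d0 by (intro bexI[of _ p]) (auto simp: \<Phi>_def)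
  next
    fix g assume g: "g \<in> aut f K" and z: "\<forall>i\<in>{(0 :: nat, {} :: 'x set)}. int 0 dvd \<Phi> g i"
    then have "D g div int d = 0" by (simp add: \<Phi>_def)
    then have "D g = 0" using dvd[OF g] d0 by auto
    then show "g \<in> comm_prods (aut f K) 2" by (rule kernel[OF g])
  qed
  then show ?thesis by blast
qed

end

section \<open>Abelianizations of exponent two\<close>

definition aut_group :: "('x \<Rightarrow> 'x) \<Rightarrow> 'x set \<Rightarrow> ('x \<Rightarrow> 'x) monoid"
  where "aut_group f Y = \<lparr>carrier = aut f Y, monoid.mult = (\<circ>), one = id\<rparr>"

lemma aut_group_simps [simp]: "carrier (aut_group f Y) = aut f Y" "monoid.mult (aut_group f Y) = (\<circ>)" "one (aut_group f Y) = id"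
  by (simp_all add: aut_group_def)

lemma group_aut_group: "group (aut_group f Y)"
proof (rule groupI)
  fix g assume "g \<in> carrier (aut_group f Y)"
  then show "\<exists>h\<in>carrier (aut_group f Y). h \<otimes>\<^bsub>aut_group f Y\<^esub> g = \<one>\<^bsub>aut_group f Y\<^esub>"
    by (intro bexI[of _ "pinv g"]) (auto intro: aut_inv)
qed (auto simp: comp_assoc intro: aut_comp)

lemma inv_aut_group: "g \<in> aut f Y \<Longrightarrow> inv\<^bsub>aut_group f Y\<^esub> g = pinv g"
  by (rule group.inv_equality[OF group_aut_group]) (auto intro: aut_inv)

lemma pinv_commutator:
  assumes a: "a \<in> aut f Y" and b: "b \<in> aut f Y" shows "pinv (commutator a b) = commutator b a"
proof -
  have c: "commutator a b \<in> aut f Y" by (intro aut_comp aut_inv a b)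
  have "commutator b a (commutator a b x) = x" for x
    using a b by (simp add: aut_inv_r[OF a] aut_inv_r[OF b])
  then have "commutator b a x = pinv (commutator a b) x" for x
    by (metis aut_inv_r[OF c])
  then show ?thesis by auto
qed

lemma comm_prods_Union: "g \<in> comm_prods H n \<Longrightarrow> g \<in> (\<Union>N. comm_prods H N)"
  by blast

text \<open>The inverse of a commutator is a commutator, so the generated subgroup consists of plain
  products.\<close>

lemma derived_aut_group: "derived (aut_group f Y) (aut f Y) = (\<Union>N. comm_prods (aut f Y) N)"
proof (intro equalityI subsetI)
  have com: "commutator a b \<in> comm_prods (aut f Y) 1" if "a \<in> aut f Y" "b \<in> aut f Y" for a b
    using that by (rule comm_prods_1I)
  have dsE: "\<exists>a\<in>aut f Y. \<exists>b\<in>aut f Y. g = commutator a b" if "g \<in> derived_set (aut_group f Y) (aut f Y)" for g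
    using that by (auto simp: inv_aut_group)
  fix g assume "g \<in> derived (aut_group f Y) (aut f Y)"
  then have "g \<in> generate (aut_group f Y) (derived_set (aut_group f Y) (aut f Y))" by (simp add: derived_def)
  then show "g \<in> (\<Union>N. comm_prods (aut f Y) N)"
  proof induction
    case one
    have "id \<in> comm_prods (aut f Y) 0" by simp
    then show ?case unfolding aut_group_simps by blast
  next
    case (incl h)
    from dsE[OF incl] obtain a b where ab: "a \<in> aut f Y" "b \<in> aut f Y" "h = commutator a b" by (elim bexE)
    show ?case unfolding ab(3) by (rule comm_prods_Union[OF com[OF ab(1,2)]])
  next
    case (inv h)
    from dsE[OF inv] obtain a b where ab: "a \<in> aut f Y" "b \<in> aut f Y" "h = commutator a b" by (elim bexE)
    have "commutator a b \<in> aut f Y" by (intro aut_comp aut_inv ab)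
    then have "inv\<^bsub>aut_group f Y\<^esub> h = commutator b a" unfolding ab(3) pinv_commutator[OF ab(1,2), symmetric] by (rule inv_aut_group)
    show ?case unfolding \<open>inv\<^bsub>aut_group f Y\<^esub> h = commutator b a\<close> by (rule comm_prods_Union[OF com[OF ab(2,1)]])
  next
    case (eng h1 h2)
    then obtain M N where "h1 \<in> comm_prods (aut f Y) M" "h2 \<in> comm_prods (aut f Y) N" by blast
    then show ?case unfolding aut_group_simps by (intro comm_prods_Union[OF comm_prods_add])
  qed
next
  fix g assume "g \<in> (\<Union>N. comm_prods (aut f Y) N)"
  then obtain N where "g \<in> comm_prods (aut f Y) N" by blast
  then show "g \<in> derived (aut_group f Y) (aut f Y)"
  proof (induction N arbitrary: g)
    case 0
    then have g: "g = \<one>\<^bsub>aut_group f Y\<^esub>" by simp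
    show ?case unfolding g derived_def by (rule generate.one)
  next
    case (Suc N)
    then obtain a b u where u: "g = commutator a b \<circ> u" "a \<in> aut f Y" "b \<in> aut f Y" "u \<in> comm_prods (aut f Y) N" by auto
    have "commutator a b = a \<otimes>\<^bsub>aut_group f Y\<^esub> b \<otimes>\<^bsub>aut_group f Y\<^esub> inv\<^bsub>aut_group f Y\<^esub> a \<otimes>\<^bsub>aut_group f Y\<^esub> inv\<^bsub>aut_group f Y\<^esub> b"
      by (simp only: aut_group_simps inv_aut_group[OF u(2)] inv_aut_group[OF u(3)])
    then have "commutator a b \<in> derived_set (aut_group f Y) (aut f Y)" using u(2,3) by blast
    then have c: "commutator a b \<in> derived (aut_group f Y) (aut f Y)" unfolding derived_def by (rule generate.incl)
    have "commutator a b \<otimes>\<^bsub>aut_group f Y\<^esub> u \<in> derived (aut_group f Y) (aut f Y)"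
      using c Suc.IH[OF u(4)] unfolding derived_def by (rule generate.eng)
    then show ?case unfolding u(1) aut_group_simps .
  qed
qed

text \<open>\<open>B\<close> is a basis over the field with two elements, obtained as a maximal
  independent set. A linear combination is a finite subset of \<open>B\<close>, evaluated by
  \<open>finprod\<close>, and its addition is symmetric difference because repeated elements
  cancel.\<close>

lemma (in comm_group) exponent_2_basis:
  assumes two: "\<And>x. x \<in> carrier G \<Longrightarrow> x \<otimes> x = \<one>"
  shows "\<exists>(B :: 'a set) s. bij_betw s (Fpow B) (carrier G) \<and> (\<forall>E\<in>Fpow B. \<forall>F\<in>Fpow B. s (sym_diff E F) = s E \<otimes> s F)"
proof -
  define s where "s F = finprod G id F" for F
  have s_in: "s F \<in> carrier G" if "F \<subseteq> carrier G" for F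
    unfolding s_def using that by (intro finprod_closed) auto
  have s_Un: "s (E \<union> F) = s E \<otimes> s F" if "finite E" "finite F" "E \<subseteq> carrier G" "F \<subseteq> carrier G" "E \<inter> F = {}" for E F
    unfolding s_def using that by (intro finprod_Un_disjoint) auto
  have s_diff: "s (sym_diff E F) = s E \<otimes> s F"
    if fin: "finite E" "finite F" and sub: "E \<subseteq> carrier G" "F \<subseteq> carrier G" for E F
  proof -
    let ?a = "s (E - F)" and ?b = "s (F - E)" and ?c = "s (E \<inter> F)"
    have c: "?a \<in> carrier G" "?b \<in> carrier G" "?c \<in> carrier G" using sub by (auto intro!: s_in)
    have 1: "s (sym_diff E F) = ?a \<otimes> ?b" using fin sub by (intro s_Un) auto
    have "s E = s ((E - F) \<union> (E \<inter> F))" "s F = s ((F - E) \<union> (E \<inter> F))" by (auto intro: arg_cong[of _ _ s])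
    then have 2: "s E = ?a \<otimes> ?c" "s F = ?b \<otimes> ?c" using s_Un[of "E - F" "E \<inter> F"] s_Un[of "F - E" "E \<inter> F"] fin sub by auto
    have "s E \<otimes> s F = (?a \<otimes> ?b) \<otimes> (?c \<otimes> ?c)" unfolding 2 using c by (simp add: m_ac)
    then show ?thesis using 1 two[OF c(3)] c by simp
  qed
  define \<A> where "\<A> = {B. B \<subseteq> carrier G \<and> (\<forall>F\<in>Fpow B. s F = \<one> \<longrightarrow> F = {})}"
  have "\<exists>M\<in>\<A>. \<forall>X\<in>\<A>. M \<subseteq> X \<longrightarrow> X = M"
  proof (rule subset_Zorn_nonempty)
    have "{} \<in> \<A>" by (auto simp: \<A>_def Fpow_def)
    then show "\<A> \<noteq> {}" by blast
    fix C assume C: "C \<noteq> {}" "subset.chain \<A> C"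
    have "F = {}" if F: "F \<in> Fpow (\<Union>C)" "s F = \<one>" for F
    proof -
      have fin: "finite F" "F \<subseteq> \<Union>C" using F(1) by (auto simp: Fpow_def)
      obtain X where X: "X \<in> C" "F \<subseteq> X"
        using finite_subset_Union_chain[OF fin C] by blast
      have "X \<in> \<A>" using X(1) C(2) by (auto simp: subset.chain_def)
      then show ?thesis using F(2) X(2) fin(1) by (auto simp: \<A>_def Fpow_def)
    qed
    moreover have "\<Union>C \<subseteq> carrier G" using C(2) by (auto simp: subset.chain_def \<A>_def)
    ultimately show "\<Union>C \<in> \<A>" by (simp add: \<A>_def)
  qed
  then obtain B where B: "B \<in> \<A>" "\<And>X. X \<in> \<A> \<Longrightarrow> B \<subseteq> X \<Longrightarrow> X = B" by auto
  have BG: "B \<subseteq> carrier G" and ind: "\<And>F. F \<in> Fpow B \<Longrightarrow> s F = \<one> \<Longrightarrow> F = {}" using B(1) by (auto simp: \<A>_def)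
  have FB: "finite F" "F \<subseteq> carrier G" if "F \<in> Fpow B" for F using that BG by (auto simp: Fpow_def)
  have "inj_on s (Fpow B)"
  proof (rule inj_onI)
    fix E F assume EF: "E \<in> Fpow B" "F \<in> Fpow B" "s E = s F"
    have "s (sym_diff E F) = \<one>" using s_diff[OF FB(1)[OF EF(1)] FB(1)[OF EF(2)] FB(2)[OF EF(1)] FB(2)[OF EF(2)]]
        EF(3) two s_in[OF FB(2)[OF EF(2)]] by simp
    moreover have "sym_diff E F \<in> Fpow B" using EF by (auto simp: Fpow_def)
    ultimately have "sym_diff E F = {}" using ind by blast
    then show "E = F" by blast
  qed
  moreover have "s ` Fpow B = carrier G"
  proof (intro equalityI subsetI)
    fix x assume x: "x \<in> carrier G"
    show "x \<in> s ` Fpow B"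
    proof (rule ccontr)
      assume n: "x \<notin> s ` Fpow B"
      have "F = {}" if F: "F \<in> Fpow (insert x B)" "s F = \<one>" for F
      proof (cases "x \<in> F")
        case False
        then have "F \<in> Fpow B" using F(1) by (auto simp: Fpow_def)
        then show ?thesis using ind F(2) by blast
      next
        case True
        let ?E = "F - {x}"
        have E: "?E \<in> Fpow B" using F(1) by (auto simp: Fpow_def)
        have "s F = s ({x} \<union> ?E)" using True by (auto intro: arg_cong[of _ _ s])
        also have "\<dots> = s {x} \<otimes> s ?E" using FB[OF E] x by (intro s_Un) auto
        also have "s {x} = x" using x by (simp add: s_def)
        finally have "x \<otimes> s ?E = \<one>" using F(2) by simp
        then have "x \<otimes> s ?E \<otimes> s ?E = s ?E" using s_in[OF FB(2)[OF E]] by simp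
        then have "x = s ?E" using x s_in[OF FB(2)[OF E]] two by (simp add: m_assoc)
        then show ?thesis using n E by blast
      qed
      then have "insert x B \<in> \<A>" using x BG by (simp add: \<A>_def)
      then have "x \<in> B" using B(2)[of "insert x B"] by auto
      moreover have "s {x} = x" using x by (simp add: s_def)
      moreover have "{x} \<in> Fpow B" using \<open>x \<in> B\<close> by (simp add: Fpow_def)
      ultimately show False using n image_eqI[of x s "{x}" "Fpow B"] by simp
    qed
  qed (use s_in FB(2) in auto)
  ultimately have "bij_betw s (Fpow B) (carrier G)" by (simp add: bij_betw_def)
  moreover have "\<forall>E\<in>Fpow B. \<forall>F\<in>Fpow B. s (sym_diff E F) = s E \<otimes> s F" using s_diff FB by simp
  ultimately show ?thesis by (intro exI[of _ B] exI[of _ s] conjI)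
qed

lemma comm_group_Pow: "comm_group \<lparr>carrier = Pow J, monoid.mult = (\<lambda>A B. sym_diff A B), one = {}\<rparr>"
proof (rule comm_groupI)
  fix A assume "A \<in> carrier \<lparr>carrier = Pow J, monoid.mult = (\<lambda>A B. sym_diff A B), one = {}\<rparr>"
  then show "\<exists>B\<in>carrier \<lparr>carrier = Pow J, monoid.mult = (\<lambda>A B. sym_diff A B), one = {}\<rparr>.
      B \<otimes>\<^bsub>\<lparr>carrier = Pow J, monoid.mult = (\<lambda>A B. sym_diff A B), one = {}\<rparr>\<^esub> A = \<one>\<^bsub>\<lparr>carrier = Pow J, monoid.mult = (\<lambda>A B. sym_diff A B), one = {}\<rparr>\<^esub>"
    by (intro bexI[of _ A]) auto
qed auto

lemma finite_Fpow: "finite B \<Longrightarrow> finite (Fpow B)"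
  by (rule finite_subset[OF Fpow_subset_Pow]) simp

text \<open>Bases are chosen on both sides. For infinite \<open>B\<close> the set
  \<open>Fpow B\<close> has the cardinality of \<open>B\<close>; so equipotent groups have
  equipotent bases, and a bijection between the bases induces the isomorphism.\<close>

lemma exponent_2_iso_Pow:
  fixes G :: "('g, 'm) monoid_scheme" and J :: "'j set"
  assumes G: "comm_group G" and two: "\<And>x. x \<in> carrier G \<Longrightarrow> x \<otimes>\<^bsub>G\<^esub> x = \<one>\<^bsub>G\<^esub>"
    and inf: "infinite J" and card: "carrier G \<approx> Pow J"
  shows "\<exists>\<psi>. bij_betw \<psi> (carrier G) (Pow J) \<and>
    (\<forall>x\<in>carrier G. \<forall>y\<in>carrier G. \<psi> (x \<otimes>\<^bsub>G\<^esub> y) = sym_diff (\<psi> x) (\<psi> y))"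
proof -
  interpret G: comm_group G by (rule G)
  let ?P = "\<lparr>carrier = Pow J, monoid.mult = (\<lambda>A B. sym_diff A B), one = {}\<rparr>"
  interpret P: comm_group ?P by (rule comm_group_Pow)
  obtain B :: "'g set" and s where s: "bij_betw s (Fpow B) (carrier G)"
      "\<And>E F. E \<in> Fpow B \<Longrightarrow> F \<in> Fpow B \<Longrightarrow> s (sym_diff E F) = s E \<otimes>\<^bsub>G\<^esub> s F"
    using G.exponent_2_basis[OF two] by auto
  have "\<exists>(C :: 'j set set) t. bij_betw t (Fpow C) (Pow J) \<and> (\<forall>E\<in>Fpow C. \<forall>F\<in>Fpow C. t (sym_diff E F) = sym_diff (t E) (t F))"
    using P.exponent_2_basis by simp
  then obtain C :: "'j set set" and t where t0: "bij_betw t (Fpow C) (Pow J)"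
      "\<forall>E\<in>Fpow C. \<forall>F\<in>Fpow C. t (sym_diff E F) = sym_diff (t E) (t F)" by blast
  have t: "bij_betw t (Fpow C) (Pow J)"
      "\<And>E F. E \<in> Fpow C \<Longrightarrow> F \<in> Fpow C \<Longrightarrow> t (sym_diff E F) = sym_diff (t E) (t F)" for E F
    using t0 by simp_all
  have infP: "infinite (Pow J)" using inf by simp
  have "Fpow B \<approx> carrier G" using s(1) unfolding eqpoll_def by blast
  then have "Fpow B \<approx> Pow J" using card by (rule eqpoll_trans)
  moreover have tP: "Fpow C \<approx> Pow J" using t(1) unfolding eqpoll_def by blast
  ultimately have BC: "Fpow B \<approx> Fpow C" by (rule eqpoll_trans[OF _ eqpoll_sym])
  have "infinite (Fpow C)" "infinite (Fpow B)" using eqpoll_finite_iff[OF tP] eqpoll_finite_iff[OF BC] infP by auto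
  then have "infinite B" "infinite C" using finite_Fpow by blast+
  then have "B \<approx> Fpow C" "Fpow C \<approx> C"
    using eqpoll_trans[OF eqpoll_sym[OF eqpoll_Fpow] BC] eqpoll_Fpow by simp_all
  then have "B \<approx> C" by (rule eqpoll_trans)
  then obtain \<beta> where \<beta>: "bij_betw \<beta> B C" unfolding eqpoll_def by blast
  have \<beta>F: "bij_betw ((`) \<beta>) (Fpow B) (Fpow C)"
  proof (rule bij_betwI[where g = "(`) (inv_into B \<beta>)"])
    show "(`) \<beta> \<in> Fpow B \<rightarrow> Fpow C" using \<beta> by (auto simp: Fpow_def bij_betw_def)
    show "(`) (inv_into B \<beta>) \<in> Fpow C \<rightarrow> Fpow B" using bij_betw_inv_into[OF \<beta>] by (auto simp: Fpow_def bij_betw_def)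
    show "inv_into B \<beta> ` \<beta> ` F = F" if "F \<in> Fpow B" for F
    proof -
      have "inv_into B \<beta> (\<beta> x) = x" if "x \<in> F" for x
        using bij_betw_inv_into_left[OF \<beta>] \<open>F \<in> Fpow B\<close> that by (auto simp: Fpow_def)
      then show ?thesis by (auto simp: image_iff)
    qed
    show "\<beta> ` inv_into B \<beta> ` F = F" if "F \<in> Fpow C" for F
    proof -
      have "\<beta> (inv_into B \<beta> x) = x" if "x \<in> F" for x
        using bij_betw_inv_into_right[OF \<beta>] \<open>F \<in> Fpow C\<close> that by (auto simp: Fpow_def)
      then show ?thesis by (auto simp: image_iff)
    qed
  qed
  have \<beta>d: "\<beta> ` (sym_diff E F) = sym_diff (\<beta> ` E) (\<beta> ` F)" if "E \<in> Fpow B" "F \<in> Fpow B" for E F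
  proof -
    have "inj_on \<beta> (E \<union> F)" using \<beta> that by (auto simp: Fpow_def bij_betw_def intro: inj_on_subset)
    then show ?thesis unfolding inj_on_def by blast
  qed
  define \<psi> where "\<psi> = t \<circ> ((`) \<beta>) \<circ> inv_into (Fpow B) s"
  have "bij_betw \<psi> (carrier G) (Pow J)" unfolding \<psi>_def
    by (rule bij_betw_trans[OF bij_betw_inv_into[OF s(1)] bij_betw_trans[OF \<beta>F t(1)], unfolded comp_assoc[symmetric]])
  moreover have "\<psi> (x \<otimes>\<^bsub>G\<^esub> y) = sym_diff (\<psi> x) (\<psi> y)" if xy: "x \<in> carrier G" "y \<in> carrier G" for x y
  proof -
    obtain E F where EF: "E \<in> Fpow B" "x = s E" "F \<in> Fpow B" "y = s F"
      using xy s(1) unfolding bij_betw_def by (metis imageE)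
    have d: "sym_diff E F \<in> Fpow B" using EF by (auto simp: Fpow_def)
    have inv: "inv_into (Fpow B) s (s D) = D" if "D \<in> Fpow B" for D
      using bij_betw_inv_into_left[OF s(1) that] .
    have "\<psi> (x \<otimes>\<^bsub>G\<^esub> y) = t (\<beta> ` (sym_diff E F))"
      unfolding EF(2,4) s(2)[OF EF(1,3), symmetric] \<psi>_def by (simp only: comp_apply inv[OF d])
    also have "\<dots> = sym_diff (t (\<beta> ` E)) (t (\<beta> ` F))"
      unfolding \<beta>d[OF EF(1,3)] by (rule t(2)) (use bij_betw_apply[OF \<beta>F] EF in auto)
    also have "t (\<beta> ` E) = \<psi> x" unfolding EF(2) \<psi>_def by (simp only: comp_apply inv[OF EF(1)])
    also have "t (\<beta> ` F) = \<psi> y" unfolding EF(4) \<psi>_def by (simp only: comp_apply inv[OF EF(3)])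
    finally show ?thesis .
  qed
  ultimately show ?thesis by blast
qed

section \<open>Families of automorphisms on disjoint pieces\<close>

locale disjoint_pieces =
  fixes f :: "'x \<Rightarrow> 'x" and B :: "'x \<Rightarrow> 'c option"
  assumes B_f: "\<And>x. B (f x) = None \<or> B (f x) = B x"
begin

definition "piece c = {x. B x = Some c}"
definition "D = {x. B x \<noteq> None}"
definition "glued u x = (case B x of None \<Rightarrow> x | Some c \<Rightarrow> u c x)"

lemma glued_Some: "B x = Some c \<Longrightarrow> glued u x = u c x" and glued_None: "B x = None \<Longrightarrow> glued u x = x"
  by (simp_all add: glued_def)

lemma B_piece: assumes "u \<in> aut f (piece c)" shows "B (u x) = B x"
proof (cases "B x = Some c")
  case True
  then have "u x \<in> piece c" using aut_in[OF assms] by (simp add: piece_def)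
  then show ?thesis using True by (simp add: piece_def)
next
  case False
  then show ?thesis using aut_out[OF assms, of x] by (simp add: piece_def)
qed

lemma glued_aut: assumes u: "\<And>c. u c \<in> aut f (piece c)" shows "glued u \<in> aut f D"
proof -
  define k where "k b = (case b of None \<Rightarrow> id | Some c \<Rightarrow> u c)" for b
  have Bk: "B (k b x) = B x" for b x using B_piece[OF u] by (cases b) (simp_all add: k_def)
  have "(\<lambda>x. k (B x) x) \<in> aut f D"
  proof (rule glue_aut[where s = "\<lambda>b. b" and B = B and k = k])
    show "k (B x) \<in> aut f UNIV" for x using aut_UNIV[OF u] by (cases "B x") (simp_all add: k_def)
    show "k (B x) (f x) = k (B (f x)) (f x)" for x
    proof (cases "B (f x) = B x")
      case False
      then have "B (f x) = None" using B_f by blast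
      then show ?thesis using aut_out[OF u, of "f x"] by (cases "B x") (simp_all add: k_def piece_def)
    qed simp
    show "B (k (B y) x) = B y \<longleftrightarrow> B x = B y" for x y by (simp only: Bk)
    show "\<exists>x. B x = B y" for y by blast
    show "x \<notin> D \<Longrightarrow> k (B x) x = x" for x by (simp add: k_def D_def)
  qed simp
  moreover have "glued u = (\<lambda>x. k (B x) x)" by (auto simp: glued_def k_def fun_eq_iff split: option.splits)
  ultimately show ?thesis by simp
qed

lemma glued_comp: assumes v: "\<And>c. v c \<in> aut f (piece c)" shows "glued u \<circ> glued v = glued (\<lambda>c. u c \<circ> v c)"
proof
  fix x show "(glued u \<circ> glued v) x = glued (\<lambda>c. u c \<circ> v c) x"
  proof (cases "B x")
    case (Some c)
    then show ?thesis using B_piece[OF v, of c x] by (simp add: glued_Some)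
  qed (simp add: glued_None)
qed

lemma glued_inv: assumes u: "\<And>c. u c \<in> aut f (piece c)" shows "pinv (glued u) = glued (\<lambda>c. pinv (u c))"
proof -
  have "glued u \<circ> glued (\<lambda>c. pinv (u c)) = glued (\<lambda>c. u c \<circ> pinv (u c))" by (rule glued_comp) (rule aut_inv[OF u])
  also have "\<dots> = id" by (auto simp: glued_def fun_eq_iff aut_inv_r[OF u] split: option.splits)
  finally have "glued u (glued (\<lambda>c. pinv (u c)) x) = x" for x by (metis comp_apply id_apply)
  then show ?thesis using aut_inv_l[OF glued_aut[OF u]] by (metis ext)
qed

text \<open>Commutators of glued families are formed piecewise, so the first factors of all pieces
  make up one commutator, and likewise the second ones up to the \<open>N\<close>-th.\<close>

lemma glued_comm_prods:
  assumes "\<And>c. u c \<in> comm_prods (aut f (piece c)) N" shows "glued u \<in> comm_prods (aut f D) N"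
  using assms
proof (induction N arbitrary: u)
  case 0
  then have "glued u = id" by (auto simp: glued_def fun_eq_iff split: option.splits)
  then show ?case by (simp only: comm_prods.simps singleton_iff)
next
  case (Suc N)
  have "\<forall>c. \<exists>t. fst t \<in> aut f (piece c) \<and> fst (snd t) \<in> aut f (piece c) \<and> snd (snd t) \<in> comm_prods (aut f (piece c)) N \<and>
      u c = commutator (fst t) (fst (snd t)) \<circ> snd (snd t)"
  proof
    fix c
    obtain a b w where "u c = commutator a b \<circ> w" "a \<in> aut f (piece c)" "b \<in> aut f (piece c)" "w \<in> comm_prods (aut f (piece c)) N"
      using Suc.prems[of c] by auto
    then show "\<exists>t. fst t \<in> aut f (piece c) \<and> fst (snd t) \<in> aut f (piece c) \<and> snd (snd t) \<in> comm_prods (aut f (piece c)) N \<and>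
      u c = commutator (fst t) (fst (snd t)) \<circ> snd (snd t)" by (intro exI[of _ "(a, b, w)"]) simp
  qed
  from choice[OF this] obtain t where t: "\<And>c. fst (t c) \<in> aut f (piece c)" "\<And>c. fst (snd (t c)) \<in> aut f (piece c)"
      "\<And>c. snd (snd (t c)) \<in> comm_prods (aut f (piece c)) N" "\<And>c. u c = commutator (fst (t c)) (fst (snd (t c))) \<circ> snd (snd (t c))"
    by blast
  define a b w where "a = (\<lambda>c. fst (t c))" and "b = (\<lambda>c. fst (snd (t c)))" and "w = (\<lambda>c. snd (snd (t c)))"
  have a: "a c \<in> aut f (piece c)" and b: "b c \<in> aut f (piece c)" and w: "w c \<in> comm_prods (aut f (piece c)) N"
    and u: "u c = commutator (a c) (b c) \<circ> w c" for c
    using t by (simp_all only: a_def b_def w_def)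
  have wa: "w c \<in> aut f (piece c)" for c using w by (rule comm_prods_aut)
  have "glued u = glued (\<lambda>c. a c \<circ> b c \<circ> pinv (a c) \<circ> pinv (b c) \<circ> w c)" using u by (intro arg_cong[of _ _ glued] ext) metis
  also have "\<dots> = commutator (glued a) (glued b) \<circ> glued w"
    by (simp only: glued_comp[symmetric] glued_inv a b wa aut_inv)
  finally have e: "glued u = commutator (glued a) (glued b) \<circ> glued w" .
  show ?case unfolding e by (rule comm_prods_SucI[OF glued_aut[OF a] glued_aut[OF b] Suc.IH[OF w]])
qed

lemma glued_rs: assumes "\<And>x. B x = None \<Longrightarrow> g x = x" shows "glued (\<lambda>c. restr g (piece c)) = g"
  using assms by (auto simp: glued_def restr_def piece_def fun_eq_iff split: option.splits)

lemma restr_piece: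
  assumes g: "g \<in> aut f UNIV" and Bg: "\<And>x. B (g x) = B x"
    and b: "\<And>x. B x = Some c \<Longrightarrow> B (f x) = None \<Longrightarrow> g (f x) = f x"
  shows "restr g (piece c) \<in> aut f (piece c)"
proof -
  have "(\<lambda>x. if x \<in> piece c then g x else x) \<in> aut f (piece c)"
  proof (rule glue_restrict[OF g])
    show "g x \<in> piece c \<longleftrightarrow> x \<in> piece c" for x by (simp add: piece_def Bg)
    show "g (f x) = f x" if "x \<in> piece c" "f x \<notin> piece c" for x using that b B_f[of x] by (auto simp: piece_def)
    show "f x \<notin> piece c" if "x \<notin> piece c" for x using that B_f[of x] by (auto simp: piece_def)
  qed
  then show ?thesis by (simp add: restr_def[abs_def])
qed

end

text \<open>The orbit of \<open>y0\<close> is divided according to the image of \<open>p\<close>.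
  Each part is a translate of a subset of the part where \<open>p\<close> is fixed, and there are
  finitely many parts.\<close>

lemma finite_orbit_over:
  assumes p: "p = (f ^^ i) y0" and fin: "finite {g p | g. g \<in> aut f Y}" "finite {g y0 | g. g \<in> aut f Y \<and> g p = p}"
  shows "finite {g y0 | g. g \<in> aut f Y}"
proof -
  have sub: "{g y0 | g. g \<in> aut f Y} \<subseteq> (\<Union>q\<in>{g p | g. g \<in> aut f Y}. {g y0 | g. g \<in> aut f Y \<and> g p = q})" by blast
  have fib: "finite {g y0 | g. g \<in> aut f Y \<and> g p = q}" if q: "q \<in> {g p | g. g \<in> aut f Y}" for q
  proof -
    obtain k where k: "k \<in> aut f Y" "q = k p" using q by blast
    have "{g y0 | g. g \<in> aut f Y \<and> g p = q} \<subseteq> k ` {g y0 | g. g \<in> aut f Y \<and> g p = p}"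
    proof
      fix z assume "z \<in> {g y0 | g. g \<in> aut f Y \<and> g p = q}"
      then obtain g where g: "g \<in> aut f Y" "g p = q" "z = g y0" by blast
      have "(pinv k \<circ> g) p = p" using g k by simp
      moreover have "pinv k \<circ> g \<in> aut f Y" by (intro aut_comp aut_inv g k)
      ultimately have "(pinv k \<circ> g) y0 \<in> {g y0 | g. g \<in> aut f Y \<and> g p = p}" by blast
      moreover have "z = k ((pinv k \<circ> g) y0)" using g(3) by (simp add: aut_inv_r[OF k(1)])
      ultimately show "z \<in> k ` {g y0 | g. g \<in> aut f Y \<and> g p = p}" by blast
    qed
    then show ?thesis using fin(2) finite_subset by blast
  qed
  show ?thesis by (rule finite_subset[OF sub finite_UN_I[OF fin(1) fib]])
qed

section \<open>Components that are exhausted by stabilizers along a ray\<close>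

definition rooted :: "('x \<Rightarrow> 'x) \<Rightarrow> 'x set \<Rightarrow> bool"
  where "rooted f Z \<longleftrightarrow> (\<forall>x. x \<notin> Z \<longrightarrow> f x \<notin> Z) \<and> (\<forall>x. \<exists>n. (f ^^ n) x \<notin> Z)"

lemma rooted_tree: assumes "rooted f Z" shows "tree f Z (- Z) id 1"
proof
  show "\<exists>i. \<forall>x\<in>- Z. g x = (id ^^ i) x" if "g \<in> aut f Z" for g
    using aut_out[OF that] by (intro exI[of _ 0]) auto
  show "x \<in> - Z \<Longrightarrow> f x \<in> - Z" for x using assms by (simp add: rooted_def)
  show "\<exists>n. (f ^^ n) x \<in> - Z" for x using assms by (simp add: rooted_def)
qed simp_all

text \<open>The notions of \<open>tree\<close> for \<open>\<rho> = id\<close>, with the set as an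
  explicit argument, since signs on many rooted sets have to be compared.\<close>

definition rooted_orb :: "('x \<Rightarrow> 'x) \<Rightarrow> 'x set \<Rightarrow> 'x \<Rightarrow> 'x set"
  where "rooted_orb f Z x = {g x | g. g \<in> aut f Z}"

definition rooted_branching :: "('x \<Rightarrow> 'x) \<Rightarrow> 'x set \<Rightarrow> 'x set set"
  where "rooted_branching f Z = {rooted_orb f Z x | x. x \<in> Z \<and> finite (rooted_orb f Z x) \<and> (\<exists>y\<in>rooted_orb f Z x. y \<noteq> x \<and> f y = f x)}"

definition rooted_parity :: "('x \<Rightarrow> 'x) \<Rightarrow> 'x set \<Rightarrow> ('x \<Rightarrow> 'x) \<Rightarrow> 'x set set"
  where "rooted_parity f Z g = {S \<in> rooted_branching f Z. \<not> evenperm (restr g S)}"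

context
  fixes f :: "'x \<Rightarrow> 'x" and Z :: "'x set"
  assumes rooted: "rooted f Z"
begin

interpretation T: tree f Z "- Z" id 1 by (rule rooted_tree[OF rooted])

lemma rooted_branching_tree: "rooted_branching f Z = T.branching"
  unfolding rooted_branching_def T.branching_def rooted_orb_def T.orb_def by simp

lemma rooted_parity_tree: "rooted_parity f Z g = T.parity g"
  unfolding rooted_parity_def T.parity_def rooted_branching_tree ..

lemma rooted_parity_surj: "E \<subseteq> rooted_branching f Z \<Longrightarrow> \<exists>g\<in>aut f Z. rooted_parity f Z g = E"
  unfolding rooted_branching_tree rooted_parity_tree using T.parity_surj by simp

lemma rooted_parity_kernel: "g \<in> aut f Z \<Longrightarrow> rooted_parity f Z g = {} \<Longrightarrow> g \<in> comm_prods (aut f Z) 3"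
  unfolding rooted_parity_tree using T.parity_kernel by simp

lemma rooted_parity_comp: "g \<in> aut f Z \<Longrightarrow> h \<in> aut f Z \<Longrightarrow> S \<in> rooted_parity f Z (g \<circ> h) \<longleftrightarrow> (S \<in> rooted_parity f Z g) \<noteq> (S \<in> rooted_parity f Z h)"
  unfolding rooted_parity_tree by (rule T.parity_comp)

end

lemma rooted_parity_sub: "rooted_parity f Z g \<subseteq> rooted_branching f Z"
  by (auto simp: rooted_parity_def)

text \<open>A sign is a homomorphism to a group of order two and so kills commutators.\<close>

lemma parity_comm_prods:
  assumes comp: "\<And>g h. g \<in> aut f Y \<Longrightarrow> h \<in> aut f Y \<Longrightarrow> P (g \<circ> h) \<longleftrightarrow> P g \<noteq> P h" and g: "g \<in> comm_prods (aut f Y) N"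
  shows "\<not> P g"
proof -
  have id: "\<not> P id" using comp[of id id] by simp
  have inv: "P (pinv a) \<longleftrightarrow> P a" if "a \<in> aut f Y" for a
    using comp[OF that aut_inv[OF that]] that id by simp
  show ?thesis using g
  proof (induction N arbitrary: g)
    case 0
    then have g: "g = id" by simp
    show ?case unfolding g by (rule id)
  next
    case (Suc N)
    then obtain a b u where u: "g = commutator a b \<circ> u" "a \<in> aut f Y" "b \<in> aut f Y" "u \<in> comm_prods (aut f Y) N" by auto
    note m = u(2,3) aut_inv[OF u(2)] aut_inv[OF u(3)] comm_prods_aut[OF u(4)]
    have "P g \<longleftrightarrow> ((((P a \<noteq> P b) \<noteq> P (pinv a)) \<noteq> P (pinv b)) \<noteq> P u)"
      unfolding u(1) using m by (simp only: comp aut_comp)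
    then show ?case using inv u(2,3) Suc.IH[OF u(4)] by auto
  qed
qed

text \<open>The case without cycles and translations. By \<open>ev\<close>, every automorphism is
  the identity far enough along any forward path, so the group is the increasing union of the
  stabilizers of the vertices on the ray from \<open>x0\<close>.\<close>

locale ray = acyclic_component f K x0 for f :: "'x \<Rightarrow> 'x" and K x0 +
  assumes ev: "\<And>g x. g \<in> aut f K \<Longrightarrow> x \<in> K \<Longrightarrow> \<exists>a. (f ^^ a) (g x) = (f ^^ a) x"
begin

abbreviation "H \<equiv> aut f K"

definition "X n = (f ^^ n) x0"
definition "T n = {x. \<exists>i. (f ^^ i) x = X n}"
text \<open>Whatever fixes \<open>X n\<close> fixes all later vertices of the ray. With this whole
  tail removed from \<open>K\<close>, the stabilizer of \<open>X n\<close> becomes the group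
  \<open>aut f (Zn n)\<close> of a rooted set.\<close>

definition "Zn n = K - X ` {n..}"
abbreviation "A n \<equiv> aut f (Zn n)"

lemma X_K: "X n \<in> K" by (simp add: X_def pow_K x0)
lemma f_X: "f (X n) = X (Suc n)" by (simp add: X_def)
lemma pow_X: "(f ^^ i) (X n) = X (n + i)" by (simp add: X_def funpow_plus add.commute)
lemma X_inj: "X n = X m \<longleftrightarrow> n = m" using pow_inj[OF x0] by (auto simp: X_def)

lemma T_K: "T n \<subseteq> K" using X_K pow_K unfolding T_def by (auto, metis)

lemma T_I: "(f ^^ i) x = X n \<Longrightarrow> x \<in> T n" by (auto simp: T_def)

lemma T_mono: assumes "n \<le> m" shows "T n \<subseteq> T m"
proof
  fix x assume "x \<in> T n"
  then obtain i where "(f ^^ i) x = X n" by (auto simp: T_def)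
  then have "(f ^^ (m - n)) ((f ^^ i) x) = X m" using pow_X[of "m - n" n] assms by simp
  then have "(f ^^ (m - n + i)) x = X m" unfolding funpow_plus .
  then show "x \<in> T m" by (rule T_I)
qed

lemma T_ex: assumes "x \<in> K" shows "\<exists>n. x \<in> T n"
proof -
  obtain a b where "(f ^^ a) x = (f ^^ b) x0" using conn_K[OF assms x0] unfolding conn_def by blast
  then have "(f ^^ a) x = X b" by (simp add: X_def)
  then show ?thesis using T_I by blast
qed

lemma T_f: assumes "x \<in> T n" "x \<noteq> X n" shows "f x \<in> T n"
proof -
  obtain i where i: "(f ^^ i) x = X n" using assms(1) by (auto simp: T_def)
  show ?thesis
  proof (cases i)
    case 0 then show ?thesis using i assms(2) by simp
  next
    case (Suc j)
    then have "(f ^^ j) (f x) = X n" using i funpow_swap1[of f j x] by simp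
    then show ?thesis by (rule T_I)
  qed
qed

lemma T_f': assumes "f x \<in> T n" shows "x \<in> T n"
proof -
  obtain i where "(f ^^ i) (f x) = X n" using assms by (auto simp: T_def)
  then have "(f ^^ Suc i) x = X n" using funpow_swap1[of f i x] by simp
  then show ?thesis by (rule T_I)
qed

lemma X_T: "X m \<in> T n \<longleftrightarrow> m \<le> n"
proof
  assume "X m \<in> T n"
  then obtain i where "X (m + i) = X n" by (auto simp: T_def pow_X)
  then show "m \<le> n" by (simp add: X_inj)
next
  assume "m \<le> n"
  then have "(f ^^ (n - m)) (X m) = X n" by (simp add: pow_X)
  then show "X m \<in> T n" by (rule T_I)
qed

lemma A_iff: "g \<in> A n \<longleftrightarrow> g \<in> H \<and> g (X n) = X n"
proof
  assume g: "g \<in> A n"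
  have "g \<in> H" using g by (rule aut_mono') (auto simp: Zn_def)
  moreover have "g (X n) = X n" by (rule aut_out[OF g]) (auto simp: Zn_def)
  ultimately show "g \<in> H \<and> g (X n) = X n" ..
next
  assume g: "g \<in> H \<and> g (X n) = X n"
  have gX: "g (X k) = X k" if "n \<le> k" for k
  proof -
    have "g ((f ^^ (k - n)) (X n)) = (f ^^ (k - n)) (X n)" using g aut_comm_funpow by metis
    then show ?thesis using that by (simp add: pow_X)
  qed
  have gZ: "g x = x" if x: "x \<notin> Zn n" for x
  proof (cases "x \<in> K")
    case True
    then obtain k where k: "n \<le> k" "x = X k" using x by (auto simp: Zn_def)
    show ?thesis unfolding k(2) by (rule gX[OF k(1)])
  next
    case False
    then show ?thesis using aut_out[of g f K x] g by blast
  qed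
  show "g \<in> A n" by (rule aut_restrict[OF conjunct1[OF g] gZ])
qed

lemma A_H: "A n \<subseteq> H" using A_iff by blast

lemma A_mono: assumes "n \<le> m" shows "A n \<subseteq> A m"
  by (rule aut_mono) (use assms in \<open>auto simp: Zn_def\<close>)

lemma A_fix: assumes "g \<in> A n" "n \<le> k" shows "g (X k) = X k"
  using A_mono[OF assms(2)] assms(1) A_iff by blast

lemma A_ex: assumes "g \<in> H" shows "\<exists>n. g \<in> A n"
proof -
  obtain a where a: "(f ^^ a) (g x0) = (f ^^ a) x0" using ev[OF assms x0] by blast
  have "g (X a) = X a" unfolding X_def using a by (simp add: aut_comm_funpow[OF assms])
  then show ?thesis using A_iff assms by blast
qed

lemma A_T: assumes g: "g \<in> A n" and k: "n \<le> k" shows "g x \<in> T k \<longleftrightarrow> x \<in> T k"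
proof -
  have "(f ^^ i) (g x) = X k \<longleftrightarrow> (f ^^ i) x = X k" for i
    using aut_eq[OF g, of "(f ^^ i) x" "X k"] A_fix[OF g k] by (simp add: aut_comm_funpow[OF g])
  then show ?thesis by (simp add: T_def)
qed

text \<open>\<open>V n\<close> is the tree strictly below \<open>X n\<close>, and \<open>U k\<close>
  consists of the branches at \<open>X (Suc k)\<close> other than that of \<open>X k\<close>. Apart
  from the tail of the ray, \<open>K\<close> is the disjoint union of \<open>V n\<close> and all
  \<open>U k\<close> with \<open>n \<le> k\<close>; the stabilizer of \<open>X n\<close> is the
  direct product of the groups of these pieces.\<close>

definition "V n = T n - {X n}"
definition "U k = T (Suc k) - T k - {X (Suc k)}"

lemma rooted_V: "rooted f (V n)"
  unfolding rooted_def
proof (intro conjI allI impI)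
  fix x assume x: "x \<notin> V n"
  show "f x \<notin> V n"
  proof
    assume "f x \<in> V n"
    then have "f x \<in> T n" "f x \<noteq> X n" by (auto simp: V_def)
    then have "x = X n" using T_f'[of x n] x by (auto simp: V_def)
    then show False using \<open>f x \<in> T n\<close> X_T[of "Suc n" n] by (simp add: f_X)
  qed
next
  fix x show "\<exists>i. (f ^^ i) x \<notin> V n"
  proof (cases "x \<in> V n")
    case True
    then obtain i where "(f ^^ i) x = X n" by (auto simp: V_def T_def)
    then show ?thesis by (intro exI[of _ i]) (simp add: V_def)
  qed (auto intro: exI[of _ 0])
qed

lemma U_D: "x \<in> U k \<Longrightarrow> f x \<in> U k \<or> f x = X (Suc k)"
  using T_f[of x "Suc k"] T_f'[of x k] by (auto simp: U_def)

lemma U_f: assumes "f x \<in> U k" shows "x \<in> U k"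
proof -
  have fx: "f x \<in> T (Suc k)" "f x \<notin> T k" "f x \<noteq> X (Suc k)" using assms by (auto simp: U_def)
  have "x \<in> T (Suc k)" using fx(1) by (rule T_f')
  moreover have "x \<noteq> X (Suc k)" using fx(1) X_T[of "Suc (Suc k)" "Suc k"] by (auto simp: f_X)
  moreover have "x \<notin> T k"
  proof
    assume "x \<in> T k"
    then have "x = X k" using T_f[of x k] fx(2) by blast
    then show False using fx(3) by (simp add: f_X)
  qed
  ultimately show ?thesis by (simp add: U_def)
qed

lemma rooted_U: "rooted f (U k)"
  unfolding rooted_def
proof (intro conjI allI impI)
  show "x \<notin> U k \<Longrightarrow> f x \<notin> U k" for x using U_f by blast
  fix x show "\<exists>i. (f ^^ i) x \<notin> U k"
  proof (cases "x \<in> U k")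
    case True
    then obtain i where "(f ^^ i) x = X (Suc k)" by (auto simp: U_def T_def)
    then show ?thesis by (intro exI[of _ i]) (simp add: U_def)
  qed (auto intro: exI[of _ 0])
qed

lemma Zn_f: "x \<notin> Zn n \<Longrightarrow> f x \<notin> Zn n"
  unfolding Zn_def using f_K[of x] f_X by (auto intro!: image_eqI[of _ X "Suc _"])

lemma rooted_Zn: "rooted f (Zn n)"
  unfolding rooted_def
proof (intro conjI allI impI)
  show "x \<notin> Zn n \<Longrightarrow> f x \<notin> Zn n" for x by (rule Zn_f)
  fix x show "\<exists>i. (f ^^ i) x \<notin> Zn n"
  proof (cases "x \<in> K")
    case True
    then obtain m where "x \<in> T m" using T_ex by blast
    then have "x \<in> T (max m n)" using T_mono[of m "max m n"] by auto
    then obtain i where "(f ^^ i) x = X (max m n)" by (auto simp: T_def)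
    then show ?thesis by (intro exI[of _ i]) (simp add: Zn_def)
  qed (auto simp: Zn_def intro: exI[of _ 0])
qed

lemma comm_prods_A: assumes "g \<in> comm_prods H N" shows "\<exists>n. g \<in> comm_prods (A n) N"
  using assms
proof (induction N arbitrary: g)
  case 0 then show ?case by (simp only: comm_prods.simps) simp
next
  case (Suc N)
  then obtain a b u where u: "g = commutator a b \<circ> u" "a \<in> H" "b \<in> H" "u \<in> comm_prods H N" by auto
  obtain i where i: "a \<in> A i" using A_ex[OF u(2)] by blast
  obtain j where j: "b \<in> A j" using A_ex[OF u(3)] by blast
  obtain k where k: "u \<in> comm_prods (A k) N" using Suc.IH[OF u(4)] by blast
  let ?n = "max i (max j k)"
  have le: "i \<le> ?n" "j \<le> ?n" "k \<le> ?n" by auto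
  have "a \<in> A ?n" "b \<in> A ?n" using A_mono[OF le(1)] A_mono[OF le(2)] i j by blast+
  moreover have "u \<in> comm_prods (A ?n) N" using comm_prods_mono[OF A_mono[OF le(3)], of N] k by blast
  ultimately show ?case unfolding u(1) using comm_prods_SucI by blast
qed

text \<open>The finitely many factors lie in one common stabilizer. All signs for this stabilizer
  vanish on the product, so three commutators suffice. Hence the bound 3 describes the whole derived
  subgroup.\<close>

lemma comm_prods_3: assumes "g \<in> comm_prods H N" shows "g \<in> comm_prods H 3"
proof -
  obtain n where n: "g \<in> comm_prods (A n) N" using comm_prods_A[OF assms] by blast
  have "S \<notin> rooted_parity f (Zn n) g" for S
    by (rule parity_comm_prods[OF _ n]) (rule rooted_parity_comp[OF rooted_Zn])
  then have "g \<in> comm_prods (A n) 3" using rooted_parity_kernel[OF rooted_Zn comm_prods_aut[OF n]] by blast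
  then show ?thesis using comm_prods_mono[OF A_H] by blast
qed

lemma square_comm_prods: assumes "g \<in> H" shows "g \<circ> g \<in> comm_prods H 3"
proof -
  obtain n where n: "g \<in> A n" using A_ex[OF assms] by blast
  have "rooted_parity f (Zn n) (g \<circ> g) = {}" using rooted_parity_comp[OF rooted_Zn n n] by blast
  then have "g \<circ> g \<in> comm_prods (A n) 3" using rooted_parity_kernel[OF rooted_Zn aut_comp[OF n n]] by blast
  then show ?thesis using comm_prods_mono[OF A_H] by blast
qed

section \<open>Pieces of a stabilizer and their signs\<close>

definition "t x = (LEAST k. x \<in> T k)"

lemma t_le: assumes "x \<in> K" shows "t x \<le> k \<longleftrightarrow> x \<in> T k"
proof
  assume "t x \<le> k"
  moreover have "x \<in> T (t x)" unfolding t_def by (rule LeastI_ex[OF T_ex[OF assms]])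
  ultimately show "x \<in> T k" using T_mono by blast
qed (auto simp: t_def intro: Least_le)

text \<open>The label of \<open>U k\<close> is \<open>Suc k\<close> for every \<open>n\<close>, so
  that signs belonging to different stabilizers can be compared; labels from 1 to \<open>n\<close>
  remain empty.\<close>

definition "Bn n x = (if x \<notin> Zn n then None else if t x \<le> n then Some 0 else Some (t x))"
definition "P n c = (if c = 0 then V n else if c \<le> n then {} else U (c - 1))"

lemma Zn_T: "x \<in> Zn n \<and> x \<in> T n \<longleftrightarrow> x \<in> V n"
  using T_K X_T by (auto simp: Zn_def V_def)

lemma Bn_0: "Bn n x = Some 0 \<longleftrightarrow> x \<in> V n"
  using Zn_T[of x n] t_le[of x n] by (auto simp: Bn_def Zn_def)

lemma Bn_Suc: assumes k: "n \<le> k" shows "Bn n x = Some (Suc k) \<longleftrightarrow> x \<in> U k"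
proof
  assume B: "Bn n x = Some (Suc k)"
  then have x: "x \<in> Zn n" "t x = Suc k" by (auto simp: Bn_def split: if_splits)
  then have "x \<in> K" "x \<noteq> X (Suc k)" using k by (auto simp: Zn_def)
  then show "x \<in> U k" using t_le[of x k] t_le[of x "Suc k"] x(2) by (simp add: U_def)
next
  assume x: "x \<in> U k"
  then have xK: "x \<in> K" using T_K by (auto simp: U_def)
  have "t x = Suc k" using t_le[OF xK, of k] t_le[OF xK, of "Suc k"] x by (auto simp: U_def)
  moreover have "x \<noteq> X j" if "n \<le> j" for j
    using x X_T[of j "Suc k"] X_T[of j k] by (auto simp: U_def le_Suc_eq)
  ultimately show "Bn n x = Some (Suc k)" using xK k by (auto simp: Bn_def Zn_def)
qed

lemma piece_cases:
  obtains "c = 0" | "0 < c" "c \<le> n" | k where "c = Suc k" "n \<le> k"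
proof (cases "c \<le> n")
  case False
  then have "c = Suc (c - 1)" "n \<le> c - 1" by auto
  then show ?thesis by (rule that(3))
qed (use that(1,2) in auto)

lemma Bn_P: "Bn n x = Some c \<longleftrightarrow> x \<in> P n c"
proof -
  consider "c = 0" | "0 < c" "c \<le> n" | k where "c = Suc k" "n \<le> k" by (rule piece_cases)
  then show ?thesis
  proof cases
    case 2
    then have "Bn n x \<noteq> Some c" by (auto simp: Bn_def)
    then show ?thesis using 2 by (simp add: P_def)
  qed (simp_all add: Bn_0 Bn_Suc P_def)
qed

lemma Bn_f: "Bn n (f x) = None \<or> Bn n (f x) = Bn n x"
proof (cases "Bn n x")
  case None
  then have "x \<notin> Zn n" by (auto simp: Bn_def split: if_splits)
  then show ?thesis using Zn_f[of x n] by (simp add: Bn_def)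
next
  case (Some c)
  consider "c = 0" | "0 < c" "c \<le> n" | k where "c = Suc k" "n \<le> k" by (rule piece_cases)
  then show ?thesis
  proof cases
    case 1
    then have "x \<in> V n" using Some Bn_0 by simp
    then have "f x \<in> T n" using T_f[of x n] by (auto simp: V_def)
    then show ?thesis using 1 Some Bn_0[of n "f x"] by (auto simp: V_def Bn_def Zn_def)
  next
    case 2 then show ?thesis using Some by (auto simp: Bn_def split: if_splits)
  next
    case 3
    then have "f x \<in> U k \<or> f x = X (Suc k)" using Some Bn_Suc U_D by auto
    then show ?thesis
    proof
      assume "f x = X (Suc k)"
      then have "f x \<notin> Zn n" using 3(2) by (auto simp: Zn_def)
      then show ?thesis by (simp add: Bn_def)
    next
      assume "f x \<in> U k"
      then have "Bn n (f x) = Bn n x" using 3 Some Bn_Suc[OF 3(2), of "f x"] by simp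
      then show ?thesis ..
    qed
  qed
qed

lemma pieces: "disjoint_pieces f (Bn n)"
  by (rule disjoint_pieces.intro) (rule Bn_f)

lemma piece_P: "disjoint_pieces.piece (Bn n) c = P n c"
  using Bn_P by (auto simp: disjoint_pieces.piece_def[OF pieces])

lemma D_Zn: "disjoint_pieces.D (Bn n) = Zn n"
  by (auto simp: disjoint_pieces.D_def[OF pieces] Bn_def)

lemma rooted_P: "rooted f (P n c)"
  using rooted_V rooted_U by (auto simp: P_def rooted_def intro: exI[of _ 0])

lemma Bn_A: assumes g: "g \<in> A n" shows "Bn n (g x) = Bn n x"
proof (cases "x \<in> Zn n")
  case True
  have gH: "g \<in> H" using g A_iff by blast
  have x: "x \<in> K" "g x \<in> K" "g x \<in> Zn n" using True aut_in[OF g, of x] by (auto simp: Zn_def)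
  have "t (g x) \<le> k \<longleftrightarrow> t x \<le> k" if "n \<le> k" for k using t_le[OF x(1)] t_le[OF x(2)] A_T[OF g that] by simp
  from this[of n] this[of "t x"] this[of "t (g x)"]
  have "t (g x) \<le> n \<longleftrightarrow> t x \<le> n" "n < t x \<Longrightarrow> n < t (g x) \<Longrightarrow> t (g x) = t x"
    by auto
  then show ?thesis using x True by (auto simp: Bn_def)
next
  case False then show ?thesis using aut_out[OF g] by simp
qed

lemma restr_P: assumes g: "g \<in> A n" shows "restr g (P n c) \<in> aut f (P n c)"
proof -
  interpret D: disjoint_pieces f "Bn n" by (rule pieces)
  have "g (f x) = f x" if "Bn n (f x) = None" for x
    using that aut_out[OF g, of "f x"] by (auto simp: Bn_def split: if_splits)
  then show ?thesis using D.restr_piece[OF aut_UNIV[OF g] Bn_A[OF g], of c] unfolding piece_P by blast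
qed

definition "pr n c g = rooted_parity f (P n c) (restr g (P n c))"

lemma pr_comp: assumes g: "g \<in> A n" and h: "h \<in> A n"
  shows "S \<in> pr n c (g \<circ> h) \<longleftrightarrow> (S \<in> pr n c g) \<noteq> (S \<in> pr n c h)"
proof -
  have "h x \<in> P n c \<longleftrightarrow> x \<in> P n c" for x using Bn_A[OF h] Bn_P by metis
  then have "restr (g \<circ> h) (P n c) = restr g (P n c) \<circ> restr h (P n c)" by (auto simp: restr_def fun_eq_iff)
  then show ?thesis unfolding pr_def using rooted_parity_comp[OF rooted_P restr_P[OF g] restr_P[OF h]] by simp
qed

lemma pr_sub: "pr n c g \<subseteq> rooted_branching f (P n c)"
  unfolding pr_def by (rule rooted_parity_sub)

lemma pr_Suc: "n \<le> k \<Longrightarrow> m \<le> k \<Longrightarrow> pr n (Suc k) g = pr m (Suc k) g"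
  by (simp add: pr_def P_def)

text \<open>The signs below \<open>X n\<close> are lost in the abelianization, in the strong sense
  of a bounded number of commutators. If they are not, \<open>alive_lepoll\<close> limits how many
  there can be.\<close>

definition "dead n \<longleftrightarrow> aut f (V n) \<subseteq> comm_prods H 2"

text \<open>All pieces with vanishing signs are treated together by three commutators. A dead piece
  \<open>V n\<close> costs two more, and \<open>comm_prods_3\<close> brings the five back to
  three.\<close>

lemma pr_kernel:
  assumes g: "g \<in> A n" and 0: "pr n 0 g = {} \<or> dead n" and S: "\<And>k. n \<le> k \<Longrightarrow> pr n (Suc k) g = {}"
  shows "g \<in> comm_prods H 3"
proof -
  interpret D: disjoint_pieces f "Bn n" by (rule pieces)
  have c: "restr g (P n c) \<in> comm_prods (aut f (P n c)) 3" if "c > 0 \<or> pr n 0 g = {}" for c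
  proof (rule rooted_parity_kernel[OF rooted_P restr_P[OF g]])
    consider "c = 0" | "0 < c" "c \<le> n" | k where "c = Suc k" "n \<le> k" by (rule piece_cases)
    then have "pr n c g = {}"
    proof cases
      case 2
      then have "rooted_branching f (P n c) = {}" by (simp add: P_def rooted_branching_def)
      then show ?thesis using pr_sub by blast
    qed (use that S in auto)
    then show "rooted_parity f (P n c) (restr g (P n c)) = {}" by (simp add: pr_def)
  qed
  have gD: "D.glued (\<lambda>c. restr g (P n c)) = g"
  proof -
    have "g x = x" if "Bn n x = None" for x using that aut_out[OF g, of x] by (auto simp: Bn_def split: if_splits)
    then show ?thesis using D.glued_rs[of g] unfolding piece_P by blast
  qed
  have AH: "comm_prods (A n) k \<subseteq> comm_prods H k" for k by (rule comm_prods_mono[OF A_H])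
  show ?thesis
  proof (cases "pr n 0 g = {}")
    case True
    have "D.glued (\<lambda>c. restr g (P n c)) \<in> comm_prods (A n) 3"
      using D.glued_comm_prods[of "\<lambda>c. restr g (P n c)" 3] c True unfolding piece_P D_Zn by blast
    then show ?thesis unfolding gD using AH by blast
  next
    case False
    then have d: "dead n" using 0 by blast
    define u where "u c = (if c = 0 then id else restr g (P n c))" for c :: nat
    define v where "v c = (if c = 0 then restr g (P n c) else id)" for c :: nat
    have u: "u c \<in> comm_prods (aut f (P n c)) 3" for c
    proof (cases "c = 0")
      case True
      then have "u c = id" by (simp add: u_def)
      show ?thesis unfolding \<open>u c = id\<close> by (rule id_in_comm_prods[OF aut_id])
    next
      case False then show ?thesis using c[of c] by (simp add: u_def)
    qed
    have v: "v c \<in> aut f (P n c)" for c using restr_P[OF g] by (simp add: v_def)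
    have "D.glued u \<in> comm_prods (A n) 3" using D.glued_comm_prods[of u 3] u unfolding piece_P D_Zn by blast
    then have 1: "D.glued u \<in> comm_prods H 3" using AH by blast
    have "D.glued v = restr g (V n)"
    proof
      fix x show "D.glued v x = restr g (V n) x"
      proof (cases "Bn n x")
        case None
        then show ?thesis using Bn_0[of n x] by (simp add: D.glued_None restr_def)
      next
        case (Some c)
        then show ?thesis using Bn_0[of n x] by (simp add: D.glued_Some v_def restr_def P_def)
      qed
    qed
    moreover have "restr g (V n) \<in> aut f (V n)" using restr_P[OF g, of 0] by (simp add: P_def)
    ultimately have 2: "D.glued v \<in> comm_prods H 2" using d by (auto simp: dead_def)
    have "D.glued u \<circ> D.glued v = D.glued (\<lambda>c. u c \<circ> v c)" using D.glued_comp[of v] v unfolding piece_P by blast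
    also have "(\<lambda>c. u c \<circ> v c) = (\<lambda>c. restr g (P n c))" by (auto simp: u_def v_def fun_eq_iff)
    finally have "D.glued u \<circ> D.glued v = g" unfolding gD .
    then have "g \<in> comm_prods H (3 + 2)" using comm_prods_add[OF 1 2] by (simp only:)
    then show ?thesis by (rule comm_prods_3)
  qed
qed

text \<open>Let \<open>J = Suc k\<close> be the first index for which the stabilizer of
  \<open>X J\<close> moves \<open>X n\<close> to infinitely many places. Then \<open>X k\<close> has
  infinitely many images under this stabilizer, all siblings with image \<open>X (Suc k)\<close>.
  The subtrees at these siblings are isomorphic blocks, and one of them contains \<open>V n\<close>;
  so the swindle for blocks applies, with the identity as permutation of the blocks.\<close>

lemma dead_if_infinite:
  assumes inf: "infinite {g (X n) | g. g \<in> A j}"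
  shows "dead n"
proof -
  define Inf where "Inf j \<longleftrightarrow> infinite {g (X n) | g. g \<in> A j}" for j
  define J where "J = (LEAST j. Inf j)"
  have J: "Inf J" unfolding J_def by (rule LeastI[of Inf j]) (simp add: Inf_def inf)
  have nJ: "n < J"
  proof (rule ccontr)
    assume "\<not> n < J"
    then have "{g (X n) | g. g \<in> A J} \<subseteq> {X n}" using A_fix by auto
    then show False using J finite_subset unfolding Inf_def by blast
  qed
  then obtain k where k: "J = Suc k" "n \<le> k" by (cases J) auto
  have "\<not> Inf k" using not_less_Least[of k Inf] k(1) unfolding J_def by simp
  then have fin: "finite {g (X n) | g. g \<in> A k}" by (simp add: Inf_def)
  have infk: "infinite {g (X k) | g. g \<in> A (Suc k)}"
  proof
    assume f: "finite {g (X k) | g. g \<in> A (Suc k)}"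
    have "{g (X n) | g. g \<in> A (Suc k) \<and> g (X k) = X k} \<subseteq> {g (X n) | g. g \<in> A k}"
      using A_iff by blast
    then have "finite {g (X n) | g. g \<in> A (Suc k) \<and> g (X k) = X k}" using fin finite_subset by blast
    moreover have "X k = (f ^^ (k - n)) (X n)" using k(2) by (simp add: pow_X)
    ultimately have "finite {g (X n) | g. g \<in> A (Suc k)}" using finite_orbit_over[OF _ f] by blast
    then show False using J k(1) by (simp add: Inf_def)
  qed
  define W where "W = {g (X k) | g. g \<in> A (Suc k)}"
  have WI: "g (X k) \<in> W" if "g \<in> A (Suc k)" for g using that by (auto simp: W_def)
  have fW: "f z = X (Suc k)" "z \<in> K" if z: "z \<in> W" for z
  proof -
    obtain g where g: "g \<in> A (Suc k)" "z = g (X k)" using z by (auto simp: W_def)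
    have "f z = g (X (Suc k))" unfolding g(2) using aut_comm[OF g(1), of "X k"] by (simp add: f_X)
    then show "f z = X (Suc k)" using A_fix[OF g(1)] by simp
    show "z \<in> K" using f_K[of z] X_K \<open>f z = X (Suc k)\<close> by simp
  qed
  have uniq: "z = z'" if "z \<in> W" "z' \<in> W" "(f ^^ i) x = z" "(f ^^ i') x = z'" for z z' x i i'
  proof -
    have "(f ^^ Suc i) x = X (Suc k)" "(f ^^ Suc i') x = X (Suc k)" using that fW by simp_all
    moreover from this have "x \<in> K" using pow_K[of "Suc i" x] X_K by simp
    ultimately have "Suc i = Suc i'" using pow_inj[of x "Suc i" "Suc i'"] by metis
    then show ?thesis using that by simp
  qed
  define B where "B x = (if \<exists>z\<in>W. \<exists>i. (f ^^ i) x = z then Some (THE z. z \<in> W \<and> (\<exists>i. (f ^^ i) x = z)) else None)" for x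
  have B: "B x = Some z \<longleftrightarrow> z \<in> W \<and> (\<exists>i. (f ^^ i) x = z)" for x z
  proof -
    have the: "(THE z. z \<in> W \<and> (\<exists>i. (f ^^ i) x = z)) = z" if "z \<in> W" "(f ^^ i) x = z" for z i
      by (rule the_equality) (use that uniq in blast)+
    show ?thesis
    proof (cases "\<exists>z\<in>W. \<exists>i. (f ^^ i) x = z")
      case True
      then obtain w i where w: "w \<in> W" "(f ^^ i) x = w" by blast
      then have "B x = Some w" using the[OF w] True by (simp add: B_def)
      have "z \<in> W \<and> (\<exists>i. (f ^^ i) x = z) \<longleftrightarrow> z = w"
      proof
        assume "z \<in> W \<and> (\<exists>i. (f ^^ i) x = z)"
        then obtain j where "z \<in> W" "(f ^^ j) x = z" by blast
        then show "z = w" using uniq[OF _ w(1) _ w(2)] by blast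
      qed (use w in blast)
      then show ?thesis using \<open>B x = Some w\<close> by auto
    next
      case False then show ?thesis by (auto simp: B_def)
    qed
  qed
  have XS: "B (X (Suc k)) = None"
  proof (rule ccontr)
    assume "B (X (Suc k)) \<noteq> None"
    then obtain z i where "z \<in> W" "(f ^^ i) (X (Suc k)) = z" using B by (cases "B (X (Suc k))") auto
    then have "(f ^^ Suc i) (X (Suc k)) = X (Suc k)" using fW by simp
    then show False using acyc[OF X_K, of "Suc i"] by blast
  qed
  interpret I: block_system f B W "W \<times> W"
  proof
    show "B (f x) = None \<or> B (f x) = B x" for x
    proof (cases "B (f x)")
      case (Some z)
      then obtain i where z: "z \<in> W" "(f ^^ i) (f x) = z" using B by blast
      then have "(f ^^ Suc i) x = z" using funpow_swap1[of f i x] by simp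
      then show ?thesis using Some B z by metis
    qed simp
    show "w \<in> W \<longleftrightarrow> (\<exists>x. B x = Some w)" for w
    proof
      assume "w \<in> W"
      moreover have "(f ^^ 0) w = w" by simp
      ultimately show "\<exists>x. B x = Some w" using B by blast
    qed (use B in blast)
    show "equiv W (W \<times> W)" by (auto simp: equiv_def refl_on_def sym_def trans_def)
    show "infinite ((W \<times> W) `` {w})" if "w \<in> W" for w using that infk by (simp add: W_def[symmetric] Image_def)
    show "\<exists>h\<in>aut f UNIV. (\<forall>x. B (h x) = Some w' \<longleftrightarrow> B x = Some w) \<and> (\<forall>x. B x = Some w \<longrightarrow> B (f x) = None \<longrightarrow> h (f x) = f x)"
      if ww: "(w, w') \<in> W \<times> W" for w w'
    proof -
      obtain g g' where g: "g \<in> A (Suc k)" "w = g (X k)" "g' \<in> A (Suc k)" "w' = g' (X k)" using ww by (auto simp: W_def)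
      define h where "h = g' \<circ> pinv g"
      have h: "h \<in> A (Suc k)" unfolding h_def by (intro aut_comp aut_inv g)
      have hw: "h w = w'" unfolding h_def g using g(1) by simp
      have "(f ^^ i) (h x) = w' \<longleftrightarrow> (f ^^ i) x = w" for i x
        unfolding hw[symmetric] aut_comm_funpow[OF h, symmetric] by (rule aut_eq[OF h])
      then have "B (h x) = Some w' \<longleftrightarrow> B x = Some w" for x using ww by (auto simp: B)
      moreover have "h (f x) = f x" if x: "B x = Some w" "B (f x) = None" for x
      proof -
        obtain i where i: "w \<in> W" "(f ^^ i) x = w" using x(1) B by blast
        have "i = 0"
        proof (cases i)
          case (Suc j)
          then have "(f ^^ j) (f x) = w" using i funpow_swap1[of f j x] by simp
          then have "B (f x) = Some w" using i B by blast
          then show ?thesis using x(2) by simp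
        qed
        then have "f x = X (Suc k)" using i fW by simp
        then show ?thesis using A_fix[OF h, of "Suc k"] by simp
      qed
      ultimately show ?thesis using aut_UNIV[OF h] by blast
    qed
  qed
  have XkW: "X k \<in> W" using WI[OF aut_id] by simp
  have VD: "V n \<subseteq> I.D"
  proof
    fix x assume "x \<in> V n"
    then have "x \<in> T k" using T_mono[OF k(2)] by (auto simp: V_def)
    then have "B x = Some (X k)" using B XkW by (auto simp: T_def)
    then show "x \<in> I.D" by (simp add: I.D_def)
  qed
  have DK: "I.D \<subseteq> K" using B fW pow_K by (fastforce simp: I.D_def)
  show ?thesis unfolding dead_def
  proof
    fix a assume a: "a \<in> aut f (V n)"
    have WV: "z \<notin> V n" if "z \<in> W" for z
    proof
      assume "z \<in> V n"
      then obtain i where iz: "(f ^^ i) z = X n" "z \<noteq> X n" by (auto simp: V_def T_def)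
      then have "(f ^^ (k - n)) ((f ^^ i) z) = X k" using pow_X[of "k - n" n] k(2) by simp
      then have "(f ^^ (k - n + i)) z = X k" unfolding funpow_plus .
      moreover have "z = (f ^^ 0) z" by simp
      ultimately have z: "z = X k" using uniq[OF that XkW] by metis
      then have "X (k + i) = X n" using iz(1) by (simp add: pow_X)
      then have "k = n" using k(2) by (simp add: X_inj)
      then show False using z iz(2) by simp
    qed
    have "a \<in> comm_prods (aut f I.D) 2"
    proof (rule I.comm_prods_blocks[where \<gamma> = id])
      show "a \<in> aut f I.D" using a VD by (rule aut_mono')
      show "B (a x) = Some (id w)" if x: "B x = Some w" for x w
      proof -
        obtain i where "w \<in> W" "(f ^^ i) x = w" using x B by blast
        moreover from this have "(f ^^ i) (a x) = w" using aut_comm_funpow[OF a, of i x] aut_out[OF a WV] by simp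
        ultimately show ?thesis using B by auto
      qed
    qed (auto simp: permutes_def)
    then show "a \<in> comm_prods H 2" using comm_prods_mono[OF aut_mono[OF DK]] by blast
  qed
qed

lemma restr_V: assumes g: "g \<in> H" "g (X n) = X n" shows "restr g (V n) \<in> aut f (V n)"
  using restr_P[of g n 0] g A_iff by (simp add: P_def)

text \<open>\<open>s\<close> moves \<open>X k\<close> to a sibling and thereby carries
  \<open>V n\<close> into \<open>U k\<close>; it maps branching orbits to branching orbits, which
  stay finite because the orbits of \<open>X n\<close> are. If two orbits were merged, the
  automorphism joining their images could be pulled back by \<open>s\<close>. The result fixes
  \<open>X n\<close> for reasons of level, so its restriction to \<open>V n\<close> already joins
  the two orbits there.\<close>

lemma alive_lepoll:
  assumes fin: "\<And>j. finite {g (X n) | g. g \<in> A j}" and k: "n \<le> k" and s: "s \<in> A (Suc k)" "s (X k) \<noteq> X k"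
  shows "rooted_branching f (V n) \<lesssim> rooted_branching f (U k)"
proof -
  have sH: "s \<in> H" using s A_iff by blast
  have AU: "aut f (U k) \<subseteq> A (Suc k)"
  proof (rule aut_mono, rule subsetI)
    fix x assume "x \<in> U k"
    then have "Bn k x \<noteq> None" "x \<in> K" "x \<noteq> X j" if "Suc k \<le> j" for j
      using Bn_Suc[of k k x] T_K X_T[of j "Suc k"] that by (auto simp: U_def)
    then show "x \<in> Zn (Suc k)" by (force simp: Zn_def)
  qed
  have sT: "s x \<in> U k" if x: "x \<in> T k" for x
  proof -
    obtain i where i: "(f ^^ i) x = X k" using x by (auto simp: T_def)
    have si: "(f ^^ i) (s x) = s (X k)" using i aut_comm_funpow[OF s(1), of i x] by simp
    have fs: "f (s (X k)) = X (Suc k)" using aut_comm[OF s(1), of "X k"] A_fix[OF s(1), of "Suc k"] by (simp add: f_X)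
    have S: "(f ^^ Suc i) (s x) = X (Suc k)" using si fs by simp
    have sxK: "s x \<in> K" using x T_K aut_in[OF sH] by blast
    have "s x \<in> T (Suc k)" using S by (rule T_I)
    moreover have "s x \<notin> T k"
    proof
      assume "s x \<in> T k"
      then obtain j where j: "(f ^^ j) (s x) = X k" by (auto simp: T_def)
      then have "(f ^^ Suc j) (s x) = X (Suc k)" by (simp add: f_X)
      then have "i = j" using pow_inj[OF sxK, of "Suc i" "Suc j"] S by simp
      then show False using si j s(2) by simp
    qed
    moreover have "s x \<noteq> X (Suc k)"
    proof
      assume "s x = X (Suc k)"
      then have "(f ^^ Suc i) (X (Suc k)) = X (Suc k)" using S by simp
      then show False using acyc[OF X_K, of "Suc i"] by blast
    qed
    ultimately show ?thesis by (simp add: U_def)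
  qed
  have VT: "V n \<subseteq> T k" using T_mono[OF k] by (auto simp: V_def)
  have conj: "s \<circ> a \<circ> pinv s \<in> aut f (U k)" if a: "a \<in> aut f (V n)" for a
  proof (rule aut_restrict[of _ f UNIV])
    show "s \<circ> a \<circ> pinv s \<in> aut f UNIV" using a sH by (intro aut_comp aut_inv) (auto intro: aut_UNIV)
    fix x assume x: "x \<notin> U k"
    have "pinv s x \<notin> V n"
    proof
      assume "pinv s x \<in> V n"
      then have "s (pinv s x) \<in> U k" using sT VT by blast
      then show False using x by (simp add: aut_inv_r[OF s(1)])
    qed
    then show "(s \<circ> a \<circ> pinv s) x = x" using aut_out[OF a] by (simp add: aut_inv_r[OF s(1)])
  qed
  have in_rorb: "s z \<in> rooted_orb f (U k) (s x)" if z: "z \<in> rooted_orb f (V n) x" for x z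
  proof -
    obtain a where a: "a \<in> aut f (V n)" "z = a x" using z by (auto simp: rooted_orb_def)
    have "(s \<circ> a \<circ> pinv s) (s x) = s z" using a(2) s(1) by simp
    then show ?thesis using conj[OF a(1)] unfolding rooted_orb_def by (metis (mono_tags, lifting) mem_Collect_eq)
  qed
  have rooted_orb_self: "x \<in> rooted_orb f Y x" for Y x unfolding rooted_orb_def by (rule CollectI, rule exI[of _ id]) simp
  have rooted_orb_eq: "rooted_orb f Y y = rooted_orb f Y x" if y: "y \<in> rooted_orb f Y x" for Y x y
  proof -
    obtain g where g: "g \<in> aut f Y" "y = g x" using y by (auto simp: rooted_orb_def)
    have "h x \<in> rooted_orb f Y y" if h: "h \<in> aut f Y" for h
    proof -
      have "(h \<circ> pinv g) y = h x" using g by simp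
      then show ?thesis using aut_comp[OF h aut_inv[OF g(1)]] unfolding rooted_orb_def by (metis (mono_tags, lifting) mem_Collect_eq)
    qed
    moreover have "h y \<in> rooted_orb f Y x" if h: "h \<in> aut f Y" for h
      using aut_comp[OF h g(1)] g(2) unfolding rooted_orb_def by (metis (mono_tags, lifting) comp_apply mem_Collect_eq)
    ultimately show ?thesis unfolding rooted_orb_def by blast
  qed
  have sibling: "y \<in> rooted_orb f (V n) x"
    if x: "x \<in> V n" and y: "y \<in> V n" and c: "c \<in> H" "c x = y" for x y c
  proof -
    obtain i where i: "(f ^^ i) x = X n" using x by (auto simp: V_def T_def)
    obtain j where j: "(f ^^ j) y = X n" using y by (auto simp: V_def T_def)
    have xK: "x \<in> K" using x T_K by (auto simp: V_def)
    obtain a where a: "(f ^^ a) y = (f ^^ a) x" using ev[OF c(1) xK] c(2) by blast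
    have aK: "(f ^^ a) x \<in> K" using xK pow_K by simp
    have "(f ^^ i) ((f ^^ a) x) = (f ^^ a) (X n)" using i by (simp add: funpow_plus add.commute[of i] funpow_plus[symmetric])
    also have "\<dots> = (f ^^ j) ((f ^^ a) x)" unfolding a[symmetric] j[symmetric] by (simp add: funpow_plus add.commute)
    finally have "i = j" by (rule pow_inj[OF aK])
    then have "c (X n) = X n" using i j c aut_comm_funpow[OF c(1), of i x] by simp
    then have "restr c (V n) \<in> aut f (V n)" using restr_V c(1) by blast
    moreover have "restr c (V n) x = y" using x c(2) by (simp add: restr_def)
    ultimately show ?thesis unfolding rooted_orb_def by blast
  qed
  define \<iota> where "\<iota> S = rooted_orb f (U k) (s (SOME x. x \<in> V n \<and> S = rooted_orb f (V n) x))" for S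
  have \<iota>: "\<iota> (rooted_orb f (V n) x) = rooted_orb f (U k) (s x)" if x: "x \<in> V n" for x
  proof -
    let ?y = "SOME y. y \<in> V n \<and> rooted_orb f (V n) x = rooted_orb f (V n) y"
    have "?y \<in> V n \<and> rooted_orb f (V n) x = rooted_orb f (V n) ?y" by (rule someI[of _ x]) (simp add: x)
    then have "?y \<in> rooted_orb f (V n) x" using rooted_orb_self by metis
    then show ?thesis unfolding \<iota>_def by (rule rooted_orb_eq[OF in_rorb])
  qed
  have "inj_on \<iota> (rooted_branching f (V n))"
  proof (rule inj_onI)
    fix S S' assume "S \<in> rooted_branching f (V n)" "S' \<in> rooted_branching f (V n)" and e: "\<iota> S = \<iota> S'"
    then obtain x y where x: "S = rooted_orb f (V n) x" "x \<in> V n" and y: "S' = rooted_orb f (V n) y" "y \<in> V n"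
      unfolding rooted_branching_def by blast
    have "s y \<in> rooted_orb f (U k) (s x)" using e \<iota>[OF x(2)] \<iota>[OF y(2)] x(1) y(1) rooted_orb_self by metis
    then obtain b where b: "b \<in> aut f (U k)" "s y = b (s x)" by (auto simp: rooted_orb_def)
    have bH: "b \<in> H" using AU b(1) A_H by blast
    have "(pinv s \<circ> b \<circ> s) x = y" using b(2)[symmetric] s(1) by simp
    then have "y \<in> rooted_orb f (V n) x" by (intro sibling[OF x(2) y(2), of "pinv s \<circ> b \<circ> s"] aut_comp aut_inv sH bH)
    then show "S = S'" unfolding x(1) y(1) by (rule rooted_orb_eq[symmetric])
  qed
  moreover have "\<iota> S \<in> rooted_branching f (U k)" if S: "S \<in> rooted_branching f (V n)" for S
  proof -
    obtain x z where x: "S = rooted_orb f (V n) x" "x \<in> V n" "finite S" "z \<in> S" "z \<noteq> x" "f z = f x"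
      using S unfolding rooted_branching_def by blast
    obtain i where i: "(f ^^ i) x = X n" using x(2) by (auto simp: V_def T_def)
    have sub: "{g x | g. g \<in> A (Suc k) \<and> g (X n) = X n} \<subseteq> S"
    proof
      fix y assume "y \<in> {g x | g. g \<in> A (Suc k) \<and> g (X n) = X n}"
      then obtain g where g: "g \<in> A (Suc k)" "g (X n) = X n" "y = g x" by blast
      then have "restr g (V n) \<in> aut f (V n)" using restr_V A_H by blast
      moreover have "restr g (V n) x = y" using x(2) g(3) by (simp add: restr_def)
      ultimately show "y \<in> S" unfolding x(1) rooted_orb_def by blast
    qed
    have "finite {g x | g. g \<in> A (Suc k)}"
      by (rule finite_orbit_over[OF i[symmetric] fin finite_subset[OF sub x(3)]])
    moreover have "rooted_orb f (U k) (s x) \<subseteq> {g x | g. g \<in> A (Suc k)}"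
    proof
      fix y assume "y \<in> rooted_orb f (U k) (s x)"
      then obtain b where "b \<in> aut f (U k)" "y = (b \<circ> s) x" by (auto simp: rooted_orb_def)
      then show "y \<in> {g x | g. g \<in> A (Suc k)}" using AU s(1) aut_comp by blast
    qed
    ultimately have "finite (rooted_orb f (U k) (s x))" using finite_subset by blast
    moreover have "s z \<in> rooted_orb f (U k) (s x)" using in_rorb x(1,4) by blast
    moreover have "s z \<noteq> s x" "f (s z) = f (s x)"
      using aut_eq[OF s(1)] x(5,6) aut_comm[OF s(1), of z] aut_comm[OF s(1), of x] by simp_all
    moreover have "s x \<in> U k" using sT VT x(2) by blast
    ultimately show ?thesis unfolding x(1) \<iota>[OF x(2)] rooted_branching_def by blast
  qed
  ultimately show ?thesis unfolding lepoll_def by blast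
qed

text \<open>Cardinals are well ordered, so only finitely many \<open>k\<close> can fail.\<close>

lemma recurrent_tail:
  fixes S :: "nat \<Rightarrow> 'b set"
  shows "\<exists>n0. \<forall>k\<ge>n0. infinite {k'. S k \<lesssim> S k'}"
proof -
  define bad where "bad = {k. finite {k'. S k \<lesssim> S k'}}"
  have "finite bad"
  proof (rule ccontr)
    assume inf: "infinite bad"
    then have "(\<lambda>k. |S k| ) ` bad \<noteq> {}" by auto
    then obtain r where r: "r \<in> (\<lambda>k. |S k| ) ` bad" "\<And>y. (y, r) \<in> ordLess \<Longrightarrow> y \<notin> (\<lambda>k. |S k| ) ` bad"
      using wfE_min[OF wf_ordLess] by (metis equals0I)
    then obtain k where k: "k \<in> bad" "r = |S k|" by auto
    have "S k \<lesssim> S k'" if "k' \<in> bad" for k'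
    proof (rule ccontr)
      assume "\<not> S k \<lesssim> S k'"
      then have "( |S k'|, |S k| ) \<in> ordLess" by (simp add: lepoll_iff_ordLeq)
      then show False using r(2) k that by blast
    qed
    then have "bad \<subseteq> {k'. S k \<lesssim> S k'}" by blast
    then show False using inf k(1) finite_subset unfolding bad_def by blast
  qed
  then obtain n0 where "\<forall>k\<in>bad. k < n0" using finite_nat_set_iff_bounded by blast
  then have "infinite {k'. S k \<lesssim> S k'}" if "n0 \<le> k" for k using that unfolding bad_def by force
  then show ?thesis by blast
qed

text \<open>The map \<open>q\<close> makes each index \<open>k\<close> recur arbitrarily late,
  always at places whose set is at least as large as \<open>S k\<close>. The increasing sequence
  \<open>p\<close> reserves one place for each pair of an index and a repetition number; elsewhere
  \<open>q\<close> is the identity.\<close>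

lemma dovetail:
  assumes "\<And>k. n0 \<le> k \<Longrightarrow> infinite {k'. S k \<lesssim> S k'}"
  shows "\<exists>q :: nat \<Rightarrow> nat. (\<forall>k'\<ge>n0. n0 \<le> q k' \<and> S (q k') \<lesssim> S k') \<and> (\<forall>k\<ge>n0. \<forall>n. \<exists>k'\<ge>n. q k' = k)"
proof -
  define e where "e i = n0 + fst (prod_decode i)" for i
  have "\<exists>p. \<forall>i. S (e i) \<lesssim> S (p i) \<and> p i < p (Suc i)"
  proof (rule dependent_nat_choice)
    have "infinite {k'. S (e 0) \<lesssim> S k'}" using assms by (simp add: e_def)
    then show "\<exists>x. S (e 0) \<lesssim> S x" using not_finite_existsD by blast
  next
    fix x i
    have "infinite {k'. S (e (Suc i)) \<lesssim> S k'}" using assms by (simp add: e_def)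
    then show "\<exists>y. S (e (Suc i)) \<lesssim> S y \<and> x < y" unfolding infinite_nat_iff_unbounded by blast
  qed
  then obtain p where p: "\<And>i. S (e i) \<lesssim> S (p i)" "\<And>i. p i < p (Suc i)" by blast
  have mono: "strict_mono p" using p(2) by (simp add: strict_mono_Suc_iff)
  define q where "q k' = (if k' \<in> range p then e (inv_into UNIV p k') else k')" for k'
  have qp: "q (p i) = e i" for i using strict_mono_imp_inj_on[OF mono] by (simp add: q_def)
  show ?thesis
  proof (intro exI[of _ q] conjI allI impI)
    fix k' assume k': "n0 \<le> k'"
    have "n0 \<le> q k' \<and> S (q k') \<lesssim> S k'"
    proof (cases "k' \<in> range p")
      case True
      then obtain i where "k' = p i" by blast
      then show ?thesis using qp p(1) by (simp add: e_def)
    next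
      case False then show ?thesis using k' by (simp add: q_def)
    qed
    then show "n0 \<le> q k'" "S (q k') \<lesssim> S k'" by simp_all
  next
    fix k n assume that: "n0 \<le> k"
    show "\<exists>k'\<ge>n. q k' = k"
    proof -
      define i where "i = prod_encode (k - n0, n)"
      have "e i = k" using that by (simp add: e_def i_def)
      moreover have "n \<le> p i" using strict_mono_imp_increasing[OF mono, of i] le_prod_encode_2[of n "k - n0"]
        unfolding i_def by linarith
      ultimately show ?thesis using qp by blast
    qed
  qed
qed

text \<open>Everything outside \<open>Zn n\<close> is fixed by the group and serves as base. With
  \<open>m = 1\<close> the factor for rotations is trivial.\<close>

lemma cyclic_ab_rooted_case:
  assumes n: "H \<subseteq> A n" shows "\<exists>I n. cyclic_ab f K 3 (I :: (nat \<times> 'x set) set) n"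
proof -
  interpret T: tree f K "- Zn n" id 1
  proof
    show "- K \<subseteq> - Zn n" by (auto simp: Zn_def)
    show "x \<in> - Zn n \<Longrightarrow> f x \<in> - Zn n" for x using Zn_f by blast
    show "\<exists>i. (f ^^ i) x \<in> - Zn n" for x using rooted_Zn[of n] by (simp add: rooted_def)
    show "\<exists>i. \<forall>x\<in>- Zn n. g x = (id ^^ i) x" if "g \<in> H" for g
    proof -
      have "g \<in> A n" using n that by blast
      then show ?thesis using aut_out[of g f "Zn n"] by (intro exI[of _ 0]) auto
    qed
  qed simp_all
  have "cyclic_ab f K 3 (insert (1, {}) (Pair 0 ` T.branching)) (\<lambda>(k :: nat, S :: 'x set). if k = 0 then 2 else 1)"
    by (rule T.cyclic_ab_tree) simp
  then show ?thesis by blast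
qed

text \<open>The cardinality of the abelianization is squeezed to that of \<open>Pow J\<close>. For
  the upper bound, an element is determined modulo commutators by a stabilizer containing it and by
  its surviving signs. For the lower bound, subsets of \<open>J\<close> are written into signs with
  infinitely many copies of each bit, because the signs on any initial part of the ray may get
  lost.\<close>

lemma cyclic_ab_limit_case:
  assumes II: "\<And>n. \<not> H \<subseteq> A n" shows "\<exists>I n. cyclic_ab f K 3 (I :: (nat \<times> 'x set) set) n"
proof -
  \<comment> \<open>Otherwise the stabilizers would be constant from \<open>n\<close> on and exhaust
    the group.\<close>
  have step: "\<exists>k\<ge>n. \<exists>s\<in>A (Suc k). s (X k) \<noteq> X k" for n
  proof (rule ccontr)
    assume "\<not> ?thesis"
    then have st: "A (Suc k) \<subseteq> A k" if "n \<le> k" for k using that A_iff by blast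
    have "A k \<subseteq> A n" if nk: "n \<le> k" for k using nk
    proof (induction k rule: dec_induct)
      case (step k) then show ?case using st[of k] by blast
    qed simp
    have "g \<in> A n" if g: "g \<in> H" for g
    proof -
      obtain m where "g \<in> A m" using A_ex[OF g] by blast
      then have "g \<in> A (max m n)" using A_mono[of m "max m n"] by auto
      then show ?thesis using \<open>\<And>k. n \<le> k \<Longrightarrow> A k \<subseteq> A n\<close>[of "max m n"] by auto
    qed
    then have "H \<subseteq> A n" by blast
    then show False using II by blast
  qed
  define S where "S k = rooted_branching f (U k)" for k
  obtain n0 where n0: "\<And>k. n0 \<le> k \<Longrightarrow> infinite {k'. S k \<lesssim> S k'}" using recurrent_tail[of S] by blast
  define J where "J = Sigma {n0..} S"
  have PS: "P n (Suc k) = U k" if "n \<le> k" for n k using that by (simp add: P_def)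
  have P0: "P n 0 = V n" for n by (simp add: P_def)
  have V_le: "rooted_branching f (V n) \<lesssim> J" if nd: "\<not> dead n" for n
  proof -
    have fin: "finite {g (X n) | g. g \<in> A j}" for j using dead_if_infinite nd by blast
    obtain k s where k: "max n n0 \<le> k" "s \<in> A (Suc k)" "s (X k) \<noteq> X k" using step by blast
    have "rooted_branching f (V n) \<lesssim> S k" unfolding S_def by (rule alive_lepoll[OF fin _ k(2,3)]) (use k in simp)
    also have "S k \<lesssim> J" unfolding lepoll_def J_def using k(1) by (intro exI[of _ "Pair k"]) (auto simp: inj_on_def)
    finally show ?thesis .
  qed
  define D where "D = derived (aut_group f K) H"
  have D_iff: "g \<in> D \<longleftrightarrow> g \<in> comm_prods H 3" for g
    unfolding D_def derived_aut_group using comm_prods_3 by blast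
  define N where "N g = (LEAST n. n0 \<le> n \<and> g \<in> A n)" for g
  have N: "n0 \<le> N g \<and> g \<in> A (N g)" if g: "g \<in> H" for g
  proof -
    obtain n where "g \<in> A n" using A_ex[OF g] by blast
    then have "g \<in> A (max n n0)" using A_mono[of n "max n n0"] by auto
    then have "\<exists>n. n0 \<le> n \<and> g \<in> A n" by (intro exI[of _ "max n n0"]) simp
    then show ?thesis unfolding N_def by (rule LeastI_ex)
  qed
  show ?thesis
  proof (cases "J = {}")
    case True
    have "g \<in> comm_prods H 3" if g: "g \<in> H" for g
    proof (rule pr_kernel)
      show "g \<in> A (N g)" using N[OF g] by simp
      show "pr (N g) 0 g = {} \<or> dead (N g)" using V_le[of "N g"] True pr_sub[of "N g" 0 g] unfolding P0 by auto
      show "pr (N g) (Suc k) g = {}" if "N g \<le> k" for k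
      proof -
        have "(k, s) \<notin> J" for s using True by simp
        then have "S k = {}" using that N[OF g] by (auto simp: J_def)
        then show ?thesis using pr_sub[of "N g" "Suc k" g] PS[OF that] by (simp add: S_def)
      qed
    qed
    \<comment> \<open>Without branching orbits from \<open>n0\<close> on, the group is perfect and
      needs no factor at all.\<close>
    then have "cyclic_ab f K 3 ({} :: (nat \<times> 'x set) set) (\<lambda>_. 0)" unfolding cyclic_ab_def
      using bexI[OF TrueI aut_id[of f K]] by (intro exI[of _ "\<lambda>_ _. 0"]) simp
    then show ?thesis by blast
  next
    case False
    then obtain k0 S0 where k0: "n0 \<le> k0" "S0 \<in> S k0" by (auto simp: J_def)
    \<comment> \<open>By the choice of \<open>n0\<close>, a nonempty \<open>S k0\<close> embeds into
      infinitely many later sets.\<close>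
    have infJ: "infinite J"
    proof
      assume fin: "finite J"
      have "{k'. S k0 \<lesssim> S k'} \<subseteq> fst ` J \<union> {..<n0}"
      proof
        fix k' assume "k' \<in> {k'. S k0 \<lesssim> S k'}"
        then have "S k' \<noteq> {}" using k0(2) by auto
        then show "k' \<in> fst ` J \<union> {..<n0}" by (cases "n0 \<le> k'") (force simp: J_def)+
      qed
      then show False using n0[OF k0(1)] fin finite_subset by blast
    qed
    have "\<forall>n. \<exists>\<iota>. \<not> dead n \<longrightarrow> inj_on \<iota> (rooted_branching f (V n)) \<and> \<iota> ` rooted_branching f (V n) \<subseteq> J"
      using V_le unfolding lepoll_def by blast
    from choice[OF this] obtain \<iota> where \<iota>: "\<And>n. \<not> dead n \<Longrightarrow> inj_on (\<iota> n) (rooted_branching f (V n))"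
        "\<And>n. \<not> dead n \<Longrightarrow> \<iota> n ` rooted_branching f (V n) \<subseteq> J" by blast
    \<comment> \<open>Signs below \<open>X (N g)\<close> are recorded only if they are not dead, and
      then through the injection into \<open>J\<close>.\<close>
    define \<delta> where "\<delta> g = (N g, (if dead (N g) then {} else \<iota> (N g) ` pr (N g) 0 g),
        {(k, s). N g \<le> k \<and> s \<in> pr (N g) (Suc k) g})" for g
    have \<delta>J: "\<delta> g \<in> UNIV \<times> Pow J \<times> Pow J" if g: "g \<in> H" for g
    proof -
      have "pr (N g) 0 g \<subseteq> rooted_branching f (V (N g))" using pr_sub[of "N g" 0 g] unfolding P0 .
      moreover have "pr (N g) (Suc k) g \<subseteq> S k" if "N g \<le> k" for k
        using pr_sub[of "N g" "Suc k" g] PS[OF that] by (simp add: S_def)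
      ultimately have 1: "(if dead (N g) then {} else \<iota> (N g) ` pr (N g) 0 g) \<subseteq> J"
          and 2: "\<And>k s. N g \<le> k \<Longrightarrow> s \<in> pr (N g) (Suc k) g \<Longrightarrow> s \<in> S k"
        using \<iota>(2)[of "N g"] by (auto, blast)
      have "{(k, s). N g \<le> k \<and> s \<in> pr (N g) (Suc k) g} \<subseteq> J"
        using 2 N[OF g] by (auto simp: J_def)
      with 1 show ?thesis unfolding \<delta>_def by blast
    qed
    have \<delta>_inj: "h \<circ> pinv g \<in> D" if g: "g \<in> H" and h: "h \<in> H" and e: "\<delta> g = \<delta> h" for g h
    proof -
      let ?c = "h \<circ> pinv g"
      have Ng: "g \<in> A (N g)" "h \<in> A (N g)" using N[OF g] N[OF h] e by (auto simp: \<delta>_def)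
      have c: "?c \<in> A (N g)" by (intro aut_comp aut_inv Ng)
      have cg: "?c \<circ> g = h" using g by (simp add: comp_assoc)
      have same: "pr (N g) i ?c = {}" if "pr (N g) i g = pr (N g) i h" for i
        using pr_comp[OF c Ng(1), of _ i] that unfolding cg by blast
      have "?c \<in> comm_prods H 3"
      proof (rule pr_kernel[OF c])
        show "pr (N g) 0 ?c = {} \<or> dead (N g)"
        proof (cases "dead (N g)")
          case False
          have "\<iota> (N g) ` pr (N g) 0 g = \<iota> (N g) ` pr (N g) 0 h" using e False by (auto simp: \<delta>_def)
          then have "pr (N g) 0 g = pr (N g) 0 h"
            using inj_on_image_eq_iff[OF \<iota>(1)[OF False]] pr_sub[of "N g" 0] unfolding P0 by blast
          then show ?thesis using same by blast
        qed simp
        show "pr (N g) (Suc k) ?c = {}" if "N g \<le> k" for k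
        proof (rule same)
          have NN: "N h = N g" using arg_cong[OF e, of fst] by (simp add: \<delta>_def)
          have "{(k, s). N g \<le> k \<and> s \<in> pr (N g) (Suc k) g} = {(k, s). N g \<le> k \<and> s \<in> pr (N g) (Suc k) h}"
            using arg_cong[OF e, of "\<lambda>d. snd (snd d)"] unfolding \<delta>_def snd_conv NN .
          then show "pr (N g) (Suc k) g = pr (N g) (Suc k) h" using that by auto
        qed
      qed
      then show ?thesis by (simp add: D_iff)
    qed
    have "\<exists>q :: nat \<Rightarrow> nat. (\<forall>k'\<ge>n0. n0 \<le> q k' \<and> S (q k') \<lesssim> S k') \<and> (\<forall>k\<ge>n0. \<forall>n. \<exists>k'\<ge>n. q k' = k)"
      by (rule dovetail) (rule n0)
    then obtain q where q0: "\<forall>k'\<ge>n0. n0 \<le> q k' \<and> S (q k') \<lesssim> S k'"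
        "\<forall>k\<ge>n0. \<forall>n. \<exists>k'\<ge>n. q k' = k" by (elim exE conjE)
    have q: "\<And>k'. n0 \<le> k' \<Longrightarrow> n0 \<le> q k' \<and> S (q k') \<lesssim> S k'" "\<And>k n. n0 \<le> k \<Longrightarrow> \<exists>k'\<ge>n. q k' = k"
      using q0 by simp_all
    have "\<forall>k'. \<exists>j. n0 \<le> k' \<longrightarrow> inj_on j (S (q k')) \<and> j ` S (q k') \<subseteq> S k'"
      using q(1) unfolding lepoll_def by blast
    from choice[OF this] obtain j where j: "\<And>k'. n0 \<le> k' \<Longrightarrow> inj_on (j k') (S (q k'))"
        "\<And>k'. n0 \<le> k' \<Longrightarrow> j k' ` S (q k') \<subseteq> S k'" by blast
    \<comment> \<open>Level \<open>k'\<close> holds a copy of the bits of \<open>E\<close> at level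
      \<open>q k'\<close>; this is possible since \<open>S (q k')\<close> embeds into
      \<open>S k'\<close>.\<close>
    define E' where "E' E k' = j k' ` {s. (q k', s) \<in> E}" for E k'
    have "\<exists>g. g \<in> A n0 \<and> (\<forall>k'\<ge>n0. pr n0 (Suc k') g = E' E k')" if E: "E \<subseteq> J" for E
    proof -
      interpret Dp: disjoint_pieces f "Bn n0" by (rule pieces)
      have sub: "E' E k' \<subseteq> S k'" if "n0 \<le> k'" for k'
        using E j(2)[OF that] unfolding E'_def J_def by blast
      have "\<forall>c. \<exists>u. u \<in> aut f (P n0 c) \<and> (\<forall>k'. c = Suc k' \<longrightarrow> n0 \<le> k' \<longrightarrow> rooted_parity f (P n0 c) u = E' E k')"
      proof
        fix c
        show "\<exists>u. u \<in> aut f (P n0 c) \<and> (\<forall>k'. c = Suc k' \<longrightarrow> n0 \<le> k' \<longrightarrow> rooted_parity f (P n0 c) u = E' E k')"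
        proof (cases "\<exists>k'. c = Suc k' \<and> n0 \<le> k'")
          case True
          then obtain k' where k': "c = Suc k'" "n0 \<le> k'" by blast
          have "E' E k' \<subseteq> rooted_branching f (P n0 c)" using sub[OF k'(2)] PS[OF k'(2)] k'(1) by (simp add: S_def)
          from rooted_parity_surj[OF rooted_P this] obtain u where "u \<in> aut f (P n0 c)" "rooted_parity f (P n0 c) u = E' E k'"
            by (elim bexE)
          then show ?thesis using k' by (intro exI[of _ u]) simp
        qed (use aut_id in blast)
      qed
      from choice[OF this] obtain u where u: "\<And>c. u c \<in> aut f (P n0 c)"
          "\<And>k'. n0 \<le> k' \<Longrightarrow> rooted_parity f (P n0 (Suc k')) (u (Suc k')) = E' E k'" by blast
      have gA: "Dp.glued u \<in> A n0" using Dp.glued_aut[of u] u(1) unfolding piece_P D_Zn by blast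
      have "restr (Dp.glued u) (P n0 c) = u c" for c
      proof
        fix x show "restr (Dp.glued u) (P n0 c) x = u c x"
        proof (cases "x \<in> P n0 c")
          case True
          then have "Bn n0 x = Some c" using Bn_P by simp
          then show ?thesis using True by (simp add: restr_def Dp.glued_Some)
        next
          case False then show ?thesis using aut_out[OF u(1)] by (simp add: restr_def)
        qed
      qed
      then show ?thesis using gA u(2) by (intro exI[of _ "Dp.glued u"]) (simp add: pr_def)
    qed
    then have "\<forall>E\<in>Pow J. \<exists>g. g \<in> A n0 \<and> (\<forall>k'\<ge>n0. pr n0 (Suc k') g = E' E k')" by blast
    from bchoice[OF this] obtain G where G: "\<And>E. E \<subseteq> J \<Longrightarrow> G E \<in> A n0"
        "\<And>E k'. E \<subseteq> J \<Longrightarrow> n0 \<le> k' \<Longrightarrow> pr n0 (Suc k') (G E) = E' E k'" by blast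
    have G_inj: "E = F" if E: "E \<subseteq> J" and F: "F \<subseteq> J" and D: "G F \<circ> pinv (G E) \<in> D" for E F
    proof -
      let ?c = "G F \<circ> pinv (G E)"
      have GH: "G E \<in> H" "G F \<in> H" using G(1)[OF E] G(1)[OF F] A_iff by blast+
      have "?c \<in> comm_prods H 3" using D D_iff by blast
      then obtain n where n: "?c \<in> comm_prods (A n) 3" using comm_prods_A by blast
      define m where "m = max n n0"
      have m: "?c \<in> comm_prods (A m) 3" "G E \<in> A m" "G F \<in> A m" "n0 \<le> m"
        using comm_prods_mono[OF A_mono[of n m]] n G(1)[OF E] G(1)[OF F] A_mono[of n0 m] unfolding m_def by auto
      \<comment> \<open>Membership in the derived subgroup is witnessed in the stabilizer of some
        \<open>X m\<close>, which controls the signs on levels from \<open>m\<close> on. Every bit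
        has a copy there.\<close>
      have eq: "E' E k' = E' F k'" if "m \<le> k'" for k'
      proof -
        have nk: "n0 \<le> k'" using that m(4) by simp
        have "s \<notin> pr m (Suc k') ?c" for s by (rule parity_comm_prods[OF _ m(1)]) (rule pr_comp)
        moreover have "?c \<circ> G E = G F" using GH by (simp add: comp_assoc)
        ultimately have "pr m (Suc k') (G F) = pr m (Suc k') (G E)"
          using pr_comp[OF comm_prods_aut[OF m(1)] m(2), of _ "Suc k'"] by auto
        then show ?thesis using G(2)[OF E nk] G(2)[OF F nk] pr_Suc[OF that nk] by simp
      qed
      have "(k, s) \<in> E \<longleftrightarrow> (k, s) \<in> F" for k s
      proof (cases "(k, s) \<in> J")
        case True
        then have k: "n0 \<le> k" by (auto simp: J_def)
        obtain k' where k': "m \<le> k'" "q k' = k" using q(2)[OF k] by blast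
        have nk: "n0 \<le> k'" using k' m(4) by simp
        have sub: "{s. (q k', s) \<in> E} \<subseteq> S (q k')" "{s. (q k', s) \<in> F} \<subseteq> S (q k')" using E F by (auto simp: J_def)
        have "j k' ` {s. (q k', s) \<in> E} = j k' ` {s. (q k', s) \<in> F}" using eq[OF k'(1)] unfolding E'_def .
        then have "{s. (q k', s) \<in> E} = {s. (q k', s) \<in> F}"
          using inj_on_image_eq_iff[OF j(1)[OF nk] sub] by simp
        then show ?thesis unfolding k'(2) by auto
      qed (use E F in blast)
      then show ?thesis by auto
    qed
    interpret AGr: group "aut_group f K" by (rule group_aut_group)
    define Q where "Q = aut_group f K Mod D"
    have Dn: "D \<lhd> aut_group f K" using AGr.derived_self_is_normal by (simp add: D_def)
    interpret Dn: normal D "aut_group f K" by (rule Dn)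
    have Qc: "comm_group Q" unfolding Q_def D_def using AGr.derived_quot_is_comm_group by simp
    define cs where "cs g = D #>\<^bsub>aut_group f K\<^esub> g" for g
    have cs_eq: "cs g = cs h \<longleftrightarrow> h \<circ> pinv g \<in> D" if "g \<in> H" "h \<in> H" for g h
    proof -
      have "cs g = cs h \<longleftrightarrow> h \<in> cs g"
        unfolding cs_def using AGr.repr_independence[OF _ _ Dn.subgroup_axioms] AGr.rcos_self[OF _ Dn.subgroup_axioms] that
        by (metis aut_group_simps(1))
      also have "\<dots> \<longleftrightarrow> h \<circ> pinv g \<in> D"
        unfolding cs_def using Dn.rcos_module[OF AGr.group_axioms, of g h] that by (simp add: inv_aut_group)
      finally show ?thesis .
    qed
    have carQ: "carrier Q = cs ` H" unfolding Q_def FactGroup_def RCOSETS_def cs_def by auto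
    have cs_mult: "cs g \<otimes>\<^bsub>Q\<^esub> cs h = cs (g \<circ> h)" if "g \<in> H" "h \<in> H" for g h
      unfolding Q_def cs_def FactGroup_def using Dn.rcos_sum[of g h] that by simp
    have cs_one: "\<one>\<^bsub>Q\<^esub> = cs id"
      unfolding Q_def cs_def FactGroup_def using AGr.coset_mult_one[OF Dn.subset] by simp
    have two: "x \<otimes>\<^bsub>Q\<^esub> x = \<one>\<^bsub>Q\<^esub>" if "x \<in> carrier Q" for x
    proof -
      obtain g where g: "g \<in> H" "x = cs g" using \<open>x \<in> carrier Q\<close> carQ by auto
      have "cs id = cs (g \<circ> g)"
        unfolding cs_eq[OF aut_id aut_comp[OF g(1) g(1)]] D_iff inv_id comp_id by (rule square_comm_prods[OF g(1)])
      then show ?thesis unfolding g(2) cs_mult[OF g(1) g(1)] cs_one by (rule sym)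
    qed
    have "carrier Q \<approx> Pow J"
    proof (rule lepoll_antisym)
      have "carrier Q \<lesssim> (UNIV :: nat set) \<times> Pow J \<times> Pow J"
      proof -
        define rep where "rep x = (SOME g. g \<in> H \<and> x = cs g)" for x
        have rep: "rep x \<in> H" "x = cs (rep x)" if "x \<in> carrier Q" for x
        proof -
          have "\<exists>g. g \<in> H \<and> x = cs g" using that carQ by auto
          from someI_ex[OF this] show "rep x \<in> H" "x = cs (rep x)" unfolding rep_def by auto
        qed
        have "inj_on (\<delta> \<circ> rep) (carrier Q)"
        proof (rule inj_onI)
          fix x y assume xy: "x \<in> carrier Q" "y \<in> carrier Q" "(\<delta> \<circ> rep) x = (\<delta> \<circ> rep) y"
          then have "rep y \<circ> pinv (rep x) \<in> D" using \<delta>_inj[OF rep(1) rep(1)] by simp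
          then have "cs (rep x) = cs (rep y)" using cs_eq[OF rep(1) rep(1)] xy by simp
          then show "x = y" using rep(2) xy by metis
        qed
        moreover have "(\<delta> \<circ> rep) ` carrier Q \<subseteq> UNIV \<times> Pow J \<times> Pow J" by (intro image_subsetI) (simp only: comp_apply \<delta>J[OF rep(1)])
        ultimately show ?thesis unfolding lepoll_def by blast
      qed
      also have "(UNIV :: nat set) \<times> Pow J \<times> Pow J \<lesssim> Pow J"
      proof -
        have infP: "infinite (Pow J)" using infJ by simp
        have 1: "Pow J \<times> Pow J \<approx> Pow J" by (rule infinite_times_eqpoll[OF infP]) auto
        have "(UNIV :: nat set) \<times> Pow J \<times> Pow J \<approx> (UNIV :: nat set) \<times> Pow J"
          by (rule times_eqpoll_cong[OF eqpoll_refl 1])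
        also have "(UNIV :: nat set) \<times> Pow J \<approx> Pow J \<times> (UNIV :: nat set)" by (rule times_commute_eqpoll)
        also have "\<dots> \<approx> Pow J"
          by (rule infinite_times_eqpoll[OF infP]) (use infP infinite_le_lepoll in auto)
        finally show ?thesis by (rule eqpoll_imp_lepoll)
      qed
      finally show "carrier Q \<lesssim> Pow J" .
      have "inj_on (cs \<circ> G) (Pow J)"
      proof (rule inj_onI)
        fix E F assume EF: "E \<in> Pow J" "F \<in> Pow J" "(cs \<circ> G) E = (cs \<circ> G) F"
        have "G E \<in> H" "G F \<in> H" using G(1) EF A_iff by blast+
        then have "G F \<circ> pinv (G E) \<in> D" using cs_eq EF(3) by simp
        then show "E = F" using G_inj EF by blast
      qed
      moreover have "(cs \<circ> G) ` Pow J \<subseteq> carrier Q" unfolding carQ using G(1) A_iff by auto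
      ultimately show "Pow J \<lesssim> carrier Q" unfolding lepoll_def by blast
    qed
    then obtain \<psi> where \<psi>: "bij_betw \<psi> (carrier Q) (Pow J)"
        "\<And>x y. x \<in> carrier Q \<Longrightarrow> y \<in> carrier Q \<Longrightarrow> \<psi> (x \<otimes>\<^bsub>Q\<^esub> y) = sym_diff (\<psi> x) (\<psi> y)"
      using exponent_2_iso_Pow[OF Qc two infJ] by blast
    have csQ: "cs g \<in> carrier Q" if "g \<in> H" for g using that carQ by auto
    have \<psi>c: "\<psi> (cs (g \<circ> h)) = sym_diff (\<psi> (cs g)) (\<psi> (cs h))" if "g \<in> H" "h \<in> H" for g h
      using \<psi>(2)[OF csQ[OF that(1)] csQ[OF that(2)]] unfolding cs_mult[OF that] .
    have \<psi>1: "\<psi> (cs id) = {}" using \<psi>c[OF aut_id aut_id] by auto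
    define \<Phi> :: "('x \<Rightarrow> 'x) \<Rightarrow> nat \<times> 'x set \<Rightarrow> int" where "\<Phi> g i = (if i \<in> \<psi> (cs g) then 1 else 0)" for g i
    have "cyclic_ab f K 3 J (\<lambda>_. 2)" unfolding cyclic_ab_def
    proof (intro exI[of _ \<Phi>] conjI ballI allI impI)
      fix g h i assume gh: "g \<in> H" "h \<in> H"
      show "int 2 dvd \<Phi> (g \<circ> h) i - (\<Phi> g i + \<Phi> h i)" unfolding \<Phi>_def \<psi>c[OF gh] by auto
    next
      fix t :: "nat \<times> 'x set \<Rightarrow> int"
      have "{i \<in> J. odd (t i)} \<in> \<psi> ` carrier Q" using \<psi>(1) unfolding bij_betw_def by auto
      then obtain g where g: "g \<in> H" "\<psi> (cs g) = {i \<in> J. odd (t i)}" unfolding carQ by auto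
      then show "\<exists>g\<in>H. \<forall>i\<in>J. int 2 dvd \<Phi> g i - t i" by (intro bexI[of _ g]) (auto simp: \<Phi>_def)
    next
      fix g assume g: "g \<in> H" "\<forall>i\<in>J. int 2 dvd \<Phi> g i"
      have "\<psi> (cs g) \<subseteq> J" using bij_betw_apply[OF \<psi>(1) csQ[OF g(1)]] by simp
      then have "\<psi> (cs g) = {}" using g(2) by (force simp: \<Phi>_def)
      then have "cs id = cs g" using \<psi>1 inj_onD[OF bij_betw_imp_inj_on[OF \<psi>(1)] _ csQ[OF aut_id] csQ[OF g(1)]] by simp
      then have "g \<circ> pinv id \<in> D" using cs_eq[OF aut_id g(1)] by blast
      then show "g \<in> comm_prods H 3" unfolding D_iff by (simp only: inv_id comp_id)
    qed
    then show ?thesis by blast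
  qed
qed

end

text \<open>A component has a cycle, or an automorphism that translates along \<open>f\<close>, or
  it satisfies the assumptions of \<open>ray\<close>. In the last case either one stabilizer is
  already the whole group, or no stabilizer is.\<close>

theorem cyclic_ab_component:
  fixes f :: "'x \<Rightarrow> 'x"
  assumes K: "K = {y. conn f x0 y}"
  shows "\<exists>I n. cyclic_ab f K 3 (I :: (nat \<times> 'x set) set) n"
proof -
  interpret C: component f K x0 by standard (rule K)
  show ?thesis
  proof (cases "\<exists>z l. z \<in> K \<and> l > 0 \<and> (f ^^ l) z = z")
    case True
    then obtain z l where "z \<in> K" "l > 0" "(f ^^ l) z = z" by blast
    then show ?thesis by (rule C.cyclic_ab_cycle)
  next
    case False
    interpret AC: acyclic_component f K x0 by standard (use False in blast)
    show ?thesis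
    proof (cases "\<exists>\<sigma> y r. \<sigma> \<in> aut f K \<and> y \<in> K \<and> r > 0 \<and> \<sigma> y = (f ^^ r) y")
      case True
      then obtain \<sigma> y r where "\<sigma> \<in> aut f K" "y \<in> K" "r > 0" "\<sigma> y = (f ^^ r) y" by blast
      then have "\<exists>I n. cyclic_ab f K 2 (I :: (nat \<times> 'x set) set) n" by (rule AC.cyclic_ab_translation)
      then obtain I :: "(nat \<times> 'x set) set" and n where "cyclic_ab f K 2 I n" by (elim exE)
      then have "cyclic_ab f K 3 I n" by (rule cyclic_ab_le) simp
      then show ?thesis by (intro exI)
    next
      case noT: False
      interpret R: ray f K x0
      proof
        fix g x assume g: "g \<in> aut f K" and x: "x \<in> K"
        have gx: "g x \<in> K" using aut_in[OF g] x by simp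
        then obtain a b where ab: "(f ^^ a) (g x) = (f ^^ b) x" using C.conn_K[OF gx x] unfolding conn_def by blast
        \<comment> \<open>Different exponents would make \<open>g\<close> or its inverse a
          translation.\<close>
        have "a = b"
        proof (rule ccontr)
          assume "a \<noteq> b"
          then consider "a < b" | "b < a" by linarith
          then show False
          proof cases
            case 1
            have "g ((f ^^ a) x) = (f ^^ (b - a)) ((f ^^ a) x)"
              using ab 1 by (simp add: aut_comm_funpow[OF g] funpow_plus)
            then show False using noT g x 1 C.pow_K[of a x] by (metis zero_less_diff)
          next
            case 2
            have "pinv g ((f ^^ b) (g x)) = (f ^^ b) x" using g by (simp add: aut_comm_funpow[OF aut_inv[OF g]])
            moreover have "(f ^^ (a - b)) ((f ^^ b) (g x)) = (f ^^ b) x" using ab 2 by (simp add: funpow_plus)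
            ultimately have "pinv g ((f ^^ b) (g x)) = (f ^^ (a - b)) ((f ^^ b) (g x))" by simp
            then show False using noT aut_inv[OF g] gx 2 C.pow_K[of b "g x"] by (metis zero_less_diff)
          qed
        qed
        then show "\<exists>a. (f ^^ a) (g x) = (f ^^ a) x" using ab by blast
      qed
      show ?thesis
      proof (cases "\<exists>n. aut f K \<subseteq> R.A n")
        case True
        then obtain n where "aut f K \<subseteq> R.A n" by blast
        then show ?thesis by (rule R.cyclic_ab_rooted_case)
      next
        case False
        then show ?thesis by (intro R.cyclic_ab_limit_case) simp
      qed
    qed
  qed
qed

section \<open>Families of components\<close>

text \<open>Automorphisms preserve every piece, so the group is the product of the groups of the
  pieces and \<open>\<Phi>\<close> can be chosen for each piece separately. The common
  \<open>N\<close> lets the kernel condition pass to the product.\<close>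

lemma cyclic_ab_pieces:
  fixes I :: "'c \<Rightarrow> 'k set"
  assumes "disjoint_pieces f B"
    and Bg: "\<And>g x. g \<in> aut f (disjoint_pieces.D B) \<Longrightarrow> B (g x) = B x"
    and Bf: "\<And>x. B x \<noteq> None \<Longrightarrow> B (f x) = B x"
    and cyclic_ab: "\<And>c. cyclic_ab f (disjoint_pieces.piece B c) N (I c) (n c)"
  shows "cyclic_ab f (disjoint_pieces.D B) N {(c, i). i \<in> I c} (\<lambda>(c, i). n c i)"
proof -
  interpret D: disjoint_pieces f B by fact
  have "\<forall>c. \<exists>\<Phi> :: ('a \<Rightarrow> 'a) \<Rightarrow> 'k \<Rightarrow> int.
    (\<forall>g\<in>aut f (D.piece c). \<forall>h\<in>aut f (D.piece c). \<forall>i\<in>I c. int (n c i) dvd \<Phi> (g \<circ> h) i - (\<Phi> g i + \<Phi> h i)) \<and>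
    (\<forall>t. \<exists>g\<in>aut f (D.piece c). \<forall>i\<in>I c. int (n c i) dvd \<Phi> g i - t i) \<and>
    (\<forall>g\<in>aut f (D.piece c). (\<forall>i\<in>I c. int (n c i) dvd \<Phi> g i) \<longrightarrow> g \<in> comm_prods (aut f (D.piece c)) N)"
    using cyclic_ab unfolding cyclic_ab_def by (rule allI)
  from choice[OF this] obtain \<Phi> :: "'c \<Rightarrow> ('a \<Rightarrow> 'a) \<Rightarrow> 'k \<Rightarrow> int" where \<Phi>:
    "\<And>c g h i. g \<in> aut f (D.piece c) \<Longrightarrow> h \<in> aut f (D.piece c) \<Longrightarrow> i \<in> I c \<Longrightarrow> int (n c i) dvd \<Phi> c (g \<circ> h) i - (\<Phi> c g i + \<Phi> c h i)"
    "\<And>c t. \<exists>g\<in>aut f (D.piece c). \<forall>i\<in>I c. int (n c i) dvd \<Phi> c g i - t i"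
    "\<And>c g. g \<in> aut f (D.piece c) \<Longrightarrow> \<forall>i\<in>I c. int (n c i) dvd \<Phi> c g i \<Longrightarrow> g \<in> comm_prods (aut f (D.piece c)) N"
    by blast
  have rsp: "restr g (D.piece c) \<in> aut f (D.piece c)" if g: "g \<in> aut f D.D" for g c
    by (rule D.restr_piece[OF aut_UNIV[OF g] Bg[OF g]]) (use Bf in auto)
  have rsc: "restr (g \<circ> h) (D.piece c) = restr g (D.piece c) \<circ> restr h (D.piece c)" if h: "h \<in> aut f D.D" for g h c
    using Bg[OF h] by (auto simp: restr_def D.piece_def fun_eq_iff)
  define \<Psi> where "\<Psi> g = (\<lambda>(c, i). \<Phi> c (restr g (D.piece c)) i)" for g
  show ?thesis unfolding cyclic_ab_def
  proof (intro exI[of _ \<Psi>] conjI ballI allI impI)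
    fix g h x assume g: "g \<in> aut f D.D" and h: "h \<in> aut f D.D" and "x \<in> {(c, i). i \<in> I c}"
    then obtain c i where x: "x = (c, i)" "i \<in> I c" by auto
    show "int ((\<lambda>(c, i). n c i) x) dvd \<Psi> (g \<circ> h) x - (\<Psi> g x + \<Psi> h x)"
      unfolding x(1) \<Psi>_def prod.case rsc[OF h] by (rule \<Phi>(1)[OF rsp[OF g] rsp[OF h] x(2)])
  next
    fix t :: "'c \<times> 'k \<Rightarrow> int"
    have "\<forall>c. \<exists>u. u \<in> aut f (D.piece c) \<and> (\<forall>i\<in>I c. int (n c i) dvd \<Phi> c u i - t (c, i))"
      using \<Phi>(2)[of _ "\<lambda>i. t (_, i)"] by blast
    from choice[OF this] obtain u where u: "\<And>c. u c \<in> aut f (D.piece c)"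
        "\<And>c i. i \<in> I c \<Longrightarrow> int (n c i) dvd \<Phi> c (u c) i - t (c, i)" by blast
    have "restr (D.glued u) (D.piece c) = u c" for c
    proof
      fix x show "restr (D.glued u) (D.piece c) x = u c x"
      proof (cases "x \<in> D.piece c")
        case True then show ?thesis by (simp add: restr_def D.glued_Some D.piece_def)
      next
        case False then show ?thesis using aut_out[OF u(1)] by (simp add: restr_def)
      qed
    qed
    then show "\<exists>g\<in>aut f D.D. \<forall>x\<in>{(c, i). i \<in> I c}. int ((\<lambda>(c, i). n c i) x) dvd \<Psi> g x - t x"
      using u(2) D.glued_aut[OF u(1)] by (intro bexI[of _ "D.glued u"]) (auto simp: \<Psi>_def)
  next
    fix g assume g: "g \<in> aut f D.D" and z: "\<forall>x\<in>{(c, i). i \<in> I c}. int ((\<lambda>(c, i). n c i) x) dvd \<Psi> g x"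
    have "restr g (D.piece c) \<in> comm_prods (aut f (D.piece c)) N" for c
      by (rule \<Phi>(3)[OF rsp[OF g]]) (use z in \<open>force simp: \<Psi>_def\<close>)
    then have "D.glued (\<lambda>c. restr g (D.piece c)) \<in> comm_prods (aut f D.D) N" by (rule D.glued_comm_prods)
    moreover have "D.glued (\<lambda>c. restr g (D.piece c)) = g"
      by (rule D.glued_rs) (use aut_out[OF g] in \<open>simp add: D.D_def\<close>)
    ultimately show "g \<in> comm_prods (aut f D.D) N" by simp
  qed
qed

lemma single_orbit_conj:
  assumes v: "v permutes W" "single_orbit v W" and u: "u permutes W" "single_orbit u W"
  shows "\<exists>r. r permutes W \<and> r \<circ> v = u \<circ> r"
proof (cases "W = {}")
  case True
  then show ?thesis using v u by (intro exI[of _ id]) auto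
next
  case False
  then obtain w0 where w0: "w0 \<in> W" by blast
  have cl: "v w \<in> W" "u w \<in> W" if "w \<in> W" for w using that v u by (simp_all add: permutes_in_image)
  have pw: "(v ^^ i) w0 = (v ^^ j) w0 \<longleftrightarrow> (u ^^ i) w0 = (u ^^ j) w0" for i j
  proof -
    have *: "(v ^^ i) w0 = (v ^^ j) w0 \<longleftrightarrow> (u ^^ i) w0 = (u ^^ j) w0" if "i \<le> j" for i j
      using single_orbit_funpow_cong[OF v(2) cl(1) permutes_inj[OF v(1)] w0 that]
        single_orbit_funpow_cong[OF u(2) cl(2) permutes_inj[OF u(1)] w0 that] by simp
    show ?thesis using *[of i j] *[of j i] by (cases "i \<le> j") auto
  qed
  define r where "r w = (if w \<in> W then (u ^^ (SOME i. (v ^^ i) w0 = w)) w0 else w)" for w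
  have vi: "(v ^^ i) w0 \<in> W" and ui: "(u ^^ i) w0 \<in> W" for i
    using funpow_in[OF cl(1) w0] funpow_in[OF cl(2) w0] by simp_all
  have r: "r ((v ^^ i) w0) = (u ^^ i) w0" for i
  proof -
    have "(v ^^ (SOME j. (v ^^ j) w0 = (v ^^ i) w0)) w0 = (v ^^ i) w0" by (rule someI[of _ i]) simp
    then show ?thesis unfolding r_def using pw vi by simp
  qed
  have ex: "\<exists>i. w = (v ^^ i) w0" "\<exists>i. w = (u ^^ i) w0" if "w \<in> W" for w
    using single_orbitE[OF v(2) w0 that] single_orbitE[OF u(2) w0 that] by metis+
  have "bij_betw r W W" unfolding bij_betw_def
  proof
    show "inj_on r W"
    proof (rule inj_onI)
      fix x y assume "x \<in> W" "y \<in> W" "r x = r y"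
      moreover from this obtain i j where "x = (v ^^ i) w0" "y = (v ^^ j) w0" using ex by blast
      ultimately show "x = y" using r pw by simp
    qed
    show "r ` W = W"
    proof (intro equalityI subsetI)
      fix y assume "y \<in> r ` W"
      then obtain x where "x \<in> W" "y = r x" by blast
      then show "y \<in> W" using ex(1)[of x] r ui by auto
    next
      fix y assume "y \<in> W"
      then obtain i where "y = (u ^^ i) w0" using ex by blast
      then have "y = r ((v ^^ i) w0)" using r by simp
      then show "y \<in> r ` W" using vi by blast
    qed
  qed
  then have rp: "r permutes W" by (rule bij_imp_permutes) (simp add: r_def)
  have "(r \<circ> v) w = (u \<circ> r) w" for w
  proof (cases "w \<in> W")
    case True
    then obtain i where i: "w = (v ^^ i) w0" using ex by blast
    have "r ((v ^^ Suc i) w0) = (u ^^ Suc i) w0" by (rule r)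
    then show ?thesis unfolding i by (simp add: r)
  next
    case False
    then show ?thesis using v(1) u(1) rp by (simp add: permutes_not_in)
  qed
  then have "r \<circ> v = u \<circ> r" by (rule ext)
  then show ?thesis using rp by blast
qed

text \<open>A union \<open>Y\<close> of components, all of them images of that of \<open>x0\<close>.
  Its group is the wreath product of the group of one component with all permutations of the set
  \<open>W\<close> of components.\<close>

locale copies =
  fixes f :: "'x \<Rightarrow> 'x" and Y :: "'x set" and x0 :: 'x
  assumes x0: "x0 \<in> Y" and closed: "\<And>y z. y \<in> Y \<Longrightarrow> conn f y z \<Longrightarrow> z \<in> Y"
    and transitive: "\<And>y. y \<in> Y \<Longrightarrow> \<exists>g\<in>aut f Y. conn f (g x0) y"
begin

abbreviation "H \<equiv> aut f Y"

definition "cpt y = {z. conn f y z}"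
definition "K = cpt x0"
definition "W = cpt ` Y"
definition "B y = (if y \<in> Y then Some (cpt y) else None)"

lemma cpt_eq: "cpt y = cpt z \<longleftrightarrow> conn f y z"
proof
  assume "cpt y = cpt z"
  moreover have "z \<in> cpt z" by (simp add: cpt_def conn_refl)
  ultimately show "conn f y z" unfolding cpt_def by blast
next
  assume yz: "conn f y z"
  have "conn f y x \<longleftrightarrow> conn f z x" for x
    using conn_trans[OF yz, of x] conn_trans[OF conn_sym[OF yz], of x] by (rule iffI[rotated])
  then show "cpt y = cpt z" by (simp add: cpt_def)
qed

lemma cpt_mem: "z \<in> cpt y \<longleftrightarrow> cpt z = cpt y"
  unfolding cpt_eq by (auto simp: cpt_def intro: conn_sym)

lemma cpt_f: "cpt (f y) = cpt y"
  unfolding cpt_eq using conn_f[of f y y] conn_refl conn_sym by metis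

lemma conn_img: assumes g: "g \<in> H" shows "conn f (g y) (g z) \<longleftrightarrow> conn f y z"
  using conn_aut[OF g, of y z] conn_aut[OF aut_inv[OF g], of "g y" "g z"] g by auto

lemma cpt_img: assumes g: "g \<in> H" shows "g ` cpt y = cpt (g y)"
proof (intro equalityI subsetI)
  fix z assume "z \<in> g ` cpt y"
  then show "z \<in> cpt (g y)" using conn_img[OF g] by (auto simp: cpt_def)
next
  fix z assume "z \<in> cpt (g y)"
  then have "conn f (g y) (g (pinv g z))" by (simp add: cpt_def aut_inv_r[OF g])
  then have "pinv g z \<in> cpt y" using conn_img[OF g] by (simp add: cpt_def)
  then show "z \<in> g ` cpt y" by (metis aut_inv_r[OF g] image_eqI)
qed

lemma K_Y: "K \<subseteq> Y" unfolding K_def cpt_def using closed[OF x0] by blast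

lemma W_I: "y \<in> Y \<Longrightarrow> cpt y \<in> W" by (simp add: W_def)

lemma K_W: "K \<in> W" by (simp add: K_def W_I x0)

lemma W_ex: assumes "w \<in> W" obtains g where "g \<in> H" "w = cpt (g x0)"
proof -
  obtain y where "y \<in> Y" "w = cpt y" using assms by (auto simp: W_def)
  then show ?thesis using transitive[of y] that cpt_eq by metis
qed

section \<open>Action on the copies and local coordinates\<close>

definition "act g = restr (\<lambda>w. g ` w) W"

lemma act: assumes "g \<in> H" "y \<in> Y" shows "act g (cpt y) = cpt (g y)"
  unfolding act_def restr_def using W_I[OF assms(2)] cpt_img[OF assms(1)] by simp

lemma act_W: assumes g: "g \<in> H" and w: "w \<in> W" shows "act g w \<in> W"
proof -
  obtain y where y: "y \<in> Y" "w = cpt y" using w by (auto simp: W_def)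
  then show ?thesis using act[OF g y(1)] W_I aut_in[OF g] by simp
qed

lemma act_comp: assumes g: "g \<in> H" and h: "h \<in> H" shows "act (g \<circ> h) = act g \<circ> act h"
proof
  fix w show "act (g \<circ> h) w = (act g \<circ> act h) w"
  proof (cases "w \<in> W")
    case True
    then show ?thesis using act_W[OF h True] by (simp add: act_def restr_def image_comp)
  qed (simp add: act_def restr_def)
qed

lemma act_id: "act id = id" by (auto simp: act_def restr_def)

lemma act_permutes: assumes g: "g \<in> H" shows "act g permutes W"
proof (rule bij_imp_permutes)
  have 1: "act g (act (pinv g) w) = w" for w
    using act_comp[OF g aut_inv[OF g]] act_id g by (metis aut_pinv_o(2) comp_apply id_apply)
  have 2: "act (pinv g) (act g w) = w" for w
    using act_comp[OF aut_inv[OF g] g] act_id g by (metis aut_pinv_o(1) comp_apply id_apply)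
  show "bij_betw (act g) W W"
    by (rule bij_betwI[where g = "act (pinv g)"]) (use act_W[OF g] act_W[OF aut_inv[OF g]] 1 2 in auto)
qed (simp add: act_def restr_def)

lemma B_f: "B (f x) = B x"
proof (cases "x \<in> Y")
  case True
  then have "f x \<in> Y" using closed[of x "f x"] cpt_f cpt_eq conn_sym by metis
  then show ?thesis using True by (simp add: B_def cpt_f)
next
  case False
  then have "f x \<notin> Y" using closed[of "f x" x] cpt_f cpt_eq by metis
  then show ?thesis using False by (simp add: B_def)
qed

lemma B_g: assumes g: "g \<in> H" shows "B (g x) = map_option (act g) (B x)"
  using aut_in[OF g, of x] act[OF g, of x] by (simp add: B_def)

lemma cyclic_ab_infinite:
  assumes inf: "infinite W" shows "cyclic_ab f Y 2 ({} :: 'j set) n"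
proof -
  interpret I: block_system f B W "W \<times> W"
  proof
    show "B (f x) = None \<or> B (f x) = B x" for x using B_f by simp
    show "w \<in> W \<longleftrightarrow> (\<exists>x. B x = Some w)" for w by (auto simp: W_def B_def)
    show "equiv W (W \<times> W)" by (auto simp: equiv_def refl_on_def sym_def trans_def)
    show "infinite ((W \<times> W) `` {w})" if "w \<in> W" for w using that inf by (simp add: Image_def)
    show "\<exists>k\<in>aut f UNIV. (\<forall>x. B (k x) = Some w' \<longleftrightarrow> B x = Some w) \<and> (\<forall>x. B x = Some w \<longrightarrow> B (f x) = None \<longrightarrow> k (f x) = f x)"
      if ww: "(w, w') \<in> W \<times> W" for w w'
    proof -
      obtain g where g: "g \<in> H" "w = cpt (g x0)" using ww W_ex by blast
      obtain g' where g': "g' \<in> H" "w' = cpt (g' x0)" using ww W_ex by blast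
      define k where "k = g' \<circ> pinv g"
      have k: "k \<in> H" unfolding k_def by (intro aut_comp aut_inv g(1) g'(1))
      have "g x0 \<in> Y" using aut_in[OF g(1)] x0 by simp
      then have "act k w = w'" using act[OF k, of "g x0"] g g'(2) by (simp add: k_def)
      then have "B (k x) = Some w' \<longleftrightarrow> B x = Some w" for x
        unfolding B_g[OF k] using inj_eq[OF permutes_inj[OF act_permutes[OF k]]] by auto
      then show ?thesis using aut_UNIV[OF k] B_f by (intro bexI[of _ k]) auto
    qed
  qed
  have D: "I.D = Y" by (auto simp: I.D_def B_def)
  have "g \<in> comm_prods (aut f I.D) 2" if g: "g \<in> H" for g
  proof (rule I.comm_prods_blocks)
    show "g \<in> aut f I.D" using g by (simp only: D)
    show "act g permutes W" by (rule act_permutes[OF g])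
    show "B (g x) = Some (act g w)" if "B x = Some w" for x w using B_g[OF g] that by simp
    show "(w, act g w) \<in> W \<times> W" if "w \<in> W" for w using act_W[OF g that] that by simp
  qed
  then have "g \<in> comm_prods H 2" if "g \<in> H" for g using that by (simp only: D)
  then show ?thesis unfolding cyclic_ab_def using bexI[OF TrueI aut_id[of f Y]] by (intro exI[of _ "\<lambda>_ _. 0"]) simp
qed

text \<open>Fixed isomorphisms of the component \<open>K\<close> with its copies; relative to these an automorphism has local coordinates \<open>lc\<close>.\<close>

definition "kp w = (if w = K then id else SOME g. g \<in> H \<and> cpt (g x0) = w)"

lemma kp: assumes "w \<in> W" shows "kp w \<in> H" "cpt (kp w x0) = w"
proof -
  have "kp w \<in> H \<and> cpt (kp w x0) = w"
  proof (cases "w = K")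
    case False
    have "\<exists>g. g \<in> H \<and> cpt (g x0) = w" using W_ex[OF assms] by metis
    from someI_ex[OF this] show ?thesis using False by (simp add: kp_def)
  next
    case True
    then have "kp w = id" by (simp add: kp_def)
    then show ?thesis using aut_id True by (simp only: K_def id_apply) simp
  qed
  then show "kp w \<in> H" "cpt (kp w x0) = w" by blast+
qed

lemma kp_K: "kp K = id" by (simp add: kp_def)

lemma kp_comp: assumes "w \<in> W" "x \<in> K" shows "cpt (kp w x) = w" "kp w x \<in> Y"
proof -
  have "cpt (kp w x) = kp w ` cpt x0" using cpt_img[OF kp(1)[OF assms(1)], of x] assms(2) by (simp add: K_def cpt_mem)
  then show "cpt (kp w x) = w" using cpt_img[OF kp(1)[OF assms(1)], of x0] kp(2)[OF assms(1)] by simp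
  show "kp w x \<in> Y" using aut_in[OF kp(1)[OF assms(1)]] assms(2) K_Y by blast
qed

lemma kp_comp': assumes "y \<in> Y" shows "pinv (kp (cpt y)) y \<in> K"
proof -
  have w: "cpt y \<in> W" using W_I assms .
  note k = kp[OF w]
  have "conn f (kp (cpt y) (pinv (kp (cpt y)) y)) (kp (cpt y) x0)"
    unfolding aut_inv_r[OF k(1)] cpt_eq[symmetric] by (rule k(2)[symmetric])
  then have "conn f (pinv (kp (cpt y)) y) x0" using conn_img[OF k(1)] by simp
  then show ?thesis unfolding K_def cpt_mem cpt_eq .
qed

text \<open>A splitting of \<open>act\<close>: the permutation of copies that has trivial local
  coordinates with respect to the identifications \<open>kp\<close>.\<close>

definition "lift s x = (if x \<in> Y then kp (s (cpt x)) (pinv (kp (cpt x)) x) else x)"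

lemma lift_comp_Y:
  assumes s: "s permutes W" and x: "x \<in> Y"
  shows "lift s x \<in> Y" "cpt (lift s x) = s (cpt x)"
proof -
  have "s (cpt x) \<in> W" using permutes_in_image[OF s] W_I[OF x] by simp
  then show "lift s x \<in> Y" "cpt (lift s x) = s (cpt x)"
    using kp_comp[OF _ kp_comp'[OF x]] x by (simp_all add: lift_def)
qed

lemma lift: assumes s: "s permutes W" shows "lift s \<in> H"
proof -
  define k where "k b = (case b of None \<Rightarrow> id | Some w \<Rightarrow> kp (s w) \<circ> pinv (kp w))" for b
  have BW: "w \<in> W \<and> s w \<in> W" if "B x = Some w" for x w
    using that W_I permutes_in_image[OF s] by (auto simp: B_def split: if_splits)
  have kH: "k (B x) \<in> H" for x
  proof (cases "B x")
    case None
    then have "k (B x) = id" by (simp add: k_def)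
    then show ?thesis using aut_id by (simp only:)
  next
    case (Some w)
    then show ?thesis using BW[OF Some] kp(1) by (simp add: k_def aut_comp aut_inv)
  qed
  have Bk: "B (k (B y) x) = map_option s (B y) \<longleftrightarrow> B x = B y" for x y
  proof (cases "B y")
    case (Some w)
    note w = BW[OF Some]
    have kw: "k (Some w) \<in> H" using kH[of y] Some by simp
    have act: "act (k (Some w)) w = s w"
    proof -
      have 1: "kp w x0 \<in> Y" using aut_in[OF kp(1)] w x0 by blast
      have "act (k (Some w)) (cpt (kp w x0)) = cpt (k (Some w) (kp w x0))" by (rule act[OF kw 1])
      then show ?thesis using kp(2) w kp(1)[of w] by (simp add: k_def)
    qed
    show ?thesis unfolding Some B_g[OF kw] option.map act[symmetric]
      using inj_eq[OF permutes_inj[OF act_permutes[OF kw]]] by (cases "B x") auto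
  qed (simp add: k_def)
  have "(\<lambda>x. k (B x) x) \<in> H"
  proof (rule glue_aut[where B = B and k = k and s = "map_option s"])
    show "k (B x) \<in> aut f UNIV" for x using aut_UNIV[OF kH] .
    show "B (k (B y) x) = map_option s (B y) \<longleftrightarrow> B x = B y" for x y by (rule Bk)
    show "map_option s (B x) = map_option s (B y) \<Longrightarrow> B x = B y" for x y
      using inj_eq[OF permutes_inj[OF s]] by (cases "B x"; cases "B y") auto
    show "\<exists>x. map_option s (B x) = B y" for y
    proof (cases "B y")
      case None then show ?thesis by (intro exI[of _ y]) simp
    next
      case (Some w)
      then have "pinv s w \<in> W" using BW[OF Some] permutes_in_image[OF permutes_inv[OF s]] by blast
      then obtain z where "z \<in> Y" "pinv s w = cpt z" by (auto simp: W_def)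
      then have "B z = Some (pinv s w)" by (simp add: B_def)
      then show ?thesis using Some permutes_inverses(1)[OF s] by (intro exI[of _ z]) simp
    qed
    show "k (B x) (f x) = k (B (f x)) (f x)" for x by (simp add: B_f)
    show "x \<notin> Y \<Longrightarrow> k (B x) x = x" for x by (simp add: B_def k_def)
  qed
  moreover have "(\<lambda>x. k (B x) x) = lift s" by (auto simp: lift_def k_def B_def fun_eq_iff)
  ultimately show ?thesis by simp
qed

lemma act_lift: assumes s: "s permutes W" shows "act (lift s) = s"
proof
  fix w show "act (lift s) w = s w"
  proof (cases "w \<in> W")
    case True
    then obtain y where "y \<in> Y" "w = cpt y" by (auto simp: W_def)
    then show ?thesis using act[OF lift[OF s]] lift_comp_Y(2)[OF s] by simp
  next
    case False
    then show ?thesis using permutes_not_in[OF s] by (simp add: act_def restr_def)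
  qed
qed

definition "lc g w = restr (pinv (kp (act g w)) \<circ> g \<circ> kp w) K"

lemma lc_in: assumes g: "g \<in> H" and w: "w \<in> W" and x: "x \<in> K"
  shows "(pinv (kp (act g w)) \<circ> g \<circ> kp w) x \<in> K"
proof -
  have 1: "cpt (kp w x) = w" "kp w x \<in> Y" using kp_comp[OF w x] .
  then have "cpt (g (kp w x)) = act g w" using act[OF g 1(2)] by simp
  moreover have "g (kp w x) \<in> Y" using aut_in[OF g] 1(2) by simp
  ultimately show ?thesis using kp_comp'[of "g (kp w x)"] by simp
qed

lemma lc_aut: assumes g: "g \<in> H" and w: "w \<in> W" shows "lc g w \<in> aut f K"
proof -
  let ?h = "pinv (kp (act g w)) \<circ> g \<circ> kp w"
  have h: "?h \<in> H" using kp(1)[OF act_W[OF g w]] kp(1)[OF w] g by (intro aut_comp aut_inv)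
  have hx: "cpt (?h x0) = K" using lc_in[OF g w, of x0] by (simp add: K_def cpt_mem)
  have "?h x \<in> K \<longleftrightarrow> x \<in> K" for x
  proof -
    have "?h x \<in> K \<longleftrightarrow> cpt (?h x) = cpt (?h x0)" unfolding hx by (simp only: K_def cpt_mem)
    also have "\<dots> \<longleftrightarrow> x \<in> K" unfolding cpt_eq conn_img[OF h] K_def cpt_mem ..
    finally show ?thesis .
  qed
  moreover have "f x \<in> K \<longleftrightarrow> x \<in> K" for x by (simp add: K_def cpt_mem cpt_f)
  ultimately have "(\<lambda>x. if x \<in> K then ?h x else x) \<in> aut f K"
    by (intro glue_restrict aut_UNIV[OF h]) auto
  then show ?thesis by (simp add: lc_def restr_def[abs_def])
qed

text \<open>The cocycle rule of a wreath product.\<close>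

lemma lc_comp: assumes g: "g \<in> H" and h: "h \<in> H" and w: "w \<in> W"
  shows "lc (g \<circ> h) w = lc g (act h w) \<circ> lc h w"
proof
  fix x show "lc (g \<circ> h) w x = (lc g (act h w) \<circ> lc h w) x"
  proof (cases "x \<in> K")
    case True
    then show ?thesis using lc_in[OF h w True] act_comp[OF g h]
      by (simp add: lc_def restr_def aut_inv_r[OF kp(1)[OF act_W[OF h w]]])
  qed (simp add: lc_def restr_def)
qed

lemma lc_lift: assumes s: "s permutes W" and w: "w \<in> W" shows "lc (lift s) w = id"
proof
  fix x show "lc (lift s) w x = id x"
  proof (cases "x \<in> K")
    case True
    have sw: "s w \<in> W" using permutes_in_image[OF s] w by simp
    have "lift s (kp w x) = kp (s w) x" using kp_comp[OF w True] kp(1)[OF w] by (simp add: lift_def)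
    then show ?thesis using True kp(1)[OF sw] by (simp add: lc_def restr_def act_lift[OF s])
  qed (simp add: lc_def restr_def)
qed

lemma act_local: assumes g: "g \<in> aut f K" shows "act g = id"
proof
  fix w
  have gH: "g \<in> H" using g K_Y by (rule aut_mono')
  show "act g w = id w"
  proof (cases "w \<in> W")
    case True
    then obtain y where y: "y \<in> Y" "w = cpt y" by (auto simp: W_def)
    have "cpt (g y) = cpt y"
    proof (cases "y \<in> K")
      case True
      then have "g y \<in> K" using aut_in[OF g] by simp
      then show ?thesis using True by (simp add: K_def cpt_mem)
    qed (simp add: aut_out[OF g])
    then show ?thesis using act[OF gH y(1)] y by simp
  qed (simp add: act_def restr_def)
qed

lemma lc_local: assumes g: "g \<in> aut f K" and w: "w \<in> W"
  shows "lc g w = (if w = K then g else id)"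
proof
  fix x
  show "lc g w x = (if w = K then g else id) x"
  proof (cases "x \<in> K")
    case True
    have "kp w x \<notin> K" if "w \<noteq> K" using kp_comp(1)[OF w True] that by (auto simp: K_def cpt_mem)
    then show ?thesis using True aut_out[OF g] kp(1)[OF w] by (auto simp: lc_def restr_def act_local[OF g] kp_K)
  next
    case False
    then show ?thesis using aut_out[OF g] by (simp add: lc_def restr_def)
  qed
qed

text \<open>Two kinds of invariants survive in a finite wreath product: the sign of the permutation
  of the copies, if there are at least two, and the sums of the local invariants over all copies. In
  the kernel, one commutator accounts for the permutation, another one moves all local coordinates
  into the copy \<open>K\<close>, and the hypothesis on \<open>K\<close> contributes the remaining
  \<open>N\<close>.\<close>

lemma cyclic_ab_finite:
  fixes I :: "'j set"
  assumes fin: "finite W" and cyclic_ab: "cyclic_ab f K N I n"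
  shows "cyclic_ab f Y (N + 2) (insert None (Some ` I)) (\<lambda>i. case i of None \<Rightarrow> if card W \<ge> 2 then 2 else 1 | Some i \<Rightarrow> n i)"
proof -
  obtain \<Phi> :: "('x \<Rightarrow> 'x) \<Rightarrow> 'j \<Rightarrow> int" where \<Phi>:
    "\<And>g h i. g \<in> aut f K \<Longrightarrow> h \<in> aut f K \<Longrightarrow> i \<in> I \<Longrightarrow> int (n i) dvd \<Phi> (g \<circ> h) i - (\<Phi> g i + \<Phi> h i)"
    "\<And>t. \<exists>g\<in>aut f K. \<forall>i\<in>I. int (n i) dvd \<Phi> g i - t i"
    "\<And>g. g \<in> aut f K \<Longrightarrow> \<forall>i\<in>I. int (n i) dvd \<Phi> g i \<Longrightarrow> g \<in> comm_prods (aut f K) N"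
    using cyclic_ab unfolding cyclic_ab_def by blast
  define \<Psi> where "\<Psi> g i = (\<Sum>w\<in>W. \<Phi> (lc g w) i)" for g i
  have \<Phi>_id: "int (n i) dvd \<Phi> id i" if "i \<in> I" for i
    using \<Phi>(1)[OF aut_id aut_id that] by simp
  have \<Psi>_comp: "int (n i) dvd \<Psi> (g \<circ> h) i - (\<Psi> g i + \<Psi> h i)" if g: "g \<in> H" and h: "h \<in> H" and i: "i \<in> I" for g h i
  proof -
    \<comment> \<open>Reindexing by \<open>act h\<close> absorbs the shifted argument in the cocycle
      rule.\<close>
    have "\<Psi> g i = (\<Sum>w\<in>W. \<Phi> (lc g (act h w)) i)"
      unfolding \<Psi>_def using sum.permute[OF act_permutes[OF h], of "\<lambda>w. \<Phi> (lc g w) i"] by simp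
    then have "\<Psi> (g \<circ> h) i - (\<Psi> g i + \<Psi> h i)
        = (\<Sum>w\<in>W. \<Phi> (lc (g \<circ> h) w) i - (\<Phi> (lc g (act h w)) i + \<Phi> (lc h w) i))"
      by (simp add: \<Psi>_def sum_subtractf sum.distrib)
    also have "int (n i) dvd \<dots>"
    proof (rule dvd_sum)
      fix w assume w: "w \<in> W"
      show "int (n i) dvd \<Phi> (lc (g \<circ> h) w) i - (\<Phi> (lc g (act h w)) i + \<Phi> (lc h w) i)"
        unfolding lc_comp[OF g h w] by (rule \<Phi>(1)[OF lc_aut[OF g act_W[OF h w]] lc_aut[OF h w] i])
    qed
    finally show ?thesis .
  qed
  have \<Psi>_lift: "int (n i) dvd \<Psi> (lift s) i" if "s permutes W" "i \<in> I" for s i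
    unfolding \<Psi>_def by (rule dvd_sum) (simp only: lc_lift[OF that(1)] \<Phi>_id[OF that(2)])
  have \<Psi>_local: "int (n i) dvd \<Psi> g i - \<Phi> g i" if g: "g \<in> aut f K" and i: "i \<in> I" for g i
  proof -
    have "\<Psi> g i = \<Phi> (lc g K) i + (\<Sum>w\<in>W - {K}. \<Phi> (lc g w) i)" unfolding \<Psi>_def by (rule sum.remove[OF fin K_W])
    moreover have "lc g K = g" using lc_local[OF g K_W] by simp
    ultimately have "\<Psi> g i - \<Phi> g i = (\<Sum>w\<in>W - {K}. \<Phi> (lc g w) i)" by simp
    also have "int (n i) dvd \<dots>"
    proof (rule dvd_sum)
      fix w assume w: "w \<in> W - {K}"
      then have "lc g w = id" using lc_local[OF g, of w] by simp
      then show "int (n i) dvd \<Phi> (lc g w) i" using \<Phi>_id[OF i] by (simp only:)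
    qed
    finally show ?thesis .
  qed
  have \<Psi>_add: "int (n i) dvd \<Psi> (g \<circ> h) i \<longleftrightarrow> int (n i) dvd \<Psi> h i"
    if "g \<in> H" "h \<in> H" "i \<in> I" "int (n i) dvd \<Psi> g i" for g h i
  proof -
    have "int (n i) dvd (\<Psi> (g \<circ> h) i - (\<Psi> g i + \<Psi> h i)) + \<Psi> g i" using \<Psi>_comp[OF that(1,2,3)] that(4) by (rule dvd_add)
    then have "int (n i) dvd \<Psi> (g \<circ> h) i - \<Psi> h i" by simp
    then show ?thesis by (metis dvd_diff_right_iff dvd_diff_left_iff)
  qed
  have \<Psi>_id: "int (n i) dvd \<Psi> id i" if "i \<in> I" for i
    using \<Psi>_comp[OF aut_id aut_id that] by simp
  have \<Psi>_commutator: "int (n i) dvd \<Psi> (commutator a b) i" if a: "a \<in> H" and b: "b \<in> H" and i: "i \<in> I" for a b i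
  proof -
    have ai: "pinv a \<in> H" and bi: "pinv b \<in> H" using a b by (auto intro: aut_inv)
    have 1: "int (n i) dvd \<Psi> id i - (\<Psi> a i + \<Psi> (pinv a) i)" using \<Psi>_comp[OF a ai i] a by (simp only: aut_pinv_o)
    have 2: "int (n i) dvd \<Psi> id i - (\<Psi> b i + \<Psi> (pinv b) i)" using \<Psi>_comp[OF b bi i] b by (simp only: aut_pinv_o)
    note 3 = \<Psi>_comp[OF a b i] \<Psi>_comp[OF aut_comp[OF a b] ai i] \<Psi>_comp[OF aut_comp[OF aut_comp[OF a b] ai] bi i]
    have "\<Psi> (commutator a b) i = (\<Psi> (a \<circ> b) i - (\<Psi> a i + \<Psi> b i)) + (\<Psi> (a \<circ> b \<circ> pinv a) i - (\<Psi> (a \<circ> b) i + \<Psi> (pinv a) i))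
      + (\<Psi> (commutator a b) i - (\<Psi> (a \<circ> b \<circ> pinv a) i + \<Psi> (pinv b) i))
      - (\<Psi> id i - (\<Psi> a i + \<Psi> (pinv a) i)) - (\<Psi> id i - (\<Psi> b i + \<Psi> (pinv b) i)) + \<Psi> id i + \<Psi> id i" by linarith
    then show ?thesis using 1 2 3 \<Psi>_id[OF i] by (metis dvd_add dvd_diff)
  qed
  have perm: "permutation (act g)" if "g \<in> H" for g using act_permutes[OF that] fin by (auto simp: permutation_permutes)
  define \<Theta> where "\<Theta> g i = (case i of None \<Rightarrow> if evenperm (act g) then 0 else 1 | Some i \<Rightarrow> \<Psi> g i)" for g i
  show ?thesis unfolding cyclic_ab_def
  proof (intro exI[of _ \<Theta>] conjI ballI allI impI)
    fix g h i assume g: "g \<in> H" and h: "h \<in> H" and i: "i \<in> insert None (Some ` I)"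
    have "evenperm (act (g \<circ> h)) = (evenperm (act g) = evenperm (act h))"
      unfolding act_comp[OF g h] by (rule evenperm_comp[OF perm[OF g] perm[OF h]])
    then show "int (case i of None \<Rightarrow> if card W \<ge> 2 then 2 else 1 | Some i \<Rightarrow> n i) dvd \<Theta> (g \<circ> h) i - (\<Theta> g i + \<Theta> h i)"
      using i \<Psi>_comp[OF g h] by (auto simp: \<Theta>_def)
  next
    fix t :: "'j option \<Rightarrow> int"
    obtain g0 where g0: "g0 \<in> aut f K" "\<And>i. i \<in> I \<Longrightarrow> int (n i) dvd \<Phi> g0 i - t (Some i)"
      using \<Phi>(2)[of "\<lambda>i. t (Some i)"] by blast
    have g0H: "g0 \<in> H" using g0(1) K_Y by (rule aut_mono')
    have "\<exists>s. s permutes W \<and> (card W \<ge> 2 \<longrightarrow> (evenperm s \<longleftrightarrow> even (t None)))"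
    proof (cases "card W \<ge> 2 \<and> odd (t None)")
      case True
      then have "\<not> is_singleton W" by (auto simp: is_singleton_altdef)
      then obtain w where "w \<in> W" "w \<noteq> K" using K_W unfolding is_singleton_def by blast
      then show ?thesis using True K_W by (intro exI[of _ "transpose w K"]) (simp add: permutes_swap_id evenperm_swap)
    next
      case False
      then show ?thesis by (intro exI[of _ id]) auto
    qed
    then obtain s where s: "s permutes W" "card W \<ge> 2 \<Longrightarrow> evenperm s \<longleftrightarrow> even (t None)" by blast
    have gH: "lift s \<circ> g0 \<in> H" using lift[OF s(1)] g0H by (rule aut_comp)
    have "act (lift s \<circ> g0) = s" using act_comp[OF lift[OF s(1)] g0H] act_lift[OF s(1)] act_local[OF g0(1)] by simp
    moreover have "int (n i) dvd \<Psi> (lift s \<circ> g0) i - t (Some i)" if i: "i \<in> I" for i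
    proof -
      have "\<Psi> (lift s \<circ> g0) i - t (Some i) = (\<Psi> (lift s \<circ> g0) i - (\<Psi> (lift s) i + \<Psi> g0 i)) + \<Psi> (lift s) i
        + (\<Psi> g0 i - \<Phi> g0 i) + (\<Phi> g0 i - t (Some i))" by simp
      then show ?thesis
        using \<Psi>_comp[OF lift[OF s(1)] g0H i] \<Psi>_lift[OF s(1) i] \<Psi>_local[OF g0(1) i] g0(2)[OF i] by (metis dvd_add)
    qed
    ultimately show "\<exists>g\<in>H. \<forall>i\<in>insert None (Some ` I). int (case i of None \<Rightarrow> if card W \<ge> 2 then 2 else 1 | Some i \<Rightarrow> n i) dvd \<Theta> g i - t i"
      using gH s(2) by (intro bexI[of _ "lift s \<circ> g0"]) (auto simp: \<Theta>_def)
  next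
    fix g assume g: "g \<in> H"
      and z: "\<forall>i\<in>insert None (Some ` I). int (case i of None \<Rightarrow> if card W \<ge> 2 then 2 else 1 | Some i \<Rightarrow> n i) dvd \<Theta> g i"
    have \<Psi>g: "int (n i) dvd \<Psi> g i" if "i \<in> I" for i using z that by (force simp: \<Theta>_def)
    have even: "evenperm (act g)"
    proof (cases "card W \<ge> 2")
      case True
      have "int (if card W \<ge> 2 then 2 else 1) dvd \<Theta> g None" using z by force
      then show ?thesis using True by (auto simp: \<Theta>_def split: if_splits)
    next
      case False
      then have "card W = 1" using fin K_W card_gt_0_iff[of W] by auto
      then obtain w where "W = {w}" by (auto simp: card_1_singleton_iff)
      then have "act g = id" using act_permutes[OF g] by simp
      then show ?thesis by simp
    qed
    \<comment> \<open>The cycle \<open>c\<close> is used twice: to write \<open>act g\<close> as a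
      commutator, and later to carry local coordinates around the copies.\<close>
    obtain c where c: "c permutes W" "single_orbit c W" "single_orbit (act g \<circ> c) W"
      using even_factor_long_cycles[OF fin act_permutes[OF g] even] by blast
    obtain r where r: "r permutes W" "r \<circ> c = (act g \<circ> c) \<circ> r"
      using single_orbit_conj[OF c(1,2) permutes_compose[OF c(1) act_permutes[OF g]] c(3)] by blast
    define e where "e = commutator (lift r) (lift c)"
    note lr = lift[OF r(1)] and lcc = lift[OF c(1)]
    have e: "e \<in> H" unfolding e_def by (intro aut_comp aut_inv lr lcc)
    have act_e: "act e = act g"
    proof -
      have "e \<circ> lift c \<circ> lift r = lift r \<circ> lift c"
        by (auto simp: e_def fun_eq_iff aut_inv_l[OF lr] aut_inv_l[OF lcc])
      then have "act (e \<circ> lift c \<circ> lift r) = act (lift r \<circ> lift c)" by simp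
      then have "act e \<circ> c \<circ> r = act g \<circ> c \<circ> r"
        by (simp only: act_comp aut_comp e lr lcc act_lift[OF r(1)] act_lift[OF c(1)] r(2))
      then have "act e (c (r w)) = act g (c (r w))" for w by (metis comp_apply)
      then have "act e (c (r (pinv r (pinv c w)))) = act g (c (r (pinv r (pinv c w))))" for w .
      then show ?thesis by (auto simp: permutes_inverses[OF r(1)] permutes_inverses[OF c(1)])
    qed
    define g' where "g' = pinv e \<circ> g"
    have g': "g' \<in> H" unfolding g'_def by (intro aut_comp aut_inv e g)
    have eg': "e \<circ> g' = g" unfolding g'_def using e by (simp add: comp_assoc[symmetric])
    have "act e \<circ> act g' = act e" using act_comp[OF e g'] act_e unfolding eg' by simp
    then have act_g': "act g' = id" using inj_eq[OF permutes_inj[OF act_permutes[OF e]]] by (auto simp: fun_eq_iff)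
    have \<Psi>g': "int (n i) dvd \<Psi> g' i" if "i \<in> I" for i
      using \<Psi>_add[OF e g' that] \<Psi>_commutator[OF lr lcc that] \<Psi>g[OF that] unfolding eg' e_def[symmetric] by blast
    \<comment> \<open>The recursion solves
      \<open>h \<circ> lift c = g' \<circ> lift c \<circ> h\<close> copy by copy along the cycle,
      starting with the identity on \<open>K\<close>. It closes up except at the last copy, whose
      successor is \<open>K\<close>. So the commutator of \<open>h\<close> and \<open>lift c\<close>
      agrees with \<open>g'\<close> off \<open>K\<close>, and the whole defect
      \<open>\<delta>\<close> is supported on \<open>K\<close>.\<close>
    define P where "P = rec_nat id (\<lambda>_ p. g' \<circ> lift c \<circ> p \<circ> pinv (lift c))"
    have P0: "P 0 = id" and PS: "P (Suc i) = g' \<circ> lift c \<circ> P i \<circ> pinv (lift c)" for i by (simp_all add: P_def)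
    have PH: "P i \<in> H" for i
    proof (induction i)
      case 0 show ?case unfolding P0 by (rule aut_id)
    next
      case (Suc i) show ?case unfolding PS by (intro aut_comp aut_inv g' lcc Suc)
    qed
    have actP: "act (P i) = id" for i
    proof (induction i)
      case 0 show ?case unfolding P0 by (rule act_id)
    next
      case (Suc i)
      have "P (Suc i) \<circ> lift c = g' \<circ> (lift c \<circ> P i)" unfolding PS by (auto simp: fun_eq_iff aut_inv_l[OF lcc])
      then have "act (P (Suc i)) \<circ> act (lift c) = act g' \<circ> (act (lift c) \<circ> act (P i))"
        unfolding act_comp[OF PH lcc, symmetric] act_comp[OF lcc PH, symmetric] act_comp[OF g' aut_comp[OF lcc PH], symmetric]
        by (rule arg_cong)
      then have "act (P (Suc i)) \<circ> c = c" unfolding act_lift[OF c(1)] act_g' Suc by (simp only: id_comp comp_id)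
      then have "act (P (Suc i)) (c (pinv c w)) = c (pinv c w)" for w by (metis comp_apply)
      then show ?case by (auto simp: permutes_inverses[OF c(1)])
    qed
    define ix where "ix w = (LEAST i. (c ^^ i) K = w)" for w
    have cW: "c w \<in> W" if "w \<in> W" for w using permutes_in_image[OF c(1)] that by simp
    have ix: "(c ^^ ix w) K = w" if w: "w \<in> W" for w
    proof -
      obtain i where "(c ^^ i) K = w" by (rule single_orbitE[OF c(2) K_W w])
      then show ?thesis unfolding ix_def by (rule LeastI)
    qed
    have ix_lt: "ix w < card W" if "w \<in> W" for w
    proof -
      have "(c ^^ card W) K = K" using single_orbit_funpow_eq_iff(1)[OF c(2) cW K_W, where i = "card W"] by simp
      then have "(c ^^ (ix w mod card W)) K = w" using funpow_mod_eq[where f = c and n = "card W" and x = K and m = "ix w"] ix[OF that] by simp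
      then have "ix w \<le> ix w mod card W" unfolding ix_def[of w] by (rule Least_le)
      moreover have "0 < card W" using fin K_W card_gt_0_iff by blast
      ultimately show ?thesis using mod_less_divisor[of "card W" "ix w"] by linarith
    qed
    have ix_eq: "ix ((c ^^ i) K) = i" if "i < card W" for i
    proof -
      have iW: "(c ^^ i) K \<in> W" by (rule funpow_in[OF cW K_W])
      have le: "ix ((c ^^ i) K) \<le> i" unfolding ix_def by (rule Least_le) simp
      have "(c ^^ ix ((c ^^ i) K)) K = (c ^^ i) K" by (rule ix[OF iW])
      then have "card W dvd i - ix ((c ^^ i) K)"
        using single_orbit_funpow_cong[OF c(2) cW permutes_inj[OF c(1)] K_W le] by simp
      then have "i - ix ((c ^^ i) K) = 0" using that by (meson dvd_imp_le less_imp_diff_less not_le gr0I)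
      then show ?thesis using le by simp
    qed
    define h where "h x = (case B x of None \<Rightarrow> x | Some w \<Rightarrow> P (ix w) x)" for x
    have BP: "B (P i x) = B x" for i x using B_g[OF PH, of i x] actP[of i] by (simp add: option.map_id)
    have hH: "h \<in> H"
    proof -
      define k where "k b = (case b of None \<Rightarrow> id | Some w \<Rightarrow> P (ix w))" for b
      have kH: "k b \<in> H" for b
      proof (cases b)
        case None
        then have "k b = id" by (simp add: k_def)
        then show ?thesis using aut_id by (simp only:)
      qed (simp add: k_def PH)
      have Bk: "B (k b x) = B x" for b x by (cases b) (simp_all add: k_def BP)
      have "(\<lambda>x. k (B x) x) \<in> H"
      proof (rule glue_aut[where B = B and k = k and s = "\<lambda>b. b"])
        show "k (B x) \<in> aut f UNIV" for x using aut_UNIV[OF kH] .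
        show "B (k (B y) x) = B y \<longleftrightarrow> B x = B y" for x y by (simp only: Bk)
        show "\<exists>x. B x = B y" for y by blast
        show "k (B x) (f x) = k (B (f x)) (f x)" for x by (simp add: B_f)
        show "x \<notin> Y \<Longrightarrow> k (B x) x = x" for x by (simp add: k_def B_def)
      qed simp
      moreover have "(\<lambda>x. k (B x) x) = h" by (auto simp: h_def k_def fun_eq_iff split: option.splits)
      ultimately show ?thesis by simp
    qed
    have Bh: "B (h x) = B x" for x by (cases "B x") (simp_all add: h_def BP)
    define \<delta> where "\<delta> = pinv (commutator h (lift c)) \<circ> g'"
    have cH: "commutator h (lift c) \<in> H" by (intro aut_comp aut_inv hH lcc)
    have \<delta>H: "\<delta> \<in> H" unfolding \<delta>_def by (intro aut_comp aut_inv[OF cH] g')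
    have main: "commutator h (lift c) x = g' x" if x: "x \<in> Y" "x \<notin> K" for x
    proof -
      have wW: "cpt x \<in> W" using W_I[OF x(1)] .
      have "cpt x \<noteq> K" using x(2) by (auto simp: K_def cpt_mem)
      then have "ix (cpt x) \<noteq> 0" using ix[OF wW] by (cases "ix (cpt x)") auto
      then obtain i where i: "ix (cpt x) = Suc i" by (cases "ix (cpt x)") auto
      have iN: "Suc i < card W" using ix_lt[OF wW] i by simp
      define y where "y = pinv (lift c) x"
      define z where "z = pinv h y"
      have lcy: "lift c y = x" unfolding y_def by (rule aut_inv_r[OF lcc])
      have hz: "h z = y" unfolding z_def by (rule aut_inv_r[OF hH])
      have yY: "y \<in> Y" using aut_in[OF lcc, of y] lcy x(1) by simp
      have "c (cpt y) = c ((c ^^ i) K)" using lift_comp_Y(2)[OF c(1) yY] lcy ix[OF wW] i by simp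
      then have cy: "cpt y = (c ^^ i) K" using inj_eq[OF permutes_inj[OF c(1)]] by simp
      have Bz: "B z = Some ((c ^^ i) K)" using Bh[of z] hz yY cy by (simp add: B_def)
      have hPz: "h z = P i z" using Bz ix_eq[of i] iN by (simp add: h_def)
      have zY: "z \<in> Y" using Bz by (auto simp: B_def split: if_splits)
      have "B (lift c z) = Some ((c ^^ Suc i) K)" using B_g[OF lcc, of z] Bz act_lift[OF c(1)] by simp
      then have "h (lift c z) = P (Suc i) (lift c z)" using ix_eq[OF iN] by (simp add: h_def)
      also have "\<dots> = g' (lift c (P i z))" unfolding PS by (simp add: aut_inv_l[OF lcc])
      also have "\<dots> = g' x" unfolding hPz[symmetric] hz lcy ..
      finally show ?thesis unfolding z_def y_def by simp
    qed
    have "\<delta> x = x" if "x \<notin> K" for x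
    proof (cases "x \<in> Y")
      case True
      have "\<delta> x = pinv (commutator h (lift c)) (commutator h (lift c) x)"
        unfolding main[OF True that] \<delta>_def by (rule comp_apply)
      also have "\<dots> = x" by (rule aut_inv_l[OF cH])
      finally show ?thesis .
    qed (rule aut_out[OF \<delta>H])
    then have \<delta>K: "\<delta> \<in> aut f K" by (rule aut_restrict[OF \<delta>H])
    have c\<delta>: "commutator h (lift c) \<circ> \<delta> = g'" unfolding \<delta>_def using cH by (simp only: comp_assoc[symmetric] aut_pinv_o id_comp)
    have "int (n i) dvd \<Phi> \<delta> i" if i: "i \<in> I" for i
    proof -
      have "int (n i) dvd \<Psi> \<delta> i"
        using \<Psi>_add[OF cH \<delta>H i \<Psi>_commutator[OF hH lcc i]] \<Psi>g'[OF i] unfolding c\<delta> by blast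
      then show ?thesis using \<Psi>_local[OF \<delta>K i] by (metis dvd_diff_right_iff)
    qed
    then have "\<delta> \<in> comm_prods (aut f K) N" using \<Phi>(3)[OF \<delta>K] by blast
    then have "\<delta> \<in> comm_prods H N" using comm_prods_mono[OF aut_mono[OF K_Y]] by blast
    then have "g' \<in> comm_prods H (Suc N)" unfolding c\<delta>[symmetric] by (rule comm_prods_SucI[OF hH lcc])
    then have "e \<circ> g' \<in> comm_prods H (Suc (Suc N))" unfolding e_def by (rule comm_prods_SucI[OF lr lcc])
    then show "g \<in> comm_prods H (N + 2)" unfolding eg' by simp
  qed
qed

end

text \<open>The pieces are the orbits of components under the whole group. An infinite family of
  copies costs two commutators, a finite one \<open>3 + 2\<close>.\<close>

theorem cyclic_ab_total:
  fixes f :: "'x \<Rightarrow> 'x"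
  assumes fX: "\<And>x. x \<in> X \<Longrightarrow> f x \<in> X" and fO: "\<And>x. x \<notin> X \<Longrightarrow> f x = x"
  shows "\<exists>I n. cyclic_ab f X 5 (I :: ('x \<times> (nat \<times> 'x set) option) set) n"
proof -
  let ?H = "aut f X"
  have fX_iff: "f x \<in> X \<longleftrightarrow> x \<in> X" for x using fX fO by metis
  have pX: "(f ^^ i) x \<in> X \<longleftrightarrow> x \<in> X" for i x by (induction i) (simp_all add: fX_iff)
  have cX: "z \<in> X" if "y \<in> X" "conn f y z" for y z using that pX unfolding conn_def by metis
  define rel where "rel x y \<longleftrightarrow> x \<in> X \<and> (\<exists>g\<in>?H. conn f (g x) y)" for x y
  have rel_refl: "rel x x" if "x \<in> X" for x unfolding rel_def using that conn_refl by (auto intro!: bexI[of _ id])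
  have rel_X: "y \<in> X" if "rel x y" for x y
    using that cX aut_in unfolding rel_def by metis
  have rel_sym: "rel y x" if r: "rel x y" for x y
  proof -
    obtain g where g: "g \<in> ?H" "conn f (g x) y" using r unfolding rel_def by blast
    then have "conn f (pinv g y) x" using conn_aut[OF aut_inv[OF g(1)] g(2)] conn_sym by fastforce
    then show ?thesis using rel_X[OF r] aut_inv[OF g(1)] unfolding rel_def by blast
  qed
  have rel_trans: "rel x z" if r: "rel x y" "rel y z" for x y z
  proof -
    obtain g where g: "g \<in> ?H" "conn f (g x) y" using r(1) unfolding rel_def by blast
    obtain h where h: "h \<in> ?H" "conn f (h y) z" using r(2) unfolding rel_def by blast
    have "conn f ((h \<circ> g) x) z" using conn_trans[OF conn_aut[OF h(1) g(2)] h(2)] by simp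
    then show ?thesis using r(1) aut_comp[OF h(1) g(1)] unfolding rel_def by blast
  qed
  \<comment> \<open>Related points have the same predicate \<open>rel x\<close>, so the choice
    depends only on the class and can serve as its label.\<close>
  define q where "q x = (SOME y. rel x y)" for x
  have q: "rel x (q x)" if "x \<in> X" for x unfolding q_def by (rule someI[of _ x]) (rule rel_refl[OF that])
  have q_eq: "q x = q y" if "rel x y" for x y
  proof -
    have "rel x = rel y" using that rel_sym rel_trans by (intro ext) blast
    then show ?thesis by (simp add: q_def)
  qed
  define B where "B x = (if x \<in> X then Some (q x) else None)" for x
  have Bf: "B (f x) = B x" for x
  proof (cases "x \<in> X")
    case True
    have "conn f (id x) (f x)" using conn_pow[of f x 1] by simp
    then have "rel x (f x)" unfolding rel_def using True by (intro conjI bexI[of _ id]) simp_all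
    then show ?thesis using True fX q_eq by (simp add: B_def)
  next
    case False then show ?thesis by (simp add: fO)
  qed
  have dp: "disjoint_pieces f B" by (rule disjoint_pieces.intro) (simp add: Bf)
  interpret D: disjoint_pieces f B by (rule dp)
  have DX: "D.D = X" by (auto simp: D.D_def B_def)
  have Bg: "B (g x) = B x" if g: "g \<in> ?H" for g x
  proof (cases "x \<in> X")
    case True
    moreover have "conn f (g x) (g x)" by (rule conn_refl)
    ultimately have "rel x (g x)" unfolding rel_def using g by blast
    then show ?thesis using True aut_in[OF g, of x] q_eq[of x "g x"] by (simp add: B_def)
  next
    case False then show ?thesis using aut_out[OF g] by simp
  qed
  have "\<exists>I n. cyclic_ab f (D.piece c) 5 (I :: (nat \<times> 'x set) option set) n" for c
  proof (cases "D.piece c = {}")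
    case True
    have "cyclic_ab f {} 5 ({} :: (nat \<times> 'x set) option set) (\<lambda>_. 0)" unfolding cyclic_ab_def
    proof (intro exI[of _ "\<lambda>_ _. 0"] conjI ballI allI impI)
      show "\<exists>g\<in>aut f {}. \<forall>i\<in>{}. int 0 dvd 0 - t i" for t :: "(nat \<times> 'x set) option \<Rightarrow> int" using aut_id by blast
      fix g assume "g \<in> aut f {}"
      then have g: "g = id" by (auto simp: aut_def)
      show "g \<in> comm_prods (aut f {}) 5" unfolding g by (rule id_in_comm_prods[OF aut_id])
    qed simp
    then show ?thesis unfolding True by blast
  next
    case False
    then obtain x0 where x0: "x0 \<in> D.piece c" by blast
    have piece: "D.piece c = {y. rel x0 y}"
    proof -
      have c: "x0 \<in> X" "q x0 = c" using x0 by (auto simp: D.piece_def B_def split: if_splits)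
      show ?thesis
      proof (intro equalityI subsetI)
        fix y assume "y \<in> D.piece c"
        then have "y \<in> X" "q y = c" by (auto simp: D.piece_def B_def split: if_splits)
        then show "y \<in> {y. rel x0 y}" using q[of y] q[OF c(1)] c(2) rel_sym rel_trans by (metis mem_Collect_eq)
      next
        fix y assume "y \<in> {y. rel x0 y}"
        then show "y \<in> D.piece c" using q_eq[of x0 y] rel_X[of x0 y] c(2) by (simp add: D.piece_def B_def)
      qed
    qed
    interpret C: copies f "D.piece c" x0
    proof
      show "x0 \<in> D.piece c" by (rule x0)
      show "z \<in> D.piece c" if "y \<in> D.piece c" "conn f y z" for y z
      proof -
        have "rel x0 y" using that(1) unfolding piece by simp
        moreover have "rel y z" unfolding rel_def using rel_X[OF \<open>rel x0 y\<close>] that(2) by (intro conjI bexI[of _ id]) simp_all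
        ultimately show ?thesis unfolding piece using rel_trans by blast
      qed
      show "\<exists>g\<in>aut f (D.piece c). conn f (g x0) y" if "y \<in> D.piece c" for y
      proof -
        have "\<exists>g\<in>?H. conn f (g x0) y" using that unfolding piece rel_def by blast
        then obtain g where g: "g \<in> ?H" "conn f (g x0) y" by blast
        have "restr g (D.piece c) \<in> aut f (D.piece c)"
          by (rule D.restr_piece[OF aut_UNIV[OF g(1)] Bg[OF g(1)]]) (simp add: Bf)
        moreover have "restr g (D.piece c) x0 = g x0" using x0 by (simp add: restr_def)
        ultimately show ?thesis using g(2) by (intro bexI[of _ "restr g (D.piece c)"]) simp_all
      qed
    qed
    show ?thesis
    proof (cases "finite C.W")
      case True
      have "\<exists>I n. cyclic_ab f C.K 3 (I :: (nat \<times> 'x set) set) n"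
        by (rule cyclic_ab_component) (simp add: C.K_def C.cpt_def)
      then obtain I :: "(nat \<times> 'x set) set" and n where "cyclic_ab f C.K 3 I n" by blast
      from C.cyclic_ab_finite[OF True this] show ?thesis by auto
    next
      case False
      have "cyclic_ab f (D.piece c) 2 ({} :: (nat \<times> 'x set) option set) (\<lambda>_. 0)" by (rule C.cyclic_ab_infinite[OF False])
      then have "cyclic_ab f (D.piece c) 5 ({} :: (nat \<times> 'x set) option set) (\<lambda>_. 0)" by (rule cyclic_ab_le) simp
      then show ?thesis by blast
    qed
  qed
  then have "\<forall>c. \<exists>p. cyclic_ab f (D.piece c) 5 (fst p :: (nat \<times> 'x set) option set) (snd p)" by (metis fst_conv snd_conv)
  from choice[OF this] obtain p :: "'x \<Rightarrow> (nat \<times> 'x set) option set \<times> ((nat \<times> 'x set) option \<Rightarrow> nat)" where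
    p: "\<And>c. cyclic_ab f (D.piece c) 5 (fst (p c)) (snd (p c))" by blast
  have "cyclic_ab f D.D 5 {(c, i). i \<in> fst (p c)} (\<lambda>(c, i). snd (p c) i)"
    by (rule cyclic_ab_pieces[OF dp _ _ p]) (use Bg Bf DX in simp_all)
  then show ?thesis unfolding DX by blast
qed

section \<open>Products of cyclic groups\<close>

text \<open>A description uniform in \<open>n\<close>: as \<open>x mod 0 = x\<close>, modulus 0
  gives all integers.\<close>

lemma carrier_integer_mod_group_iff: "x \<in> carrier (integer_mod_group n) \<longleftrightarrow> x mod int n = x"
proof (cases "n = 0")
  case False
  then have "x mod int n = x \<longleftrightarrow> 0 \<le> x \<and> x < int n"
    using pos_mod_bound[of "int n" x] pos_mod_sign[of "int n" x] mod_pos_pos_trivial[of x "int n"] by linarith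
  then show ?thesis using False by (simp add: carrier_integer_mod_group)
qed (simp add: carrier_integer_mod_group)

lemma cyclic_group_iso_integer_mod_group:
  assumes "group C" "cyclic_group C"
  shows "\<exists>m. integer_mod_group m \<cong> C"
proof -
  interpret C: group C by fact
  obtain x where x: "x \<in> carrier C" "carrier C = range (\<lambda>n :: int. x [^]\<^bsub>C\<^esub> n)"
    using assms(2) unfolding C.cyclic_group by blast
  define m where "m = C.ord x"
  have eq: "x [^]\<^bsub>C\<^esub> a = x [^]\<^bsub>C\<^esub> b \<longleftrightarrow> a mod int m = b mod int m" for a b :: int
    unfolding C.int_pow_eq[OF x(1)] m_def mod_eq_dvd_iff by (simp add: dvd_diff_commute)
  have "(\<lambda>k :: int. x [^]\<^bsub>C\<^esub> k) \<in> iso (integer_mod_group m) C"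
  proof (intro isoI homI)
    fix a b assume "a \<in> carrier (integer_mod_group m)" "b \<in> carrier (integer_mod_group m)"
    have "x [^]\<^bsub>C\<^esub> ((a + b) mod int m) = x [^]\<^bsub>C\<^esub> (a + b)" unfolding eq by simp
    then show "x [^]\<^bsub>C\<^esub> (a \<otimes>\<^bsub>integer_mod_group m\<^esub> b) = x [^]\<^bsub>C\<^esub> a \<otimes>\<^bsub>C\<^esub> x [^]\<^bsub>C\<^esub> b"
      using x(1) by (simp add: C.int_pow_mult)
  next
    have "inj_on (\<lambda>k :: int. x [^]\<^bsub>C\<^esub> k) (carrier (integer_mod_group m))"
      by (auto simp: inj_on_def eq carrier_integer_mod_group_iff)
    moreover have "x [^]\<^bsub>C\<^esub> k \<in> (\<lambda>k :: int. x [^]\<^bsub>C\<^esub> k) ` carrier (integer_mod_group m)" for k :: int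
      by (rule image_eqI[of _ _ "k mod int m"]) (simp_all add: eq carrier_integer_mod_group_iff)
    ultimately show "bij_betw (\<lambda>k :: int. x [^]\<^bsub>C\<^esub> k) (carrier (integer_mod_group m)) (carrier C)"
      unfolding bij_betw_def using x by auto
  qed (use x(1) in simp)
  then show ?thesis by (blast intro: is_isoI)
qed

text \<open>The common form through which the implications and the changes of witness type run: it
  mentions no type except \<open>'a\<close>. Unneeded indices get \<open>n a = 1\<close>.\<close>

definition int_mod_product :: "('a, 'b) monoid_scheme \<Rightarrow> bool"
  where "int_mod_product G \<longleftrightarrow> (\<exists>n :: 'a \<Rightarrow> nat. G \<cong> product_group UNIV (\<lambda>a. integer_mod_group (n a)))"

text \<open>The nontrivial factors can be indexed by elements of \<open>G\<close>, each factor by its generator.\<close>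

lemma int_mod_product_of_product:
  fixes G :: "('a, 'b) monoid_scheme" and m :: "'i \<Rightarrow> nat"
  assumes "group G" "G \<cong> product_group I (\<lambda>i. integer_mod_group (m i))"
  shows "int_mod_product G"
proof -
  let ?P = "product_group I (\<lambda>i. integer_mod_group (m i))"
  interpret G: group G by fact
  have "?P \<cong> G" using assms(2) by (rule G.iso_sym)
  then obtain \<phi> where \<phi>: "\<phi> \<in> iso ?P G" unfolding is_iso_def by blast
  \<comment> \<open>For moduli other than 1 these unit vectors are distinct elements of the product;
    their images in \<open>G\<close> become the new indices.\<close>
  define d where "d i = (\<lambda>j\<in>I. if j = i then 1 else 0 :: int)" for i
  define J where "J = {i \<in> I. m i \<noteq> 1}"
  have d: "d i \<in> carrier ?P" if "i \<in> J" for i using that by (auto simp: d_def J_def)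
  have d_inj: "i = j" if "i \<in> J" "j \<in> J" "d i = d j" for i j
    using fun_cong[OF that(3), of i] that(1) by (auto simp: d_def J_def split: if_splits)
  define e where "e i = \<phi> (d i)" for i
  have \<phi>_inj: "inj_on \<phi> (carrier ?P)" using \<phi> by (simp add: iso_def bij_betw_def)
  have e_inj: "inj_on e J"
  proof (rule inj_onI)
    fix i j assume "i \<in> J" "j \<in> J" "e i = e j"
    then show "i = j" using inj_onD[OF \<phi>_inj _ d d] d_inj unfolding e_def by blast
  qed
  define n where "n a = (if a \<in> e ` J then m (inv_into J e a) else 1)" for a
  let ?Q = "product_group UNIV (\<lambda>a. integer_mod_group (n a))"
  have ne: "n (e i) = m i" if "i \<in> J" for i using that by (simp add: n_def inv_into_f_f[OF e_inj])
  have n1: "n a = 1" if "a \<notin> e ` J" for a using that by (simp add: n_def)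
  define h where "h x a = (if a \<in> e ` J then x (inv_into J e a) else 0 :: int)" for x a
  have he: "h x (e i) = x i" if "i \<in> J" for x i using that by (simp add: h_def inv_into_f_f[OF e_inj])
  have h0: "h x a = 0" if "a \<notin> e ` J" for x a using that by (simp add: h_def)
  have Pc: "x \<in> carrier ?P \<longleftrightarrow> x \<in> extensional I \<and> (\<forall>i\<in>I. x i mod int (m i) = x i)" for x
    by (simp add: PiE_iff carrier_integer_mod_group_iff) blast
  have Qc: "y \<in> carrier ?Q \<longleftrightarrow> (\<forall>a. y a mod int (n a) = y a)" for y
    by (simp add: PiE_iff carrier_integer_mod_group_iff)
  have hQ: "h x \<in> carrier ?Q" if x: "x \<in> carrier ?P" for x
    unfolding Qc
  proof
    fix a show "h x a mod int (n a) = h x a"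
    proof (cases "a \<in> e ` J")
      case True
      then obtain i where i: "i \<in> J" "a = e i" by blast
      then show ?thesis using x unfolding Pc by (simp add: he ne J_def)
    qed (simp add: h0)
  qed
  have "h \<in> iso ?P ?Q"
  proof (intro isoI homI)
    fix x y assume x: "x \<in> carrier ?P" and y: "y \<in> carrier ?P"
    show "h (x \<otimes>\<^bsub>?P\<^esub> y) = h x \<otimes>\<^bsub>?Q\<^esub> h y"
    proof
      fix a show "h (x \<otimes>\<^bsub>?P\<^esub> y) a = (h x \<otimes>\<^bsub>?Q\<^esub> h y) a"
      proof (cases "a \<in> e ` J")
        case True
        then obtain i where i: "i \<in> J" "a = e i" by blast
        then show ?thesis by (simp add: he ne) (simp add: J_def)
      qed (simp add: h0)
    qed
  next
    define k where "k y = (\<lambda>i\<in>I. if i \<in> J then y (e i) else 0 :: int)" for y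
    show "bij_betw h (carrier ?P) (carrier ?Q)"
    proof (rule bij_betwI[where g = k])
      show "h \<in> carrier ?P \<rightarrow> carrier ?Q" using hQ by blast
      show "k \<in> carrier ?Q \<rightarrow> carrier ?P"
      proof
        fix y assume "y \<in> carrier ?Q"
        then have "y (e i) mod int (m i) = y (e i)" if "i \<in> J" for i using ne[OF that] unfolding Qc by metis
        then show "k y \<in> carrier ?P" unfolding Pc by (simp add: k_def)
      qed
      show "k (h x) = x" if x: "x \<in> carrier ?P" for x
      proof
        fix i show "k (h x) i = x i"
        proof (cases "i \<in> J")
          case True then show ?thesis by (simp add: k_def he) (simp add: J_def)
        next
          case False
          then show ?thesis using x unfolding Pc extensional_def by (auto simp: k_def J_def)
        qed
      qed
      show "h (k y) = y" if y: "y \<in> carrier ?Q" for y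
      proof
        fix a show "h (k y) a = y a"
        proof (cases "a \<in> e ` J")
          case True
          then obtain i where i: "i \<in> J" "a = e i" by blast
          then show ?thesis by (simp add: he k_def) (simp add: J_def)
        next
          case False
          then show ?thesis using y n1[OF False] unfolding Qc by (auto simp: h0 dest: spec[of _ a])
        qed
      qed
    qed
  qed (rule hQ)
  then have "?P \<cong> ?Q" by (rule is_isoI)
  then show ?thesis unfolding int_mod_product_def using iso_trans[OF assms(2)] by blast
qed

lemma int_mod_product_of_is_product:
  fixes G :: "('a, 'b) monoid_scheme"
  assumes G: "group G" and "is_product_of_cyclic TYPE('i \<times> 'c) G"
  shows "int_mod_product G"
proof -
  obtain I :: "'i set" and C :: "'i \<Rightarrow> 'c monoid"
    where C: "\<And>i. i \<in> I \<Longrightarrow> group (C i)" "\<And>i. i \<in> I \<Longrightarrow> cyclic_group (C i)" and GC: "G \<cong> product_group I C"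
    using assms(2) unfolding is_product_of_cyclic_def by blast
  have "\<forall>i. \<exists>k. i \<in> I \<longrightarrow> integer_mod_group k \<cong> C i" using cyclic_group_iso_integer_mod_group[OF C] by blast
  from choice[OF this] obtain m where m: "\<And>i. i \<in> I \<Longrightarrow> integer_mod_group (m i) \<cong> C i" by blast
  have "C i \<cong> integer_mod_group (m i)" if "i \<in> I" for i by (rule group.iso_sym[OF group_integer_mod_group m[OF that]])
  then have "product_group I C \<cong> product_group I (\<lambda>i. integer_mod_group (m i))"
    using C(1) by (intro iso_product_groupI) auto
  then show ?thesis by (intro int_mod_product_of_product[OF G, of I m] iso_trans[OF GC])
qed

lemma is_product_of_int_mod_product:
  fixes G :: "('a, 'b) monoid_scheme"
  assumes "int_mod_product G" shows "is_product_of_cyclic TYPE('a \<times> int) G"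
proof -
  obtain n :: "'a \<Rightarrow> nat" where "G \<cong> product_group UNIV (\<lambda>a. integer_mod_group (n a))"
    using assms unfolding int_mod_product_def by blast
  moreover have "cyclic_group (integer_mod_group k)" for k
  proof -
    interpret Z: group "integer_mod_group k" by simp
    have "x = (1 mod int k) [^]\<^bsub>integer_mod_group k\<^esub> x" if "x \<in> carrier (integer_mod_group k)" for x
      using that by (simp add: int_pow_integer_mod_group carrier_integer_mod_group_iff mod_mult_right_eq)
    moreover have "1 mod int k \<in> carrier (integer_mod_group k)" by (simp add: carrier_integer_mod_group_iff)
    ultimately show ?thesis unfolding Z.cyclic_group
      by (intro bexI[of _ "1 mod int k"] equalityI subsetI) (auto simp: image_def)
  qed
  ultimately show ?thesis unfolding is_product_of_cyclic_def by (intro exI conjI) auto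
qed

text \<open>In a vertex \<open>(k, l)\<close> the last entry of \<open>l\<close> names a cycle or
  line, \<open>k\<close> is the position on it, and the entries read from the back describe a path
  leading away. The map shortens the path and, once a single entry is left, rotates. Empty lists are
  excluded from the vertex set.\<close>

fun graft :: "('a \<Rightarrow> nat) \<Rightarrow> int \<times> 'a list \<Rightarrow> int \<times> 'a list" where
  "graft n (k, []) = (k, [])"
| "graft n (k, [b]) = ((k + 1) mod int (n b), [b])"
| "graft n (k, b # c # l) = (k, c # l)"

lemma ex_wf_total_trans: "\<exists>R :: ('a \<times> 'a) set. wf R \<and> trans R \<and> total R"
proof -
  obtain r :: "('a \<times> 'a) set" where r: "well_order_on UNIV r" using well_order_on by blast
  then have "wf (r - Id)" "trans (r - Id)" "total (r - Id)"
    by (auto simp: well_order_on_def linear_order_on_def partial_order_on_def preorder_on_def total_on_def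
      intro: trans_diff_Id)
  then show ?thesis by blast
qed

text \<open>
  A cycle (or a two-sided infinite line) is attached to every index \<open>i\<close>, and to each of its vertices
  the tree of descending sequences below \<open>i\<close>. These trees are rigid and pairwise non-isomorphic, being
  told apart by the ordinal ranks of the indices, so that only the rotations remain.
\<close>

locale rotations =
  fixes R :: "('a \<times> 'a) set" and n :: "'a \<Rightarrow> nat"
  assumes wf: "wf R" and trans: "trans R" and total: "total R"
begin

abbreviation "f \<equiv> graft n"
definition "X = {(k :: int, l). l \<noteq> [] \<and> sorted_wrt (\<lambda>a b. (a, b) \<in> R) l \<and> k mod int (n (last l)) = k}"

lemma sorted_Cons: "sorted_wrt (\<lambda>a b. (a, b) \<in> R) (b # c # l) \<longleftrightarrow> (b, c) \<in> R \<and> sorted_wrt (\<lambda>a b. (a, b) \<in> R) (c # l)"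
  by (rule sorted_wrt2) (use trans in \<open>auto simp: transp_def dest: transD\<close>)

lemma X_single: "(k, [b]) \<in> X \<longleftrightarrow> k mod int (n b) = k"
  by (simp add: X_def)

lemma X_Cons: "(k, b # c # l) \<in> X \<longleftrightarrow> (b, c) \<in> R \<and> (k, c # l) \<in> X"
  unfolding X_def by (simp only: mem_Collect_eq prod.case sorted_Cons last.simps) auto

lemma X_cases:
  assumes "p \<in> X"
  obtains (core) k b where "p = (k, [b])" "k mod int (n b) = k"
  | (tail) k b c l where "p = (k, b # c # l)" "(b, c) \<in> R" "(k, c # l) \<in> X"
proof -
  obtain k l where p: "p = (k, l)" by (cases p)
  consider "l = []" | b where "l = [b]" | b c l' where "l = b # c # l'" by (cases l rule: remdups_adj.cases) auto
  then show ?thesis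
  proof cases
    case 1 then show ?thesis using assms p by (simp add: X_def)
  next
    case 2 then show ?thesis using assms p core X_single by blast
  next
    case 3 then show ?thesis using assms p tail X_Cons by blast
  qed
qed

lemma f_X: "p \<in> X \<Longrightarrow> f p \<in> X"
  by (cases p rule: X_cases) (auto simp: X_single)

definition "Core = {p \<in> X. tl (snd p) = []}"

abbreviation "head p \<equiv> hd (snd p)"

lemma core_E: assumes "p \<in> Core" obtains k b where "p = (k, [b])" "k mod int (n b) = k"
  using assms unfolding Core_def by (auto elim: X_cases)

lemma core_pred: assumes "p \<in> Core" shows "\<exists>q\<in>Core. f q = p"
proof -
  obtain k b where p: "p = (k, [b])" "k mod int (n b) = k" by (rule core_E[OF assms])
  then show ?thesis
    by (intro bexI[of _ "((k - 1) mod int (n b), [b])"]) (simp_all add: Core_def X_single mod_add_left_eq)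
qed

lemma tail_f: assumes "p \<in> X" "p \<notin> Core" shows "(head p, head (f p)) \<in> R"
  using assms by (cases p rule: X_cases) (auto simp: Core_def X_single)

lemma core_f: assumes "p \<in> Core" shows "f p \<in> Core"
proof -
  obtain k b where p: "p = (k, [b])" "k mod int (n b) = k" by (rule core_E[OF assms])
  then show ?thesis by (simp add: Core_def X_single)
qed

lemma tail_pred: assumes "p \<in> X" "(d, head p) \<in> R" shows "\<exists>q\<in>X - Core. f q = p \<and> head q = d"
  using assms
proof (cases p rule: X_cases)
  case (core k b)
  then show ?thesis using assms by (intro bexI[of _ "(k, [d, b])"]) (auto simp: Core_def X_Cons)
next
  case (tail k b c l)
  then show ?thesis using assms by (intro bexI[of _ "(k, d # b # c # l)"]) (auto simp: Core_def X_Cons)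
qed

text \<open>A core vertex has a core predecessor, and so on for ever, whereas each step back outside
  the core lowers the head. An image outside the core would start an infinite descent.\<close>

lemma core_preserved:
  assumes s: "\<And>p. p \<in> X \<Longrightarrow> s p \<in> X" "\<And>p. p \<in> X \<Longrightarrow> s (f p) = f (s p)" and p: "p \<in> Core"
  shows "s p \<in> Core"
proof (rule ccontr)
  have "\<forall>p\<in>Core. s p \<notin> Core \<longrightarrow> head (s p) = c \<longrightarrow> False" for c
    using wf
  proof (induction c rule: wf_induct_rule)
    case (less c)
    show ?case
    proof (intro ballI impI)
      fix p assume p: "p \<in> Core" "s p \<notin> Core" "head (s p) = c"
      obtain q where q: "q \<in> Core" "f q = p" using core_pred[OF p(1)] by blast
      have qX: "q \<in> X" using q(1) by (simp add: Core_def)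
      have fs: "f (s q) = s p" using s(2)[OF qX] q(2) by simp
      then have "s q \<notin> Core" using core_f p(2) by metis
      moreover from this have "(head (s q), c) \<in> R" using tail_f[OF s(1)[OF qX]] fs p(3) by metis
      ultimately show False using less q(1) by blast
    qed
  qed
  then show "s p \<notin> Core \<Longrightarrow> False" using p by blast
qed

text \<open>The predecessors of \<open>p\<close> outside the core have exactly the elements below
  \<open>head p\<close> as heads. Induction on the head treats \<open>s\<close> and \<open>t\<close>
  together. A smaller head of the image contradicts the induction hypothesis for the inverse; a
  larger one gives the image a predecessor with head \<open>head p\<close>, whose head the inverse
  would have to lower, against the induction hypothesis.\<close>

lemma head_preserved:
  assumes s: "\<And>p. p \<in> X \<Longrightarrow> s p \<in> X" "\<And>p. p \<in> X \<Longrightarrow> s (f p) = f (s p)"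
    and t: "\<And>p. p \<in> X \<Longrightarrow> t p \<in> X" "\<And>p. p \<in> X \<Longrightarrow> t (f p) = f (t p)"
    and st: "\<And>p. p \<in> X \<Longrightarrow> s (t p) = p" and ts: "\<And>p. p \<in> X \<Longrightarrow> t (s p) = p"
    and p: "p \<in> X"
  shows "head (s p) = head p"
proof -
  have cs: "s p \<in> Core \<longleftrightarrow> p \<in> Core" if "p \<in> X" for p
    using core_preserved[of s p, OF s] core_preserved[of t "s p", OF t] ts[OF that] by metis
  have ct: "t p \<in> Core \<longleftrightarrow> p \<in> Core" if "p \<in> X" for p
    using core_preserved[of t p, OF t] core_preserved[of s "t p", OF s] st[OF that] by metis
  have "\<forall>p\<in>X. head p = c \<longrightarrow> head (s p) = c \<and> head (t p) = c" for c
    using wf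
  proof (induction c rule: wf_induct_rule)
    case (less c)
    have *: "head (u p) = c"
      if u: "\<And>p. p \<in> X \<Longrightarrow> u p \<in> X" "\<And>p. p \<in> X \<Longrightarrow> v p \<in> X" "\<And>p. p \<in> X \<Longrightarrow> v (f p) = f (v p)"
        and uv: "\<And>p. p \<in> X \<Longrightarrow> u (v p) = p" "\<And>p. p \<in> X \<Longrightarrow> v (u p) = p"
        and cv: "\<And>p. p \<in> X \<Longrightarrow> v p \<in> Core \<longleftrightarrow> p \<in> Core"
        and IH: "\<And>d p. (d, c) \<in> R \<Longrightarrow> p \<in> X \<Longrightarrow> head p = d \<Longrightarrow> head (u p) = d \<and> head (v p) = d"
        and p: "p \<in> X" "head p = c" for u v p
    proof (rule ccontr)
      assume ne: "head (u p) \<noteq> c"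
      show False
      proof (cases "(head (u p), c) \<in> R")
        case True
        then have "head (v (u p)) = head (u p)" using IH[OF True u(1)[OF p(1)]] by blast
        then show False using uv(2)[OF p(1)] p(2) ne by simp
      next
        case False
        then have "(c, head (u p)) \<in> R" using total ne unfolding total_on_def by blast
        then obtain q where q: "q \<in> X" "q \<notin> Core" "f q = u p" "head q = c" using tail_pred[OF u(1)[OF p(1)]] by blast
        have "f (v q) = p" using u(3)[OF q(1)] q(3) uv(2)[OF p(1)] by simp
        moreover have "v q \<notin> Core" using cv[OF q(1)] q(2) by blast
        ultimately have d: "(head (v q), c) \<in> R" using tail_f[OF u(2)[OF q(1)]] p(2) by metis
        then have "head (u (v q)) = head (v q)" using IH[OF d u(2)[OF q(1)]] by blast
        then have "(c, c) \<in> R" using d uv(1)[OF q(1)] q(4) by simp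
        then show False using wf_not_refl[OF wf] by blast
      qed
    qed
    show ?case
    proof (intro ballI impI conjI)
      fix p assume p: "p \<in> X" "head p = c"
      show "head (s p) = c" by (rule *[of s t, OF s(1) t st ts ct _ p]) (use less in blast)+
      show "head (t p) = c" by (rule *[of t s, OF t(1) s ts st cs _ p]) (use less in blast)+
    qed
  qed
  then show ?thesis using p by blast
qed

text \<open>With heads and core preserved, each cycle or line goes to itself, rotated by the image
  of position 0. For a longer list the image of its tail is known by induction, and the missing
  first entry is the preserved head.\<close>

lemma rotation:
  assumes s: "\<And>p. p \<in> X \<Longrightarrow> s p \<in> X" "\<And>p. p \<in> X \<Longrightarrow> s (f p) = f (s p)"
    and h: "\<And>p. p \<in> X \<Longrightarrow> head (s p) = head p" and c: "\<And>p. p \<in> X \<Longrightarrow> s p \<in> Core \<longleftrightarrow> p \<in> Core"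
    and p: "(k, l) \<in> X"
  shows "s (k, l) = ((k + fst (s (0, [last l]))) mod int (n (last l)), l)"
  using p
proof (induction l rule: remdups_adj.induct)
  case 1
  then show ?case by (simp add: X_def)
next
  case (2 b)
  define u where "u k = fst (s (k mod int (n b), [b]))" for k
  have kX: "(k mod int (n b), [b]) \<in> X" for k by (simp add: X_single)
  have su: "s (k mod int (n b), [b]) = (u k, [b]) \<and> u k mod int (n b) = u k" for k
  proof -
    have "(k mod int (n b), [b]) \<in> Core" using kX by (simp add: Core_def)
    then have "s (k mod int (n b), [b]) \<in> Core" using c[OF kX] by blast
    then obtain k' b' where "s (k mod int (n b), [b]) = (k', [b'])" "k' mod int (n b') = k'" by (rule core_E)
    then show ?thesis using h[OF kX, of k] by (simp add: u_def)
  qed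
  have step: "u (k + 1) = (u k + 1) mod int (n b)" for k
  proof -
    have "s (f (k mod int (n b), [b])) = f (s (k mod int (n b), [b]))" by (rule s(2)[OF kX])
    then have "s ((k + 1) mod int (n b), [b]) = f (u k, [b])" using su by (simp add: mod_add_left_eq)
    then show ?thesis using su[of "k + 1"] by simp
  qed
  have "u k = (k + u 0) mod int (n b)" for k
  proof (induction k rule: int_induct[of _ 0])
    case base then show ?case using su[of 0] by simp
  next
    case (step1 i) then show ?case by (simp add: step mod_add_left_eq) (simp add: algebra_simps)
  next
    case (step2 i)
    have "(u (i - 1) + 1) mod int (n b) = (i + u 0) mod int (n b)" using step[of "i - 1"] step2 by simp
    then have "(u (i - 1) + 1 - 1) mod int (n b) = (i + u 0 - 1) mod int (n b)" by (rule mod_diff_cong) simp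
    then show ?case using su[of "i - 1"] by (simp add: algebra_simps)
  qed
  then have "u k = (k + fst (s (0, [b]))) mod int (n b)" by (simp add: u_def)
  moreover have "k mod int (n b) = k" using 2 by (simp add: X_single)
  ultimately show ?case using su[of k] by simp
next
  case (3 b d l)
  have dX: "(k, d # l) \<in> X" using 3(3) X_Cons by blast
  have "s (k, d # l) = ((k + fst (s (0, [last (d # l)]))) mod int (n (last (d # l))), d # l)"
    using 3(1,2) dX by blast
  moreover have "s (k, d # l) = f (s (k, b # d # l))" using s(2)[OF 3(3)] by simp
  moreover have "s (k, b # d # l) \<notin> Core" using c[OF 3(3)] by (simp add: Core_def)
  moreover have "head (s (k, b # d # l)) = b" using h[OF 3(3)] by simp
  ultimately show ?case using s(1)[OF 3(3)] by (cases rule: X_cases[OF s(1)[OF 3(3)]]) (auto simp: Core_def)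
qed

abbreviation "P \<equiv> product_group UNIV (\<lambda>a. integer_mod_group (n a))"

definition "rot r = (\<lambda>(k, l) \<in> X. ((k + r (last l)) mod int (n (last l)), l))"

lemma P_iff: "r \<in> carrier P \<longleftrightarrow> (\<forall>a. r a mod int (n a) = r a)"
  by (simp add: PiE_iff carrier_integer_mod_group_iff)

lemma rot_X: "(k, l) \<in> X \<Longrightarrow> rot r (k, l) = ((k + r (last l)) mod int (n (last l)), l)"
  by (simp add: rot_def)

lemma rot_in: "p \<in> X \<Longrightarrow> rot r p \<in> X"
  by (cases p) (auto simp: rot_X X_def)

lemma rot_rot: "p \<in> X \<Longrightarrow> rot r (rot r' p) = rot (\<lambda>a. (r a + r' a) mod int (n a)) p"
  using rot_in[of p r'] by (cases p) (simp add: rot_X mod_add_left_eq mod_add_right_eq ac_simps)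

lemma rot_0: "p \<in> X \<Longrightarrow> (\<And>a. r a mod int (n a) = 0) \<Longrightarrow> rot r p = p"
  by (cases p) (simp add: rot_X mod_add_eq[symmetric], simp add: X_def)

lemma rot_Aut: "rot r \<in> carrier (Aut X f)"
proof -
  have inv: "rot (\<lambda>a. - r a) (rot r p) = p" "rot r (rot (\<lambda>a. - r a) p) = p" if "p \<in> X" for p r
    using that by (simp_all add: rot_rot rot_0)
  have "bij_betw (rot r) X X" by (rule bij_betwI[where g = "rot (\<lambda>a. - r a)"]) (auto simp: rot_in inv)
  moreover have "rot r (f p) = f (rot r p)" if "p \<in> X" for p
    using that
  proof (cases p rule: X_cases)
    case (core k b)
    have "((k + 1) mod int (n b) + r b) mod int (n b) = ((k + r b) mod int (n b) + 1) mod int (n b)"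
      unfolding mod_add_left_eq by (simp add: algebra_simps)
    then show ?thesis using core by (simp add: rot_X X_single)
  next
    case (tail k b c l)
    then show ?thesis using that by (simp add: rot_X)
  qed
  ultimately show ?thesis by (simp add: Aut_def BijGroup_def Bij_def rot_def extensional_def)
qed

lemma rot_iso: "rot \<in> iso P (Aut X f)"
proof (intro isoI homI)
  show "rot r \<in> carrier (Aut X f)" for r by (rule rot_Aut)
  fix r r' assume "r \<in> carrier P" "r' \<in> carrier P"
  have "rot r \<in> Bij X" "rot r' \<in> Bij X" using rot_Aut by (auto simp: Aut_def BijGroup_def)
  then have "rot r \<otimes>\<^bsub>Aut X f\<^esub> rot r' = compose X (rot r) (rot r')" by (simp add: Aut_def BijGroup_def)
  also have "\<dots> = rot (r \<otimes>\<^bsub>P\<^esub> r')"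
  proof
    fix p show "compose X (rot r) (rot r') p = rot (r \<otimes>\<^bsub>P\<^esub> r') p"
      by (cases "p \<in> X") (simp_all add: compose_def rot_rot restrict_def, simp add: rot_def)
  qed
  finally show "rot (r \<otimes>\<^bsub>P\<^esub> r') = rot r \<otimes>\<^bsub>Aut X f\<^esub> rot r'" by simp
next
  have "inj_on rot (carrier P)"
  proof (rule inj_onI)
    fix r r' assume r: "r \<in> carrier P" "r' \<in> carrier P" "rot r = rot r'"
    have "r b = r' b" for b
    proof -
      have "rot r (0, [b]) = rot r' (0, [b])" using r(3) by simp
      then show ?thesis using r(1,2) unfolding P_iff by (simp add: rot_X X_single)
    qed
    then show "r = r'" by (rule ext)
  qed
  moreover have "s \<in> rot ` carrier P" if "s \<in> carrier (Aut X f)" for s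
  proof -
    have b: "bij_betw s X X" and ext: "s \<in> extensional X" and sf: "\<And>p. p \<in> X \<Longrightarrow> s (f p) = f (s p)"
      using that by (auto simp: Aut_def BijGroup_def Bij_def)
    have sX: "s p \<in> X" if "p \<in> X" for p using b that by (rule bij_betw_apply)
    define t where "t = inv_into X s"
    have st: "s (t p) = p" if "p \<in> X" for p unfolding t_def by (rule bij_betw_inv_into_right[OF b that])
    have ts: "t (s p) = p" if "p \<in> X" for p unfolding t_def by (rule bij_betw_inv_into_left[OF b that])
    have tX: "t p \<in> X" if "p \<in> X" for p unfolding t_def by (rule bij_betw_apply[OF bij_betw_inv_into[OF b] that])
    have tf: "t (f p) = f (t p)" if "p \<in> X" for p
      using ts[OF f_X[OF tX[OF that]]] sf[OF tX[OF that]] st[OF that] by simp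
    have c: "s p \<in> Core \<longleftrightarrow> p \<in> Core" if "p \<in> X" for p
      using core_preserved[of s p, OF sX sf] core_preserved[of t "s p", OF tX tf] ts[OF that] by metis
    have h: "head (s p) = head p" if "p \<in> X" for p by (rule head_preserved[OF sX sf tX tf st ts that])
    define r where "r b = fst (s (0, [b])) mod int (n b)" for b
    have "rot r p = s p" for p
    proof (cases "p \<in> X")
      case True
      obtain k l where p: "p = (k, l)" by (cases p)
      show ?thesis using rotation[OF sX sf h c, of k l] True unfolding p
        by (simp add: rot_X r_def mod_add_right_eq)
    next
      case False
      then show ?thesis unfolding extensional_arb[OF ext False] by (simp add: rot_def)
    qed
    then have "s = rot r" by (intro HOL.ext) (rule sym)
    then show ?thesis by (intro image_eqI[of _ _ r]) (simp_all only: P_iff, simp add: r_def)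
  qed
  ultimately show "bij_betw rot (carrier P) (carrier (Aut X f))"
    unfolding bij_betw_def using rot_Aut by blast
qed

end

lemma is_Aut_of_int_mod_product:
  fixes G :: "('a, 'b) monoid_scheme"
  assumes "int_mod_product G" shows "is_Aut TYPE(int \<times> 'a list) G"
proof -
  obtain n :: "'a \<Rightarrow> nat" where n: "G \<cong> product_group UNIV (\<lambda>a. integer_mod_group (n a))"
    using assms unfolding int_mod_product_def by blast
  obtain R :: "('a \<times> 'a) set" where "wf R" "trans R" "total R" using ex_wf_total_trans by blast
  then interpret rotations R n by unfold_locales
  have "X \<noteq> {}" using X_single[of 0] by auto
  moreover have "f \<in> X \<rightarrow> X" using f_X by blast
  ultimately show ?thesis unfolding is_Aut_def using iso_trans[OF n is_isoI[OF rot_iso]] by blast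
qed

section \<open>The equivalence\<close>

definition outside_id :: "'x set \<Rightarrow> ('x \<Rightarrow> 'x) \<Rightarrow> 'x \<Rightarrow> 'x"
  where "outside_id X f x = (if x \<in> X then f x else x)"

text \<open>The passage between two encodings of a permutation of \<open>X\<close>, with the
  identity or with \<open>undefined\<close> as values off \<open>X\<close>.\<close>

lemma aut_group_Aut_iso:
  assumes f: "f \<in> X \<rightarrow> X"
  shows "(\<lambda>g. restrict g X) \<in> iso (aut_group (outside_id X f) X) (Aut X f)"
proof -
  let ?f = "outside_id X f"
  have fX: "f x \<in> X" if "x \<in> X" for x using f that by blast
  have aut_f: "g (f x) = f (g x)" if "g \<in> aut ?f X" "x \<in> X" for g x
    using aut_comm[OF that(1), of x] aut_in[OF that(1), of x] that(2) by (simp add: outside_id_def)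
  have res: "restrict g X \<in> carrier (Aut X f)" if g: "g \<in> aut ?f X" for g
  proof -
    have "bij_betw (restrict g X) X X"
      using permutes_imp_bij[OF aut_permutes[OF g]] by (rule bij_betw_cong[THEN iffD1, rotated]) simp
    then show ?thesis using aut_f[OF g] aut_in[OF g] fX by (auto simp: Aut_def BijGroup_def Bij_def)
  qed
  show ?thesis
  proof (intro isoI homI)
    show "restrict g X \<in> carrier (Aut X f)" if "g \<in> carrier (aut_group ?f X)" for g using res that by simp
    fix g h assume "g \<in> carrier (aut_group ?f X)" "h \<in> carrier (aut_group ?f X)"
    then have g: "g \<in> aut ?f X" and h: "h \<in> aut ?f X" by simp_all
    have "restrict g X \<in> Bij X" "restrict h X \<in> Bij X" using res g h by (auto simp: Aut_def BijGroup_def)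
    then have "restrict g X \<otimes>\<^bsub>Aut X f\<^esub> restrict h X = compose X (restrict g X) (restrict h X)"
      by (simp add: Aut_def BijGroup_def)
    also have "\<dots> = restrict (g \<circ> h) X" using aut_in[OF h] by (auto simp: compose_def fun_eq_iff)
    finally show "restrict (g \<otimes>\<^bsub>aut_group ?f X\<^esub> h) X = restrict g X \<otimes>\<^bsub>Aut X f\<^esub> restrict h X" by simp
  next
    have "inj_on (\<lambda>g. restrict g X) (aut ?f X)"
    proof (rule inj_onI)
      fix g h assume g: "g \<in> aut ?f X" and h: "h \<in> aut ?f X" and eq: "restrict g X = restrict h X"
      have "g x = h x" for x
        using fun_cong[OF eq, of x] aut_out[OF g, of x] aut_out[OF h, of x] by (cases "x \<in> X") auto
      then show "g = h" by (rule ext)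
    qed
    moreover have "s \<in> (\<lambda>g. restrict g X) ` aut ?f X" if "s \<in> carrier (Aut X f)" for s
    proof -
      have b: "bij_betw s X X" and ex: "s \<in> extensional X" and sf: "\<And>x. x \<in> X \<Longrightarrow> s (f x) = f (s x)"
        using that by (auto simp: Aut_def BijGroup_def Bij_def)
      have sX: "s x \<in> X" if "x \<in> X" for x using b that by (rule bij_betw_apply)
      have "outside_id X s permutes X"
        by (rule bij_imp_permutes)
          (use b in \<open>auto simp: outside_id_def cong: bij_betw_cong\<close>)
      moreover have "outside_id X s (?f x) = ?f (outside_id X s x)" for x
        using sf[of x] sX[of x] fX[of x] by (simp add: outside_id_def)
      ultimately have "outside_id X s \<in> aut ?f X" unfolding aut_def by blast
      moreover have "s = restrict (outside_id X s) X"
        using ex by (auto simp: outside_id_def extensional_def restrict_def fun_eq_iff)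
      ultimately show ?thesis by blast
    qed
    ultimately show "bij_betw (\<lambda>g. restrict g X) (carrier (aut_group ?f X)) (carrier (Aut X f))"
      unfolding bij_betw_def aut_group_simps using res by blast
  qed
qed

lemma group_Aut:
  assumes "f \<in> X \<rightarrow> X" shows "group (Aut X f)"
proof -
  have "group (Aut X f \<lparr>one := restrict \<one>\<^bsub>aut_group (outside_id X f) X\<^esub> X\<rparr>)"
    by (rule group.iso_imp_img_group[OF group_aut_group aut_group_Aut_iso[OF assms]])
  moreover have "restrict \<one>\<^bsub>aut_group (outside_id X f) X\<^esub> X = \<one>\<^bsub>Aut X f\<^esub>" by (simp add: Aut_def BijGroup_def restrict_def fun_eq_iff)
  ultimately show ?thesis by simp
qed

lemma abelianization_comm_iso:
  assumes "comm_group A" shows "A \<cong> abelianization A"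
proof -
  interpret A: comm_group A by fact
  have "the_elem \<in> iso (A Mod {\<one>\<^bsub>A\<^esub>}) A" by (rule A.trivial_factor_iso)
  then have "A Mod {\<one>\<^bsub>A\<^esub>} \<cong> A" by (rule is_isoI)
  moreover have "group (A Mod {\<one>\<^bsub>A\<^esub>})" using A.one_is_normal by (rule normal.factorgroup_is_group)
  ultimately show ?thesis unfolding abelianization_def A.derived_eq_singleton[OF order_refl] by (simp add: group.iso_sym)
qed

lemma is_Aut_ab_of_is_Aut:
  fixes G :: "('a, 'b) monoid_scheme"
  assumes "comm_group G" "is_Aut TYPE('x) G" shows "is_Aut_ab TYPE('x) G"
proof -
  obtain X :: "'x set" and f where X: "X \<noteq> {}" "f \<in> X \<rightarrow> X" "G \<cong> Aut X f" using assms(2) unfolding is_Aut_def by blast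
  have "comm_group (Aut X f)"
    by (rule comm_group.iso_imp_comm_group[OF assms(1) X(3) group.is_monoid[OF group_Aut[OF X(2)]]])
  then have "G \<cong> abelianization (Aut X f)" by (rule iso_trans[OF X(3) abelianization_comm_iso])
  then show ?thesis unfolding is_Aut_ab_def using X by blast
qed

text \<open>As \<open>P\<close> is commutative, the kernel of \<open>\<psi>\<close> contains the
  derived subgroup; \<open>ker\<close> is the other inclusion.\<close>

lemma abelianization_iso:
  assumes "group_hom A P \<psi>" "comm_group P" "\<psi> ` carrier A = carrier P"
    and ker: "\<And>g. g \<in> carrier A \<Longrightarrow> \<psi> g = \<one>\<^bsub>P\<^esub> \<Longrightarrow> g \<in> derived A (carrier A)"
  shows "abelianization A \<cong> P"
proof -
  interpret \<psi>: group_hom A P \<psi> by fact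
  interpret P: comm_group P by fact
  have "\<psi> ` derived A (carrier A) = {\<one>\<^bsub>P\<^esub>}"
    using \<psi>.derived_img[OF order_refl] P.derived_eq_singleton[of "\<psi> ` carrier A"] assms(3) by simp
  moreover have "derived A (carrier A) \<subseteq> carrier A" by (rule \<psi>.G.derived_in_carrier) simp
  ultimately have "kernel A P \<psi> = derived A (carrier A)" unfolding kernel_def using ker by blast
  then show ?thesis unfolding abelianization_def using \<psi>.FactGroup_iso[OF assms(3)] by simp
qed

lemma abelianization_Aut:
  fixes f :: "'x \<Rightarrow> 'x"
  assumes f: "f \<in> X \<rightarrow> X"
  shows "\<exists>(I :: ('x \<times> (nat \<times> 'x set) option) set) n.
    abelianization (Aut X f) \<cong> product_group I (\<lambda>i. integer_mod_group (n i))"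
proof -
  let ?f = "outside_id X f" and ?A = "Aut X f"
  let ?H = "aut_group ?f X"
  obtain I :: "('x \<times> (nat \<times> 'x set) option) set" and n where "cyclic_ab ?f X 5 I n"
    using cyclic_ab_total[of X ?f] f by (auto simp: outside_id_def)
  then obtain \<Phi> :: "('x \<Rightarrow> 'x) \<Rightarrow> ('x \<times> (nat \<times> 'x set) option) \<Rightarrow> int" where \<Phi>:
    "\<And>g h i. g \<in> aut ?f X \<Longrightarrow> h \<in> aut ?f X \<Longrightarrow> i \<in> I \<Longrightarrow> int (n i) dvd \<Phi> (g \<circ> h) i - (\<Phi> g i + \<Phi> h i)"
    "\<And>t. \<exists>g\<in>aut ?f X. \<forall>i\<in>I. int (n i) dvd \<Phi> g i - t i"
    "\<And>g. g \<in> aut ?f X \<Longrightarrow> \<forall>i\<in>I. int (n i) dvd \<Phi> g i \<Longrightarrow> g \<in> comm_prods (aut ?f X) 5"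
    unfolding cyclic_ab_def by blast
  define \<rho> where "\<rho> g = restrict g X" for g :: "'x \<Rightarrow> 'x"
  interpret H: group ?H by (rule group_aut_group)
  interpret A: group ?A by (rule group_Aut[OF f])
  have "\<rho> \<in> iso ?H ?A" using aut_group_Aut_iso[OF f] by (simp add: \<rho>_def[abs_def])
  then have "inv_into (carrier ?H) \<rho> \<in> iso ?A ?H" by (rule H.iso_set_sym)
  then obtain \<theta> where \<theta>: "\<theta> \<in> iso ?A ?H" by blast
  let ?P = "product_group I (\<lambda>i. integer_mod_group (n i))"
  interpret P: comm_group ?P
    by (rule group.group_comm_groupI) (auto simp: ac_simps fun_eq_iff)
  define \<psi> where "\<psi> g = (\<lambda>i\<in>I. \<Phi> (\<theta> g) i mod int (n i))" for g
  interpret \<theta>: group_hom ?A ?H \<theta> using \<theta> by unfold_locales (simp add: iso_def)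
  have \<theta>H: "\<theta> g \<in> aut ?f X" if "g \<in> carrier ?A" for g using \<theta>.hom_closed[OF that] by simp
  have img: "\<theta> ` carrier ?A = aut ?f X" and inj: "inj_on \<theta> (carrier ?A)"
    using \<theta> by (simp_all add: iso_def bij_betw_def)
  have P_iff: "x \<in> carrier ?P \<longleftrightarrow> x \<in> extensional I \<and> (\<forall>i\<in>I. x i mod int (n i) = x i)" for x
    by (simp add: PiE_iff carrier_integer_mod_group_iff) blast
  have "group_hom ?A ?P \<psi>"
  proof (unfold_locales, intro homI)
    show "\<psi> g \<in> carrier ?P" if "g \<in> carrier ?A" for g unfolding P_iff by (simp add: \<psi>_def)
    fix g h assume g: "g \<in> carrier ?A" and h: "h \<in> carrier ?A"
    have "\<Phi> (\<theta> g \<circ> \<theta> h) i mod int (n i) = (\<Phi> (\<theta> g) i + \<Phi> (\<theta> h) i) mod int (n i)" if "i \<in> I" for i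
      unfolding mod_eq_dvd_iff by (rule \<Phi>(1)[OF \<theta>H[OF g] \<theta>H[OF h] that])
    moreover have "\<theta> (g \<otimes>\<^bsub>?A\<^esub> h) = \<theta> g \<circ> \<theta> h" using \<theta>.hom_mult[OF g h] unfolding aut_group_simps .
    ultimately show "\<psi> (g \<otimes>\<^bsub>?A\<^esub> h) = \<psi> g \<otimes>\<^bsub>?P\<^esub> \<psi> h"
      by (simp only: \<psi>_def mult_product_group mult_integer_mod_group) (rule restrict_ext, simp add: mod_add_eq)
  qed
  moreover have "\<psi> ` carrier ?A = carrier ?P"
  proof (intro equalityI subsetI)
    show "x \<in> carrier ?P" if "x \<in> \<psi> ` carrier ?A" for x using that unfolding P_iff by (auto simp: \<psi>_def)
    fix x assume x: "x \<in> carrier ?P"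
    obtain g where g: "g \<in> aut ?f X" "\<And>i. i \<in> I \<Longrightarrow> int (n i) dvd \<Phi> g i - x i" using \<Phi>(2) by blast
    obtain a where a: "a \<in> carrier ?A" "g = \<theta> a" using g(1) img by blast
    have "\<psi> a i = x i" for i
    proof (cases "i \<in> I")
      case True
      then show ?thesis using g(2)[OF True] x unfolding P_iff by (simp add: \<psi>_def a(2) mod_eq_dvd_iff[symmetric])
    next
      case False
      have "x \<in> extensional I" using x unfolding P_iff by blast
      then have "x i = undefined" using False by (rule extensional_arb)
      then show ?thesis using False by (simp only: \<psi>_def restrict_def if_False)
    qed
    then have "x = \<psi> a" by (intro HOL.ext) (rule sym)
    then show "x \<in> \<psi> ` carrier ?A" using a(1) by blast
  qed
  moreover have "g \<in> derived ?A (carrier ?A)" if g: "g \<in> carrier ?A" "\<psi> g = \<one>\<^bsub>?P\<^esub>" for g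
  proof -
    have "\<forall>i\<in>I. int (n i) dvd \<Phi> (\<theta> g) i"
    proof
      fix i assume "i \<in> I"
      then show "int (n i) dvd \<Phi> (\<theta> g) i" using fun_cong[OF g(2), of i] by (auto simp: \<psi>_def)
    qed
    then have "\<theta> g \<in> comm_prods (aut ?f X) 5" by (rule \<Phi>(3)[OF \<theta>H[OF g(1)]])
    then have "\<theta> g \<in> derived ?H (aut ?f X)" unfolding derived_aut_group by blast
    also have "\<dots> = \<theta> ` derived ?A (carrier ?A)" unfolding img[symmetric] by (rule \<theta>.derived_img) simp
    finally obtain a where a: "a \<in> derived ?A (carrier ?A)" "\<theta> g = \<theta> a" by blast
    moreover have "a \<in> carrier ?A" using A.derived_in_carrier[OF order_refl] a(1) by blast
    ultimately show ?thesis using inj_onD[OF inj, of g a] g(1) by simp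
  qed
  ultimately have "abelianization ?A \<cong> ?P" by (intro abelianization_iso[OF _ P.comm_group_axioms]) auto
  then show ?thesis by blast
qed

lemma int_mod_product_of_is_Aut_ab:
  fixes G :: "('a, 'b) monoid_scheme"
  assumes "group G" "is_Aut_ab TYPE('x) G" shows "int_mod_product G"
proof -
  obtain X :: "'x set" and f where X: "f \<in> X \<rightarrow> X" "G \<cong> abelianization (Aut X f)" using assms(2) unfolding is_Aut_ab_def by blast
  obtain I :: "('x \<times> (nat \<times> 'x set) option) set" and n
    where "abelianization (Aut X f) \<cong> product_group I (\<lambda>i. integer_mod_group (n i))"
    using abelianization_Aut[OF X(1)] by blast
  then show ?thesis by (intro int_mod_product_of_product[OF assms(1), of I n] iso_trans[OF X(2)])
qed

theorem corollary4p22: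
  fixes G :: "('a, 'b) monoid_scheme"
  assumes "comm_group G"
  shows
    "(is_Aut TYPE(int \<times> 'a list) G \<longleftrightarrow> is_Aut_ab TYPE(int \<times> 'a list) G) \<and>
     (is_Aut_ab TYPE(int \<times> 'a list) G \<longleftrightarrow> is_product_of_cyclic TYPE('a \<times> int) G) \<and>
     (is_Aut TYPE('x) G \<longrightarrow> is_Aut TYPE(int \<times> 'a list) G) \<and>
     (is_Aut_ab TYPE('y) G \<longrightarrow> is_Aut_ab TYPE(int \<times> 'a list) G) \<and>
     (is_product_of_cyclic TYPE('i \<times> 'c) G \<longrightarrow> is_product_of_cyclic TYPE('a \<times> int) G)"
proof -
  have G: "group G" using assms by (simp add: comm_group_def)
  note of_int_mod_product = is_Aut_of_int_mod_product is_Aut_ab_of_is_Aut[OF assms is_Aut_of_int_mod_product] is_product_of_int_mod_product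
  note to_int_mod_product = int_mod_product_of_is_Aut_ab[OF G] int_mod_product_of_is_Aut_ab[OF G is_Aut_ab_of_is_Aut[OF assms]] int_mod_product_of_is_product[OF G]
  show ?thesis
    by (intro conjI iffI impI; rule of_int_mod_product; erule to_int_mod_product)
qed

end
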